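(* Let $\Omega$ be the interior of a rectifiable simple closed curve $\partial\Omega$ in $\mathbb R^2$. Suppose $u$ is a real-valued function that is continuous on $\Omega\cup\partial\Omega$ and of class $C^1$ on $\Omega$, with second-order partial derivatives that are piecewise continuous on $\Omega$. Let $p\in[0,\infty)$, $a\in\Omega$, assume $$\kappa(\Omega)=1-(2\pi)^{-1}\int_\Omega\max\{-\Delta u(z),0\}\,dA(z)>0,$$ and set $$\mathcal F\big(p,a,\kappa(\Omega)\big)=\frac{\big(4\pi\kappa(\Omega)\big)^p}{\Gamma(p+1)}\int_\Omega\big(g_\Omega(z,a)\big)^pe^{2u(z)}\,dA(z).$$ Then: (i) If $0\le p_1<p_2<\infty$, then $$\mathcal F\big(p_2,a,\kappa(\Omega)\big)\le\mathcal F\big(p_1,a,\kappa(\Omega)\big),$$ and equality holds here if and only if there exists a conformal map $f$ from $\Omega$ onto a Euclidean disk in $\mathbb R^2$ centered at $f(a)$ such that $u=\ln|f'|$. (ii) $$\lim_{p\to\infty}\mathcal F\big(p,a,\kappa(\Omega)\big)=\begin{cases}0,&\kappa(\Omega)<1,\\ \pi\big(e^{u(a)}R_\Omega(a)\big)^2,&\kappa(\Omega)=1,\end{cases}$$ where $$e^{u(a)}R_\Omega(a)=R_{f(\Omega)}\big(f(a)\big)$$ whenever $u=\ln|f'|$ for a conformal mapping $f$ from $\Omega$ onto $f(\Omega)$.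
   Context: $\mathbb R^2$ is identified with $\mathbb C$, $z=x+iy$; $dA=dx\,dy$ is Lebesgue area measure, $\Delta=\partial_x^2+\partial_y^2$, and $\Gamma$ is the gamma function. A conformal map is an injective holomorphic map. Green function: for a bounded domain $\Omega\subset\mathbb R^2$ and $a\in\Omega$, $g_\Omega(\cdot,a)$ is the solution of $\Delta g_\Omega(\cdot,a)=-\delta_a$ in $\Omega$ with $g_\Omega(\cdot,a)=0$ on $\partial\Omega$, where $\delta_a$ is the Dirac measure at $a$. Equivalently $g_\Omega(z,a)=-(2\pi)^{-1}\big(H_\Omega(z,a)+\ln|z-a|\big)$, where $H_\Omega(\cdot,a)$ is harmonic in $\Omega$ with the same values as $-\ln|\cdot-a|$ on $\partial\Omega$. Robin function and conformal radius: $H_\Omega(a,a)=-2\pi\lim_{z\to a}\big((2\pi)^{-1}\ln|z-a|+g_\Omega(z,a)\big)$ and $R_\Omega(a)=\exp\big(-H_\Omega(a,a)\big)$. *)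

theory Defs
  imports "HOL-Complex_Analysis.Complex_Analysis"
begin

definition rectifiable_path :: "(real \<Rightarrow> complex) \<Rightarrow> bool" where
  "rectifiable_path \<gamma> \<longleftrightarrow> path \<gamma> \<and>
     bdd_above {\<Sum>i<n. dist (\<gamma> (t i)) (\<gamma> (t (Suc i))) | (n::nat) t.
                 mono_on {..n} t \<and> t ` {..n} \<subseteq> {0..1}}"

definition rectifiable_simple_closed_curve :: "(real \<Rightarrow> complex) \<Rightarrow> bool" where
  "rectifiable_simple_closed_curve \<gamma> \<longleftrightarrow>
     simple_path \<gamma> \<and> pathfinish \<gamma> = pathstart \<gamma> \<and> rectifiable_path \<gamma>"


(* The plane is the type complex, so the partial derivatives with respect to x and y are the
   derivatives in the directions v = 1 and v = \<i>. *)

definition has_partial :: "complex \<Rightarrow> (complex \<Rightarrow> real) \<Rightarrow> real \<Rightarrow> complex \<Rightarrow> bool" where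
  "has_partial v f d z \<longleftrightarrow> ((\<lambda>t::real. f (z + of_real t * v)) has_real_derivative d) (at 0)"

definition partial :: "complex \<Rightarrow> (complex \<Rightarrow> real) \<Rightarrow> complex \<Rightarrow> real" where
  "partial v f z = deriv (\<lambda>t::real. f (z + of_real t * v)) 0"

definition laplacian :: "(complex \<Rightarrow> real) \<Rightarrow> complex \<Rightarrow> real" where
  "laplacian f z = partial 1 (partial 1 f) z + partial \<i> (partial \<i> f) z"

definition C1_on :: "complex set \<Rightarrow> (complex \<Rightarrow> real) \<Rightarrow> bool" where
  "C1_on S f \<longleftrightarrow> (\<forall>v\<in>{1, \<i>}. \<exists>h. continuous_on S h \<and> (\<forall>z\<in>S. has_partial v f (h z) z))"

definition C2_on :: "complex set \<Rightarrow> (complex \<Rightarrow> real) \<Rightarrow> bool" where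
  "C2_on S f \<longleftrightarrow> C1_on S f \<and> (\<forall>v\<in>{1, \<i>}. C1_on S (partial v f))"

definition harmonic_fun_on :: "complex set \<Rightarrow> (complex \<Rightarrow> real) \<Rightarrow> bool" where
  "harmonic_fun_on S f \<longleftrightarrow> C2_on S f \<and> (\<forall>z\<in>S. laplacian f z = 0)"


(* Piecewise continuity in the classical sense: finitely many rectifiable curves divide \<Omega> into
   finitely many disjoint open pieces. On each piece the function exists and is continuous, and
   it has limits from within the piece at all points of \<Omega> on the boundary of the piece.
   Nothing is required on the dividing curves or at the boundary of \<Omega>. *)

definition curve_division :: "complex set \<Rightarrow> complex set set \<Rightarrow> bool" where
  "curve_division \<Omega> \<D> \<longleftrightarrow>
     finite \<D> \<and> (\<forall>D\<in>\<D>. open D \<and> D \<subseteq> \<Omega>) \<and> disjoint \<D> \<and>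
     (\<exists>C. finite C \<and> (\<forall>c\<in>C. rectifiable_path c) \<and> \<Omega> - \<Union>\<D> \<subseteq> (\<Union>c\<in>C. path_image c))"

definition piecewise_continuous_partial ::
    "complex set \<Rightarrow> complex \<Rightarrow> (complex \<Rightarrow> real) \<Rightarrow> bool" where
  "piecewise_continuous_partial \<Omega> v f \<longleftrightarrow>
     (\<exists>\<D>. curve_division \<Omega> \<D> \<and>
       (\<forall>D\<in>\<D>. \<exists>h. continuous_on (\<Omega> \<inter> closure D) h \<and> (\<forall>z\<in>D. has_partial v f (h z) z)))"

definition piecewise_continuous_second_partials ::
    "complex set \<Rightarrow> (complex \<Rightarrow> real) \<Rightarrow> bool" where
  "piecewise_continuous_second_partials \<Omega> f \<longleftrightarrow>
     (\<forall>v\<in>{1, \<i>}. \<forall>w\<in>{1, \<i>}. piecewise_continuous_partial \<Omega> w (partial v f))"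


(* H_\<Omega>(\<cdot>, a). It is determined on the closure of \<Omega> only, and only there is it used. *)

definition green_H :: "complex set \<Rightarrow> complex \<Rightarrow> complex \<Rightarrow> real" where
  "green_H \<Omega> a = (SOME h. continuous_on (closure \<Omega>) h \<and> harmonic_fun_on \<Omega> h \<and>
                    (\<forall>w\<in>frontier \<Omega>. h w = - ln (norm (w - a))))"

(* g_\<Omega>(z, a). The value at the pole z = a is a dummy, because ln 0 = 0. *)

definition green :: "complex set \<Rightarrow> complex \<Rightarrow> complex \<Rightarrow> real" where
  "green \<Omega> z a = - (green_H \<Omega> a z + ln (norm (z - a))) / (2 * pi)"

definition robin :: "complex set \<Rightarrow> complex \<Rightarrow> real" where
  "robin \<Omega> a = - 2 * pi * Lim (at a) (\<lambda>z. ln (norm (z - a)) / (2 * pi) + green \<Omega> z a)"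

definition conformal_radius :: "complex set \<Rightarrow> complex \<Rightarrow> real" where
  "conformal_radius \<Omega> a = exp (- robin \<Omega> a)"

definition conformal_map_on :: "complex set \<Rightarrow> (complex \<Rightarrow> complex) \<Rightarrow> bool" where
  "conformal_map_on \<Omega> f \<longleftrightarrow> f holomorphic_on \<Omega> \<and> inj_on f \<Omega>"


(* The integrals are over the completed measure lebesgue, because laplacian u has unspecified
   values on the (null) dividing curves. *)

definition kappa :: "complex set \<Rightarrow> (complex \<Rightarrow> real) \<Rightarrow> real" where
  "kappa \<Omega> u = 1 - (LINT z:\<Omega>|lebesgue. max (- laplacian u z) 0) / (2 * pi)"

definition green_functional ::
    "complex set \<Rightarrow> (complex \<Rightarrow> real) \<Rightarrow> real \<Rightarrow> complex \<Rightarrow> real \<Rightarrow> real" where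
  "green_functional \<Omega> u p a k =
     (4 * pi * k) powr p / Gamma (p + 1) *
     (LINT z:\<Omega>|lebesgue. green \<Omega> z a powr p * exp (2 * u z))"

end

theory Submission
  imports Defs
begin

text \<open>Let \<open>\<psi>\<close> be the Riemann map of \<open>\<Omega>\<close> onto the unit disc with \<open>\<psi> a = 0\<close>, so that the Green function is
  \<open>- ln \<bar>\<psi>\<bar> / (2 \<pi>)\<close>, and let \<open>A r\<close> be the area of \<open>\<bar>\<psi>\<bar> < r\<close> and \<open>L r\<close> the length of its boundary in the
  metric \<open>exp (2 u) \<bar>dz\<bar>\<^sup>2\<close>. Green's identity bounds \<open>u\<close>, pulled back to the disc, by its Poisson integral
  plus the Green potential of the negative part of the Laplacian, whose mass is \<open>2 \<pi> (1 - \<kappa>)\<close>. Jensen's inequality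
  for this potential and a weighted Carleman inequality for holomorphic functions give the isoperimetric
  inequality \<open>4 \<pi> \<kappa> A r \<le> (L r)\<^sup>2\<close>, and by Cauchy-Schwarz \<open>2 \<kappa> A r \<le> r A' r\<close>. Hence
  \<open>B s = exp s * A (exp (- s / (2 \<kappa>)))\<close> is decreasing in \<open>s\<close>. By the layer cake formula the functional at \<open>p\<close> is the
  average of \<open>B\<close> against the Gamma density \<open>s powr (p - 1) * exp (- s) / Gamma p\<close>. Two such densities cross once and
  their mass moves to infinity as \<open>p\<close> grows, which gives monotonicity and the limit. Equality makes \<open>B\<close>
  constant, so \<open>\<kappa> = 1\<close> and equality holds in Cauchy-Schwarz on every circle: the conformal factor is constant on the disc.

  If \<open>u = ln \<bar>f'\<bar>\<close>, then \<open>\<bar>f'\<bar>\<close> is bounded, and rectifiability of the boundary makes \<open>f ` \<Omega>\<close> bounded, so that its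
  Green function is well defined.\<close>

section \<open>Lebesgue measure of the complex plane\<close>

text \<open>The constant \<kappa> enters through one exponent. Jensen turns the exponential of the
  potential of a mass at most 2 pi (1 - \<kappa>) into an average of powers |T|^(-2 (1 - \<kappa>))
  with T a disc automorphism. In the area integral of a power series, the weight |z|^(-2 (1 -
  \<kappa>)) changes the factor 1 / (n + 1) into 1 / (n + \<kappa>), and (n + 1) / (n + \<kappa>)
  \<le> 1 / \<kappa> because \<kappa> \<le> 1.

  Two obstacles shape the rest. Second derivatives of u exist only off the dividing curves. Green's
  identity is therefore obtained by integrating by parts along horizontal and vertical lines: almost
  every such line meets a rectifiable curve in finitely many points, and there continuity of the
  first derivatives is enough. Moreover, nothing is known about second derivatives of u or about the
  Riemann map near the boundary of \<Omega>. So the isoperimetric inequality is proved for r < 1,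
  where the maps are holomorphic across the circle, and only a monotone quantity is carried to r =
  1.\<close>

lemma borel_measurable_Complex [measurable (raw)]:
  assumes "f \<in> borel_measurable M" "g \<in> borel_measurable M"
  shows "(\<lambda>x. Complex (f x) (g x)) \<in> borel_measurable M"
  using assms unfolding Complex_eq by measurable

lemma lborel_complex_eq_distr:
  "(lborel :: complex measure) = distr (lborel \<Otimes>\<^sub>M lborel) borel (\<lambda>p. Complex (fst p) (snd p))"
proof (rule lborel_eqI)
  fix l u :: complex
  assume "\<And>b. b \<in> Basis \<Longrightarrow> l \<bullet> b \<le> u \<bullet> b"
  from this[of 1] this[of \<i>] have lu: "Re l \<le> Re u" "Im l \<le> Im u"
    by (auto simp: Basis_complex_def)
  have "(\<lambda>p. Complex (fst p) (snd p)) -` box l u = box (Re l) (Re u) \<times> box (Im l) (Im u)"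
    by (auto simp: box_def Basis_complex_def)
  then show "emeasure (distr (lborel \<Otimes>\<^sub>M lborel) borel (\<lambda>p. Complex (fst p) (snd p))) (box l u)
      = (\<Prod>b\<in>Basis. (u - l) \<bullet> b)"
    using lu by (subst emeasure_distr)
      (auto simp: lborel.emeasure_pair_measure_Times Basis_complex_def ennreal_mult space_pair_measure)
qed simp

lemma nn_integral_complex_Re_Im:
  fixes f :: "complex \<Rightarrow> ennreal"
  assumes [measurable]: "f \<in> borel_measurable borel"
  shows "(\<integral>\<^sup>+z. f z \<partial>lborel) = (\<integral>\<^sup>+x. \<integral>\<^sup>+y. f (Complex x y) \<partial>lborel \<partial>lborel)"
  by (subst lborel_complex_eq_distr)
     (simp add: nn_integral_distr lborel.nn_integral_fst[symmetric])

lemma nn_integral_complex_Im_Re: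
  fixes f :: "complex \<Rightarrow> ennreal"
  assumes [measurable]: "f \<in> borel_measurable borel"
  shows "(\<integral>\<^sup>+z. f z \<partial>lborel) = (\<integral>\<^sup>+y. \<integral>\<^sup>+x. f (Complex x y) \<partial>lborel \<partial>lborel)"
  unfolding nn_integral_complex_Re_Im[OF assms]
  by (rule lborel_pair.Fubini') simp

section \<open>Change of variables for conformal maps\<close>

definition vec_of_complex :: "complex \<Rightarrow> real^2" where
  "vec_of_complex z = (\<chi> i. if i = 1 then Re z else Im z)"

definition complex_of_vec :: "real^2 \<Rightarrow> complex" where
  "complex_of_vec x = Complex (vec_nth x 1) (vec_nth x 2)"

lemma vec_of_complex_inverse [simp]: "complex_of_vec (vec_of_complex z) = z"
  by (simp add: complex_of_vec_def vec_of_complex_def)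

lemma complex_of_vec_inverse [simp]: "vec_of_complex (complex_of_vec x) = x"
  by (simp add: complex_of_vec_def vec_of_complex_def vec_eq_iff forall_2)

lemma linear_vec_of_complex: "bounded_linear vec_of_complex"
  unfolding linear_conv_bounded_linear[symmetric] by (rule linearI) (auto simp: vec_of_complex_def vec_eq_iff)

lemma linear_complex_of_vec: "bounded_linear complex_of_vec"
  unfolding linear_conv_bounded_linear[symmetric] by (rule linearI)
     (auto simp: complex_of_vec_def complex_eq_iff)

lemma measurable_vec_of_complex [measurable]: "vec_of_complex \<in> borel_measurable borel"
  by (intro borel_measurable_continuous_onI linear_continuous_on linear_vec_of_complex)

lemma measurable_complex_of_vec [measurable]: "complex_of_vec \<in> borel_measurable borel"
  by (intro borel_measurable_continuous_onI linear_continuous_on linear_complex_of_vec)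

lemma lborel_vec_eq_distr: "(lborel :: (real^2) measure) = distr lborel borel vec_of_complex"
proof (rule lborel_eqI)
  fix l u :: "real^2"
  assume "\<And>b. b \<in> Basis \<Longrightarrow> l \<bullet> b \<le> u \<bullet> b"
  then have lu: "vec_nth l i \<le> vec_nth u i" for i
    by (metis axis_in_Basis_iff cart_eq_inner_axis one_neq_zero Basis_real_def insertI1)
  have 1: "vec_of_complex -` box l u = box (complex_of_vec l) (complex_of_vec u)"
    by (auto simp: box_vec_eq_empty mem_box_cart vec_of_complex_def complex_of_vec_def in_box_complex_iff
        forall_2)
  have 2: "(\<Prod>b\<in>Basis. (u - l) \<bullet> b) = (\<Prod>i\<in>UNIV. vec_nth (u - l) i)"
  proof -
    have B: "(Basis :: (real^2) set) = (\<lambda>i::2. axis i (1::real)) ` UNIV"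
      by (auto simp: Basis_vec_def)
    have "inj (\<lambda>i::2. axis i (1::real))"
      by (simp add: inj_on_def axis_eq_axis)
    then show ?thesis
      unfolding B by (subst prod.reindex) (simp_all add: cart_eq_inner_axis)
  qed
  have "emeasure lborel (box (complex_of_vec l) (complex_of_vec u)) = (\<Prod>i\<in>UNIV. vec_nth (u - l) i)"
    using lu by (subst emeasure_lborel_box)
      (auto simp: Basis_complex_def complex_of_vec_def UNIV_2)
  then show "emeasure (distr lborel borel vec_of_complex) (box l u) = (\<Prod>b\<in>Basis. (u - l) \<bullet> b)"
    using lu 2 by (subst emeasure_distr) (auto simp: 1)
qed simp

text \<open>The change-of-variables theorem \<open>has_measure_differentiable_image\<close> is
  stated on \<open>real^'n\<close>, so everything is transported to \<open>real^2\<close>. There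
  multiplication by f' has determinant |f'|^2 by the Cauchy-Riemann equations.\<close>

lemma emeasure_conformal_image:
  fixes f :: "complex \<Rightarrow> complex"
  assumes "open S" and f: "f holomorphic_on S" "inj_on f S"
    and T: "T \<subseteq> S" "T \<in> sets borel" "f ` T \<in> sets borel"
  shows "emeasure lborel (f ` T) = (\<integral>\<^sup>+z\<in>T. ennreal ((norm (deriv f z))\<^sup>2) \<partial>lborel)"
proof -
  let ?V = "vec_of_complex" and ?C = "complex_of_vec"
  define g where "g = ?V \<circ> f \<circ> ?C"
  define T' where "T' = ?V ` T"
  define g' where "g' = (\<lambda>x h. ?V (deriv f (?C x) * ?C h))"
  have img: "?V ` A = ?C -` A" for A
  proof
    show "?C -` A \<subseteq> ?V ` A"
      by (metis complex_of_vec_inverse image_eqI subsetI vimageE)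
  qed auto
  have sb: "?V ` A \<in> sets borel" if "A \<in> sets borel" for A
    using measurable_sets[OF measurable_complex_of_vec that] by (simp add: img)
  have em: "emeasure lborel (?V ` A) = emeasure lborel A" if "A \<in> sets borel" for A
  proof -
    have "?V -` ?V ` A = A" by (auto simp: img)
    then show ?thesis
      using sb[OF that] by (subst lborel_vec_eq_distr) (simp add: emeasure_distr)
  qed
  have T'S: "T' \<in> sets borel" unfolding T'_def using T sb by blast
  have gT': "g ` T' = ?V ` (f ` T)"
    by (auto simp: g_def T'_def image_image)
  have der: "(g has_derivative g' x) (at x within T')" if "x \<in> T'" for x
  proof -
    have "?C x \<in> S" using that T by (auto simp: T'_def)
    then have "(f has_derivative (\<lambda>h. deriv f (?C x) * h)) (at (?C x))"
      using f(1) \<open>open S\<close> by (metis has_field_derivative_def holomorphic_derivI)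
    then have "((\<lambda>x. ?V (f (?C x))) has_derivative (\<lambda>h. ?V (deriv f (?C x) * ?C h))) (at x)"
      by (intro bounded_linear.has_derivative[OF linear_vec_of_complex]
          has_derivative_compose[OF bounded_linear_imp_has_derivative[OF linear_complex_of_vec]])
    then show ?thesis
      by (simp add: g_def g'_def o_def has_derivative_at_withinI)
  qed
  have inj: "inj_on g T'"
    using f(2) T(1) unfolding g_def T'_def inj_on_def
    by simp (metis subsetD vec_of_complex_inverse)
  have det: "\<bar>det (matrix (g' x))\<bar> = (norm (deriv f (?C x)))\<^sup>2" for x
    by (simp add: det_2 matrix_def g'_def vec_of_complex_def complex_of_vec_def axis_def cmod_power2)
       (simp add: power2_eq_square)
  have meas: "(\<lambda>x. (norm (deriv f (?C x)))\<^sup>2 * indicator T' x) \<in> borel_measurable borel"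
  proof -
    have "continuous_on S (\<lambda>z. (norm (deriv f z))\<^sup>2)"
      using holomorphic_deriv[OF f(1) \<open>open S\<close>] by (intro continuous_intros holomorphic_on_imp_continuous_on)
    then have "(\<lambda>z. indicator S z *\<^sub>R (norm (deriv f z))\<^sup>2) \<in> borel_measurable borel"
      by (intro borel_measurable_continuous_on_indicator) (use \<open>open S\<close> in simp)
    then have "(\<lambda>x. (indicator S (?C x) *\<^sub>R (norm (deriv f (?C x)))\<^sup>2) * indicator T' x) \<in> borel_measurable borel"
      using T'S by measurable
    moreover have "(indicator S (?C x) *\<^sub>R (norm (deriv f (?C x)))\<^sup>2) * indicator T' x
        = (norm (deriv f (?C x)))\<^sup>2 * indicator T' x" for x
      using T by (auto simp: T'_def indicator_def)
    ultimately show ?thesis by (simp only:)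
  qed
  have key: "g ` T' \<in> lmeasurable \<and> measure lebesgue (g ` T') = m
     \<longleftrightarrow> ((\<lambda>x. (norm (deriv f (?C x)))\<^sup>2) has_integral m) T'" for m
    using has_measure_differentiable_image[OF _ der inj, of m] T'S by (simp add: det)
  define N where "N = (\<integral>\<^sup>+x. ennreal ((norm (deriv f (?C x)))\<^sup>2 * indicator T' x) \<partial>lborel)"
  have N: "N = (\<integral>\<^sup>+z\<in>T. ennreal ((norm (deriv f z))\<^sup>2) \<partial>lborel)"
  proof -
    have "indicator T' (?V z) = (indicator T z :: real)" for z
      unfolding T'_def img by (auto simp: indicator_def)
    then show ?thesis
      unfolding N_def using meas
      by (subst lborel_vec_eq_distr) (auto simp: nn_integral_distr indicator_def intro!: nn_integral_cong)
  qed
  have hi: "((\<lambda>x. (norm (deriv f (?C x)))\<^sup>2) has_integral m) T' \<longleftrightarrow> N = ennreal m" if "0 \<le> m" for m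
  proof -
    have "((\<lambda>x. (norm (deriv f (?C x)))\<^sup>2) has_integral m) T' \<longleftrightarrow>
      ((\<lambda>x. (norm (deriv f (?C x)))\<^sup>2 * indicator T' x) has_integral m) UNIV"
    proof -
      have *: "(\<lambda>x. (norm (deriv f (?C x)))\<^sup>2 * indicator T' x) =
          (\<lambda>x. if x \<in> T' then (norm (deriv f (?C x)))\<^sup>2 else 0)"
        by auto
      show ?thesis unfolding * by (rule has_integral_restrict_UNIV[symmetric])
    qed
    also have "\<dots> \<longleftrightarrow> N = ennreal m"
    proof
      assume "N = ennreal m"
      then show "((\<lambda>x. (norm (deriv f (?C x)))\<^sup>2 * indicator T' x) has_integral m) UNIV"
        unfolding N_def by (intro nn_integral_has_integral meas that) auto
    next
      assume "((\<lambda>x. (norm (deriv f (?C x)))\<^sup>2 * indicator T' x) has_integral m) UNIV"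
      then show "N = ennreal m"
        unfolding N_def by (intro nn_integral_has_integral_lborel meas) auto
    qed
    finally show ?thesis .
  qed
  have gb: "g ` T' \<in> sets borel" using gT' sb T(3) by simp
  have e1: "emeasure lborel (f ` T) = emeasure lebesgue (g ` T')"
    using em[OF T(3)] gb by (simp add: gT')
  show ?thesis
  proof (cases "N < \<infinity>")
    case True
    then obtain m where m: "0 \<le> m" "N = ennreal m"
      by (metis ennreal_cases infinity_ennreal_def less_irrefl)
    then have "g ` T' \<in> lmeasurable \<and> measure lebesgue (g ` T') = m"
      using key hi by blast
    then show ?thesis
      using e1 m N emeasure_eq_measure2[of "g ` T'" lebesgue] by simp
  next
    case False
    \<comment> \<open>\<open>key\<close> speaks about real values only. If the area were finite,
      \<open>key\<close> applied to it would make the integral finite as well.\<close>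
    have "emeasure lebesgue (g ` T') = \<infinity>"
    proof (rule ccontr)
      assume "emeasure lebesgue (g ` T') \<noteq> \<infinity>"
      then have "g ` T' \<in> lmeasurable"
        using gb by (simp add: fmeasurable_def less_top)
      then show False
        using key[of "measure lebesgue (g ` T')"] hi False by auto
    qed
    then show ?thesis
      using e1 False N by (simp add: less_top[symmetric])
  qed
qed

text \<open>f is constrained on S only; extension by 0 makes it Borel measurable on the whole plane,
  as \<open>distr\<close> requires.\<close>

definition conformal_extension :: "complex set \<Rightarrow> (complex \<Rightarrow> complex) \<Rightarrow> complex \<Rightarrow> complex" where
  "conformal_extension S f z = (if z \<in> S then f z else 0)"

definition conformal_density :: "complex set \<Rightarrow> (complex \<Rightarrow> complex) \<Rightarrow> complex \<Rightarrow> real" where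
  "conformal_density S f z = indicator S z * (norm (deriv f z))\<^sup>2"

lemma conformal_borel_measurable:
  assumes S: "open S" and f: "f holomorphic_on S"
  shows "conformal_extension S f \<in> borel_measurable borel"
    "conformal_density S f \<in> borel_measurable borel"
proof -
  have cf: "continuous_on S f" and cd: "continuous_on S (\<lambda>z. (norm (deriv f z))\<^sup>2)"
    using f holomorphic_deriv[OF f S]
    by (auto intro!: continuous_intros holomorphic_on_imp_continuous_on)
  have "conformal_extension S f = (\<lambda>z. indicator S z *\<^sub>R f z)"
    by (auto simp: conformal_extension_def indicator_def)
  then show "conformal_extension S f \<in> borel_measurable borel"
    using borel_measurable_continuous_on_indicator[OF _ cf] S by simp
  show "conformal_density S f \<in> borel_measurable borel"
    using borel_measurable_continuous_on_indicator[OF _ cd] S by (simp add: conformal_density_def[abs_def])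
qed

text \<open>An identity of measures rather than of integrals: the version for nonnegative integrands
  and the one for real integrands, which carries no integrability hypothesis, both follow by
  unfolding \<open>distr\<close> and \<open>density\<close>.\<close>

lemma density_conformal_image:
  assumes S: "open S" and f: "f holomorphic_on S" "inj_on f S"
  shows "density lborel (indicator (f ` S)) =
    distr (density lborel (\<lambda>z. ennreal (conformal_density S f z))) borel (conformal_extension S f)"
proof (rule measure_eqI)
  let ?F = "conformal_extension S f" and ?d = "conformal_density S f"
  note [measurable] = conformal_borel_measurable[OF S f(1)]
  have [measurable]: "S \<in> sets borel" "f ` S \<in> sets borel"
    using S open_mapping_thm3[OF f(1) S f(2)] by auto
  fix E :: "complex set"
  assume "E \<in> sets (density lborel (indicator (f ` S)))"
  then have [measurable]: "E \<in> sets borel" by simp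
  let ?T = "S \<inter> ?F -` E"
  have FE: "?F -` E \<in> sets borel"
    using measurable_sets[OF conformal_borel_measurable(1)[OF S f(1)] \<open>E \<in> sets borel\<close>] by simp
  then have T: "?T \<in> sets borel" by simp
  have im: "f ` ?T = E \<inter> f ` S" by (auto simp: conformal_extension_def)
  have "emeasure (density lborel (indicator (f ` S))) E = emeasure lborel (f ` ?T)"
    by (simp add: emeasure_density im nn_integral_set_ennreal flip: indicator_inter_arith)
       (simp add: Int_commute)
  also have "\<dots> = (\<integral>\<^sup>+z\<in>?T. ennreal ((norm (deriv f z))\<^sup>2) \<partial>lborel)"
    by (rule emeasure_conformal_image[OF S f]) (use T im in auto)
  also have "\<dots> = (\<integral>\<^sup>+z. ennreal (?d z) * indicator (?F -` E) z \<partial>lborel)"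
    by (intro nn_integral_cong) (auto simp: conformal_density_def indicator_def)
  also have "\<dots> = emeasure (distr (density lborel (\<lambda>z. ennreal (?d z))) borel ?F) E"
    using FE by (simp add: emeasure_distr emeasure_density)
  finally show "emeasure (density lborel (indicator (f ` S))) E = \<dots>" .
qed simp

lemma nn_integral_conformal_image:
  fixes f :: "complex \<Rightarrow> complex" and h :: "complex \<Rightarrow> ennreal"
  assumes S: "open S" and f: "f holomorphic_on S" "inj_on f S"
    and [measurable]: "h \<in> borel_measurable borel"
  shows "(\<integral>\<^sup>+w\<in>f ` S. h w \<partial>lborel) = (\<integral>\<^sup>+z\<in>S. h (f z) * ennreal ((norm (deriv f z))\<^sup>2) \<partial>lborel)"
proof -
  note [measurable] = conformal_borel_measurable[OF S f(1)]
  have [measurable]: "f ` S \<in> sets borel"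
    using open_mapping_thm3[OF f(1) S f(2)] by auto
  have "(\<integral>\<^sup>+w. h w \<partial>density lborel (indicator (f ` S)))
      = (\<integral>\<^sup>+z. ennreal (conformal_density S f z) * h (conformal_extension S f z) \<partial>lborel)"
    unfolding density_conformal_image[OF S f] by (simp add: nn_integral_distr nn_integral_density)
  also have "\<dots> = (\<integral>\<^sup>+z\<in>S. h (f z) * ennreal ((norm (deriv f z))\<^sup>2) \<partial>lborel)"
    by (intro nn_integral_cong) (auto simp: conformal_density_def conformal_extension_def indicator_def mult.commute)
  finally show ?thesis
    by (simp add: nn_integral_density mult.commute)
qed

lemma integral_conformal_image:
  fixes f :: "complex \<Rightarrow> complex" and h :: "complex \<Rightarrow> real"
  assumes S: "open S" and f: "f holomorphic_on S" "inj_on f S"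
    and [measurable]: "h \<in> borel_measurable borel"
  shows "(\<integral>w. indicator (f ` S) w * h w \<partial>lborel) = (\<integral>z. indicator S z * (h (f z) * (norm (deriv f z))\<^sup>2) \<partial>lborel)"
proof -
  note [measurable] = conformal_borel_measurable[OF S f(1)]
  have [measurable]: "f ` S \<in> sets borel"
    using open_mapping_thm3[OF f(1) S f(2)] by auto
  have "(\<integral>w. indicator (f ` S) w * h w \<partial>lborel) = (\<integral>w. h w \<partial>density lborel (\<lambda>w. ennreal (indicator (f ` S) w)))"
    by (subst integral_density) auto
  also have "\<dots> = (\<integral>w. h w \<partial>distr (density lborel (\<lambda>z. ennreal (conformal_density S f z))) borel (conformal_extension S f))"
    using density_conformal_image[OF S f] by (simp add: ennreal_indicator)
  also have "\<dots> = (\<integral>z. conformal_density S f z * h (conformal_extension S f z) \<partial>lborel)"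
  proof -
    have "0 \<le> conformal_density S f z" for z by (simp add: conformal_density_def)
    then show ?thesis by (simp add: integral_distr integral_density)
  qed
  also have "\<dots> = (\<integral>z. indicator S z * (h (f z) * (norm (deriv f z))\<^sup>2) \<partial>lborel)"
    by (intro Bochner_Integration.integral_cong) (auto simp: conformal_density_def conformal_extension_def indicator_def)
  finally show ?thesis .
qed

section \<open>Circle means and disc automorphisms\<close>

lemma has_integral_circle_mean:
  fixes f :: "complex \<Rightarrow> complex"
  assumes "f holomorphic_on ball 0 R" "1 < R"
  shows "((\<lambda>t. f (cis t)) has_integral (2 * pi * f 0)) {0..2 * pi}"
proof -
  have "f holomorphic_on cball 0 1"
    using assms by (auto elim!: holomorphic_on_subset)
  then have "((\<lambda>u. f u / (u - 0)) has_contour_integral (2 * of_real pi * \<i> * f 0)) (circlepath 0 1)"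
    by (intro Cauchy_integral_circlepath_simple) auto
  then have "((\<lambda>t. f (cis t) / cis t * \<i> * cis t) has_integral (2 * of_real pi * \<i> * f 0)) {0..2*pi}"
    unfolding circlepath_def by (subst (asm) has_contour_integral_part_circlepath_iff) auto
  then have "((\<lambda>t. - \<i> * (f (cis t) / cis t * \<i> * cis t)) has_integral - \<i> * (2 * of_real pi * \<i> * f 0)) {0..2*pi}"
    by (rule has_integral_mult_right)
  moreover have "- \<i> * (f (cis t) / cis t * \<i> * cis t) = f (cis t)" for t
    by (simp add: field_simps)
  ultimately show ?thesis
    by (simp add: algebra_simps)
qed

lemma has_integral_circle_mean_Re:
  assumes "f holomorphic_on ball 0 R" "1 < R"
  shows "((\<lambda>t. Re (f (cis t))) has_integral (2 * pi * Re (f 0))) {0..2 * pi}"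
  using has_integral_linear[OF has_integral_circle_mean[OF assms] bounded_linear_Re]
  by (simp add: o_def)

text \<open>On the unit circle \<open>z * cnj z = 1\<close>, so a term z^i times the conjugate of
  z^j is a power of z or the conjugate of one, with the same real part. Thus Re p Re q = Re (p q + p
  cnj q) / 2 is again the real part of a polynomial. This closure under products lets the
  Stone-Weierstrass theorem act on real parts of polynomials.\<close>

lemma Re_poly_mult_on_circle:
  fixes p q :: "complex poly"
  obtains r where "\<And>z. norm z = 1 \<Longrightarrow> Re (poly p z) * Re (poly q z) = Re (poly r z)"
proof -
  define s where "s = (\<Sum>i\<le>degree p. \<Sum>j\<le>degree q.
     if j \<le> i then monom (coeff p i * cnj (coeff q j)) (i - j)
     else monom (cnj (coeff p i) * coeff q j) (j - i))"
  have *: "Re (poly p z * cnj (poly q z)) = Re (poly s z)" if z: "norm z = 1" for z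
  proof -
    have zz: "z * cnj z = 1"
      using z by (simp add: complex_norm_square[symmetric])
    have pw: "z ^ i * cnj z ^ j = z ^ (i - j)" if "j \<le> i" for i j
    proof -
      have "z ^ i * cnj z ^ j = z ^ (i - j) * (z * cnj z) ^ j"
        using that by (simp add: power_mult_distrib flip: mult.assoc power_add)
      then show ?thesis by (simp add: zz)
    qed
    have "poly p z * cnj (poly q z) =
       (\<Sum>i\<le>degree p. \<Sum>j\<le>degree q. (coeff p i * z ^ i) * cnj (coeff q j * z ^ j))"
      by (simp add: poly_altdef sum_product)
    also have "Re \<dots> = Re (poly s z)"
      unfolding s_def poly_sum Re_sum
    proof (intro sum.cong refl)
      fix i j
      show "Re (coeff p i * z ^ i * cnj (coeff q j * z ^ j)) =
         Re (poly (if j \<le> i then monom (coeff p i * cnj (coeff q j)) (i - j)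
           else monom (cnj (coeff p i) * coeff q j) (j - i)) z)"
      proof (cases "j \<le> i")
        case True
        have "coeff p i * z ^ i * cnj (coeff q j * z ^ j) = coeff p i * cnj (coeff q j) * (z ^ i * cnj z ^ j)"
          by simp
        then show ?thesis using True by (simp only: if_True poly_monom pw[OF True])
      next
        case False
        then have ij: "i \<le> j" by simp
        have "cnj (coeff p i * z ^ i * cnj (coeff q j * z ^ j)) = cnj (coeff p i) * coeff q j * (z ^ j * cnj z ^ i)"
          by simp
        then have "Re (coeff p i * z ^ i * cnj (coeff q j * z ^ j)) = Re (cnj (coeff p i) * coeff q j * z ^ (j - i))"
          unfolding pw[OF ij] by (metis cnj.sel(1))
        then show ?thesis using False by (simp only: if_False poly_monom)
      qed
    qed
    finally show ?thesis .
  qed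
  have "Re (poly p z) * Re (poly q z) = Re (poly (smult (1/2) (p * q + s)) z)" if "norm z = 1" for z
    using *[OF that] by (simp add: field_simps)
  then show ?thesis by (rule that)
qed

lemma real_polynomial_function_eq_Re_poly_on_circle:
  fixes g :: "complex \<Rightarrow> real"
  assumes "real_polynomial_function g"
  shows "\<exists>p. \<forall>z. norm z = 1 \<longrightarrow> g z = Re (poly p z)"
  using assms
proof induction
  case (linear f)
  then interpret bounded_linear f .
  have "f z = Re (poly [:0, Complex (f 1) (- f \<i>):] z)" for z
  proof -
    have "z = Re z *\<^sub>R 1 + Im z *\<^sub>R \<i>"
      by (simp add: complex_eq_iff)
    then have "f z = Re z * f 1 + Im z * f \<i>"
      by (metis add scaleR real_scaleR_def)
    then show ?thesis by (simp add: algebra_simps)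
  qed
  then show ?case by blast
next
  case (const c)
  then show ?case by (intro exI[of _ "[:of_real c:]"]) simp
next
  case (add f g)
  then obtain p q where "\<forall>z. norm z = 1 \<longrightarrow> f z = Re (poly p z)" "\<forall>z. norm z = 1 \<longrightarrow> g z = Re (poly q z)"
    by blast
  then show ?case by (intro exI[of _ "p + q"]) simp
next
  case (mult f g)
  then obtain p q where *: "\<forall>z. norm z = 1 \<longrightarrow> f z = Re (poly p z)" "\<forall>z. norm z = 1 \<longrightarrow> g z = Re (poly q z)"
    by blast
  obtain r where "\<And>z. norm z = 1 \<Longrightarrow> Re (poly p z) * Re (poly q z) = Re (poly r z)"
    by (rule Re_poly_mult_on_circle[of p q]) blast
  then show ?case using * by (intro exI[of _ r]) simp
qed

text \<open>Takes the place of the Dirichlet problem on the disc: Re p is harmonic everywhere and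
  has almost the prescribed boundary values.\<close>

lemma Re_poly_approx_on_circle:
  fixes f :: "complex \<Rightarrow> real"
  assumes "continuous_on (sphere 0 1) f" "0 < e"
  obtains p :: "complex poly" where "\<And>z. norm z = 1 \<Longrightarrow> \<bar>f z - Re (poly p z)\<bar> < e"
proof -
  obtain g where g: "real_polynomial_function g" "\<And>x. x \<in> sphere 0 1 \<Longrightarrow> \<bar>f x - g x\<bar> < e"
    using Stone_Weierstrass_real_polynomial_function[OF compact_sphere assms] by blast
  obtain p where "\<forall>z. norm z = 1 \<longrightarrow> g z = Re (poly p z)"
    using real_polynomial_function_eq_Re_poly_on_circle[OF g(1)] by blast
  with g(2) show ?thesis by (intro that[of p]) auto
qed

text \<open>The automorphism of the unit disc that sends 0 to w, with inverse
  \<open>disc_aut (- w)\<close>. The function - ln |disc_aut (- w) z| is 2 pi times the Green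
  function of the disc with pole w.\<close>

definition disc_aut :: "complex \<Rightarrow> complex \<Rightarrow> complex" where
  "disc_aut w z = (z + w) / (1 + cnj w * z)"

lemma disc_aut_0 [simp]: "disc_aut w 0 = w" "disc_aut 0 z = z"
  by (simp_all add: disc_aut_def)

lemma disc_aut_denominator_nonzero:
  assumes "norm w < 1" "norm z \<le> 1"
  shows "1 + cnj w * z \<noteq> 0"
proof
  assume "1 + cnj w * z = 0"
  then have "norm (cnj w * z) = 1"
    by (metis add_eq_0_iff norm_minus_cancel norm_one)
  then have "norm w * norm z = 1" by (simp add: norm_mult)
  moreover have "norm w * norm z \<le> norm w * 1"
    using assms by (intro mult_left_mono) auto
  ultimately show False using assms by simp
qed

lemma one_minus_norm_disc_aut:
  assumes "norm w < 1" "norm z \<le> 1"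
  shows "1 - (norm (disc_aut w z))\<^sup>2 =
    (1 - (norm w)\<^sup>2) * (1 - (norm z)\<^sup>2) / (norm (1 + cnj w * z))\<^sup>2"
proof -
  have nz: "norm (1 + cnj w * z) \<noteq> 0"
    using disc_aut_denominator_nonzero[OF assms] by simp
  have "(norm (1 + cnj w * z))\<^sup>2 - (norm (z + w))\<^sup>2 = (1 - (norm w)\<^sup>2) * (1 - (norm z)\<^sup>2)"
    unfolding cmod_power2 by (simp add: power2_eq_square algebra_simps)
  then show ?thesis
    using nz by (simp add: disc_aut_def norm_divide power_divide field_simps)
qed

lemma norm_disc_aut_less_1:
  assumes "norm w < 1" "norm z < 1"
  shows "norm (disc_aut w z) < 1"
proof -
  have "0 < (1 - (norm w)\<^sup>2) * (1 - (norm z)\<^sup>2) / (norm (1 + cnj w * z))\<^sup>2"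
    using assms disc_aut_denominator_nonzero[of w z]
    by (intro divide_pos_pos mult_pos_pos) (auto simp: abs_square_less_1)
  then have "(norm (disc_aut w z))\<^sup>2 < 1"
    using one_minus_norm_disc_aut[of w z] assms by simp
  then show ?thesis by (simp add: abs_square_less_1)
qed

lemma norm_disc_aut_eq_1:
  assumes "norm w < 1" "norm z = 1"
  shows "norm (disc_aut w z) = 1"
proof -
  have "(norm (disc_aut w z))\<^sup>2 = 1\<^sup>2"
    using one_minus_norm_disc_aut[of w z] assms by simp
  then show ?thesis by (rule power2_eq_imp_eq) auto
qed

lemma disc_aut_inverse:
  assumes "norm w < 1" "norm z \<le> 1"
  shows "disc_aut (- w) (disc_aut w z) = z"
proof -
  have a: "1 + cnj w * z \<noteq> 0" using disc_aut_denominator_nonzero[OF assms] .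
  have b: "1 - cnj w * w \<noteq> 0" using disc_aut_denominator_nonzero[of w "-w"] assms by simp
  have "disc_aut w z - w = z * (1 - cnj w * w) / (1 + cnj w * z)"
    using a by (simp add: disc_aut_def field_simps)
  moreover have "1 - cnj w * disc_aut w z = (1 - cnj w * w) / (1 + cnj w * z)"
    using a by (simp add: disc_aut_def field_simps)
  ultimately show ?thesis
    using a b by (simp add: disc_aut_def[of "-w"])
qed

lemma inj_on_disc_aut: "norm w < 1 \<Longrightarrow> inj_on (disc_aut w) (cball 0 1)"
  by (rule inj_on_inverseI[of _ "disc_aut (- w)"]) (simp add: disc_aut_inverse)

lemma disc_aut_image_ball:
  assumes "norm w < 1"
  shows "disc_aut w ` ball 0 1 = ball 0 1"
proof
  show "disc_aut w ` ball 0 1 \<subseteq> ball 0 1"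
    using assms norm_disc_aut_less_1 by auto
  show "ball 0 1 \<subseteq> disc_aut w ` ball 0 1"
  proof
    fix z :: complex assume "z \<in> ball 0 1"
    then have "z = disc_aut w (disc_aut (- w) z)" "disc_aut (- w) z \<in> ball 0 1"
      using assms disc_aut_inverse[of "- w" z] norm_disc_aut_less_1[of "-w" z] by auto
    then show "z \<in> disc_aut w ` ball 0 1" by blast
  qed
qed

text \<open>The symmetry of the Green function of the disc. It lets pole and variable trade places
  after Fubini in the isoperimetric inequality.\<close>

lemma norm_disc_aut_commute: "norm (disc_aut (- w) z) = norm (disc_aut (- z) w)"
proof -
  have "norm (1 - cnj w * z) = norm (cnj (1 - cnj w * z))" by (rule complex_mod_cnj[symmetric])
  then have "norm (1 - cnj w * z) = norm (1 - cnj z * w)" by (simp add: mult.commute)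
  then show ?thesis by (simp add: disc_aut_def norm_divide norm_minus_commute)
qed

lemma disc_aut_has_field_derivative:
  assumes "1 + cnj w * z \<noteq> 0"
  shows "(disc_aut w has_field_derivative (1 - (norm w)\<^sup>2) / (1 + cnj w * z)\<^sup>2) (at z)"
proof -
  have "((\<lambda>z. (z + w) / (1 + cnj w * z)) has_field_derivative (1 - w * cnj w) / (1 + cnj w * z)\<^sup>2) (at z)"
    using assms by (auto intro!: derivative_eq_intros simp: power2_eq_square field_simps)
  then show ?thesis by (simp add: disc_aut_def[abs_def] complex_norm_square[symmetric])
qed

lemma deriv_disc_aut:
  "1 + cnj w * z \<noteq> 0 \<Longrightarrow> deriv (disc_aut w) z = (1 - (norm w)\<^sup>2) / (1 + cnj w * z)\<^sup>2"
  by (rule DERIV_imp_deriv) (rule disc_aut_has_field_derivative)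

text \<open>Circle means below are taken of functions holomorphic past the unit circle. By
  compactness of the closed disc an open condition that holds there holds on a slightly larger
  disc.\<close>

lemma disc_aut_nbhd:
  assumes w: "norm w < 1" and R: "1 < R"
  obtains R' where "1 < R'" "\<And>z. norm z < R' \<Longrightarrow> 1 + cnj w * z \<noteq> 0"
    "disc_aut w holomorphic_on ball 0 R'" "disc_aut w ` ball 0 R' \<subseteq> ball 0 R"
    "inj_on (disc_aut w) (ball 0 R')"
proof -
  let ?U = "{z. 1 + cnj w * z \<noteq> 0}"
  have oU: "open ?U" by (intro open_Collect_neq continuous_intros)
  have hU: "disc_aut w holomorphic_on ?U"
    unfolding disc_aut_def[abs_def] by (intro holomorphic_intros) auto
  have "open (?U \<inter> disc_aut w -` ball 0 R)"
    by (intro continuous_open_preimage oU holomorphic_on_imp_continuous_on hU) auto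
  moreover have "cball 0 1 \<subseteq> ?U \<inter> disc_aut w -` ball 0 R"
  proof
    fix z :: complex assume "z \<in> cball 0 1"
    then have z: "norm z \<le> 1" by simp
    have "norm (disc_aut w z) \<le> 1"
      using norm_disc_aut_less_1[OF w, of z] norm_disc_aut_eq_1[OF w, of z] z by force
    then show "z \<in> ?U \<inter> disc_aut w -` ball 0 R"
      using R disc_aut_denominator_nonzero[OF w z] by simp
  qed
  ultimately obtain e where e: "0 < e" "(\<Union>z\<in>cball 0 1. ball z e) \<subseteq> ?U \<inter> disc_aut w -` ball 0 R"
    using compact_subset_open_imp_ball_epsilon_subset[OF compact_cball] by metis
  have sub: "ball 0 (1 + e) \<subseteq> ?U \<inter> disc_aut w -` ball 0 R"
  proof
    fix z :: complex assume z: "z \<in> ball 0 (1 + e)"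
    show "z \<in> ?U \<inter> disc_aut w -` ball 0 R"
    proof (cases "norm z \<le> 1")
      case True
      then show ?thesis using e by force
    next
      case False
      have "dist (z / norm z) z = norm z - 1"
      proof -
        have "norm z \<noteq> 0" using False by auto
        then have "z / norm z - z = (1 - norm z) *\<^sub>R (z / norm z)"
          by (simp add: scaleR_conv_of_real field_simps)
        moreover have "norm ((1 - norm z) *\<^sub>R (z / norm z)) = norm z - 1"
          using \<open>norm z \<noteq> 0\<close> False by (simp add: norm_divide)
        ultimately show ?thesis by (simp add: dist_norm)
      qed
      moreover have "z / norm z \<in> cball 0 1" using False by (simp add: norm_divide)
      ultimately show ?thesis using e(2) z by force
    qed
  qed
  show ?thesis
  proof (rule that[of "1 + e"])
    show "inj_on (disc_aut w) (ball 0 (1 + e))"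
    proof (rule inj_onI)
      fix x y assume xy: "x \<in> ball 0 (1 + e)" "y \<in> ball 0 (1 + e)" "disc_aut w x = disc_aut w y"
      then have nz: "1 + cnj w * x \<noteq> 0" "1 + cnj w * y \<noteq> 0" using sub by auto
      have b: "1 - cnj w * w \<noteq> 0" using disc_aut_denominator_nonzero[of w "-w"] w by simp
      have "(x + w) * (1 + cnj w * y) = (y + w) * (1 + cnj w * x)"
        using xy(3) nz by (simp add: disc_aut_def field_simps)
      then have "(x - y) * (1 - cnj w * w) = 0" by (simp add: algebra_simps)
      then show "x = y" using b by simp
    qed
  qed (use e sub hU in \<open>auto intro: holomorphic_on_subset\<close>)
qed

text \<open>An automorphism T preserves the circle and its orientation, so its angular derivative z
  T' / T is positive there and equals |T'|. The second form is the Poisson kernel as the real part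
  of a holomorphic function. Each form turns an integral weighted by |T'| into the mean of a
  holomorphic function.\<close>

lemma norm_deriv_disc_aut_on_circle:
  assumes w: "norm w < 1" and z: "norm z = 1"
  shows "of_real (norm (deriv (disc_aut w) z)) = z * deriv (disc_aut w) z / disc_aut w z"
    and "norm (deriv (disc_aut w) z) = Re ((1 - cnj w * z) / (1 + cnj w * z))"
proof -
  have nz: "1 + cnj w * z \<noteq> 0" using disc_aut_denominator_nonzero[of w z] w z by simp
  have zz: "z * cnj z = 1" using z by (simp add: complex_norm_square[symmetric])
  have w2: "0 < 1 - (norm w)\<^sup>2" using w by (simp add: abs_square_less_1)
  have zw: "z + w \<noteq> 0"
    using w z by (metis add_eq_0_iff norm_minus_cancel less_irrefl)
  have cn: "cnj (1 + cnj w * z) = (z + w) * cnj z"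
    using zz by (simp add: algebra_simps)
  have cn': "(1 + cnj w * z) * (z + w) * cnj z = of_real ((norm (1 + cnj w * z))\<^sup>2)"
    unfolding complex_norm_square cn by (simp add: mult.assoc)
  have nd: "norm (deriv (disc_aut w) z) = (1 - (norm w)\<^sup>2) / (norm (1 + cnj w * z))\<^sup>2"
  proof -
    have "deriv (disc_aut w) z = of_real (1 - (norm w)\<^sup>2) / (1 + cnj w * z)\<^sup>2"
      by (simp add: deriv_disc_aut[OF nz])
    then show ?thesis
      using w2 by (simp only: norm_divide norm_of_real norm_power abs_of_pos)
  qed
  have "z * deriv (disc_aut w) z / disc_aut w z = z * (1 - (norm w)\<^sup>2) / ((1 + cnj w * z) * (z + w))"
    using nz zw by (simp add: deriv_disc_aut[OF nz] disc_aut_def power2_eq_square)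
  also have "\<dots> = (1 - (norm w)\<^sup>2) / ((1 + cnj w * z) * (z + w) * cnj z)"
  proof -
    have "z \<noteq> 0" using z by auto
    then have "cnj z = 1 / z" using zz by (simp add: field_simps)
    then show ?thesis using \<open>z \<noteq> 0\<close> by simp
  qed
  finally show "of_real (norm (deriv (disc_aut w) z)) = z * deriv (disc_aut w) z / disc_aut w z"
    unfolding cn' nd by simp
  have "Re ((1 - cnj w * z) / (1 + cnj w * z)) = Re ((1 - cnj w * z) * cnj (1 + cnj w * z)) / (norm (1 + cnj w * z))\<^sup>2"
    unfolding complex_div_cnj[of "1 - cnj w * z"] by (rule Re_divide_of_real)
  also have "Re ((1 - cnj w * z) * cnj (1 + cnj w * z)) = 1 - (norm (cnj w * z))\<^sup>2"
    by (simp only: cmod_power2) (simp add: power2_eq_square algebra_simps)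
  also have "norm (cnj w * z) = norm w" using z by (simp add: norm_mult)
  finally show "norm (deriv (disc_aut w) z) = Re ((1 - cnj w * z) / (1 + cnj w * z))"
    using nd by simp
qed

lemma norm_deriv_disc_aut_continuous_on:
  "norm w < 1 \<Longrightarrow> continuous_on (cball 0 1) (\<lambda>z. norm (deriv (disc_aut w) z))"
proof -
  assume w: "norm w < 1"
  have "continuous_on (cball 0 1) (\<lambda>z. norm ((1 - (norm w)\<^sup>2) / (1 + cnj w * z)\<^sup>2))"
    using disc_aut_denominator_nonzero[OF w] by (intro continuous_intros) auto
  then show ?thesis
    by (rule continuous_on_eq) (use disc_aut_denominator_nonzero[OF w] in \<open>auto simp: deriv_disc_aut\<close>)
qed

lemma disc_aut_continuous_on:
  "norm w < 1 \<Longrightarrow> continuous_on (cball 0 1) (disc_aut w)"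
  unfolding disc_aut_def[abs_def] using disc_aut_denominator_nonzero[of w]
  by (intro continuous_intros) auto

text \<open>Write q = c + z q1 and T for the automorphism. The constant is handled by the Poisson
  form of |T'|; in the rest |T'| T q1(T) equals z T' q1(T), which is holomorphic and vanishes at
  0.\<close>

lemma has_integral_circle_disc_aut_poly:
  fixes q :: "complex poly"
  assumes w: "norm w < 1"
  shows "((\<lambda>t. Re (poly q (disc_aut w (cis t))) * norm (deriv (disc_aut w) (cis t)))
    has_integral 2 * pi * Re (poly q 0)) {0..2 * pi}"
proof -
  obtain c q1 where q: "q = pCons c q1" by (rule pCons_cases)
  obtain R where R: "1 < R" "\<And>z. norm z < R \<Longrightarrow> 1 + cnj w * z \<noteq> 0"
    "disc_aut w holomorphic_on ball 0 R"
    by (rule disc_aut_nbhd[OF w, of 2]) auto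
  have "(\<lambda>z. z * deriv (disc_aut w) z * poly q1 (disc_aut w z)) holomorphic_on ball 0 R"
    using R(3) by (intro holomorphic_intros holomorphic_deriv holomorphic_on_compose_gen[unfolded o_def, of "disc_aut w" _ "poly q1" UNIV]) auto
  from has_integral_circle_mean_Re[OF this R(1)]
  have 1: "((\<lambda>t. Re (cis t * deriv (disc_aut w) (cis t) * poly q1 (disc_aut w (cis t)))) has_integral 0) {0..2*pi}"
    by simp
  have "(\<lambda>z. (1 - cnj w * z) / (1 + cnj w * z)) holomorphic_on ball 0 R"
    using R(2) by (intro holomorphic_intros) auto
  from has_integral_circle_mean_Re[OF this R(1)]
  have 2: "((\<lambda>t. Re ((1 - cnj w * cis t) / (1 + cnj w * cis t))) has_integral 2 * pi) {0..2*pi}"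
    by simp
  have "((\<lambda>t. Re c * Re ((1 - cnj w * cis t) / (1 + cnj w * cis t)) +
     Re (cis t * deriv (disc_aut w) (cis t) * poly q1 (disc_aut w (cis t)))) has_integral (Re c * (2 * pi) + 0)) {0..2*pi}"
    by (intro has_integral_add has_integral_mult_right 1 2)
  then show ?thesis
  proof (rule has_integral_eq_rhs[OF has_integral_eq[rotated]])
    fix t :: real
    let ?z = "cis t"
    have nz: "disc_aut w ?z \<noteq> 0" using norm_disc_aut_eq_1[OF w, of ?z] by auto
    have "?z * deriv (disc_aut w) ?z * poly q1 (disc_aut w ?z)
        = of_real (norm (deriv (disc_aut w) ?z)) * (disc_aut w ?z * poly q1 (disc_aut w ?z))"
      unfolding norm_deriv_disc_aut_on_circle(1)[OF w norm_cis] using nz by (simp add: field_simps)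
    then have "Re (?z * deriv (disc_aut w) ?z * poly q1 (disc_aut w ?z))
        = norm (deriv (disc_aut w) ?z) * Re (disc_aut w ?z * poly q1 (disc_aut w ?z))"
      by (simp only: Re_complex_of_real times_complex.sel Im_complex_of_real mult_zero_left diff_zero)
    then show "Re c * Re ((1 - cnj w * ?z) / (1 + cnj w * ?z)) +
        Re (?z * deriv (disc_aut w) ?z * poly q1 (disc_aut w ?z)) =
        Re (poly q (disc_aut w ?z)) * norm (deriv (disc_aut w) ?z)"
      unfolding norm_deriv_disc_aut_on_circle(2)[OF w norm_cis, symmetric] by (simp add: q algebra_simps)
  qed (simp add: q)
qed

lemma integrable_circle_disc_aut:
  fixes f :: "complex \<Rightarrow> real"
  assumes w: "norm w < 1" and f: "continuous_on (sphere 0 1) f"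
  shows "(\<lambda>t. f (disc_aut w (cis t)) * norm (deriv (disc_aut w) (cis t))) integrable_on {0..2 * pi}"
proof (intro integrable_continuous_real continuous_on_mult)
  have cc: "continuous_on {0..2*pi} cis" "cis ` {0..2*pi} \<subseteq> cball 0 1"
    by (auto intro!: continuous_intros simp: cis_conv_exp)
  show "continuous_on {0..2*pi} (\<lambda>t. norm (deriv (disc_aut w) (cis t)))"
    by (rule continuous_on_compose2[OF norm_deriv_disc_aut_continuous_on[OF w] cc])
  have "continuous_on {0..2*pi} (\<lambda>t. disc_aut w (cis t))"
    by (rule continuous_on_compose2[OF disc_aut_continuous_on[OF w] cc])
  then show "continuous_on {0..2*pi} (\<lambda>t. f (disc_aut w (cis t)))"
    by (rule continuous_on_compose2[OF f]) (auto simp: norm_disc_aut_eq_1[OF w])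
qed

text \<open>Change of variables on the circle without an angle function for the automorphism: for
  real parts of polynomials both sides are 2 pi times the value at 0, and such functions are
  uniformly dense.\<close>

lemma integral_circle_disc_aut:
  fixes f :: "complex \<Rightarrow> real"
  assumes w: "norm w < 1" and f: "continuous_on (sphere 0 1) f"
  shows "integral {0..2 * pi} (\<lambda>t. f (disc_aut w (cis t)) * norm (deriv (disc_aut w) (cis t)))
    = integral {0..2 * pi} (\<lambda>t. f (cis t))" (is "?L = ?R")
proof -
  have "\<bar>?L - ?R\<bar> \<le> e" if "0 < e" for e
  proof -
    \<comment> \<open>Both dt and |T'| dt have mass 2 pi on the circle, so this tolerance costs e /
      2 on each side.\<close>
    obtain p where p: "\<And>z. norm z = 1 \<Longrightarrow> \<bar>f z - Re (poly p z)\<bar> < e / (4 * pi)"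
      using Re_poly_approx_on_circle[OF f, of "e / (4 * pi)"] \<open>0 < e\<close> by auto
    let ?d = "\<lambda>t. norm (deriv (disc_aut w) (cis t))"
    have 1: "((\<lambda>t. Re (poly p (disc_aut w (cis t))) * ?d t) has_integral 2 * pi * Re (poly p 0)) {0..2 * pi}"
      by (rule has_integral_circle_disc_aut_poly[OF w])
    have 2: "((\<lambda>t. Re (poly p (cis t))) has_integral 2 * pi * Re (poly p 0)) {0..2 * pi}"
      by (rule has_integral_circle_mean_Re[of _ 2]) (auto intro!: holomorphic_intros)
    have 3: "(?d has_integral 2 * pi) {0..2 * pi}"
      using has_integral_circle_disc_aut_poly[OF w, of 1] by simp
    have iL: "(\<lambda>t. f (disc_aut w (cis t)) * ?d t) integrable_on {0..2 * pi}"
      by (rule integrable_circle_disc_aut[OF w f])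
    have iR: "(\<lambda>t. f (cis t)) integrable_on {0..2 * pi}"
      by (intro integrable_continuous_real continuous_on_compose2[OF f])
         (auto intro!: continuous_intros simp: cis_conv_exp)
    have b1: "\<bar>f (disc_aut w (cis t)) * ?d t - Re (poly p (disc_aut w (cis t))) * ?d t\<bar> \<le> e / (4 * pi) * ?d t" for t
    proof -
      have "\<bar>f (disc_aut w (cis t)) - Re (poly p (disc_aut w (cis t)))\<bar> \<le> e / (4 * pi)"
        using p[of "disc_aut w (cis t)"] norm_disc_aut_eq_1[OF w, of "cis t"] by simp
      then have "\<bar>f (disc_aut w (cis t)) - Re (poly p (disc_aut w (cis t)))\<bar> * ?d t \<le> e / (4 * pi) * ?d t"
        by (intro mult_right_mono) auto
      then show ?thesis by (simp add: left_diff_distrib[symmetric] abs_mult)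
    qed
    have "norm (integral {0..2*pi} (\<lambda>t. f (disc_aut w (cis t)) * ?d t - Re (poly p (disc_aut w (cis t))) * ?d t))
        \<le> integral {0..2*pi} (\<lambda>t. e / (4 * pi) * ?d t)"
      using b1 by (intro integral_norm_bound_integral integrable_diff iL has_integral_integrable[OF 1]
         has_integral_integrable[OF has_integral_mult_right[OF 3]]) auto
    also have "\<dots> = e / 2"
      using integral_unique[OF has_integral_mult_right[OF 3, of "e / (4*pi)"]] by simp
    finally have 4: "\<bar>?L - 2 * pi * Re (poly p 0)\<bar> \<le> e / 2"
      using integral_diff[OF iL has_integral_integrable[OF 1]] integral_unique[OF 1] by simp
    have "norm (integral {0..2*pi} (\<lambda>t. f (cis t) - Re (poly p (cis t))))
        \<le> integral {0..2*pi} (\<lambda>t. e / (4 * pi))"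
      by (intro integral_norm_bound_integral integrable_diff iR has_integral_integrable[OF 2])
        (auto intro!: less_imp_le p)
    also have "\<dots> = e / 2" by simp
    finally have 5: "\<bar>?R - 2 * pi * Re (poly p 0)\<bar> \<le> e / 2"
      using integral_diff[OF iR has_integral_integrable[OF 2]] integral_unique[OF 2] by simp
    show ?thesis using 4 5 by linarith
  qed
  then show ?thesis using field_le_epsilon[of "\<bar>?L - ?R\<bar>" 0] by simp
qed

section \<open>Polar coordinates and a weighted Carleman inequality\<close>

lemma nn_integral_exp_lessThan:
  fixes c b :: real
  assumes "0 < c"
  shows "(\<integral>\<^sup>+x\<in>{..<b}. ennreal (exp (c * x)) \<partial>lborel) = ennreal (exp (c * b) / c)"
proof -
  have "(\<integral>\<^sup>+x\<in>{..<b}. ennreal (exp (c * x)) \<partial>lborel)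
      = (\<integral>\<^sup>+x. ennreal (exp (c * (- x))) * indicator {..<b} (- x) \<partial>lborel)"
    by (subst nn_integral_real_affine[where c = "-1" and t = 0]) auto
  also have "\<dots> = (\<integral>\<^sup>+x\<in>{-b..}. ennreal (exp (- c * x)) \<partial>lborel)"
  proof (rule nn_integral_cong_AE)
    have "AE x in lborel. x \<noteq> - b" by (rule AE_lborel_singleton)
    then show "AE x in lborel. ennreal (exp (c * (- x))) * indicator {..<b} (- x)
        = ennreal (exp (- c * x)) * indicator {-b..} x"
      by eventually_elim (auto simp: indicator_def)
  qed
  also have "\<dots> = ennreal (exp (- c * (- b)) / c)"
    by (rule nn_integral_has_integral_lebesgue') (use has_integral_exp_minus_to_infinity[OF assms, of "-b"] in auto)
  finally show ?thesis by simp
qed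

lemma set_nn_integral_continuous_eq_integral:
  fixes g :: "real \<Rightarrow> real"
  assumes "continuous_on {a..b} g" "\<And>x. x \<in> {a..b} \<Longrightarrow> 0 \<le> g x"
  shows "(\<integral>\<^sup>+x\<in>{a..b}. ennreal (g x) \<partial>lborel) = ennreal (integral {a..b} g)"
  by (rule nn_integral_has_integral_lebesgue')
     (use assms in \<open>auto intro: integrable_integral integrable_continuous_real\<close>)

lemma AE_lborel_Im_neq: "AE z in lborel. Im z \<noteq> c"
proof -
  have "negligible {z::complex. z \<bullet> \<i> = c}"
    by (rule negligible_standard_hyperplane) (simp add: Basis_complex_def)
  then have "{z::complex. Im z = c} \<in> null_sets lebesgue"
    by (simp add: negligible_iff_null_sets)
  moreover have "{z::complex. Im z = c} \<in> sets borel" by measurable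
  ultimately have "{z::complex. Im z = c} \<in> null_sets lborel"
    by (simp add: null_sets_completion_iff)
  then show ?thesis by (auto intro: AE_I')
qed

lemma exp_strip_image:
  "exp ` {z. Re z < b \<and> 0 < Im z \<and> Im z < 2 * pi} = ball 0 (exp b) - {z. Im z = 0 \<and> 0 \<le> Re z}"
proof (intro equalityI subsetI)
  fix w assume "w \<in> exp ` {z. Re z < b \<and> 0 < Im z \<and> Im z < 2 * pi}"
  then obtain z where z: "w = exp z" "Re z < b" "0 < Im z" "Im z < 2 * pi" by auto
  have "Arg2pi w = Im z" using z by (simp add: Arg2pi_exp)
  then have "\<not> (w \<in> \<real> \<and> 0 \<le> Re w)" using z Arg2pi_eq_0[of w] by auto
  then show "w \<in> ball 0 (exp b) - {z. Im z = 0 \<and> 0 \<le> Re z}"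
    using z by (auto simp: complex_is_Real_iff)
next
  fix w assume w: "w \<in> ball 0 (exp b) - {z. Im z = 0 \<and> 0 \<le> Re z}"
  then have w0: "w \<noteq> 0" by auto
  have A: "0 < Arg2pi w" "Arg2pi w < 2 * pi"
    using w Arg2pi_eq_0[of w] Arg2pi[of w] by (auto simp: complex_is_Real_iff order.order_iff_strict)
  have "w = of_real (norm w) * exp (\<i> * of_real (Arg2pi w))"
    using Arg2pi[of w] unfolding is_Arg_def by blast
  also have "\<dots> = exp (Complex (ln (norm w)) (Arg2pi w))"
    using w0 unfolding exp_eq_polar[of "Complex _ _"] by (simp add: cis_conv_exp)
  finally have "w = exp (Complex (ln (norm w)) (Arg2pi w))" .
  moreover have "ln (norm w) < b"
    using w w0 by (metis Diff_iff mem_ball_0 exp_less_cancel_iff exp_ln zero_less_norm_iff)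
  ultimately show "w \<in> exp ` {z. Re z < b \<and> 0 < Im z \<and> Im z < 2 * pi}"
    using A by (intro image_eqI[of _ _ "Complex (ln (norm w)) (Arg2pi w)"]) auto
qed

lemma inj_on_exp_strip: "inj_on exp {z. 0 < Im z \<and> Im z < 2 * pi}"
proof (rule inj_onI)
  fix x y assume *: "x \<in> {z. 0 < Im z \<and> Im z < 2 * pi}" "y \<in> {z. 0 < Im z \<and> Im z < 2 * pi}" "exp x = exp y"
  then have "Im x = Im y" by (metis (no_types, lifting) Arg2pi_exp less_imp_le mem_Collect_eq)
  moreover have "Re x = Re y" using *(3) by (metis norm_exp_eq_Re exp_inj_iff)
  ultimately show "x = y" by (simp add: complex_eq_iff)
qed

text \<open>Polar coordinates as the conformal map exp on a half strip, with Jacobian exp (2 x); the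
  image misses only a slit of measure zero. With the logarithmic radius x as coordinate, powers of
  |z| become exponentials.\<close>

lemma nn_integral_ball_polar:
  fixes h :: "complex \<Rightarrow> ennreal"
  assumes [measurable]: "h \<in> borel_measurable borel"
  shows "(\<integral>\<^sup>+z\<in>ball 0 (exp b). h z \<partial>lborel) =
    (\<integral>\<^sup>+x\<in>{..<b}. (\<integral>\<^sup>+y\<in>{0..2*pi}. h (exp (Complex x y)) \<partial>lborel) * ennreal (exp (2 * x)) \<partial>lborel)"
proof -
  let ?S = "{z. Re z < b \<and> 0 < Im z \<and> Im z < 2 * pi}"
  have S: "open ?S"
    by (intro open_Collect_conj open_Collect_less continuous_intros)
  have Sm [measurable]: "?S \<in> sets borel" using S by simp
  have "(\<integral>\<^sup>+z\<in>ball 0 (exp b). h z \<partial>lborel) = (\<integral>\<^sup>+z\<in>exp ` ?S. h z \<partial>lborel)"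
  proof (rule nn_integral_cong_AE)
    show "AE z in lborel. h z * indicator (ball 0 (exp b)) z = h z * indicator (exp ` ?S) z"
      using AE_lborel_Im_neq[of 0]
      by eventually_elim (auto simp: exp_strip_image indicator_def)
  qed
  also have "\<dots> = (\<integral>\<^sup>+z\<in>?S. h (exp z) * ennreal ((norm (deriv exp z))\<^sup>2) \<partial>lborel)"
    by (rule nn_integral_conformal_image[OF S])
       (auto intro!: holomorphic_intros inj_on_subset[OF inj_on_exp_strip])
  also have "\<dots> = (\<integral>\<^sup>+z. h (exp z) * ennreal (exp (2 * Re z)) * indicator ?S z \<partial>lborel)"
    by (intro nn_integral_cong) (simp add: DERIV_imp_deriv[OF DERIV_exp] power2_eq_square exp_add[symmetric])
  also have "\<dots> = (\<integral>\<^sup>+x. \<integral>\<^sup>+y. h (exp (Complex x y)) * ennreal (exp (2 * x)) * indicator ?S (Complex x y) \<partial>lborel \<partial>lborel)"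
    by (subst nn_integral_complex_Re_Im) (simp_all add: borel_measurable_indicator)
  also have "\<dots> = (\<integral>\<^sup>+x\<in>{..<b}. (\<integral>\<^sup>+y\<in>{0..2*pi}. h (exp (Complex x y)) \<partial>lborel) * ennreal (exp (2 * x)) \<partial>lborel)"
  proof (rule nn_integral_cong)
    fix x :: real
    have "(\<integral>\<^sup>+y. h (exp (Complex x y)) * ennreal (exp (2 * x)) * indicator ?S (Complex x y) \<partial>lborel)
      = (\<integral>\<^sup>+y. (h (exp (Complex x y)) * indicator {0..2*pi} y) * (ennreal (exp (2 * x)) * indicator {..<b} x) \<partial>lborel)"
    proof (rule nn_integral_cong_AE)
      show "AE y in lborel. h (exp (Complex x y)) * ennreal (exp (2 * x)) * indicator ?S (Complex x y)
        = (h (exp (Complex x y)) * indicator {0..2*pi} y) * (ennreal (exp (2 * x)) * indicator {..<b} x)"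
        using AE_lborel_singleton[of 0] AE_lborel_singleton[of "2*pi"]
        by eventually_elim (auto simp: indicator_def)
    qed
    also have "\<dots> = (\<integral>\<^sup>+y\<in>{0..2*pi}. h (exp (Complex x y)) \<partial>lborel) * (ennreal (exp (2 * x)) * indicator {..<b} x)"
      by (rule nn_integral_multc) measurable
    finally show "(\<integral>\<^sup>+y. h (exp (Complex x y)) * ennreal (exp (2 * x)) * indicator ?S (Complex x y) \<partial>lborel)
      = (\<integral>\<^sup>+y\<in>{0..2*pi}. h (exp (Complex x y)) \<partial>lborel) * ennreal (exp (2 * x)) * indicator {..<b} x"
      by (simp add: mult.assoc)
  qed
  finally show ?thesis .
qed

section \<open>Parseval's identity and the weighted Carleman inequality\<close>

lemma has_integral_cis_multiple:
  "((\<lambda>t. cis ((real i - real j) * t)) has_integral (if i = j then 2 * pi else 0)) {0..2*pi}"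
proof (cases "i = j")
  case True
  then show ?thesis
    using has_integral_const_real[of "1::complex" 0 "2*pi"] by (simp add: scaleR_conv_of_real)
next
  case False
  let ?k = "real i - real j"
  have k: "?k \<noteq> 0" using False by simp
  have "((\<lambda>t. cis (?k * t)) has_integral
     ((\<lambda>t. cis (?k * t) / (\<i> * ?k)) (2*pi) - (\<lambda>t. cis (?k * t) / (\<i> * ?k)) 0)) {0..2*pi}"
  proof (intro fundamental_theorem_of_calculus)
    fix t :: real
    define c where "c = \<i> * complex_of_real ?k"
    have "c \<noteq> 0" using k by (simp add: c_def)
    then have "((\<lambda>z. exp (c * z) / c) has_field_derivative exp (c * of_real t)) (at (of_real t))"
      by (auto intro!: derivative_eq_intros)
    from has_vector_derivative_real_field[OF this]
    show "((\<lambda>t. cis (?k * t) / (\<i> * ?k)) has_vector_derivative cis (?k * t)) (at t within {0..2*pi})"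
      by (simp add: cis_conv_exp c_def mult.assoc)
  qed simp
  moreover have "cis (?k * (2 * pi)) = 1"
    using cis_multiple_2pi[of "?k"] by (simp add: mult.commute mult.left_commute)
  ultimately show ?thesis using False by simp
qed

lemma parseval_poly:
  fixes q :: "complex poly"
  shows "((\<lambda>t. (norm (poly q (of_real r * cis t)))\<^sup>2) has_integral
    2 * pi * (\<Sum>n\<le>degree q. (norm (coeff q n))\<^sup>2 * r ^ (2 * n))) {0..2*pi}"
proof -
  let ?c = "\<lambda>i j. coeff q i * cnj (coeff q j) * of_real (r ^ i * r ^ j)"
  have "((\<lambda>t. \<Sum>i\<le>degree q. \<Sum>j\<le>degree q. ?c i j * cis ((real i - real j) * t)) has_integral
     (\<Sum>i\<le>degree q. \<Sum>j\<le>degree q. ?c i j * (if i = j then 2 * pi else 0))) {0..2*pi}"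
    by (intro has_integral_sum has_integral_mult_right has_integral_cis_multiple) auto
  then have "((\<lambda>t. Re (\<Sum>i\<le>degree q. \<Sum>j\<le>degree q. ?c i j * cis ((real i - real j) * t))) has_integral
     Re (\<Sum>i\<le>degree q. \<Sum>j\<le>degree q. ?c i j * (if i = j then 2 * pi else 0))) {0..2*pi}"
    by (drule_tac has_integral_linear[OF _ bounded_linear_Re]) (simp only: o_def)
  moreover have "Re (\<Sum>i\<le>degree q. \<Sum>j\<le>degree q. ?c i j * cis ((real i - real j) * t)) =
     (norm (poly q (of_real r * cis t)))\<^sup>2" for t
  proof -
    have "of_real ((norm (poly q (of_real r * cis t)))\<^sup>2) =
      poly q (of_real r * cis t) * cnj (poly q (of_real r * cis t))"
      by (rule complex_norm_square)
    also have "\<dots> = (\<Sum>i\<le>degree q. \<Sum>j\<le>degree q. ?c i j * cis ((real i - real j) * t))"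
    proof -
      have "cis t ^ i * cnj (cis t) ^ j = cis ((real i - real j) * t)" for i j
        by (simp add: Complex.DeMoivre cis_cnj cis_mult left_diff_distrib)
      then have "coeff q i * (of_real r * cis t) ^ i * cnj (coeff q j * (of_real r * cis t) ^ j)
          = ?c i j * cis ((real i - real j) * t)" for i j
        by (simp add: power_mult_distrib flip: \<open>\<And>i j. _ = cis ((real i - real j) * t)\<close>)
      then show ?thesis
        unfolding poly_altdef cnj_sum sum_product by (intro sum.cong refl)
    qed
    finally show ?thesis by (metis Re_complex_of_real)
  qed
  moreover have "Re (\<Sum>i\<le>degree q. \<Sum>j\<le>degree q. ?c i j * (if i = j then 2 * pi else 0))
     = 2 * pi * (\<Sum>n\<le>degree q. (norm (coeff q n))\<^sup>2 * r ^ (2 * n))"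
  proof -
    have "(\<Sum>i\<le>degree q. \<Sum>j\<le>degree q. ?c i j * (if i = j then 2 * pi else 0))
       = (\<Sum>i\<le>degree q. ?c i i * (2 * pi))"
    proof (intro sum.cong refl)
      fix i assume "i \<in> {..degree q}"
      have "(\<Sum>j\<le>degree q. ?c i j * (if i = j then 2 * pi else 0)) =
          (\<Sum>j\<le>degree q. if i = j then ?c i j * (2 * pi) else 0)"
        by (intro sum.cong refl) simp
      also have "\<dots> = ?c i i * (2 * pi)"
        using \<open>i \<in> {..degree q}\<close> by (subst sum.delta') auto
      finally show "(\<Sum>j\<le>degree q. ?c i j * (if i = j then 2 * pi else 0)) = ?c i i * (2 * pi)" .
    qed
    also have "\<dots> = of_real (2 * pi * (\<Sum>n\<le>degree q. (norm (coeff q n))\<^sup>2 * r ^ (2 * n)))"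
    proof -
      have "?c n n * (2 * pi) = of_real (2 * pi * ((norm (coeff q n))\<^sup>2 * r ^ (2 * n)))" for n
      proof -
        have "r ^ (2 * n) = r ^ n * r ^ n" by (metis mult_2 power_add)
        then have "?c n n * (2 * pi) = (coeff q n * cnj (coeff q n)) * of_real (r ^ (2 * n) * (2 * pi))"
          by simp
        also have "\<dots> = of_real ((norm (coeff q n))\<^sup>2) * of_real (r ^ (2 * n) * (2 * pi))"
          by (simp only: complex_norm_square)
        finally show ?thesis by (simp add: mult_ac)
      qed
      then show ?thesis
        unfolding sum_distrib_left of_real_sum by (intro sum.cong refl)
    qed
    finally show ?thesis by (metis Re_complex_of_real)
  qed
  ultimately show ?thesis by (simp only:)
qed

lemma norm_sum_squared_le:
  fixes f :: "nat \<Rightarrow> 'a :: real_normed_vector"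
  shows "(norm (\<Sum>i\<le>n. f i))\<^sup>2 \<le> (real n + 1) * (\<Sum>i\<le>n. (norm (f i))\<^sup>2)"
proof -
  have "(norm (\<Sum>i\<le>n. f i))\<^sup>2 \<le> (\<Sum>i\<le>n. norm (f i))\<^sup>2"
    by (intro power_mono norm_sum) auto
  also have "\<dots> \<le> (\<Sum>i\<le>n. (norm (f i))\<^sup>2) * card {..n}"
    by (rule sum_squared_le_sum_of_squares)
  finally show ?thesis by (simp add: mult.commute add.commute)
qed

text \<open>The n-th coefficient of g^2 is a sum of n + 1 products, so Cauchy-Schwarz costs a factor
  n + 1, and (n + 1) / (n + k) \<le> 1 / k. The remaining convolution of the numbers |g_i|^2 is the
  coefficient sequence of A^2, where A carries these numbers as coefficients, and its sum is
  A(1)^2.\<close>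

lemma carleman_coefficients:
  fixes g :: "complex poly"
  assumes k: "0 < k" "k \<le> 1"
  shows "(\<Sum>n\<le>degree (g * g). (norm (coeff (g * g) n))\<^sup>2 / (real n + k))
     \<le> (\<Sum>n\<le>degree g. (norm (coeff g n))\<^sup>2)\<^sup>2 / k"
proof -
  define A :: "real poly" where "A = (\<Sum>i\<le>degree g. monom ((norm (coeff g i))\<^sup>2) i)"
  have cA: "coeff A i = (norm (coeff g i))\<^sup>2" for i
    by (auto simp: A_def coeff_sum coeff_eq_0)
  have A1: "poly A 1 = (\<Sum>n\<le>degree g. (norm (coeff g n))\<^sup>2)"
    by (simp add: A_def poly_sum poly_monom)
  have le: "(norm (coeff (g * g) n))\<^sup>2 / (real n + k) \<le> coeff (A * A) n / k" for n
  proof -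
    have "(norm (coeff (g * g) n))\<^sup>2 \<le> (real n + 1) * (\<Sum>i\<le>n. (norm (coeff g i * coeff g (n - i)))\<^sup>2)"
      unfolding coeff_mult by (rule norm_sum_squared_le)
    also have "(\<Sum>i\<le>n. (norm (coeff g i * coeff g (n - i)))\<^sup>2) = coeff (A * A) n"
      by (simp add: coeff_mult cA norm_mult power_mult_distrib)
    finally have 1: "(norm (coeff (g * g) n))\<^sup>2 \<le> (real n + 1) * coeff (A * A) n" .
    have c0: "0 \<le> coeff (A * A) n"
      by (auto simp: coeff_mult cA intro!: sum_nonneg)
    have "k * (real n + 1) \<le> real n + k"
      using mult_right_mono[OF k(2), of "real n"] by (simp add: algebra_simps)
    then have "(real n + 1) / (real n + k) \<le> 1 / k"
      using k by (simp add: field_simps)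
    then have "(real n + 1) / (real n + k) * coeff (A * A) n \<le> 1 / k * coeff (A * A) n"
      using c0 by (rule mult_right_mono)
    moreover have "(norm (coeff (g * g) n))\<^sup>2 / (real n + k) \<le> (real n + 1) * coeff (A * A) n / (real n + k)"
      using k by (intro divide_right_mono 1) auto
    ultimately show ?thesis by simp
  qed
  have "(\<Sum>n\<le>degree (g * g). (norm (coeff (g * g) n))\<^sup>2 / (real n + k))
     \<le> (\<Sum>n\<le>degree (g * g). coeff (A * A) n / k)"
    by (intro sum_mono le)
  \<comment> \<open>The coefficients of \<open>A * A\<close> are nonnegative, so the range of
    summation may grow to the larger degree; this avoids comparing the two degrees.\<close>
  also have "\<dots> \<le> (\<Sum>n\<le>max (degree (g * g)) (degree (A * A)). coeff (A * A) n / k)"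
    using k by (intro sum_mono2) (auto simp: coeff_mult cA intro!: divide_nonneg_pos sum_nonneg)
  also have "\<dots> = (\<Sum>n\<le>degree (A * A). coeff (A * A) n / k)"
    by (intro sum.mono_neutral_right) (auto simp: coeff_eq_0)
  also have "\<dots> = poly (A * A) 1 / k"
    by (simp only: poly_altdef sum_divide_distrib) simp
  finally show ?thesis by (simp add: A1 power2_eq_square)
qed

text \<open>Here g is thought of as the square root of a holomorphic conformal factor: |g|^2 is the
  density of length and |g|^4 that of area. The radial integral of the n-th term of |g^2|^2 against
  the weight is 1 / (2 (n + k)). For k = 1 this is Carleman's isoperimetric inequality.\<close>

lemma carleman_poly:
  fixes g :: "complex poly"
  assumes k: "0 < k" "k \<le> 1"
  shows "(\<integral>\<^sup>+z\<in>ball 0 1. ennreal ((norm (poly g z)) ^ 4 * norm z powr (- 2 * (1 - k))) \<partial>lborel)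
    \<le> ennreal ((integral {0..2*pi} (\<lambda>t. (norm (poly g (cis t)))\<^sup>2))\<^sup>2 / (4 * pi * k))"
proof -
  let ?q = "g * g"
  let ?b = "\<lambda>n. (norm (coeff ?q n))\<^sup>2"
  have [measurable]: "poly g \<in> borel_measurable borel"
    by (intro borel_measurable_continuous_onI continuous_intros)
  have "(\<integral>\<^sup>+z\<in>ball 0 (exp 0). ennreal ((norm (poly g z)) ^ 4 * norm z powr (- 2 * (1 - k))) \<partial>lborel) =
     (\<integral>\<^sup>+x\<in>{..<0}. (\<integral>\<^sup>+y\<in>{0..2*pi}. ennreal ((norm (poly g (exp (Complex x y)))) ^ 4 * norm (exp (Complex x y)) powr (- 2 * (1 - k))) \<partial>lborel)
        * ennreal (exp (2 * x)) \<partial>lborel)"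
    by (rule nn_integral_ball_polar) measurable
  also have "\<dots> = (\<integral>\<^sup>+x\<in>{..<0}. ennreal (\<Sum>n\<le>degree ?q. 2 * pi * ?b n * exp ((2 * (real n + k)) * x)) \<partial>lborel)"
  proof (intro nn_integral_cong)
    fix x :: real
    have e: "exp (Complex x y) = of_real (exp x) * cis y" for y
      by (simp add: exp_eq_polar)
    have n4: "(norm (poly g z)) ^ 4 = (norm (poly ?q z))\<^sup>2" for z
      by (simp add: norm_mult power_mult_distrib flip: power_add)
    have "(\<integral>\<^sup>+y\<in>{0..2*pi}. ennreal ((norm (poly g (exp (Complex x y)))) ^ 4 * norm (exp (Complex x y)) powr (- 2 * (1 - k))) \<partial>lborel)
      = (\<integral>\<^sup>+y\<in>{0..2*pi}. ennreal ((norm (poly ?q (of_real (exp x) * cis y)))\<^sup>2 * exp (x * (- 2 * (1 - k)))) \<partial>lborel)"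
      by (intro nn_integral_cong) (simp add: e n4 norm_mult exp_powr_real)
    also have "\<dots> = ennreal (2 * pi * (\<Sum>n\<le>degree ?q. ?b n * (exp x) ^ (2 * n)) * exp (x * (- 2 * (1 - k))))"
      by (rule nn_integral_has_integral_lebesgue'[OF _ has_integral_mult_left[OF parseval_poly]]) simp
    also have "\<dots> * ennreal (exp (2 * x)) =
      ennreal (2 * pi * (\<Sum>n\<le>degree ?q. ?b n * (exp x) ^ (2 * n)) * exp (x * (- 2 * (1 - k))) * exp (2 * x))"
      by (rule ennreal_mult[symmetric]) (auto intro!: mult_nonneg_nonneg sum_nonneg)
    also have "2 * pi * (\<Sum>n\<le>degree ?q. ?b n * (exp x) ^ (2 * n)) * exp (x * (- 2 * (1 - k))) * exp (2 * x)
      = (\<Sum>n\<le>degree ?q. 2 * pi * ?b n * exp ((2 * (real n + k)) * x))"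
    proof -
      have "exp x ^ (2 * n) * exp (x * (- 2 * (1 - k))) * exp (2 * x) = exp ((2 * (real n + k)) * x)" for n
        by (simp add: exp_of_nat_mult[symmetric] exp_add[symmetric] algebra_simps)
      then show ?thesis
        by (simp add: sum_distrib_left sum_distrib_right mult.assoc)
    qed
    finally show "(\<integral>\<^sup>+y\<in>{0..2*pi}. ennreal ((norm (poly g (exp (Complex x y)))) ^ 4 * norm (exp (Complex x y)) powr (- 2 * (1 - k))) \<partial>lborel)
        * ennreal (exp (2 * x)) * indicator {..<0} x =
        ennreal (\<Sum>n\<le>degree ?q. 2 * pi * ?b n * exp ((2 * (real n + k)) * x)) * indicator {..<0} x"
      by (simp only:)
  qed
  also have "\<dots> = (\<integral>\<^sup>+x. (\<Sum>n\<le>degree ?q. ennreal (2 * pi * ?b n) * (ennreal (exp ((2 * (real n + k)) * x)) * indicator {..<0} x)) \<partial>lborel)"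
    by (intro nn_integral_cong) (auto simp: indicator_def ennreal_mult[symmetric] sum_ennreal)
  also have "\<dots> = (\<Sum>n\<le>degree ?q. ennreal (2 * pi * ?b n) * ennreal (1 / (2 * (real n + k))))"
    using k by (subst nn_integral_sum) (simp_all add: nn_integral_cmult nn_integral_exp_lessThan)
  also have "\<dots> = ennreal (pi * (\<Sum>n\<le>degree ?q. ?b n / (real n + k)))"
  proof -
    have "2 * pi * ?b n * (1 / (2 * (real n + k))) = pi * (?b n / (real n + k))" for n
      using k by (simp add: field_simps)
    then show ?thesis
      using k by (simp add: ennreal_mult[symmetric] sum_ennreal sum_distrib_left)
  qed
  also have "\<dots> \<le> ennreal (pi * ((\<Sum>n\<le>degree g. (norm (coeff g n))\<^sup>2)\<^sup>2 / k))"
    by (intro ennreal_leI mult_left_mono carleman_coefficients k) auto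
  also have "pi * ((\<Sum>n\<le>degree g. (norm (coeff g n))\<^sup>2)\<^sup>2 / k) =
     (integral {0..2*pi} (\<lambda>t. (norm (poly g (cis t)))\<^sup>2))\<^sup>2 / (4 * pi * k)"
    using integral_unique[OF parseval_poly[of g 1]] k by (simp add: power2_eq_square)
  finally show ?thesis by simp
qed

lemma taylor_poly_approx:
  fixes f :: "complex \<Rightarrow> complex"
  assumes f: "f holomorphic_on ball 0 R" and R: "1 < R"
  obtains g :: "nat \<Rightarrow> complex poly" where "uniform_limit (cball 0 1) (\<lambda>n. poly (g n)) f sequentially"
proof -
  define a where "a n = (deriv ^^ n) f 0 / fact n" for n
  define g where "g n = (\<Sum>i<n. monom (a i) i)" for n
  define r where "r = (1 + R) / 2"
  have r: "1 < r" "r < R" using R by (auto simp: r_def)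
  have sums: "(\<lambda>n. a n * w ^ n) sums f w" if "w \<in> ball 0 R" for w
    using holomorphic_power_series[OF f that] by (simp add: a_def)
  have "summable (\<lambda>n. a n * of_real r ^ n)"
    using sums[of "of_real r"] r by (auto simp: summable_def)
  then have "uniform_limit (cball 0 1) (\<lambda>n x. \<Sum>i<n. a i * (x - 0) ^ i) (\<lambda>x. suminf (\<lambda>i. a i * (x - 0) ^ i)) sequentially"
    by (intro powser_uniform_limit) (use r conv_radius_geI[of a "of_real r"] in \<open>auto intro: less_le_trans[of _ "ereal r"]\<close>)
  then have "uniform_limit (cball 0 1) (\<lambda>n. poly (g n)) f sequentially"
  proof (rule uniform_limit_cong'[THEN iffD1, rotated -1])
    show "(\<Sum>i. a i * (x - 0) ^ i) = f x" if "x \<in> cball 0 1" for x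
      using sums[of x] that R by (simp add: sums_iff)
  qed (simp add: g_def poly_sum poly_monom)
  then show ?thesis by (rule that)
qed

text \<open>Taylor polynomials converge uniformly on the closed disc, so the circle integrals
  converge, while Fatou's lemma suffices for the area side.\<close>

lemma carleman_holomorphic:
  fixes f :: "complex \<Rightarrow> complex"
  assumes f: "f holomorphic_on ball 0 R" "1 < R" and k: "0 < k" "k \<le> 1"
  shows "(\<integral>\<^sup>+z\<in>ball 0 1. ennreal ((norm (f z)) ^ 4 * norm z powr (- 2 * (1 - k))) \<partial>lborel)
    \<le> ennreal ((integral {0..2*pi} (\<lambda>t. (norm (f (cis t)))\<^sup>2))\<^sup>2 / (4 * pi * k))"
proof -
  obtain g where g: "uniform_limit (cball 0 1) (\<lambda>n. poly (g n)) f sequentially"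
    using taylor_poly_approx[OF f] .
  let ?I = "\<lambda>F. integral {0..2*pi} (\<lambda>t. (norm (F (cis t)))\<^sup>2)"
  have ul: "uniform_limit {0..2*pi} (\<lambda>n t. poly (g n) (cis t)) (\<lambda>t. f (cis t)) sequentially"
    by (rule uniform_limit_compose'[OF g]) auto
  have cf: "continuous_on (cball 0 1) f"
    using f by (intro holomorphic_on_imp_continuous_on holomorphic_on_subset[OF f(1)]) auto
  have cfc: "continuous_on {0..2*pi} (\<lambda>t. f (cis t))"
    by (rule continuous_on_compose2[OF cf]) (auto intro!: continuous_intros simp: cis_conv_exp)
  have bf: "bounded ((\<lambda>t. f (cis t)) ` {0..2*pi})"
    using compact_continuous_image[OF cfc] compact_imp_bounded by blast
  have ul2: "uniform_limit {0..2*pi} (\<lambda>n t. (norm (poly (g n) (cis t)))\<^sup>2) (\<lambda>t. (norm (f (cis t)))\<^sup>2) sequentially"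
    unfolding power2_eq_square
    by (intro uniform_lim_mult uniform_limit_intros ul) (use bf in \<open>auto simp: bounded_norm_comp\<close>)
  have lim: "(\<lambda>n. ?I (poly (g n))) \<longlonglongrightarrow> ?I f"
  proof -
    obtain I J where IJ: "\<And>n. ((\<lambda>t. (norm (poly (g n) (cis t)))\<^sup>2) has_integral I n) {0..2*pi}"
      "((\<lambda>t. (norm (f (cis t)))\<^sup>2) has_integral J) {0..2*pi}" "(I \<longlongrightarrow> J) sequentially"
      by (rule uniform_limit_integral[OF ul2])
         (auto intro!: continuous_intros simp: cis_conv_exp)
    have "?I (poly (g n)) = I n" "?I f = J" for n
      by (rule integral_unique, rule IJ)+
    then show ?thesis using IJ(3) by simp
  qed
  have "(\<integral>\<^sup>+z\<in>ball 0 1. ennreal ((norm (f z)) ^ 4 * norm z powr (- 2 * (1 - k))) \<partial>lborel)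
     = (\<integral>\<^sup>+z. liminf (\<lambda>n. ennreal ((norm (poly (g n) z)) ^ 4 * norm z powr (- 2 * (1 - k))) * indicator (ball 0 1) z) \<partial>lborel)"
  proof (intro nn_integral_cong)
    fix z
    have "(\<lambda>n. ennreal ((norm (poly (g n) z)) ^ 4 * norm z powr (- 2 * (1 - k))) * indicator (ball 0 1) z)
       \<longlonglongrightarrow> ennreal ((norm (f z)) ^ 4 * norm z powr (- 2 * (1 - k))) * indicator (ball 0 1) z"
    proof (cases "z \<in> ball 0 1")
      case True
      then have "(\<lambda>n. poly (g n) z) \<longlonglongrightarrow> f z"
        by (intro tendsto_uniform_limitI[OF g]) auto
      then show ?thesis using True by (auto intro!: tendsto_intros)
    qed simp
    then show "ennreal ((norm (f z)) ^ 4 * norm z powr (- 2 * (1 - k))) * indicator (ball 0 1) z =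
      liminf (\<lambda>n. ennreal ((norm (poly (g n) z)) ^ 4 * norm z powr (- 2 * (1 - k))) * indicator (ball 0 1) z)"
      by (simp add: lim_imp_Liminf)
  qed
  also have "\<dots> \<le> liminf (\<lambda>n. \<integral>\<^sup>+z\<in>ball 0 1. ennreal ((norm (poly (g n) z)) ^ 4 * norm z powr (- 2 * (1 - k))) \<partial>lborel)"
  proof (rule nn_integral_liminf)
    fix n
    have [measurable]: "poly (g n) \<in> borel_measurable borel"
      by (intro borel_measurable_continuous_onI continuous_intros)
    have "(\<lambda>z. ennreal ((norm (poly (g n) z)) ^ 4 * norm z powr (- 2 * (1 - k)))) \<in> borel_measurable borel"
      by measurable
    then show "(\<lambda>z. ennreal ((norm (poly (g n) z)) ^ 4 * norm z powr (- 2 * (1 - k))) * indicator (ball 0 1) z) \<in> borel_measurable lborel"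
      by (auto intro!: borel_measurable_times_ennreal borel_measurable_indicator)
  qed
  also have "\<dots> \<le> liminf (\<lambda>n. ennreal ((?I (poly (g n)))\<^sup>2 / (4 * pi * k)))"
    by (intro Liminf_mono always_eventually allI carleman_poly k)
  also have "\<dots> = ennreal ((?I f)\<^sup>2 / (4 * pi * k))"
    using k by (intro lim_imp_Liminf tendsto_intros lim) auto
  finally show ?thesis .
qed

text \<open>Substituting the automorphism moves the pole of the weight from 0 to w and leaves the
  circle integral unchanged. The bound is uniform in w, so it can later be integrated over the
  pole.\<close>

lemma carleman_disc_aut:
  fixes p :: "complex poly"
  assumes k: "0 < k" "k \<le> 1" and w: "norm w < 1"
  shows "(\<integral>\<^sup>+z\<in>ball 0 1. ennreal (exp (2 * Re (poly p z)) * norm (disc_aut (- w) z) powr (- 2 * (1 - k))) \<partial>lborel)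
    \<le> ennreal ((integral {0..2*pi} (\<lambda>t. exp (Re (poly p (cis t)))))\<^sup>2 / (4 * pi * k))"
proof -
  obtain R where R: "1 < R" "\<And>z. norm z < R \<Longrightarrow> 1 + cnj w * z \<noteq> 0"
    "disc_aut w holomorphic_on ball 0 R"
    by (rule disc_aut_nbhd[OF w, of 2]) auto
  \<comment> \<open>With T = \<open>disc_aut w\<close>, G^2 = exp (p(T)) T'. The derivative T' has
    an explicit holomorphic square root, so no branch has to be chosen.\<close>
  define G where "G z = exp (poly p (disc_aut w z) / 2) * (sqrt (1 - (norm w)\<^sup>2) / (1 + cnj w * z))" for z
  have "(poly p \<circ> disc_aut w) holomorphic_on ball 0 R"
    by (rule holomorphic_on_compose_gen[OF R(3), of _ UNIV]) (auto intro!: holomorphic_intros)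
  then have hG: "G holomorphic_on ball 0 R"
    unfolding G_def[abs_def] o_def using R(2,3) by (intro holomorphic_intros) auto
  have w1: "0 \<le> 1 - (norm w)\<^sup>2" using w by (simp add: abs_square_le_1)
  have G2: "(norm (G z))\<^sup>2 = exp (Re (poly p (disc_aut w z))) * norm (deriv (disc_aut w) z)" if "norm z < R" for z
  proof -
    have "deriv (disc_aut w) z = of_real (1 - (norm w)\<^sup>2) / (1 + cnj w * z)\<^sup>2"
      by (simp add: deriv_disc_aut[OF R(2)[OF that]])
    then have 1: "norm (deriv (disc_aut w) z) = (1 - (norm w)\<^sup>2) / (norm (1 + cnj w * z))\<^sup>2"
      using w1 by (simp only: norm_divide norm_of_real norm_power abs_of_nonneg)
    have "(norm (G z))\<^sup>2 = (exp (Re (poly p (disc_aut w z)) / 2))\<^sup>2 * ((sqrt (1 - (norm w)\<^sup>2))\<^sup>2 / (norm (1 + cnj w * z))\<^sup>2)"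
      by (simp add: G_def norm_mult norm_divide power_mult_distrib power_divide)
    also have "\<dots> = exp (Re (poly p (disc_aut w z))) * ((1 - (norm w)\<^sup>2) / (norm (1 + cnj w * z))\<^sup>2)"
      using w1 by (simp add: exp_double[symmetric])
    finally show ?thesis by (simp only: 1)
  qed
  have [measurable]: "poly p \<in> borel_measurable borel"
    by (intro borel_measurable_continuous_onI continuous_intros)
  have "(\<integral>\<^sup>+z\<in>disc_aut w ` ball 0 1. ennreal (exp (2 * Re (poly p z)) * norm (disc_aut (- w) z) powr (- 2 * (1 - k))) \<partial>lborel)
    = (\<integral>\<^sup>+z\<in>ball 0 1. ennreal (exp (2 * Re (poly p (disc_aut w z))) * norm (disc_aut (- w) (disc_aut w z)) powr (- 2 * (1 - k)))
       * ennreal ((norm (deriv (disc_aut w) z))\<^sup>2) \<partial>lborel)"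
  proof (rule nn_integral_conformal_image)
    show "inj_on (disc_aut w) (ball 0 1)" using inj_on_disc_aut[OF w] by (rule inj_on_subset) auto
    show "disc_aut w holomorphic_on ball 0 1" using R by (intro holomorphic_on_subset[OF R(3)]) auto
  qed (simp_all add: disc_aut_def)
  also have "\<dots> = (\<integral>\<^sup>+z\<in>ball 0 1. ennreal ((norm (G z)) ^ 4 * norm z powr (- 2 * (1 - k))) \<partial>lborel)"
  proof (intro set_nn_integral_cong refl)
    fix z :: complex assume "z \<in> space lborel \<inter> ball 0 1"
    then have z: "norm z < 1" by simp
    have "norm (G z) ^ 4 = ((norm (G z))\<^sup>2)\<^sup>2" by (simp flip: power_mult)
    also have "\<dots> = exp (2 * Re (poly p (disc_aut w z))) * (norm (deriv (disc_aut w) z))\<^sup>2"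
      using z R(1) by (simp add: G2 power_mult_distrib exp_double)
    finally show "ennreal (exp (2 * Re (poly p (disc_aut w z))) * norm (disc_aut (- w) (disc_aut w z)) powr (- 2 * (1 - k)))
       * ennreal ((norm (deriv (disc_aut w) z))\<^sup>2) = ennreal ((norm (G z)) ^ 4 * norm z powr (- 2 * (1 - k)))"
      using z w by (simp add: disc_aut_inverse ennreal_mult[symmetric] mult_ac)
  qed
  also have "\<dots> \<le> ennreal ((integral {0..2*pi} (\<lambda>t. (norm (G (cis t)))\<^sup>2))\<^sup>2 / (4 * pi * k))"
    by (rule carleman_holomorphic[OF hG R(1) k])
  also have "integral {0..2*pi} (\<lambda>t. (norm (G (cis t)))\<^sup>2) = integral {0..2*pi} (\<lambda>t. exp (Re (poly p (disc_aut w (cis t)))) * norm (deriv (disc_aut w) (cis t)))"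
    using R(1) by (simp add: G2)
  also have "\<dots> = integral {0..2*pi} (\<lambda>t. exp (Re (poly p (cis t))))"
    by (rule integral_circle_disc_aut[OF w]) (intro continuous_intros)
  finally show ?thesis by (simp only: disc_aut_image_ball[OF w])
qed

section \<open>The isoperimetric inequality on the unit disc\<close>

lemma measurable_cnj [measurable]: "cnj \<in> borel_measurable borel"
  by (intro borel_measurable_continuous_onI continuous_intros)

text \<open>Jensen's inequality for exp, by integrating the tangent line at the mean value.\<close>

lemma nn_integral_exp_jensen:
  fixes K :: "'a \<Rightarrow> ennreal" and X :: "'a \<Rightarrow> real"
  assumes [measurable]: "K \<in> borel_measurable M" "X \<in> borel_measurable M"
    and X: "AE x in M. 0 \<le> X x" and m: "0 < m" "(\<integral>\<^sup>+x. K x \<partial>M) = ennreal m"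
    and N: "0 \<le> N" "(\<integral>\<^sup>+x. ennreal (X x) * K x \<partial>M) = ennreal N"
  shows "ennreal (exp (N / m) * m) \<le> (\<integral>\<^sup>+x. ennreal (exp (X x)) * K x \<partial>M)"
proof -
  define c where "c = N / m"
  have c: "0 \<le> c" "N = c * m" using m N by (auto simp: c_def)
  have "ennreal (exp c) * ennreal m + ennreal (exp c) * ennreal N
     = (\<integral>\<^sup>+x. ennreal (exp c) * K x + ennreal (exp c) * (ennreal (X x) * K x) \<partial>M)"
    by (subst nn_integral_add) (simp_all add: nn_integral_cmult m N)
  also have "\<dots> \<le> (\<integral>\<^sup>+x. ennreal (exp (X x)) * K x + ennreal (exp c * c) * K x \<partial>M)"
  proof (rule nn_integral_mono_AE)
    show "AE x in M. ennreal (exp c) * K x + ennreal (exp c) * (ennreal (X x) * K x)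
       \<le> ennreal (exp (X x)) * K x + ennreal (exp c * c) * K x"
      using X
    proof eventually_elim
      fix x assume X: "0 \<le> X x"
      have "exp c * (1 + (X x - c)) \<le> exp c * exp (X x - c)"
        by (intro mult_left_mono exp_ge_add_one_self) auto
      then have "exp c + exp c * X x \<le> exp (X x) + exp c * c"
        by (simp add: exp_diff algebra_simps)
      then have "ennreal (exp c + exp c * X x) * K x \<le> ennreal (exp (X x) + exp c * c) * K x"
        by (intro mult_right_mono ennreal_leI) auto
      then show "ennreal (exp c) * K x + ennreal (exp c) * (ennreal (X x) * K x)
       \<le> ennreal (exp (X x)) * K x + ennreal (exp c * c) * K x"
        using X c by (simp add: ennreal_plus[symmetric] ennreal_mult distrib_right mult.assoc del: ennreal_plus)
          (simp add: ennreal_mult distrib_right mult.assoc)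
    qed
  qed
  also have "\<dots> = (\<integral>\<^sup>+x. ennreal (exp (X x)) * K x \<partial>M) + ennreal (exp c * c) * ennreal m"
    by (subst nn_integral_add) (simp_all add: nn_integral_cmult m)
  also have "ennreal (exp c * c) * ennreal m = ennreal (exp c) * ennreal N"
    using c m by (simp add: ennreal_mult[symmetric] mult.assoc)
  finally have "ennreal (exp c) * ennreal m + ennreal (exp c) * ennreal N
     \<le> (\<integral>\<^sup>+x. ennreal (exp (X x)) * K x \<partial>M) + ennreal (exp c) * ennreal N" .
  then have "ennreal (exp c) * ennreal m \<le> (\<integral>\<^sup>+x. ennreal (exp (X x)) * K x \<partial>M)"
    by (simp add: add.commute[of _ "ennreal (exp c) * ennreal N"] ennreal_add_left_cancel_le ennreal_mult_eq_top_iff)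
  then show ?thesis
    using m by (simp add: c_def ennreal_mult[symmetric])
qed

text \<open>Let Re p majorise v on the circle and let m be the mass of K. By \<open>sub\<close>, 2
  v(w) \<le> 2 Re p(w) + N / pi, where N is the potential of K at w, and m \<le> 2 pi (1 - k) gives
  N / pi \<le> 2 (1 - k) N / m. Jensen for the probability measure K / m bounds the exponential of
  the latter by the average over z of |disc_aut (- w) z|^(-2 (1 - k)). After exchanging the
  integrals, the integral over w for fixed z is the one in \<open>carleman_disc_aut\<close> with
  pole z.\<close>

lemma isoperimetric_of_potential_bound:
  fixes v :: "complex \<Rightarrow> real" and K :: "complex \<Rightarrow> ennreal"
  assumes k: "0 < k" "k \<le> 1"
    and v: "continuous_on (cball 0 1) v"
    and K [measurable]: "K \<in> borel_measurable borel"
    and mass: "(\<integral>\<^sup>+z\<in>ball 0 1. K z \<partial>lborel) \<le> ennreal (2 * pi * (1 - k))"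
    and sub: "\<And>w. norm w < 1 \<Longrightarrow> \<exists>N\<ge>0.
      (\<integral>\<^sup>+z\<in>ball 0 1. ennreal (- ln (norm (disc_aut (- w) z))) * K z \<partial>lborel) = ennreal N \<and>
      2 * pi * v w \<le> integral {0..2*pi} (\<lambda>t. v (disc_aut w (cis t))) + N"
  shows "(\<integral>\<^sup>+z\<in>ball 0 1. ennreal (exp (2 * v z)) \<partial>lborel)
    \<le> ennreal ((integral {0..2*pi} (\<lambda>t. exp (v (cis t))))\<^sup>2 / (4 * pi * k))"
proof -
  let ?al = "1 - k"
  let ?D = "ball (0::complex) 1"
  let ?L = "\<integral>\<^sup>+z\<in>?D. ennreal (exp (2 * v z)) \<partial>lborel"
  have [measurable]: "?D \<in> sets borel" by simp
  obtain m where m: "0 \<le> m" "(\<integral>\<^sup>+z. K z * indicator ?D z \<partial>lborel) = ennreal m" "m \<le> 2 * pi * ?al"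
  proof -
    have "(\<integral>\<^sup>+z. K z * indicator ?D z \<partial>lborel) < top"
      using mass by (rule le_less_trans) simp
    then obtain m where "0 \<le> m" "(\<integral>\<^sup>+z. K z * indicator ?D z \<partial>lborel) = ennreal m"
      by (metis ennreal_cases less_irrefl)
    then show ?thesis using mass k by (intro that) simp_all
  qed
  have scont: "continuous_on (sphere 0 1) v"
    using v by (rule continuous_on_subset) auto
  have cisc: "continuous_on {0..2*pi} cis" by (auto intro!: continuous_intros simp: cis_conv_exp)
  have vint: "(\<lambda>t. exp (v (cis t))) integrable_on {0..2*pi}"
    by (intro integrable_continuous_real continuous_on_exp continuous_on_compose2[OF scont cisc]) auto
  have main: "?L \<le> ennreal (exp (2 * e) * ((integral {0..2*pi} (\<lambda>t. exp (v (cis t))))\<^sup>2 / (4 * pi * k)))"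
    if "0 < e" for e
  proof -
    obtain p0 where p0: "\<And>z. norm z = 1 \<Longrightarrow> \<bar>v z - Re (poly p0 z)\<bar> < e / 2"
      using Re_poly_approx_on_circle[OF scont, of "e/2"] \<open>0 < e\<close> by auto
    \<comment> \<open>The shift by e / 2 turns the two-sided approximation into a majorant of v on
      the circle.\<close>
    define p where "p = p0 + [:of_real (e / 2):]"
    have p: "v z \<le> Re (poly p z)" "Re (poly p z) \<le> v z + e" if "norm z = 1" for z
      using p0[OF that, unfolded abs_less_iff] by (auto simp: p_def)
    have [measurable]: "poly p \<in> borel_measurable borel"
      by (intro borel_measurable_continuous_onI continuous_intros)
    define C where "C = (integral {0..2*pi} (\<lambda>t. exp (Re (poly p (cis t)))))\<^sup>2 / (4 * pi * k)"
    have pint: "(\<lambda>t. exp (Re (poly p (cis t)))) integrable_on {0..2*pi}"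
      by (intro integrable_continuous_real continuous_intros cisc)
    have C: "C \<le> exp (2 * e) * ((integral {0..2*pi} (\<lambda>t. exp (v (cis t))))\<^sup>2 / (4 * pi * k))"
    proof -
      have "integral {0..2*pi} (\<lambda>t. exp (Re (poly p (cis t)))) \<le> integral {0..2*pi} (\<lambda>t. exp e * exp (v (cis t)))"
        by (intro integral_le pint integrable_on_mult_right vint)
           (use p(2) in \<open>auto simp: exp_add[symmetric] add.commute\<close>)
      then have "(integral {0..2*pi} (\<lambda>t. exp (Re (poly p (cis t)))))\<^sup>2
          \<le> (exp e * integral {0..2*pi} (\<lambda>t. exp (v (cis t))))\<^sup>2"
        by (intro power_mono) (auto intro!: integral_nonneg pint)
      then show ?thesis
        using k by (simp add: C_def power_mult_distrib exp_double divide_right_mono)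
    qed
    \<comment> \<open>The mean of Re p over the circle, transported by the automorphism, is Re p(w),
      because p composed with the automorphism is holomorphic. This replaces the Poisson integral of
      v.\<close>
    have bound: "2 * pi * v w \<le> 2 * pi * Re (poly p w) + N"
      if w: "norm w < 1" and N: "2 * pi * v w \<le> integral {0..2*pi} (\<lambda>t. v (disc_aut w (cis t))) + N" for w N
    proof -
      obtain R where R: "1 < R" "disc_aut w holomorphic_on ball 0 R"
        by (rule disc_aut_nbhd[OF w, of 2]) auto
      have "(\<lambda>z. poly p (disc_aut w z)) holomorphic_on ball 0 R"
        using R by (intro holomorphic_intros) auto
      from has_integral_circle_mean_Re[OF this R(1)]
      have 1: "((\<lambda>t. Re (poly p (disc_aut w (cis t)))) has_integral 2 * pi * Re (poly p w)) {0..2*pi}"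
        by simp
      have "continuous_on {0..2*pi} (\<lambda>t. disc_aut w (cis t))"
        by (rule continuous_on_compose2[OF disc_aut_continuous_on[OF w] cisc]) auto
      then have "(\<lambda>t. v (disc_aut w (cis t))) integrable_on {0..2*pi}"
        by (intro integrable_continuous_real continuous_on_compose2[OF scont])
           (auto simp: norm_disc_aut_eq_1[OF w])
      then have "integral {0..2*pi} (\<lambda>t. v (disc_aut w (cis t))) \<le> 2 * pi * Re (poly p w)"
        using 1 p(1) norm_disc_aut_eq_1[OF w]
        by (intro has_integral_le[OF integrable_integral 1]) auto
      then show ?thesis using N by simp
    qed
    have "?L \<le> ennreal C"
    proof (cases "m = 0")
      \<comment> \<open>There is no measure to normalise for Jensen. But then K vanishes almost
        everywhere, so N = 0 and v \<le> Re p; since |w|^(-2 (1 - k)) is at least 1 on the disc, the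
        weighted inequality with pole 0 still covers this case.\<close>
      case True
      have K0: "AE z in lborel. K z * indicator ?D z = 0"
        using m True by (simp add: nn_integral_0_iff_AE)
      have "?L \<le> (\<integral>\<^sup>+z\<in>?D. ennreal (exp (2 * Re (poly p z)) * norm (disc_aut (- 0) z) powr (- 2 * (1 - k))) \<partial>lborel)"
      proof (rule nn_integral_mono_AE)
        show "AE z in lborel. ennreal (exp (2 * v z)) * indicator ?D z \<le>
          ennreal (exp (2 * Re (poly p z)) * norm (disc_aut (- 0) z) powr (- 2 * (1 - k))) * indicator ?D z"
          using AE_lborel_singleton[of 0]
        proof eventually_elim
          fix w :: complex assume w0: "w \<noteq> 0"
          show "ennreal (exp (2 * v w)) * indicator ?D w \<le>
            ennreal (exp (2 * Re (poly p w)) * norm (disc_aut (- 0) w) powr (- 2 * (1 - k))) * indicator ?D w"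
          proof (cases "w \<in> ?D")
            case True
            then have w: "norm w < 1" by simp
            obtain N where N: "N \<ge> 0"
              "(\<integral>\<^sup>+z\<in>?D. ennreal (- ln (norm (disc_aut (- w) z))) * K z \<partial>lborel) = ennreal N"
              "2 * pi * v w \<le> integral {0..2*pi} (\<lambda>t. v (disc_aut w (cis t))) + N"
              using sub[OF w] by blast
            have "(\<integral>\<^sup>+z\<in>?D. ennreal (- ln (norm (disc_aut (- w) z))) * K z \<partial>lborel) = (\<integral>\<^sup>+z. 0 \<partial>(lborel :: complex measure))"
              using K0 by (intro nn_integral_cong_AE) (auto elim!: eventually_mono simp: mult.assoc)
            then have "N = 0" using N by simp
            then have "v w \<le> Re (poly p w)" using bound[OF w N(3)] by simp
            then have 1: "exp (2 * v w) \<le> exp (2 * Re (poly p w)) * 1" by simp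
            also have "\<dots> \<le> exp (2 * Re (poly p w)) * norm w powr (- 2 * (1 - k))"
            proof (intro mult_left_mono)
              have "norm w powr 0 \<le> norm w powr (- 2 * (1 - k))"
                using w w0 k by (intro powr_mono') auto
              then show "1 \<le> norm w powr (- 2 * (1 - k))" using w0 by simp
            qed simp
            finally show ?thesis using True by (simp add: ennreal_leI)
          qed simp
        qed
      qed
      also have "\<dots> \<le> ennreal C"
        unfolding C_def by (rule carleman_disc_aut[OF k]) simp
      finally show ?thesis .
    next
      case False
      then have m0: "0 < m" using m by simp
      let ?f = "\<lambda>w z. ennreal (exp (2 * Re (poly p w)) * norm (disc_aut (- w) z) powr (- 2 * (1 - k)))
          * (K z * indicator ?D z) * indicator ?D w"
      have f_meas: "case_prod ?f \<in> borel_measurable (lborel \<Otimes>\<^sub>M lborel)"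
        unfolding disc_aut_def by measurable
      have pw: "ennreal (exp (2 * v w)) * indicator ?D w * ennreal m \<le> (\<integral>\<^sup>+z. ?f w z \<partial>lborel)" for w
      proof (cases "w \<in> ?D")
        case True
        then have w: "norm w < 1" by simp
        obtain N where N: "N \<ge> 0"
          "(\<integral>\<^sup>+z\<in>?D. ennreal (- ln (norm (disc_aut (- w) z))) * K z \<partial>lborel) = ennreal N"
          "2 * pi * v w \<le> integral {0..2*pi} (\<lambda>t. v (disc_aut w (cis t))) + N"
          using sub[OF w] by blast
        define X where "X z = (if z \<in> ?D then 2 * ?al * (- ln (norm (disc_aut (- w) z))) else 0)" for z
        have lnneg: "ln (norm (disc_aut (- w) z)) \<le> 0" if "z \<in> ?D" for z
        proof -
          have "norm (disc_aut (- w) z) < 1" using norm_disc_aut_less_1[of "-w" z] w that by simp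
          then show ?thesis
            by (cases "disc_aut (- w) z = 0") auto
        qed
        have [measurable]: "X \<in> borel_measurable borel"
          unfolding X_def[abs_def] disc_aut_def by measurable
        have X0: "0 \<le> X z" for z using lnneg[of z] k by (auto simp: X_def mult_nonneg_nonpos)
        have XN: "(\<integral>\<^sup>+z. ennreal (X z) * (K z * indicator ?D z) \<partial>lborel) = ennreal (2 * ?al * N)"
        proof -
          have "(\<integral>\<^sup>+z. ennreal (X z) * (K z * indicator ?D z) \<partial>lborel)
            = (\<integral>\<^sup>+z. ennreal (2 * ?al) * (ennreal (- ln (norm (disc_aut (- w) z))) * K z * indicator ?D z) \<partial>lborel)"
            using k by (intro nn_integral_cong) (simp add: X_def ennreal_mult'[symmetric] mult.assoc[symmetric] indicator_def)
          also have "\<dots> = ennreal (2 * ?al) * ennreal N"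
            unfolding N(2)[symmetric] disc_aut_def by (rule nn_integral_cmult) measurable
          finally show ?thesis using k by (simp add: ennreal_mult')
        qed
        have "ennreal (exp (2 * ?al * N / m) * m) \<le> (\<integral>\<^sup>+z. ennreal (exp (X z)) * (K z * indicator ?D z) \<partial>lborel)"
          using m m0 X0 XN N k by (intro nn_integral_exp_jensen) auto
        also have "\<dots> = (\<integral>\<^sup>+z. ennreal (norm (disc_aut (- w) z) powr (- 2 * (1 - k))) * (K z * indicator ?D z) \<partial>lborel)"
        proof (rule nn_integral_cong_AE)
          show "AE z in lborel. ennreal (exp (X z)) * (K z * indicator ?D z)
            = ennreal (norm (disc_aut (- w) z) powr (- 2 * (1 - k))) * (K z * indicator ?D z)"
            using AE_lborel_singleton[of w]
          proof eventually_elim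
            fix z assume "z \<noteq> w"
            show "ennreal (exp (X z)) * (K z * indicator ?D z)
              = ennreal (norm (disc_aut (- w) z) powr (- 2 * (1 - k))) * (K z * indicator ?D z)"
            proof (cases "z \<in> ?D")
              case True
              then have "disc_aut (- w) z \<noteq> 0"
                using \<open>z \<noteq> w\<close> disc_aut_denominator_nonzero[of "-w" z] w by (simp add: disc_aut_def)
              then show ?thesis using True by (simp add: X_def powr_def algebra_simps)
            qed simp
          qed
        qed
        finally have J: "ennreal (exp (2 * ?al * N / m) * m) \<le> \<dots>" .
        have "2 * v w \<le> 2 * Re (poly p w) + N / pi"
        proof -
          have "(2 * pi * v w) / pi \<le> (2 * pi * Re (poly p w) + N) / pi"
            by (intro divide_right_mono bound[OF w N(3)]) simp
          then show ?thesis by (simp add: add_divide_distrib)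
        qed
        also have "N / pi \<le> 2 * ?al * N / m"
        proof -
          have "m * N \<le> 2 * pi * ?al * N" using m N by (intro mult_right_mono) auto
          then show ?thesis using m0 by (simp add: field_simps)
        qed
        finally have "exp (2 * v w) * m \<le> exp (2 * Re (poly p w)) * (exp (2 * ?al * N / m) * m)"
          using m by (simp add: exp_add[symmetric] mult.assoc[symmetric] mult_right_mono)
        then have "ennreal (exp (2 * v w) * m) \<le> ennreal (exp (2 * Re (poly p w))) * ennreal (exp (2 * ?al * N / m) * m)"
          using m by (simp add: ennreal_mult[symmetric] ennreal_leI)
        also have "\<dots> \<le> ennreal (exp (2 * Re (poly p w))) *
           (\<integral>\<^sup>+z. ennreal (norm (disc_aut (- w) z) powr (- 2 * (1 - k))) * (K z * indicator ?D z) \<partial>lborel)"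
          by (intro mult_left_mono J) simp
        also have "\<dots> = (\<integral>\<^sup>+z. ?f w z \<partial>lborel)"
          using True by (subst nn_integral_cmult[symmetric])
            (auto simp: disc_aut_def ennreal_mult mult.assoc)
        finally show ?thesis using True m by (simp add: ennreal_mult)
      qed simp
      have vD: "(\<lambda>w. ennreal (exp (2 * v w)) * indicator ?D w) \<in> borel_measurable lborel"
      proof -
        have "continuous_on ?D (\<lambda>w. exp (2 * v w))"
          by (intro continuous_intros continuous_on_subset[OF v]) auto
        then have "(\<lambda>w. indicator ?D w *\<^sub>R exp (2 * v w)) \<in> borel_measurable borel"
          by (intro borel_measurable_continuous_on_indicator) auto
        then have "(\<lambda>w. ennreal (indicator ?D w *\<^sub>R exp (2 * v w))) \<in> borel_measurable borel"
          by measurable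
        moreover have "(\<lambda>w. ennreal (indicator ?D w *\<^sub>R exp (2 * v w))) = (\<lambda>w. ennreal (exp (2 * v w)) * indicator ?D w)"
          by (auto simp: indicator_def)
        ultimately have "(\<lambda>w. ennreal (exp (2 * v w)) * indicator ?D w) \<in> borel_measurable borel"
          by (simp only:)
        then show ?thesis by simp
      qed
      have "?L * ennreal m = (\<integral>\<^sup>+w. ennreal (exp (2 * v w)) * indicator ?D w * ennreal m \<partial>lborel)"
        by (rule nn_integral_multc[symmetric, OF vD])
      also have "\<dots> \<le> (\<integral>\<^sup>+w. \<integral>\<^sup>+z. ?f w z \<partial>lborel \<partial>lborel)"
        by (intro nn_integral_mono pw)
      also have "\<dots> = (\<integral>\<^sup>+z. \<integral>\<^sup>+w. ?f w z \<partial>lborel \<partial>lborel)"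
        by (rule lborel_pair.Fubini'[OF f_meas, symmetric])
      also have "\<dots> \<le> (\<integral>\<^sup>+z. ennreal C * (K z * indicator ?D z) \<partial>lborel)"
      proof (rule nn_integral_mono)
        fix z :: complex
        show "(\<integral>\<^sup>+w. ?f w z \<partial>lborel) \<le> ennreal C * (K z * indicator ?D z)"
        proof (cases "z \<in> ?D")
          case True
          then have z: "norm z < 1" by simp
          have "(\<integral>\<^sup>+w. ?f w z \<partial>lborel) = (\<integral>\<^sup>+w. ennreal (exp (2 * Re (poly p w)) * norm (disc_aut (- z) w) powr (- 2 * (1 - k))) * indicator ?D w * (K z * indicator ?D z) \<partial>lborel)"
            by (intro nn_integral_cong) (simp add: norm_disc_aut_commute[of _ z] mult_ac)
          also have "\<dots> = (\<integral>\<^sup>+w\<in>?D. ennreal (exp (2 * Re (poly p w)) * norm (disc_aut (- z) w) powr (- 2 * (1 - k))) \<partial>lborel) * (K z * indicator ?D z)"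
            unfolding disc_aut_def by (rule nn_integral_multc) measurable
          also have "\<dots> \<le> ennreal C * (K z * indicator ?D z)"
            unfolding C_def by (intro mult_right_mono carleman_disc_aut k z) simp
          finally show ?thesis .
        qed simp
      qed
      also have "\<dots> = ennreal C * ennreal m"
        by (simp add: nn_integral_cmult m)
      finally show ?thesis
        using m0 by (simp add: mult.commute[of _ "ennreal m"] ennreal_mult_le_mult_iff)
    qed
    also have "\<dots> \<le> ennreal (exp (2 * e) * ((integral {0..2*pi} (\<lambda>t. exp (v (cis t))))\<^sup>2 / (4 * pi * k)))"
      by (intro ennreal_leI C)
    finally show ?thesis .
  qed
  let ?B = "(integral {0..2*pi} (\<lambda>t. exp (v (cis t))))\<^sup>2 / (4 * pi * k)"
  have "(\<lambda>n. ennreal (exp (2 * inverse (real (Suc n))) * ?B)) \<longlonglongrightarrow> ennreal (exp (2 * 0) * ?B)"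
    by (intro tendsto_intros LIMSEQ_inverse_real_of_nat)
  then have "?L \<le> ennreal (exp (2 * 0) * ?B)"
    by (rule LIMSEQ_le_const) (use main in auto)
  then show ?thesis by simp
qed

section \<open>Rectifiable curves and square grids\<close>

definition grid_square :: "real \<Rightarrow> complex \<Rightarrow> int \<times> int" where
  "grid_square \<delta> z = (\<lfloor>Re z / \<delta>\<rfloor>, \<lfloor>Im z / \<delta>\<rfloor>)"

lemma rectifiable_path_sum_bound:
  assumes "rectifiable_path \<gamma>"
  obtains L where "0 \<le> L" "\<And>n t. mono_on {..n} t \<Longrightarrow> t ` {..n} \<subseteq> {0..1} \<Longrightarrow>
    (\<Sum>i<n. dist (\<gamma> (t i)) (\<gamma> (t (Suc i)))) \<le> L"
proof -
  obtain L where L: "\<And>x. x \<in> {\<Sum>i<n. dist (\<gamma> (t i)) (\<gamma> (t (Suc i))) | (n::nat) t.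
                 mono_on {..n} t \<and> t ` {..n} \<subseteq> {0..1}} \<Longrightarrow> x \<le> L"
    using assms unfolding rectifiable_path_def bdd_above_def by blast
  have *: "(\<Sum>i<n. dist (\<gamma> (t i)) (\<gamma> (t (Suc i)))) \<le> L" if "mono_on {..n} t" "t ` {..n} \<subseteq> {0..1}" for n t
    by (rule L) (use that in blast)
  have "0 \<le> L" using *[of 0 "\<lambda>_. 0"] by (simp add: mono_on_def)
  with * show ?thesis by (intro that)
qed

lemma abs_diff_of_floor_diff:
  fixes x y :: real
  assumes "2 \<le> \<bar>\<lfloor>x / \<delta>\<rfloor> - \<lfloor>y / \<delta>\<rfloor>\<bar>" "0 < \<delta>"
  shows "\<delta> \<le> \<bar>x - y\<bar>"
proof -
  have "1 \<le> \<bar>x / \<delta> - y / \<delta>\<bar>" using assms(1) by linarith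
  also have "\<bar>x / \<delta> - y / \<delta>\<bar> = \<bar>x - y\<bar> / \<delta>"
    using assms(2) by (simp add: diff_divide_distrib[symmetric])
  finally show ?thesis using assms(2) by (simp add: field_simps)
qed

text \<open>Two different squares whose indices have the same parities are at distance at least \<open>\<delta>\<close>,
  so a curve cannot visit many of them.\<close>

lemma card_grid_squares_same_parity:
  assumes L: "\<And>n t. mono_on {..n} t \<Longrightarrow> t ` {..n} \<subseteq> {0..1} \<Longrightarrow>
    (\<Sum>i<n. dist (\<gamma> (t i)) (\<gamma> (t (Suc i)))) \<le> L"
    and L0: "0 \<le> L" and d: "0 < \<delta>"
    and F: "F \<subseteq> grid_square \<delta> ` path_image \<gamma>" "finite F"
    and par: "\<And>q r. q \<in> F \<Longrightarrow> r \<in> F \<Longrightarrow> even (fst q - fst r) \<and> even (snd q - snd r)"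
  shows "real (card F) \<le> L / \<delta> + 1"
proof (cases "F = {}")
  case True
  then show ?thesis using L0 d by simp
next
  case False
  have "\<forall>q\<in>F. \<exists>s. s \<in> {0..1} \<and> grid_square \<delta> (\<gamma> s) = q"
    using F(1) unfolding path_image_def by blast
  then obtain s where s: "\<And>q. q \<in> F \<Longrightarrow> s q \<in> {0..1} \<and> grid_square \<delta> (\<gamma> (s q)) = q"
    by metis
  have inj: "inj_on s F" using s by (metis inj_onI)
  define xs where "xs = sorted_list_of_set (s ` F)"
  define n where "n = card F - 1"
  have len: "length xs = Suc n"
    using False F(2) by (simp add: xs_def n_def card_image[OF inj] card_gt_0_iff)
  have set_xs: "set xs = s ` F" using F(2) by (simp add: xs_def)
  have mono: "mono_on {..n} ((!) xs)"
    using len by (auto simp: mono_on_def xs_def intro!: sorted_nth_mono)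
  have memb: "xs ! i \<in> s ` F" if "i \<le> n" for i using that len set_xs nth_mem[of i xs] by simp
  have sub: "(!) xs ` {..n} \<subseteq> {0..1}"
  proof -
    have "xs ! i \<in> {0..1}" if "i \<le> n" for i using memb[OF that] s by (metis imageE)
    then show ?thesis by blast
  qed
  have step: "\<delta> \<le> dist (\<gamma> (xs ! i)) (\<gamma> (xs ! Suc i))" if "i < n" for i
  proof -
    have "xs ! i \<in> s ` F" "xs ! Suc i \<in> s ` F" using memb that by simp_all
    then obtain q r where qr: "q \<in> F" "r \<in> F" "xs ! i = s q" "xs ! Suc i = s r" by blast
    have "distinct xs" by (simp add: xs_def)
    then have "xs ! i \<noteq> xs ! Suc i" using that len by (simp add: nth_eq_iff_index_eq)
    then have "q \<noteq> r" using qr by auto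
    define z w where "z = \<gamma> (s q)" and "w = \<gamma> (s r)"
    have q: "fst q = \<lfloor>Re z / \<delta>\<rfloor>" "snd q = \<lfloor>Im z / \<delta>\<rfloor>" and r: "fst r = \<lfloor>Re w / \<delta>\<rfloor>" "snd r = \<lfloor>Im w / \<delta>\<rfloor>"
      using s[OF qr(1)] s[OF qr(2)] unfolding z_def w_def grid_square_def by (metis fst_conv snd_conv)+
    have ev: "even (fst q - fst r)" "even (snd q - snd r)" using par[OF qr(1,2)] by blast+
    have "fst q - fst r \<noteq> 0 \<or> snd q - snd r \<noteq> 0" using \<open>q \<noteq> r\<close> by (auto simp: prod_eq_iff)
    then have "2 \<le> \<bar>fst q - fst r\<bar> \<or> 2 \<le> \<bar>snd q - snd r\<bar>" using ev by presburger
    then have "\<delta> \<le> \<bar>Re z - Re w\<bar> \<or> \<delta> \<le> \<bar>Im z - Im w\<bar>"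
      unfolding q r using abs_diff_of_floor_diff d by blast
    moreover have "\<bar>Re z - Re w\<bar> \<le> dist z w" "\<bar>Im z - Im w\<bar> \<le> dist z w"
      using abs_Re_le_cmod[of "z - w"] abs_Im_le_cmod[of "z - w"] by (simp_all add: dist_norm)
    ultimately show ?thesis unfolding qr(3,4) z_def w_def by linarith
  qed
  have "real n * \<delta> = (\<Sum>i<n. \<delta>)" by simp
  also have "\<dots> \<le> (\<Sum>i<n. dist (\<gamma> (xs ! i)) (\<gamma> (xs ! Suc i)))"
    by (intro sum_mono step) simp
  also have "\<dots> \<le> L" by (rule L[OF mono sub])
  finally have "real n \<le> L / \<delta>" using d by (simp add: field_simps)
  moreover have "card F = Suc n" using False F(2) by (simp add: n_def card_gt_0_iff)
  ultimately show ?thesis by simp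
qed

text \<open>The factor 4 counts the parity classes of indices. The previous bound holds for finite
  sets of squares only; being uniform, it also yields the finiteness of each class.\<close>

lemma card_grid_squares:
  assumes "rectifiable_path \<gamma>"
  obtains L where "0 \<le> L" "\<And>\<delta>. 0 < \<delta> \<Longrightarrow> finite (grid_square \<delta> ` path_image \<gamma>)"
    "\<And>\<delta>. 0 < \<delta> \<Longrightarrow> real (card (grid_square \<delta> ` path_image \<gamma>)) \<le> 4 * (L / \<delta> + 1)"
proof -
  obtain L where L: "0 \<le> L" "\<And>n t. mono_on {..n} t \<Longrightarrow> t ` {..n} \<subseteq> {0..1} \<Longrightarrow>
    (\<Sum>i<n. dist (\<gamma> (t i)) (\<gamma> (t (Suc i)))) \<le> L"
    by (rule rectifiable_path_sum_bound[OF assms]) blast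
  have "finite (grid_square \<delta> ` path_image \<gamma>) \<and> real (card (grid_square \<delta> ` path_image \<gamma>)) \<le> 4 * (L / \<delta> + 1)"
    if d: "0 < \<delta>" for \<delta>
  proof -
    let ?H = "grid_square \<delta> ` path_image \<gamma>"
    define C where "C a b = {q \<in> ?H. even (fst q) = a \<and> even (snd q) = b}" for a b
    have C: "finite (C a b) \<and> real (card (C a b)) \<le> L / \<delta> + 1" for a b
    proof -
      have "finite (C a b) \<and> card (C a b) \<le> nat \<lfloor>L / \<delta> + 1\<rfloor>"
      proof (rule finite_if_finite_subsets_card_bdd)
        fix G assume G: "G \<subseteq> C a b" "finite G"
        have "real (card G) \<le> L / \<delta> + 1"
        proof (rule card_grid_squares_same_parity[OF L(2) L(1) d _ G(2)])
          show "G \<subseteq> ?H" using G by (auto simp: C_def)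
          fix q r assume "q \<in> G" "r \<in> G"
          then have "even (fst q) = even (fst r)" "even (snd q) = even (snd r)"
            using G(1) unfolding C_def by blast+
          then show "even (fst q - fst r) \<and> even (snd q - snd r)" by simp
        qed auto
        then show "card G \<le> nat \<lfloor>L / \<delta> + 1\<rfloor>" by linarith
      qed
      moreover have "0 \<le> L / \<delta>" using L d by simp
      ultimately show ?thesis by linarith
    qed
    have H: "?H = (C True True \<union> C True False) \<union> (C False True \<union> C False False)"
      by (auto simp: C_def)
    have "card ?H \<le> (card (C True True) + card (C True False)) + (card (C False True) + card (C False False))"
      unfolding H by (intro order_trans[OF card_Un_le] add_mono card_Un_le)
    then have "real (card ?H) \<le> (real (card (C True True)) + real (card (C True False))) +
        (real (card (C False True)) + real (card (C False False)))"
      by (simp only: of_nat_add[symmetric] of_nat_le_iff)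
    also have "\<dots> \<le> ((L / \<delta> + 1) + (L / \<delta> + 1)) + ((L / \<delta> + 1) + (L / \<delta> + 1))"
      using C by (intro add_mono) auto
    finally have "real (card ?H) \<le> 4 * (L / \<delta> + 1)" by simp
    moreover have "finite ?H" unfolding H using C by blast
    ultimately show ?thesis by blast
  qed
  then show ?thesis using L(1) that by blast
qed

text \<open>Let N n y count the squares of mesh 1 / (n + 1) that meet the curve and lie in the row
  at height y. Its integral over y is the number of visited squares times the mesh, bounded in terms
  of the length. By Fatou liminf N n y is finite for almost every y, and it bounds the number of
  points at height y, because finitely many distinct points eventually lie in distinct
  squares.\<close>

lemma AE_finite_horizontal_slice:
  assumes "rectifiable_path \<gamma>"
  shows "AE y in lborel. finite {x. Complex x y \<in> path_image \<gamma>}"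
proof -
  obtain L where L: "0 \<le> L" "\<And>\<delta>. 0 < \<delta> \<Longrightarrow> finite (grid_square \<delta> ` path_image \<gamma>)"
    "\<And>\<delta>. 0 < \<delta> \<Longrightarrow> real (card (grid_square \<delta> ` path_image \<gamma>)) \<le> 4 * (L / \<delta> + 1)"
    using card_grid_squares[OF assms] by blast
  define d where "d n = inverse (real (Suc n))" for n
  have d: "0 < d n" "d n \<le> 1" for n by (simp_all add: d_def inverse_le_1_iff)
  define H where "H n = grid_square (d n) ` path_image \<gamma>" for n
  have fH: "finite (H n)" for n unfolding H_def using L(2) d by blast
  define N :: "nat \<Rightarrow> real \<Rightarrow> ennreal" where
    "N n y = (\<Sum>q\<in>H n. indicator {y. \<lfloor>y / d n\<rfloor> = snd q} y)" for n y
  have [measurable]: "N n \<in> borel_measurable borel" for n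
    unfolding N_def by measurable
  have "(\<integral>\<^sup>+y. N n y \<partial>lborel) \<le> ennreal (4 * (L + 1))" for n
  proof -
    have set: "{y. \<lfloor>y / d n\<rfloor> = j} = {real_of_int j * d n..<(real_of_int j + 1) * d n}" for j :: int
      using d[of n] by (auto simp: floor_eq_iff field_simps)
    have "(\<integral>\<^sup>+y. N n y \<partial>lborel) = (\<Sum>q\<in>H n. emeasure lborel {y. \<lfloor>y / d n\<rfloor> = snd q})"
      unfolding N_def by (subst nn_integral_sum) auto
    also have "\<dots> = (\<Sum>q\<in>H n. ennreal (d n))"
      using d[of n] unfolding set by (intro sum.cong refl) (simp add: algebra_simps)
    also have "\<dots> = ennreal (real (card (H n)) * d n)"
      using d[of n] by (simp add: ennreal_mult ennreal_of_nat_eq_real_of_nat)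
    also have "\<dots> \<le> ennreal (4 * (L + 1))"
    proof (rule ennreal_leI)
      have "real (card (H n)) * d n \<le> 4 * (L / d n + 1) * d n"
        unfolding H_def using d[of n] L(3)[of "d n"] by (intro mult_right_mono) auto
      also have "\<dots> = 4 * (L + d n)" using d[of n] by (simp add: field_simps)
      finally show "real (card (H n)) * d n \<le> 4 * (L + 1)" using d[of n] by simp
    qed
    finally show ?thesis .
  qed
  then have "liminf (\<lambda>n. \<integral>\<^sup>+y. N n y \<partial>lborel) \<le> ennreal (4 * (L + 1))"
    by (intro Liminf_le always_eventually allI) simp_all
  moreover have "(\<integral>\<^sup>+y. liminf (\<lambda>n. N n y) \<partial>lborel) \<le> liminf (\<lambda>n. \<integral>\<^sup>+y. N n y \<partial>lborel)"
    by (rule nn_integral_liminf) simp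
  ultimately have "(\<integral>\<^sup>+y. liminf (\<lambda>n. N n y) \<partial>lborel) \<noteq> \<infinity>"
    by (metis ennreal_less_top infinity_ennreal_def leD order_trans)
  then have "AE y in lborel. liminf (\<lambda>n. N n y) \<noteq> \<infinity>"
    by (rule nn_integral_PInf_AE[rotated]) simp
  then show ?thesis
  proof eventually_elim
    fix y :: real
    assume fin: "liminf (\<lambda>n. N n y) \<noteq> \<infinity>"
    let ?S = "{x. Complex x y \<in> path_image \<gamma>}"
    show "finite ?S"
    proof (rule ccontr)
      assume inf: "infinite ?S"
      have "of_nat m \<le> liminf (\<lambda>n. N n y)" for m :: nat
      proof -
        obtain F where F: "F \<subseteq> ?S" "finite F" "card F = m"
          using infinite_arbitrarily_large[OF inf, of m] by blast
        have "\<forall>\<^sub>F n in sequentially. \<forall>x\<in>F. \<forall>x'\<in>F. x \<noteq> x' \<longrightarrow> \<lfloor>x / d n\<rfloor> \<noteq> \<lfloor>x' / d n\<rfloor>"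
        proof (intro eventually_ball_finite ballI F(2))
          fix x x' assume "x \<in> F" "x' \<in> F"
          show "\<forall>\<^sub>F n in sequentially. x \<noteq> x' \<longrightarrow> \<lfloor>x / d n\<rfloor> \<noteq> \<lfloor>x' / d n\<rfloor>"
          proof (cases "x = x'")
            case False
            have "d \<longlonglongrightarrow> 0" unfolding d_def[abs_def] by (rule LIMSEQ_inverse_real_of_nat)
            then have "\<forall>\<^sub>F n in sequentially. d n < \<bar>x - x'\<bar>"
              using False by (intro order_tendstoD) auto
            then show ?thesis
            proof eventually_elim
              case (elim n)
              then have "1 < \<bar>x - x'\<bar> / d n" using d[of n] by simp
              also have "\<bar>x - x'\<bar> / d n = \<bar>x / d n - x' / d n\<bar>"
                using d[of n] by (simp add: diff_divide_distrib[symmetric])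
              finally show ?case by linarith
            qed
          qed simp
        qed
        then have "\<forall>\<^sub>F n in sequentially. of_nat m \<le> N n y"
        proof eventually_elim
          case (elim n)
          let ?J = "{q \<in> H n. snd q = \<lfloor>y / d n\<rfloor>}"
          have "inj_on (\<lambda>x. (\<lfloor>x / d n\<rfloor>, \<lfloor>y / d n\<rfloor>)) F" using elim by (auto simp: inj_on_def)
          then have "m = card ((\<lambda>x. (\<lfloor>x / d n\<rfloor>, \<lfloor>y / d n\<rfloor>)) ` F)"
            using F(3) by (simp add: card_image)
          also have "\<dots> \<le> card ?J"
          proof (rule card_mono)
            show "(\<lambda>x. (\<lfloor>x / d n\<rfloor>, \<lfloor>y / d n\<rfloor>)) ` F \<subseteq> ?J"
              using F(1) by (force simp: H_def grid_square_def image_iff)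
          qed (use fH in auto)
          finally have "of_nat m \<le> (of_nat (card ?J) :: ennreal)" by simp
          also have "of_nat (card ?J) = N n y"
          proof -
            have "N n y = (\<Sum>q\<in>H n. if snd q = \<lfloor>y / d n\<rfloor> then 1 else 0)"
              unfolding N_def by (intro sum.cong refl) (auto simp: indicator_def)
            also have "\<dots> = (\<Sum>q\<in>?J. 1)"
              using fH by (subst sum.inter_filter[symmetric]) auto
            finally show ?thesis by simp
          qed
          finally show ?case .
        qed
        then show ?thesis by (rule Liminf_bounded)
      qed
      then have "liminf (\<lambda>n. N n y) = \<infinity>"
        by (metis ennreal_Ex_less_of_nat infinity_ennreal_def leD less_top)
      then show False using fin by simp
    qed
  qed
qed

lemma AE_finite_vertical_slice:
  assumes "rectifiable_path \<gamma>"
  shows "AE x in lborel. finite {y. Complex x y \<in> path_image \<gamma>}"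
proof -
  \<comment> \<open>The reflection in the diagonal: an isometry that exchanges real and imaginary
    parts, so vertical slices become horizontal ones.\<close>
  define s where "s z = \<i> * cnj z" for z
  have ds: "dist (s z) (s w) = dist z w" for z w
    by (simp add: s_def dist_norm norm_mult flip: complex_cnj_diff right_diff_distrib)
  have "rectifiable_path (s \<circ> \<gamma>)"
    using assms unfolding rectifiable_path_def o_def ds
    by (auto simp: path_def s_def intro!: continuous_intros)
  then have "AE y in lborel. finite {x. Complex x y \<in> path_image (s \<circ> \<gamma>)}"
    by (rule AE_finite_horizontal_slice)
  moreover have "Complex x y \<in> path_image (s \<circ> \<gamma>) \<longleftrightarrow> Complex y x \<in> path_image \<gamma>" for x y
  proof -
    have "inj s" by (auto simp: s_def inj_on_def)
    moreover have "Complex x y = s (Complex y x)" by (simp add: s_def complex_eq_iff)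
    ultimately show ?thesis by (simp add: path_image_compose inj_image_mem_iff)
  qed
  ultimately show ?thesis by simp
qed

lemma rectifiable_path_image_null:
  assumes "rectifiable_path \<gamma>"
  shows "path_image \<gamma> \<in> null_sets lborel"
proof -
  have "closed (path_image \<gamma>)"
    using assms closed_path_image by (auto simp: rectifiable_path_def)
  then have [measurable]: "path_image \<gamma> \<in> sets borel" by simp
  have "emeasure lborel (path_image \<gamma>) = (\<integral>\<^sup>+z. indicator (path_image \<gamma>) z \<partial>lborel)"
    by simp
  also have "\<dots> = (\<integral>\<^sup>+y. \<integral>\<^sup>+x. indicator (path_image \<gamma>) (Complex x y) \<partial>lborel \<partial>lborel)"
    by (rule nn_integral_complex_Im_Re) simp
  also have "\<dots> = (\<integral>\<^sup>+y. 0 \<partial>(lborel :: real measure))"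
  proof (rule nn_integral_cong_AE)
    show "AE y in lborel. (\<integral>\<^sup>+x. indicator (path_image \<gamma>) (Complex x y) \<partial>lborel) = 0"
      using AE_finite_horizontal_slice[OF assms]
    proof eventually_elim
      case (elim y)
      have "(\<integral>\<^sup>+x. indicator (path_image \<gamma>) (Complex x y) \<partial>lborel)
          = (\<integral>\<^sup>+x. indicator {x. Complex x y \<in> path_image \<gamma>} x \<partial>lborel)"
        by (intro nn_integral_cong) (auto simp: indicator_def)
      also have "\<dots> = 0"
        using elim by (simp add: emeasure_lborel_countable countable_finite)
      finally show ?case .
    qed
  qed
  finally show ?thesis by (simp add: null_sets_def)
qed

section \<open>Green's identity for piecewise twice differentiable functions\<close>

lemma has_partial_Re:
  "has_partial 1 f d (Complex x y) \<longleftrightarrow> ((\<lambda>t. f (Complex t y)) has_real_derivative d) (at x)"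
proof -
  have "Complex x y + of_real t * 1 = Complex (t + x) y" for t by (simp add: complex_eq_iff)
  then show ?thesis
    unfolding has_partial_def using DERIV_shift[of "\<lambda>t. f (Complex t y)" d 0 x] by simp
qed

lemma has_partial_Im:
  "has_partial \<i> f d (Complex x y) \<longleftrightarrow> ((\<lambda>t. f (Complex x t)) has_real_derivative d) (at y)"
proof -
  have "Complex x y + of_real t * \<i> = Complex x (t + y)" for t by (simp add: complex_eq_iff)
  then show ?thesis
    unfolding has_partial_def using DERIV_shift[of "\<lambda>t. f (Complex x t)" d 0 y] by simp
qed

text \<open>Off S the integrand is the derivative of P = f w' - f' w, which has compact support. P
  is continuous also at the points of S, because f' is; hence the finitely many points without a
  second derivative contribute no jump.\<close>

lemma has_integral_parts_compact_support:
  fixes f f1 f2 w w1 w2 :: "real \<Rightarrow> real"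
  assumes A: "open A" and C: "closed C" "C \<subseteq> A" "\<And>t. t \<in> C \<Longrightarrow> \<bar>t\<bar> \<le> B" and S: "finite S"
    and f: "\<And>t. t \<in> A \<Longrightarrow> (f has_real_derivative f1 t) (at t)" "continuous_on A f1"
      "\<And>t. t \<in> A - S \<Longrightarrow> (f1 has_real_derivative f2 t) (at t)"
    and w: "\<And>t. (w has_real_derivative w1 t) (at t)" "\<And>t. (w1 has_real_derivative w2 t) (at t)"
    and zero: "\<And>t. t \<notin> C \<Longrightarrow> w t = 0" "\<And>t. t \<notin> C \<Longrightarrow> w1 t = 0" "\<And>t. t \<notin> C \<Longrightarrow> w2 t = 0"
  shows "((\<lambda>t. f t * w2 t - f2 t * w t) has_integral 0) UNIV"
proof -
  define P where "P t = f t * w1 t - f1 t * w t" for t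
  define b where "b = \<bar>B\<bar> + 1"
  \<comment> \<open>f is arbitrary outside A. It does no harm, since w and w' vanish on the open
    complement of C.\<close>
  have near: "\<forall>\<^sub>F s in nhds t. P s = 0" if "t \<notin> C" for t
  proof -
    have "\<forall>\<^sub>F s in nhds t. s \<in> - C"
      using C(1) that by (intro eventually_nhds_in_open) auto
    then show ?thesis by eventually_elim (simp add: P_def zero)
  qed
  have "isCont P t" for t
  proof (cases "t \<in> C")
    case True
    then have "t \<in> A" using C by blast
    then have "isCont f1 t" "isCont f t"
      using continuous_on_eq_continuous_at[OF A] f(2) DERIV_isCont[OF f(1)] by auto
    moreover have "isCont w t" "isCont w1 t"
      using DERIV_isCont[OF w(1)] DERIV_isCont[OF w(2)] by auto
    ultimately show ?thesis unfolding P_def by (intro continuous_intros)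
  next
    case False
    then show ?thesis
      using near[OF False] isCont_cong[of P "\<lambda>_. 0" t] by simp
  qed
  then have cP: "continuous_on {-b..b} P" by (simp add: continuous_at_imp_continuous_on)
  have dP: "(P has_real_derivative (f t * w2 t - f2 t * w t)) (at t)" if "t \<notin> S" for t
  proof (cases "t \<in> C")
    case True
    then have t: "t \<in> A" "t \<in> A - S" using C that by auto
    have "(P has_real_derivative ((f1 t * w1 t + f t * w2 t) - (f2 t * w t + f1 t * w1 t))) (at t)"
      unfolding P_def using f(1)[OF t(1)] f(3)[OF t(2)] w
      by (auto intro!: derivative_eq_intros)
    then show ?thesis by simp
  next
    case False
    have "((\<lambda>_. 0) has_real_derivative 0) (at t)" by simp
    then have "(P has_real_derivative 0) (at t)"
      using DERIV_cong_ev[OF refl near[OF False] refl, of 0] by simp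
    then show ?thesis using False by (simp add: zero)
  qed
  have out: "t \<notin> C" if "t \<notin> {-b<..<b}" for t
    using C(3)[of t] that by (auto simp: b_def)
  have "((\<lambda>t. f t * w2 t - f2 t * w t) has_integral (P b - P (-b))) {-b..b}"
    using dP cP S by (intro fundamental_theorem_of_calculus_interior_strong[of S])
      (auto simp: b_def has_real_derivative_iff_has_vector_derivative)
  moreover have "P b = 0" "P (-b) = 0" using out by (auto simp: P_def zero)
  ultimately have "((\<lambda>t. f t * w2 t - f2 t * w t) has_integral 0) {-b..b}" by simp
  then show ?thesis
    by (rule has_integral_on_superset) (use out in \<open>auto simp: zero\<close>)
qed

lemma integral_complex_Re_Im:
  fixes F :: "complex \<Rightarrow> real"
  assumes F: "integrable lborel F"
  shows "AE x in lborel. integrable lborel (\<lambda>y. F (Complex x y))"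
    "(\<integral>z. F z \<partial>lborel) = (\<integral>x. (\<integral>y. F (Complex x y) \<partial>lborel) \<partial>lborel)"
    "AE y in lborel. integrable lborel (\<lambda>x. F (Complex x y))"
    "(\<integral>z. F z \<partial>lborel) = (\<integral>y. (\<integral>x. F (Complex x y) \<partial>lborel) \<partial>lborel)"
proof -
  have [measurable]: "F \<in> borel_measurable borel" using F by (auto dest: borel_measurable_integrable)
  have "integrable (lborel \<Otimes>\<^sub>M lborel) (\<lambda>p. F (Complex (fst p) (snd p)))"
    using F by (subst (asm) lborel_complex_eq_distr) (simp add: integrable_distr_eq)
  then have i: "integrable (lborel \<Otimes>\<^sub>M lborel) (\<lambda>(x, y). F (Complex x y))"
    by (simp add: case_prod_beta')
  have eq: "(\<integral>z. F z \<partial>lborel) = (\<integral>p. (case p of (x, y) \<Rightarrow> F (Complex x y)) \<partial>(lborel \<Otimes>\<^sub>M lborel))"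
    by (subst lborel_complex_eq_distr) (simp add: integral_distr case_prod_beta')
  show "AE x in lborel. integrable lborel (\<lambda>y. F (Complex x y))"
    by (rule lborel_pair.AE_integrable_fst[OF i])
  show "AE y in lborel. integrable lborel (\<lambda>x. F (Complex x y))"
    by (rule lborel_pair.AE_integrable_snd[OF i])
  show "(\<integral>z. F z \<partial>lborel) = (\<integral>x. (\<integral>y. F (Complex x y) \<partial>lborel) \<partial>lborel)"
    unfolding eq by (rule lborel_pair.integral_fst[OF i, symmetric])
  show "(\<integral>z. F z \<partial>lborel) = (\<integral>y. (\<integral>x. F (Complex x y) \<partial>lborel) \<partial>lborel)"
    unfolding eq by (rule lborel_pair.integral_snd[OF i, symmetric])
qed

lemma integral_eq_0_of_AE_has_integral_0:
  fixes F :: "complex \<Rightarrow> real"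
  assumes F: "integrable lborel F"
  shows "AE y in lborel. ((\<lambda>x. F (Complex x y)) has_integral 0) UNIV \<Longrightarrow> (\<integral>z. F z \<partial>lborel) = 0"
    and "AE x in lborel. ((\<lambda>y. F (Complex x y)) has_integral 0) UNIV \<Longrightarrow> (\<integral>z. F z \<partial>lborel) = 0"
proof -
  assume "AE y in lborel. ((\<lambda>x. F (Complex x y)) has_integral 0) UNIV"
  with integral_complex_Re_Im(3)[OF F] have "AE y in lborel. (\<integral>x. F (Complex x y) \<partial>lborel) = 0"
    by eventually_elim (meson has_integral_integral_lborel has_integral_unique)
  then show "(\<integral>z. F z \<partial>lborel) = 0"
    unfolding integral_complex_Re_Im(4)[OF F] by (rule integral_eq_zero_AE)
next
  assume "AE x in lborel. ((\<lambda>y. F (Complex x y)) has_integral 0) UNIV"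
  with integral_complex_Re_Im(1)[OF F] have "AE x in lborel. (\<integral>y. F (Complex x y) \<partial>lborel) = 0"
    by eventually_elim (meson has_integral_integral_lborel has_integral_unique)
  then show "(\<integral>z. F z \<partial>lborel) = 0"
    unfolding integral_complex_Re_Im(2)[OF F] by (rule integral_eq_zero_AE)
qed

text \<open>\<Omega>' stands for \<Omega> without the dividing curves. \<open>bdd\<close> is what
  the limits from within the finitely many pieces give on compact sets, and \<open>slices\<close> is
  what rectifiability of the curves gives on lines parallel to the axes.\<close>

locale piecewise_C2 =
  fixes \<Omega> \<Omega>' :: "complex set" and u ux uy uxx uyy :: "complex \<Rightarrow> real"
  assumes open_dom: "open \<Omega>" "open \<Omega>'" "\<Omega>' \<subseteq> \<Omega>"
    and cont: "continuous_on \<Omega> u" "continuous_on \<Omega> ux" "continuous_on \<Omega> uy"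
      "continuous_on \<Omega>' uxx" "continuous_on \<Omega>' uyy"
    and part: "\<And>z. z \<in> \<Omega> \<Longrightarrow> has_partial 1 u (ux z) z" "\<And>z. z \<in> \<Omega> \<Longrightarrow> has_partial \<i> u (uy z) z"
      "\<And>z. z \<in> \<Omega>' \<Longrightarrow> has_partial 1 ux (uxx z) z" "\<And>z. z \<in> \<Omega>' \<Longrightarrow> has_partial \<i> uy (uyy z) z"
    and bdd: "\<And>K. compact K \<Longrightarrow> K \<subseteq> \<Omega> \<Longrightarrow> \<exists>B. \<forall>z\<in>K \<inter> \<Omega>'. \<bar>uxx z\<bar> \<le> B \<and> \<bar>uyy z\<bar> \<le> B"
    and slices: "AE y in lborel. finite {x. Complex x y \<in> \<Omega> - \<Omega>'}"
      "AE x in lborel. finite {y. Complex x y \<in> \<Omega> - \<Omega>'}"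
begin

lemma borel_second_partials [measurable]:
  "(\<lambda>z. indicator \<Omega>' z * uxx z) \<in> borel_measurable borel"
  "(\<lambda>z. indicator \<Omega>' z * uyy z) \<in> borel_measurable borel"
  using borel_measurable_continuous_on_indicator[of \<Omega>' uxx] borel_measurable_continuous_on_indicator[of \<Omega>' uyy]
    open_dom cont by auto

text \<open>By Fubini it is enough to integrate by parts along almost every line in direction v,
  where \<open>slices\<close> leaves finitely many exceptional points. Compact support and
  \<open>bdd\<close> provide integrability in the plane. The triple selects one of the two
  axes.\<close>

lemma integral_parts_direction:
  assumes v: "(v, d, dd) \<in> {(1, ux, uxx), (\<i>, uy, uyy)}"
    and K: "compact K" "K \<subseteq> \<Omega>"
    and w: "continuous_on UNIV w" "continuous_on UNIV w2"
    and dw: "\<And>z. has_partial v w (w1 z) z" "\<And>z. has_partial v w1 (w2 z) z"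
    and zero: "\<And>z. z \<notin> K \<Longrightarrow> w z = 0" "\<And>z. z \<notin> K \<Longrightarrow> w1 z = 0" "\<And>z. z \<notin> K \<Longrightarrow> w2 z = 0"
  shows "integrable lborel (\<lambda>z. u z * w2 z)" "integrable lborel (\<lambda>z. indicator \<Omega>' z * dd z * w z)"
    "(\<integral>z. u z * w2 z \<partial>lborel) = (\<integral>z. indicator \<Omega>' z * dd z * w z \<partial>lborel)"
proof -
  have Kb: "K \<in> sets borel" using K by (simp add: borel_compact)
  have Kf: "emeasure lborel K < \<infinity>" using emeasure_bounded_finite[OF compact_imp_bounded[OF K(1)]] by simp
  have cuw: "continuous_on K (\<lambda>z. u z * w2 z)"
    using continuous_on_subset[OF cont(1) K(2)] continuous_on_subset[OF w(2)] by (intro continuous_intros) auto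
  have "(\<lambda>z. indicator K z *\<^sub>R (u z * w2 z)) \<in> borel_measurable borel"
    by (rule borel_measurable_continuous_on_indicator[OF Kb cuw])
  moreover have "(\<lambda>z. indicator K z *\<^sub>R (u z * w2 z)) = (\<lambda>z. u z * w2 z)"
    using zero by (auto simp: indicator_def fun_eq_iff)
  ultimately have m1: "(\<lambda>z. u z * w2 z) \<in> borel_measurable lborel" by simp
  have "bounded ((\<lambda>z. u z * w2 z) ` K)"
    by (intro compact_imp_bounded compact_continuous_image cuw K)
  then obtain B1 where B1: "\<And>z. z \<in> K \<Longrightarrow> norm (u z * w2 z) \<le> B1"
    unfolding bounded_iff by blast
  show i1: "integrable lborel (\<lambda>z. u z * w2 z)"
    by (rule integrableI_bounded_set[where A = K and B = B1]) (use Kb Kf m1 B1 zero in auto)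
  have [measurable]: "w \<in> borel_measurable borel" using w by (simp add: borel_measurable_continuous_onI)
  have m2: "(\<lambda>z. indicator \<Omega>' z * dd z * w z) \<in> borel_measurable lborel"
    using v borel_second_partials by auto
  obtain B where B: "\<And>z. z \<in> K \<Longrightarrow> z \<in> \<Omega>' \<Longrightarrow> \<bar>uxx z\<bar> \<le> B \<and> \<bar>uyy z\<bar> \<le> B"
    using bdd[OF K] by blast
  have "bounded (w ` K)"
    by (intro compact_imp_bounded compact_continuous_image continuous_on_subset[OF w(1)] K) simp
  then obtain B2 where B2: "\<And>z. z \<in> K \<Longrightarrow> norm (w z) \<le> B2"
    unfolding bounded_iff by blast
  have b2: "norm (indicator \<Omega>' z * dd z * w z) \<le> \<bar>B\<bar> * B2" if "z \<in> K" for z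
  proof -
    have "\<bar>indicator \<Omega>' z * dd z\<bar> \<le> \<bar>B\<bar>"
      using B[OF that] v by (auto simp: indicator_def)
    then show ?thesis using B2[OF that] by (simp add: abs_mult mult_mono)
  qed
  show i2: "integrable lborel (\<lambda>z. indicator \<Omega>' z * dd z * w z)"
    by (rule integrableI_bounded_set[where A = K and B = "\<bar>B\<bar> * B2"]) (use Kb Kf m2 b2 zero in auto)
  let ?F = "\<lambda>z. u z * w2 z - indicator \<Omega>' z * dd z * w z"
  have i: "integrable lborel ?F" using i1 i2 by simp
  obtain B3 where B3: "\<And>z. z \<in> K \<Longrightarrow> norm z \<le> B3"
    using compact_imp_bounded[OF K(1)] unfolding bounded_iff by blast
  have "(\<integral>z. ?F z \<partial>lborel) = 0"
  proof (cases "v = 1")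
    case True
    then have vd: "d = ux" "dd = uxx" using v by auto
    show ?thesis
    proof (rule integral_eq_0_of_AE_has_integral_0(1)[OF i])
      show "AE y in lborel. ((\<lambda>x. ?F (Complex x y)) has_integral 0) UNIV"
        using slices(1)
      proof eventually_elim
        case (elim y)
        let ?c = "\<lambda>x. Complex x y"
        have cc: "continuous_on UNIV ?c" by (auto simp: Complex_eq intro!: continuous_intros)
        have pre: "?c -` \<Omega> = {x. Complex x y \<in> \<Omega>}" by auto
        show ?case
        proof (rule has_integral_parts_compact_support[where A = "?c -` \<Omega>" and C = "?c -` K" and S = "{x. Complex x y \<in> \<Omega> - \<Omega>'}"
              and ?f1.0 = "\<lambda>x. ux (?c x)" and ?w1.0 = "\<lambda>x. w1 (?c x)" and B = B3])
          show "open (?c -` \<Omega>)" using open_dom cc by (simp add: open_vimage)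
          show "closed (?c -` K)" using K cc by (simp add: closed_vimage compact_imp_closed)
          show "\<bar>t\<bar> \<le> B3" if "t \<in> ?c -` K" for t
            using B3[of "?c t"] that abs_Re_le_cmod[of "?c t"] by simp
          show "continuous_on (?c -` \<Omega>) (\<lambda>x. ux (?c x))"
            by (rule continuous_on_compose2[OF cont(2) continuous_on_subset[OF cc]]) auto
          show "((\<lambda>x. ux (?c x)) has_real_derivative indicator \<Omega>' (?c t) * dd (?c t)) (at t)"
            if "t \<in> ?c -` \<Omega> - {x. Complex x y \<in> \<Omega> - \<Omega>'}" for t
            using part(3)[of "?c t"] that by (auto simp: has_partial_Re vd)
        qed (use elim K zero in \<open>auto intro!: has_partial_Re[THEN iffD1, OF part(1)]
            has_partial_Re[THEN iffD1, OF dw(1)[unfolded True]] has_partial_Re[THEN iffD1, OF dw(2)[unfolded True]]\<close>)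
      qed
    qed
  next
    case False
    then have vd: "v = \<i>" "d = uy" "dd = uyy" using v by auto
    show ?thesis
    proof (rule integral_eq_0_of_AE_has_integral_0(2)[OF i])
      show "AE x in lborel. ((\<lambda>y. ?F (Complex x y)) has_integral 0) UNIV"
        using slices(2)
      proof eventually_elim
        case (elim x)
        let ?c = "\<lambda>y. Complex x y"
        have cc: "continuous_on UNIV ?c" by (auto simp: Complex_eq intro!: continuous_intros)
        show ?case
        proof (rule has_integral_parts_compact_support[where A = "?c -` \<Omega>" and C = "?c -` K" and S = "{y. Complex x y \<in> \<Omega> - \<Omega>'}"
              and ?f1.0 = "\<lambda>y. uy (?c y)" and ?w1.0 = "\<lambda>y. w1 (?c y)" and B = B3])
          show "open (?c -` \<Omega>)" using open_dom cc by (simp add: open_vimage)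
          show "closed (?c -` K)" using K cc by (simp add: closed_vimage compact_imp_closed)
          show "\<bar>t\<bar> \<le> B3" if "t \<in> ?c -` K" for t
            using B3[of "?c t"] that abs_Im_le_cmod[of "?c t"] by simp
          show "continuous_on (?c -` \<Omega>) (\<lambda>y. uy (?c y))"
            by (rule continuous_on_compose2[OF cont(3) continuous_on_subset[OF cc]]) auto
          show "((\<lambda>y. uy (?c y)) has_real_derivative indicator \<Omega>' (?c t) * dd (?c t)) (at t)"
            if "t \<in> ?c -` \<Omega> - {y. Complex x y \<in> \<Omega> - \<Omega>'}" for t
            using part(4)[of "?c t"] that by (auto simp: has_partial_Im vd)
        qed (use elim K zero in \<open>auto intro!: has_partial_Im[THEN iffD1, OF part(2)]
            has_partial_Im[THEN iffD1, OF dw(1)[unfolded vd(1)]] has_partial_Im[THEN iffD1, OF dw(2)[unfolded vd(1)]]\<close>)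
      qed
    qed
  qed
  then show "(\<integral>z. u z * w2 z \<partial>lborel) = (\<integral>z. indicator \<Omega>' z * dd z * w z \<partial>lborel)"
    using i1 i2 by simp
qed

end

lemma max_0_power_has_derivative:
  "((\<lambda>x::real. (max x 0) ^ Suc (Suc n)) has_real_derivative real (Suc (Suc n)) * (max x 0) ^ Suc n) (at x)"
proof -
  consider "x < 0" | "x = 0" | "0 < x" by linarith
  then show ?thesis
  proof cases
    case 1
    have "\<forall>\<^sub>F y in nhds x. y < 0" using 1 by (intro eventually_nhds_in_open[of "{..<0}", simplified]) auto
    then have "\<forall>\<^sub>F y in nhds x. (max y 0) ^ Suc (Suc n) = 0" by eventually_elim simp
    from iffD2[OF DERIV_cong_ev[OF refl this refl] DERIV_const] show ?thesis
      using 1 by simp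
  next
    case 2
    have "(\<lambda>h. (max h 0) ^ Suc n) \<midarrow>0::real\<rightarrow> (max 0 0) ^ Suc n"
      by (intro tendsto_intros)
    moreover have "\<forall>\<^sub>F h in at (0::real). (max h 0) ^ Suc n = ((max (0 + h) 0) ^ Suc (Suc n) - (max 0 0) ^ Suc (Suc n)) / h"
      unfolding eventually_at_filter by (rule always_eventually) (auto simp: max_def)
    ultimately have "(\<lambda>h. ((max (0 + h) 0) ^ Suc (Suc n) - (max 0 0) ^ Suc (Suc n)) / h) \<midarrow>0::real\<rightarrow> (max 0 0) ^ Suc n"
      by (rule Lim_transform_eventually)
    then show ?thesis using 2 by (simp add: DERIV_def)
  next
    case 3
    have "\<forall>\<^sub>F y in nhds x. 0 < y" using 3 by (intro eventually_nhds_in_open[of "{0<..}", simplified]) auto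
    then have "\<forall>\<^sub>F y in nhds x. (max y 0) ^ Suc (Suc n) = y ^ Suc (Suc n)" by eventually_elim simp
    moreover have "((\<lambda>y. y ^ Suc (Suc n)) has_real_derivative real (Suc (Suc n)) * x ^ Suc n) (at x)"
      using DERIV_pow[of "Suc (Suc n)" x] by simp
    ultimately have "((\<lambda>x. (max x 0) ^ Suc (Suc n)) has_real_derivative real (Suc (Suc n)) * x ^ Suc n) (at x)"
      by (rule iffD2[OF DERIV_cong_ev[OF refl _ refl]])
    then show ?thesis using 3 by simp
  qed
qed

text \<open>A \<open>C\<^sup>2\<close> smoothing of the function \<open>max x 0\<close> (its convolution with the triangular kernel
  of width \<open>h\<close>), and its first two derivatives.\<close>

definition ramp :: "real \<Rightarrow> real \<Rightarrow> real" where
  "ramp h x = ((max (x + h) 0) ^ 3 - 2 * (max x 0) ^ 3 + (max (x - h) 0) ^ 3) / (6 * h\<^sup>2)"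

definition ramp1 :: "real \<Rightarrow> real \<Rightarrow> real" where
  "ramp1 h x = ((max (x + h) 0) ^ 2 - 2 * (max x 0) ^ 2 + (max (x - h) 0) ^ 2) / (2 * h\<^sup>2)"

definition ramp2 :: "real \<Rightarrow> real \<Rightarrow> real" where
  "ramp2 h x = (max (x + h) 0 - 2 * max x 0 + max (x - h) 0) / h\<^sup>2"

context
  fixes h :: real
  assumes h: "0 < h"
begin

lemma ramp_has_derivative: "(ramp h has_real_derivative ramp1 h x) (at x)"
proof -
  have d: "((\<lambda>x. (max (x + a) 0) ^ 3) has_real_derivative 3 * (max (x + a) 0)\<^sup>2) (at x)" for a
    using DERIV_shift[THEN iffD1, OF max_0_power_has_derivative[of 1 "x + a"]]
    by (simp add: eval_nat_numeral)
  have "(ramp h has_real_derivative (3 * (max (x + h) 0)\<^sup>2 - 2 * (3 * (max (x + 0) 0)\<^sup>2) + 3 * (max (x + - h) 0)\<^sup>2) / (6 * h\<^sup>2)) (at x)"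
    unfolding ramp_def[abs_def] using h d[of h] d[of 0] d[of "-h"]
    by (intro DERIV_cdivide DERIV_add DERIV_diff DERIV_cmult) simp_all
  moreover have "(3 * A - 2 * (3 * B) + 3 * C) / (6 * k) = (A - 2 * B + C) / (2 * k)" for A B C k :: real
    by (cases "k = 0") (simp_all add: field_simps)
  ultimately show ?thesis by (simp only: ramp1_def add_0_right diff_conv_add_uminus[symmetric])
qed

lemma ramp1_has_derivative: "(ramp1 h has_real_derivative ramp2 h x) (at x)"
proof -
  have d: "((\<lambda>x. (max (x + a) 0) ^ 2) has_real_derivative 2 * max (x + a) 0) (at x)" for a
    using DERIV_shift[THEN iffD1, OF max_0_power_has_derivative[of 0 "x + a"]]
    by (simp add: eval_nat_numeral)
  have "(ramp1 h has_real_derivative (2 * max (x + h) 0 - 2 * (2 * max (x + 0) 0) + 2 * max (x + - h) 0) / (2 * h\<^sup>2)) (at x)"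
    unfolding ramp1_def[abs_def] using h d[of h] d[of 0] d[of "-h"]
    by (intro DERIV_cdivide DERIV_add DERIV_diff DERIV_cmult) simp_all
  moreover have "(2 * A - 2 * (2 * B) + 2 * C) / (2 * k) = (A - 2 * B + C) / k" for A B C k :: real
    by (cases "k = 0") (simp_all add: field_simps)
  ultimately show ?thesis by (simp only: ramp2_def add_0_right diff_conv_add_uminus[symmetric])
qed

lemma ramp_left: "x \<le> - h \<Longrightarrow> ramp h x = 0" "x \<le> - h \<Longrightarrow> ramp1 h x = 0" "x \<le> - h \<Longrightarrow> ramp2 h x = 0"
  using h by (auto simp: ramp_def ramp1_def ramp2_def max_def)

lemma ramp_right: "h \<le> x \<Longrightarrow> ramp h x = x" "h \<le> x \<Longrightarrow> ramp1 h x = 1" "h \<le> x \<Longrightarrow> ramp2 h x = 0"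
  using h by (auto simp: ramp_def ramp1_def ramp2_def max_def field_simps power2_eq_square power3_eq_cube)

lemma ramp2_nonneg: "0 \<le> ramp2 h x"
  using h by (auto simp: ramp2_def max_def)

lemma ramp1_mono: "x \<le> y \<Longrightarrow> ramp1 h x \<le> ramp1 h y"
  using ramp1_has_derivative ramp2_nonneg DERIV_nonneg_imp_nondecreasing by blast

lemma ramp1_bounds: "0 \<le> ramp1 h x" "ramp1 h x \<le> 1"
  using ramp1_mono[of "min x (- h)" x] ramp1_mono[of x "max x h"] ramp_left(2)[of "min x (-h)"] ramp_right(2)[of "max x h"]
  by auto

text \<open>The slope of the ramp is at most 1. This single fact yields the bounds by the kink
  function and the sign of differences of shifted ramps.\<close>

lemma ramp_minus_id_antimono: "x \<le> y \<Longrightarrow> ramp h y - y \<le> ramp h x - x"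
proof -
  assume "x \<le> y"
  moreover have "((\<lambda>x. ramp h x - x) has_real_derivative ramp1 h x - 1) (at x)" for x
    by (intro DERIV_diff ramp_has_derivative DERIV_ident)
  ultimately show ?thesis
    using ramp1_bounds(2) DERIV_nonpos_imp_nonincreasing[of x y "\<lambda>x. ramp h x - x"] by fastforce
qed

lemma ramp_ge: "x \<le> ramp h x"
  using ramp_minus_id_antimono[of x "max x h"] ramp_right(1)[of "max x h"] by simp

lemma ramp_le: "ramp h x \<le> max (x + h) 0"
  using ramp_minus_id_antimono[of "- h" x] ramp_left(1)[of "-h"] ramp_left(1)[of x] by (cases "x \<le> - h") auto

lemma ramp_continuous_on: "continuous_on A (ramp h)" "continuous_on A (ramp1 h)" "continuous_on A (ramp2 h)"
  unfolding ramp_def[abs_def] ramp1_def[abs_def] ramp2_def[abs_def] using h by (auto intro!: continuous_intros)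

text \<open>The second derivative of a ramp is an approximate unit mass at a. The hypothesis keeps
  its support in the closed negative half line, the range of ln |z| on the unit disc.\<close>

lemma integral_ramp2:
  assumes "a + h \<le> 0"
  shows "integrable lborel (\<lambda>x. indicator {..<0} x * ramp2 h (x - a))"
    "(\<integral>x. indicator {..<0} x * ramp2 h (x - a) \<partial>lborel) = 1"
proof -
  have hi: "((\<lambda>x. ramp2 h (x - a)) has_integral (ramp1 h (a + h - a) - ramp1 h (a - h - a))) {a - h..a + h}"
  proof (rule fundamental_theorem_of_calculus)
    fix x
    have "((\<lambda>x. ramp1 h (x - a)) has_real_derivative ramp2 h (x - a)) (at x)"
      using DERIV_shift[THEN iffD1, of "ramp1 h" "ramp2 h (x - a)" x "- a"] ramp1_has_derivative[of "x - a"] by simp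
    then show "((\<lambda>x. ramp1 h (x - a)) has_vector_derivative ramp2 h (x - a)) (at x within {a - h..a + h})"
      by (simp add: has_real_derivative_iff_has_vector_derivative has_vector_derivative_at_within)
  qed (use h in simp)
  then have "((\<lambda>x. ramp2 h (x - a)) has_integral 1) {a - h..a + h}"
    using ramp_left(2)[of "-h"] ramp_right(2)[of h] by simp
  then have nn: "(\<integral>\<^sup>+x. ennreal (ramp2 h (x - a)) * indicator {a - h..a + h} x \<partial>lborel) = ennreal 1"
    by (rule nn_integral_has_integral_lebesgue'[OF ramp2_nonneg])
  have m: "(\<lambda>x. indicator {..<0} x * ramp2 h (x - a)) \<in> borel_measurable lborel"
    using borel_measurable_continuous_onI[OF ramp_continuous_on(3)] by measurable
  have "(\<integral>\<^sup>+x. ennreal (indicator {..<0} x * ramp2 h (x - a)) \<partial>lborel) = ennreal 1"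
    unfolding nn[symmetric]
  proof (rule nn_integral_cong_AE)
    show "AE x in lborel. ennreal (indicator {..<0} x * ramp2 h (x - a)) = ennreal (ramp2 h (x - a)) * indicator {a - h..a + h} x"
      using AE_lborel_singleton[of 0]
    proof eventually_elim
      fix x :: real assume "x \<noteq> 0"
      show "ennreal (indicator {..<0} x * ramp2 h (x - a)) = ennreal (ramp2 h (x - a)) * indicator {a - h..a + h} x"
        using assms ramp_left(3)[of "x - a"] ramp_right(3)[of "x - a"] \<open>x \<noteq> 0\<close>
        by (cases "x \<le> a - h"; cases "a + h \<le> x") (auto simp: indicator_def)
    qed
  qed
  then show "integrable lborel (\<lambda>x. indicator {..<0} x * ramp2 h (x - a))"
    "(\<integral>x. indicator {..<0} x * ramp2 h (x - a) \<partial>lborel) = 1"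
    using m ramp2_nonneg by (auto intro!: integrableI_nn_integral_finite[of _ _ 1] integral_eq_nn_integral[THEN trans])
qed

end

section \<open>Directional derivatives of logarithms of holomorphic functions\<close>

lemma has_partial_cong_ev:
  assumes "\<forall>\<^sub>F w in nhds z. f w = g w"
  shows "has_partial v f d z \<longleftrightarrow> has_partial v g d z"
proof -
  have "(\<lambda>t::real. z + of_real t * v) \<midarrow>0\<rightarrow> z + of_real 0 * v"
    by (intro tendsto_intros)
  then have "\<forall>\<^sub>F t::real in at 0. f (z + of_real t * v) = g (z + of_real t * v)"
    using eventually_compose_filterlim[OF assms] by simp
  then have "\<forall>\<^sub>F t::real in nhds 0. f (z + of_real t * v) = g (z + of_real t * v)"
    using eventually_nhds_x_imp_x[OF assms] by (simp add: eventually_nhds_conv_at)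
  then show ?thesis unfolding has_partial_def by (intro DERIV_cong_ev refl)
qed

lemma has_partial_Re_holomorphic:
  assumes "(g has_field_derivative d) (at z)"
  shows "has_partial v (\<lambda>z. Re (g z)) (Re (v * d)) z"
proof -
  have "((\<lambda>t. g (z + t * v)) has_field_derivative d * v) (at 0)"
    using assms by (intro DERIV_chain2[where f = g]) (auto intro!: derivative_eq_intros)
  then have "((\<lambda>t. g (z + of_real t * v)) has_vector_derivative d * v) (at 0)"
    using has_vector_derivative_real_field[of "\<lambda>t. g (z + t * v)" "d * v" 0 UNIV] by simp
  then have "((\<lambda>t. Re (g (z + of_real t * v))) has_vector_derivative Re (d * v)) (at 0)"
    by (rule bounded_linear.has_vector_derivative[OF bounded_linear_Re])
  then show ?thesis
    unfolding has_partial_def by (simp add: has_real_derivative_iff_has_vector_derivative mult.commute)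
qed

text \<open>Near z, ln |q| is Re (Ln (q / q(z))) up to a constant. Dividing by q(z) keeps the
  argument of Ln near 1, away from the branch cut.\<close>

lemma has_partial_ln_norm:
  assumes q: "(q has_field_derivative d) (at z)" and nz: "q z \<noteq> 0"
  shows "has_partial v (\<lambda>z. ln (norm (q z))) (Re (v * (d / q z))) z"
proof -
  have "isCont q z" using q by (rule DERIV_isCont)
  then have "\<forall>\<^sub>F w in nhds z. q w \<noteq> 0"
    using nz by (auto simp: isCont_def tendsto_nhds_iff intro!: tendsto_imp_eventually_ne)
  then have ev: "\<forall>\<^sub>F w in nhds z. ln (norm (q w)) = Re (Ln (q w / q z) + of_real (ln (norm (q z))))"
    by eventually_elim (use nz in \<open>simp add: norm_divide ln_div\<close>)
  have d: "((\<lambda>w. Ln (q w / q z) + of_real (ln (norm (q z)))) has_field_derivative d / q z) (at z)"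
    using q nz by (auto intro!: derivative_eq_intros)
  show ?thesis
    by (rule has_partial_cong_ev[THEN iffD2, OF ev has_partial_Re_holomorphic[OF d]])
qed

lemma has_partial_compose:
  assumes "has_partial v f d z" "(g has_real_derivative e) (at (f z))"
  shows "has_partial v (\<lambda>z. g (f z)) (e * d) z"
  unfolding has_partial_def
  by (rule DERIV_chain2[where f = g]) (use assms in \<open>auto simp: has_partial_def\<close>)

lemma has_partial_mult:
  assumes "has_partial v f d z" "has_partial v g e z"
  shows "has_partial v (\<lambda>z. f z * g z) (d * g z + e * f z) z"
  using DERIV_mult[OF assms[unfolded has_partial_def]] by (simp add: has_partial_def)

lemma has_partial_const: "has_partial v (\<lambda>_. c) 0 z"
  by (simp add: has_partial_def)

context piecewise_C2
begin

text \<open>The value 0 off \<Omega>' makes the function Borel measurable on the plane; in the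
  application \<Omega> - \<Omega>' is a null set.\<close>

definition neg_laplacian :: "complex \<Rightarrow> real" where
  "neg_laplacian z = max (- (indicator \<Omega>' z * uxx z + indicator \<Omega>' z * uyy z)) 0"

lemma neg_laplacian_measurable [measurable]: "neg_laplacian \<in> borel_measurable borel"
  unfolding neg_laplacian_def[abs_def] by measurable

text \<open>Test Green's identity against a smooth truncation of the Green function
  \<open>- ln \<bar>\<psi>\<bar>\<close>, a function of \<open>ln \<bar>\<psi>\<bar>\<close> that is constant near \<open>\<Phi> 0\<close>
  and vanishes near the boundary.\<close>

lemma mean_bound_approx:
  assumes Phi: "\<Phi> holomorphic_on ball 0 1" "inj_on \<Phi> (ball 0 1)" "\<Phi> ` ball 0 1 \<subseteq> \<Omega>"
    and \<psi>: "\<And>w. w \<in> ball 0 1 \<Longrightarrow> \<psi> (\<Phi> w) = w"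
    and N: "0 \<le> N" "(\<integral>\<^sup>+z\<in>\<Phi> ` ball 0 1. ennreal (- ln (norm (\<psi> z))) * ennreal (neg_laplacian z) \<partial>lborel) = ennreal N"
    and \<delta>: "0 < \<delta>" "\<delta> < 1"
    and B: "continuous_on {0..2*pi} B" "\<And>x y. - \<delta> < x \<Longrightarrow> x < 0 \<Longrightarrow> 0 < y \<Longrightarrow> y < 2 * pi \<Longrightarrow> u (\<Phi> (exp (Complex x y))) \<le> B y"
    and b: "\<And>w. norm w < \<delta> \<Longrightarrow> b \<le> u (\<Phi> w)"
  shows "2 * pi * b \<le> integral {0..2*pi} B + N"
proof -
  \<comment> \<open>The bump at c is supported in [-4 h, -2 h], inside (- \<delta>, 0), where B
    bounds u from above. The bump at d is supported below ln \<delta>, where exp maps into the disc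
    of radius \<delta> and b bounds u from below. The second entry of the minimum ensures d < c and
    d + h < 0.\<close>
  define h where "h = \<delta> / 5"
  define c where "c = - 3 * h"
  define d where "d = min (ln \<delta> - h) (- 4 * h)"
  have h: "0 < h" and hd: "4 * h < \<delta>" using \<delta> by (auto simp: h_def)
  have dc: "d < c" "c + h < 0" "d + h < 0" "d + h \<le> ln \<delta>" using h by (auto simp: c_def d_def)
  \<comment> \<open>A smoothing of c - x truncated to the interval [0, c - d]; with x = ln |\<psi>|
    it is the truncated Green function. Its second derivative is the bump at c minus the bump at
    d.\<close>
  define cut where "cut x = ramp h (x - c) - ramp h (x - d) + (c - d)" for x
  define cut1 where "cut1 x = ramp1 h (x - c) - ramp1 h (x - d)" for x
  define cut2 where "cut2 x = ramp2 h (x - c) - ramp2 h (x - d)" for x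
  have dcut: "(cut has_real_derivative cut1 x) (at x)" "(cut1 has_real_derivative cut2 x) (at x)" for x
  proof -
    have s: "((\<lambda>x. f (x - a)) has_real_derivative f' (x - a)) (at x)"
      if "\<And>x. (f has_real_derivative f' x) (at x)" for f f' a
      using DERIV_shift[THEN iffD1, of f "f' (x - a)" x "- a"] that[of "x - a"] by simp
    show "(cut has_real_derivative cut1 x) (at x)"
      unfolding cut_def[abs_def] cut1_def
      using DERIV_add[OF DERIV_diff[OF s[OF ramp_has_derivative[OF h], of c] s[OF ramp_has_derivative[OF h], of d]] DERIV_const[of "c - d"]]
      by simp
    show "(cut1 has_real_derivative cut2 x) (at x)"
      unfolding cut1_def[abs_def] cut2_def
      by (rule DERIV_diff[OF s[OF ramp1_has_derivative[OF h]] s[OF ramp1_has_derivative[OF h]]])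
  qed
  have cutc: "continuous_on A cut" "continuous_on A cut1" "continuous_on A cut2" for A
    unfolding cut_def[abs_def] cut1_def[abs_def] cut2_def[abs_def]
    by (intro continuous_intros continuous_on_compose2[OF ramp_continuous_on(1)[OF h, of UNIV]]
        continuous_on_compose2[OF ramp_continuous_on(2)[OF h, of UNIV]]
        continuous_on_compose2[OF ramp_continuous_on(3)[OF h, of UNIV]]; simp)+
  have cutright: "cut x = 0" "cut1 x = 0" "cut2 x = 0" if "c + h \<le> x" for x
    using that dc ramp_right[OF h, of "x - c"] ramp_right[OF h, of "x - d"] by (auto simp: cut_def cut1_def cut2_def)
  have cutleft: "cut x = c - d" "cut1 x = 0" "cut2 x = 0" if "x \<le> d - h" for x
    using that dc ramp_left[OF h, of "x - c"] ramp_left[OF h, of "x - d"] by (auto simp: cut_def cut1_def cut2_def)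
  have cutpos: "0 \<le> cut x" for x
    using ramp_minus_id_antimono[OF h, of "x - c" "x - d"] dc by (simp add: cut_def)
  \<comment> \<open>Keeps the test function below the Green function, so that its pairing with the
    negative part of the Laplacian is at most N.\<close>
  have cutle: "cut x \<le> - x" if "x \<le> 0" for x
  proof (cases "c + h \<le> x")
    case True
    then show ?thesis using cutright that by simp
  next
    case False
    then show ?thesis
      using ramp_le[OF h, of "x - c"] ramp_ge[OF h, of "x - d"] h by (auto simp: cut_def c_def max_def split: if_splits)
  qed
  let ?D = "ball (0::complex) 1"
  let ?O = "\<Phi> ` ?D"
  have oO: "open ?O" using open_mapping_thm3[OF Phi(1) open_ball Phi(2)] .
  obtain g where g: "g holomorphic_on ?O" "\<And>z. z \<in> ?D \<Longrightarrow> deriv \<Phi> z * deriv g (\<Phi> z) = 1"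
    "\<And>z. z \<in> ?D \<Longrightarrow> g (\<Phi> z) = z"
    using holomorphic_has_inverse[OF Phi(1) open_ball Phi(2)] by metis
  have \<psi>g: "\<psi> z = g z" if "z \<in> ?O" for z using that \<psi> g(3) by auto
  let ?p = "\<Phi> 0"
  have gnz: "g z \<noteq> 0" if "z \<in> ?O - {?p}" for z using that g(3) by auto
  have gn: "norm (g z) < 1" if "z \<in> ?O" for z using that g(3) by auto
  define \<rho> where "\<rho> z = ln (norm (g z))" for z
  define lam where "lam z = deriv g z / g z" for z
  have oO': "open (?O - {?p})" using oO by (simp add: open_Diff)
  have hg: "g holomorphic_on ?O - {?p}" using g(1) by (rule holomorphic_on_subset) auto
  have hlam: "lam holomorphic_on ?O - {?p}"
    unfolding lam_def[abs_def] using hg gnz by (intro holomorphic_intros holomorphic_deriv oO') auto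
  have \<rho>Phi: "\<rho> (\<Phi> w) = ln (norm w)" if "w \<in> ?D" for w using g(3)[OF that] by (simp add: \<rho>_def)
  \<comment> \<open>The test function and its first and second derivatives in direction v. At the
    pole \<open>w0\<close> takes the value that \<open>cut\<close> has near minus infinity, so it is
    constant around the pole.\<close>
  define w0 where "w0 z = (if z \<in> ?O then if z = ?p then c - d else cut (\<rho> z) else 0)" for z
  define w1 where "w1 v z = (if z \<in> ?O - {?p} then cut1 (\<rho> z) * Re (v * lam z) else 0)" for v z
  define w2 where "w2 v z = (if z \<in> ?O - {?p} then cut2 (\<rho> z) * (Re (v * lam z))\<^sup>2 + cut1 (\<rho> z) * Re (v * (v * deriv lam z)) else 0)" for v z
  define K where "K = \<Phi> ` cball 0 (exp (c + h))"
  have cb: "cball 0 (exp (c + h)) \<subseteq> ?D"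
  proof -
    have "exp (c + h) < 1" using dc by simp
    then show ?thesis by (intro subsetI) (metis mem_cball_0 mem_ball_0 le_less_trans)
  qed
  have cPhi: "continuous_on ?D \<Phi>" using Phi(1) by (rule holomorphic_on_imp_continuous_on)
  have K: "compact K" "K \<subseteq> ?O"
    unfolding K_def using cb by (auto intro!: compact_continuous_image continuous_on_subset[OF cPhi])
  define U3 where "U3 = \<Phi> ` ball 0 (exp (d - h))"
  have b3: "ball 0 (exp (d - h)) \<subseteq> ?D" using dc h by (intro subset_ball) simp
  have U3: "open U3" "?p \<in> U3" "U3 \<subseteq> ?O"
    unfolding U3_def using b3 open_mapping_thm3[OF holomorphic_on_subset[OF Phi(1) b3] open_ball inj_on_subset[OF Phi(2) b3]]
    by auto
  have z1: "w0 z = 0 \<and> w1 v z = 0 \<and> w2 v z = 0" if "z \<notin> K" for v z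
  proof (cases "z \<in> ?O")
    case True
    then obtain w where w: "z = \<Phi> w" "w \<in> ?D" by blast
    then have "exp (c + h) < norm w" using that by (auto simp: K_def)
    then have "c + h \<le> \<rho> z" using w \<rho>Phi by (metis exp_gt_zero less_imp_le ln_exp ln_le_cancel_iff order.strict_trans)
    moreover have "z \<noteq> ?p" using that by (auto simp: K_def)
    ultimately show ?thesis using True cutright by (simp add: w0_def w1_def w2_def)
  qed (simp add: w0_def w1_def w2_def)
  have z3: "w0 z = c - d \<and> w1 v z = 0 \<and> w2 v z = 0" if zU: "z \<in> U3" for v z
  proof (cases "z = ?p")
    case True
    then show ?thesis using U3 by (auto simp: w0_def w1_def w2_def)
  next
    case False
    obtain w where w: "z = \<Phi> w" "w \<in> ball 0 (exp (d - h))" using zU by (auto simp: U3_def)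
    then have "w \<in> ?D" "w \<noteq> 0" using b3 False by auto
    then have "\<rho> z < d - h" using w \<rho>Phi[of w] by (metis dist_0_norm exp_less_cancel_iff exp_ln mem_ball zero_less_norm_iff)
    then show ?thesis using False U3 zU cutleft[of "\<rho> z"] by (auto simp: w0_def w1_def w2_def)
  qed
  \<comment> \<open>Smoothness is checked on three open sets: outside K everything vanishes, on
    \<open>U3\<close> around the pole \<open>w0\<close> is constant, and on the punctured image the
    explicit formulas hold.\<close>
  have cover: "UNIV = - K \<union> ((?O - {?p}) \<union> U3)" using K U3 by auto
  have oK: "open (- K)" using K by (simp add: compact_imp_closed open_Compl)
  have cont_glue: "continuous_on UNIV f"
    if "\<And>z. z \<notin> K \<Longrightarrow> f z = 0" "\<And>z. z \<in> U3 \<Longrightarrow> f z = C" "continuous_on (?O - {?p}) f" for f :: "complex \<Rightarrow> real" and C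
  proof -
    have "continuous_on (- K) f" by (rule continuous_on_eq[OF continuous_on_const[of _ 0]]) (use that in auto)
    moreover have "continuous_on U3 f" by (rule continuous_on_eq[OF continuous_on_const[of _ C]]) (use that in auto)
    ultimately show ?thesis
      unfolding cover using oK oO' U3 that(3) by (intro continuous_on_open_Un open_Un) auto
  qed
  have c\<rho>: "continuous_on (?O - {?p}) \<rho>"
    unfolding \<rho>_def[abs_def] using gnz by (intro continuous_intros holomorphic_on_imp_continuous_on[OF hg]) auto
  have clam: "continuous_on (?O - {?p}) lam" "continuous_on (?O - {?p}) (deriv lam)"
    using hlam holomorphic_deriv[OF hlam oO'] by (auto intro: holomorphic_on_imp_continuous_on)
  have ccut\<rho>: "continuous_on (?O - {?p}) (\<lambda>z. cut (\<rho> z))" "continuous_on (?O - {?p}) (\<lambda>z. cut1 (\<rho> z))" "continuous_on (?O - {?p}) (\<lambda>z. cut2 (\<rho> z))"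
    by (rule continuous_on_compose2[OF cutc(1)[of UNIV] c\<rho>] continuous_on_compose2[OF cutc(2)[of UNIV] c\<rho>] continuous_on_compose2[OF cutc(3)[of UNIV] c\<rho>]; simp)+
  have cw0: "continuous_on UNIV w0"
  proof (rule cont_glue)
    show "continuous_on (?O - {?p}) w0"
      by (rule continuous_on_eq[OF ccut\<rho>(1)]) (auto simp: w0_def)
  qed (use z1 z3 in blast)+
  have cw2: "continuous_on UNIV (w2 v)" for v
  proof (rule cont_glue)
    have "continuous_on (?O - {?p}) (\<lambda>z. cut2 (\<rho> z) * (Re (v * lam z))\<^sup>2 + cut1 (\<rho> z) * Re (v * (v * deriv lam z)))"
      by (intro continuous_intros ccut\<rho> clam)
    then show "continuous_on (?O - {?p}) (w2 v)"
      by (rule continuous_on_eq) (auto simp: w2_def)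
  qed (use z1 z3 in blast)+
  have part_glue: "has_partial v f (f' z) z"
    if "\<And>z. z \<notin> K \<Longrightarrow> f z = 0 \<and> f' z = 0" "\<And>z. z \<in> U3 \<Longrightarrow> f z = C \<and> f' z = 0"
      "\<And>z. z \<in> ?O - {?p} \<Longrightarrow> has_partial v F (f' z) z" "\<And>z. z \<in> ?O - {?p} \<Longrightarrow> f z = F z" for f f' F C v z
  proof -
    consider "z \<in> - K" | "z \<in> ?O - {?p}" | "z \<in> U3" using cover by blast
    then show ?thesis
    proof cases
      case 1
      then have "\<forall>\<^sub>F w in nhds z. f w = 0" using oK that(1) by (auto simp: eventually_nhds)
      then show ?thesis using has_partial_cong_ev[of f "\<lambda>_. 0"] has_partial_const that(1) 1 by force
    next
      case 2
      then have "\<forall>\<^sub>F w in nhds z. f w = F w" using oO' that(4) by (auto simp: eventually_nhds)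
      then show ?thesis using has_partial_cong_ev[of f F] that(3) 2 by blast
    next
      case 3
      then have "\<forall>\<^sub>F w in nhds z. f w = C" using U3 that(2) by (auto simp: eventually_nhds)
      then show ?thesis using has_partial_cong_ev[of f "\<lambda>_. C"] has_partial_const that(2) 3 by force
    qed
  qed
  have p\<rho>: "has_partial v \<rho> (Re (v * lam z)) z" if "z \<in> ?O - {?p}" for v z
    unfolding \<rho>_def[abs_def] lam_def
    by (rule has_partial_ln_norm) (use that gnz hg oO' holomorphic_derivI in blast)+
  have plam: "has_partial v (\<lambda>z. Re (v * lam z)) (Re (v * (v * deriv lam z))) z" if "z \<in> ?O - {?p}" for v z
  proof (rule has_partial_Re_holomorphic)
    have "(lam has_field_derivative deriv lam z) (at z)" using that hlam oO' holomorphic_derivI by blast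
    then show "((\<lambda>z. v * lam z) has_field_derivative v * deriv lam z) (at z)" by (rule DERIV_cmult)
  qed
  have dw0: "has_partial v w0 (w1 v z) z" for v z
  proof (rule part_glue[where F = "\<lambda>z. cut (\<rho> z)" and C = "c - d"])
    fix z assume z: "z \<in> ?O - {?p}"
    show "has_partial v (\<lambda>z. cut (\<rho> z)) (w1 v z) z"
      using has_partial_compose[OF p\<rho>[OF z] dcut(1), of v] z by (simp add: w1_def)
  qed (use z1 z3 in \<open>auto simp: w0_def\<close>)
  have dw1: "has_partial v (w1 v) (w2 v z) z" for v z
  proof (rule part_glue[where F = "\<lambda>z. cut1 (\<rho> z) * Re (v * lam z)" and C = 0])
    fix z assume z: "z \<in> ?O - {?p}"
    show "has_partial v (\<lambda>z. cut1 (\<rho> z) * Re (v * lam z)) (w2 v z) z"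
      using has_partial_mult[OF has_partial_compose[OF p\<rho>[OF z] dcut(2)] plam[OF z], of v] z
      by (simp add: w2_def power2_eq_square algebra_simps)
  qed (use z1 z3 in \<open>auto simp: w1_def\<close>)
  have KO: "K \<subseteq> \<Omega>" using K Phi(3) by blast
  note Gr1 = integral_parts_direction[of 1 ux uxx, OF _ K(1) KO cw0 cw2 dw0 dw1]
  note Gr2 = integral_parts_direction[of \<i> uy uyy, OF _ K(1) KO cw0 cw2 dw0 dw1]
  have G1: "integrable lborel (\<lambda>z. u z * w2 1 z)" "integrable lborel (\<lambda>z. indicator \<Omega>' z * uxx z * w0 z)"
      "(\<integral>z. u z * w2 1 z \<partial>lborel) = (\<integral>z. indicator \<Omega>' z * uxx z * w0 z \<partial>lborel)"
    by (rule Gr1; use z1 in simp)+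
  have G2: "integrable lborel (\<lambda>z. u z * w2 \<i> z)" "integrable lborel (\<lambda>z. indicator \<Omega>' z * uyy z * w0 z)"
      "(\<integral>z. u z * w2 \<i> z \<partial>lborel) = (\<integral>z. indicator \<Omega>' z * uyy z * w0 z \<partial>lborel)"
    by (rule Gr2; use z1 in simp)+
  let ?G = "\<lambda>z. u z * (w2 1 z + w2 \<i> z)"
  let ?L = "\<lambda>z. (indicator \<Omega>' z * uxx z + indicator \<Omega>' z * uyy z) * w0 z"
  have iG: "integrable lborel ?G" using G1 G2 by (simp add: distrib_left)
  have iL: "integrable lborel ?L" using G1 G2 by (simp add: distrib_right)
  have GL: "(\<integral>z. ?G z \<partial>lborel) = (\<integral>z. ?L z \<partial>lborel)"
    using G1 G2 by (simp add: distrib_left distrib_right)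
  have w0_nonneg: "0 \<le> w0 z" for z using cutpos dc by (simp add: w0_def)
  have lower: "- N \<le> (\<integral>z. ?L z \<partial>lborel)"
  proof -
    have [measurable]: "w0 \<in> borel_measurable borel" using cw0 by (rule borel_measurable_continuous_onI)
    have Lneg: "neg_laplacian z * w0 z = max (- ?L z) 0" for z
      by (simp only: neg_laplacian_def max_mult_distrib_right w0_nonneg if_True mult_minus_left mult_zero_left)
    have i: "integrable lborel (\<lambda>z. neg_laplacian z * w0 z)" unfolding Lneg using iL by simp
    have "ennreal (\<integral>z. neg_laplacian z * w0 z \<partial>lborel) = (\<integral>\<^sup>+z. ennreal (neg_laplacian z * w0 z) \<partial>lborel)"
      using i w0_nonneg by (intro nn_integral_eq_integral[symmetric]) (auto simp: neg_laplacian_def)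
    also have "\<dots> \<le> (\<integral>\<^sup>+z\<in>?O. ennreal (- ln (norm (\<psi> z))) * ennreal (neg_laplacian z) \<partial>lborel)"
    proof (rule nn_integral_mono_AE)
      show "AE z in lborel. ennreal (neg_laplacian z * w0 z) \<le> ennreal (- ln (norm (\<psi> z))) * ennreal (neg_laplacian z) * indicator ?O z"
        using AE_lborel_singleton[of ?p]
      proof eventually_elim
        fix z assume "z \<noteq> ?p"
        show "ennreal (neg_laplacian z * w0 z) \<le> ennreal (- ln (norm (\<psi> z))) * ennreal (neg_laplacian z) * indicator ?O z"
        proof (cases "z \<in> ?O")
          case True
          have "\<rho> z \<le> 0" using gn[OF True] gnz[of z] True \<open>z \<noteq> ?p\<close> by (simp add: \<rho>_def)
          then have "w0 z \<le> - ln (norm (\<psi> z))"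
            using True \<open>z \<noteq> ?p\<close> cutle[of "\<rho> z"] by (simp add: w0_def \<psi>g \<rho>_def)
          then have "neg_laplacian z * w0 z \<le> neg_laplacian z * (- ln (norm (\<psi> z)))"
            by (intro mult_left_mono) (simp_all add: neg_laplacian_def)
          then show ?thesis
            using True by (simp add: ennreal_mult''[symmetric] neg_laplacian_def mult.commute ennreal_leI)
        qed (simp add: w0_def)
      qed
    qed
    also have "\<dots> = ennreal N" by (rule N(2))
    finally have "(\<integral>z. neg_laplacian z * w0 z \<partial>lborel) \<le> N" using N(1) by simp
    moreover have "(\<integral>z. - (neg_laplacian z * w0 z) \<partial>lborel) \<le> (\<integral>z. ?L z \<partial>lborel)"
      unfolding Lneg by (intro integral_mono) (use i iL in \<open>simp_all add: Lneg\<close>)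
    ultimately show ?thesis by simp
  qed
  \<comment> \<open>The term with \<open>cut1\<close> drops out because 1 + \<i>^2 = 0, that is,
    because \<rho> is harmonic; what is left is cut''(\<rho>) times the squared gradient.\<close>
  have w2sum: "w2 1 z + w2 \<i> z = (if z \<in> ?O - {?p} then cut2 (\<rho> z) * (norm (lam z))\<^sup>2 else 0)" for z
    unfolding cmod_power2 by (simp add: w2_def distrib_left mult.assoc[symmetric])
  let ?S = "{z. Re z < 0 \<and> 0 < Im z \<and> Im z < 2 * pi}"
  have S: "open ?S" by (intro open_Collect_conj open_Collect_less continuous_intros)
  have eS: "exp ` ?S = ?D - {z. Im z = 0 \<and> 0 \<le> Re z}" using exp_strip_image[of 0] by simp
  have [measurable]: "?G \<in> borel_measurable borel" using iG by (auto dest: borel_measurable_integrable)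
  have Gout: "?G z = 0" if "z \<notin> ?O" for z using that by (simp add: w2sum)
  \<comment> \<open>In the coordinate \<zeta> with z = \<Phi>(exp \<zeta>), \<rho> becomes Re
    \<zeta>. The squared gradient of \<rho> is then exactly the inverse of the Jacobian and
    cancels.\<close>
  have Gstrip: "(\<integral>z. ?G z \<partial>lborel) = (\<integral>\<zeta>. indicator ?S \<zeta> * (u (\<Phi> (exp \<zeta>)) * cut2 (Re \<zeta>)) \<partial>lborel)"
  proof -
    define E where "E w = (if w \<in> ?D then ?G (\<Phi> w) * (norm (deriv \<Phi> w))\<^sup>2 else 0)" for w
    have [measurable]: "E \<in> borel_measurable borel"
    proof -
      note [measurable] = conformal_borel_measurable[OF open_ball Phi(1)]
      have "E = (\<lambda>w. ?G (conformal_extension ?D \<Phi> w) * conformal_density ?D \<Phi> w)"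
        by (auto simp: E_def conformal_extension_def conformal_density_def)
      then show ?thesis by simp
    qed
    have "(\<integral>z. ?G z \<partial>lborel) = (\<integral>z. indicator ?O z * ?G z \<partial>lborel)"
      using Gout by (intro Bochner_Integration.integral_cong) (auto simp: indicator_def)
    also have "\<dots> = (\<integral>w. indicator ?D w * (?G (\<Phi> w) * (norm (deriv \<Phi> w))\<^sup>2) \<partial>lborel)"
      by (rule integral_conformal_image[OF open_ball Phi(1,2)]) measurable
    also have "\<dots> = (\<integral>w. indicator (exp ` ?S) w * E w \<partial>lborel)"
    proof (rule integral_cong_AE)
      show "AE w in lborel. indicator ?D w * (?G (\<Phi> w) * (norm (deriv \<Phi> w))\<^sup>2) = indicator (exp ` ?S) w * E w"
        using AE_lborel_Im_neq[of 0] by eventually_elim (auto simp: eS E_def indicator_def)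
      have "(\<lambda>w. indicator ?D w * (?G (\<Phi> w) * (norm (deriv \<Phi> w))\<^sup>2)) = E" by (auto simp: E_def indicator_def)
      then show "(\<lambda>w. indicator ?D w * (?G (\<Phi> w) * (norm (deriv \<Phi> w))\<^sup>2)) \<in> borel_measurable lborel" by simp
      have "exp ` ?S \<in> sets borel"
      proof -
        have "open (exp ` ?S)"
          by (intro open_mapping_thm3 holomorphic_intros S inj_on_subset[OF inj_on_exp_strip]) auto
        then show ?thesis by simp
      qed
      then show "(\<lambda>w. indicator (exp ` ?S) w * E w) \<in> borel_measurable lborel" by simp
    qed
    also have "\<dots> = (\<integral>\<zeta>. indicator ?S \<zeta> * (E (exp \<zeta>) * (norm (deriv exp \<zeta>))\<^sup>2) \<partial>lborel)"
      by (rule integral_conformal_image[OF S]) (auto intro!: holomorphic_intros inj_on_subset[OF inj_on_exp_strip])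
    also have "\<dots> = (\<integral>\<zeta>. indicator ?S \<zeta> * (u (\<Phi> (exp \<zeta>)) * cut2 (Re \<zeta>)) \<partial>lborel)"
    proof (intro Bochner_Integration.integral_cong refl)
      fix \<zeta> :: complex
      show "indicator ?S \<zeta> * (E (exp \<zeta>) * (norm (deriv exp \<zeta>))\<^sup>2) = indicator ?S \<zeta> * (u (\<Phi> (exp \<zeta>)) * cut2 (Re \<zeta>))"
      proof (cases "\<zeta> \<in> ?S")
        case True
        then have w: "exp \<zeta> \<in> ?D" by simp
        then have "\<Phi> (exp \<zeta>) \<noteq> ?p" using Phi(2) by (metis centre_in_ball exp_not_eq_zero inj_onD zero_less_one)
        then have "E (exp \<zeta>) = u (\<Phi> (exp \<zeta>)) * (cut2 (Re \<zeta>) * (norm (lam (\<Phi> (exp \<zeta>))))\<^sup>2) * (norm (deriv \<Phi> (exp \<zeta>)))\<^sup>2"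
          using w \<rho>Phi[OF w] unfolding E_def w2sum by simp
        moreover have "norm (lam (\<Phi> (exp \<zeta>))) * norm (deriv \<Phi> (exp \<zeta>)) * norm (deriv exp \<zeta>) = 1"
        proof -
          have "deriv exp \<zeta> = exp \<zeta>" by (rule DERIV_imp_deriv[OF DERIV_exp])
          then have "lam (\<Phi> (exp \<zeta>)) * deriv \<Phi> (exp \<zeta>) * deriv exp \<zeta> = 1"
            using g(2)[OF w] g(3)[OF w] by (simp add: lam_def mult.commute)
          then show ?thesis by (metis norm_mult norm_one)
        qed
        then have "(norm (lam (\<Phi> (exp \<zeta>))))\<^sup>2 * (norm (deriv \<Phi> (exp \<zeta>)))\<^sup>2 * (norm (deriv exp \<zeta>))\<^sup>2 = 1"
          by (metis power_mult_distrib power_one)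
        ultimately show ?thesis by (simp add: mult.assoc)
      qed simp
    qed
    finally show ?thesis .
  qed
  define B' where "B' = (\<lambda>y. indicator {0<..<2*pi} y * B y)"
  let ?I = "\<lambda>a x. indicator {..<0} x * ramp2 h (x - a)"
  have ahc: "c + h \<le> 0" "d + h \<le> 0" using dc by auto
  note I = integral_ramp2[OF h ahc(1)] integral_ramp2[OF h ahc(2)]
  have Bi: "integrable lborel B'" "(\<integral>y. B' y \<partial>lborel) = integral {0..2*pi} B"
  proof -
    have s: "set_integrable lborel {0..2*pi} B" by (rule borel_integrable_atLeastAtMost') (rule B(1))
    then have "integrable lborel (\<lambda>y. indicator {0..2*pi} y * B y)" by (simp add: set_integrable_def)
    moreover have ae: "AE y in lborel. indicator {0..2*pi} y * B y = B' y"
      using AE_lborel_singleton[of 0] AE_lborel_singleton[of "2*pi"]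
      by eventually_elim (auto simp: B'_def indicator_def)
    moreover have m: "B' \<in> borel_measurable borel"
    proof -
      have "continuous_on {0<..<2*pi} B" by (rule continuous_on_subset[OF B(1)]) auto
      then show ?thesis
        using borel_measurable_continuous_on_indicator[of "{0<..<2*pi}" B] by (simp add: B'_def)
    qed
    ultimately show "integrable lborel B'" by (auto intro: integrable_cong_AE_imp)
    have "(\<integral>y. B' y \<partial>lborel) = (\<integral>y. indicator {0..2*pi} y * B y \<partial>lborel)"
      using ae m s by (intro integral_cong_AE) (auto simp: set_integrable_def dest: borel_measurable_integrable elim: eventually_mono)
    also have "\<dots> = integral {0..2*pi} B"
      using set_borel_integral_eq_integral(2)[OF s] by (simp add: set_lebesgue_integral_def)
    finally show "(\<integral>y. B' y \<partial>lborel) = integral {0..2*pi} B" .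
  qed
  have bi: "integrable lborel (\<lambda>y. indicator {0<..<2*pi} y * b)" "(\<integral>y. indicator {0<..<2*pi} y * b \<partial>lborel) = 2 * pi * b"
    by auto
  have prod: "integrable lborel (\<lambda>\<zeta>. f (Re \<zeta>) * g (Im \<zeta>))"
    "(\<integral>\<zeta>. f (Re \<zeta>) * g (Im \<zeta>) \<partial>lborel) = (\<integral>x. f x \<partial>lborel) * (\<integral>y. g y \<partial>lborel)"
    if "integrable lborel f" "integrable lborel g" for f g :: "real \<Rightarrow> real"
  proof -
    have [measurable]: "f \<in> borel_measurable borel" "g \<in> borel_measurable borel"
      using that by (auto dest: borel_measurable_integrable)
    have i: "integrable (lborel \<Otimes>\<^sub>M lborel) (\<lambda>p. f (fst p) * g (snd p))"
      by (rule lborel_pair.Fubini_integrable) (use that in \<open>simp_all add: abs_mult\<close>)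
    then show "integrable lborel (\<lambda>\<zeta>. f (Re \<zeta>) * g (Im \<zeta>))"
      by (subst lborel_complex_eq_distr) (simp add: integrable_distr_eq)
    then show "(\<integral>\<zeta>. f (Re \<zeta>) * g (Im \<zeta>) \<partial>lborel) = (\<integral>x. f x \<partial>lborel) * (\<integral>y. g y \<partial>lborel)"
      by (subst integral_complex_Re_Im(2)) simp_all
  qed
  \<comment> \<open>The majorant replaces u by B(y) under the positive bump at c and by b under the
    negative bump at d. Both bumps have unit mass, so its integral is the integral of B minus 2 pi
    b.\<close>
  let ?H = "\<lambda>\<zeta>. ?I c (Re \<zeta>) * B' (Im \<zeta>) - ?I d (Re \<zeta>) * (indicator {0<..<2*pi} (Im \<zeta>) * b)"
  have upper: "(\<integral>\<zeta>. indicator ?S \<zeta> * (u (\<Phi> (exp \<zeta>)) * cut2 (Re \<zeta>)) \<partial>lborel) \<le> integral {0..2*pi} B - 2 * pi * b"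
  proof -
    let ?F = "\<lambda>\<zeta>. indicator ?S \<zeta> * (u (\<Phi> (exp \<zeta>)) * cut2 (Re \<zeta>))"
    have iH: "integrable lborel ?H" using prod(1)[OF I(1) Bi(1)] prod(1)[OF I(3) bi(1)] by (rule Bochner_Integration.integrable_diff)
    have FH: "?F \<zeta> \<le> ?H \<zeta>" for \<zeta>
    proof (cases "\<zeta> \<in> ?S")
      case True
      define x y where "x = Re \<zeta>" and "y = Im \<zeta>"
      have xy: "x < 0" "0 < y" "y < 2 * pi" "\<zeta> = Complex x y" using True by (auto simp: x_def y_def)
      have "ramp2 h (x - c) * u (\<Phi> (exp \<zeta>)) \<le> ramp2 h (x - c) * B y"
      proof (cases "x - c \<le> - h")
        case False
        then have "- \<delta> < x" using hd by (simp add: c_def)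
        then show ?thesis using B(2)[of x y] xy ramp2_nonneg[OF h] by (intro mult_left_mono) auto
      qed (simp add: ramp_left[OF h])
      moreover have "ramp2 h (x - d) * b \<le> ramp2 h (x - d) * u (\<Phi> (exp \<zeta>))"
      proof (cases "h \<le> x - d")
        case False
        then have "x < ln \<delta>" using dc by simp
        then have "norm (exp \<zeta>) < \<delta>" using xy \<delta> by (simp add: ln_ge_iff) (metis exp_less_cancel_iff exp_ln)
        then show ?thesis using b[of "exp \<zeta>"] ramp2_nonneg[OF h] by (intro mult_left_mono) auto
      qed (simp add: ramp_right[OF h])
      ultimately show ?thesis
        using xy by (simp add: cut2_def B'_def algebra_simps)
    next
      case False
      then have "Re \<zeta> \<ge> 0 \<or> Im \<zeta> \<notin> {0<..<2*pi}" by auto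
      then have H0: "?H \<zeta> = 0" by (auto simp: B'_def)
      have "indicator ?S \<zeta> = (0::real)" using False by simp
      then show ?thesis by (simp only: H0 mult_zero_left order_refl)
    qed
    have H: "(\<integral>\<zeta>. ?H \<zeta> \<partial>lborel) = integral {0..2*pi} B - 2 * pi * b"
      by (subst Bochner_Integration.integral_diff[OF prod(1)[OF I(1) Bi(1)] prod(1)[OF I(3) bi(1)]])
         (simp only: prod(2)[OF I(1) Bi(1)] prod(2)[OF I(3) bi(1)] I(2,4) Bi(2) bi(2) mult_1_left)
    have iF: "integrable lborel ?F"
    proof -
      let ?A = "cbox (Complex (d - h) 0) (Complex (c + h) (2 * pi))"
      have A: "z \<in> ?A \<longleftrightarrow> d - h \<le> Re z \<and> Re z \<le> c + h \<and> 0 \<le> Im z \<and> Im z \<le> 2 * pi" for z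
        by (auto simp: in_cbox_complex_iff)
      have ec: "continuous_on {z. Re z < 0} (\<lambda>\<zeta>. u (\<Phi> (exp \<zeta>)))"
      proof -
        have "continuous_on ?D (\<lambda>w. u (\<Phi> w))"
          by (rule continuous_on_compose2[OF cont(1) cPhi]) (use Phi(3) in auto)
        then show ?thesis by (rule continuous_on_compose2) (auto intro!: continuous_intros)
      qed
      have fc: "continuous_on {z. Re z < 0} (\<lambda>\<zeta>. u (\<Phi> (exp \<zeta>)) * cut2 (Re \<zeta>))"
        by (intro continuous_on_mult ec continuous_on_compose2[OF cutc(3)[of UNIV]] continuous_intros) auto
      have Asub: "?A \<subseteq> {z. Re z < 0}" using A dc by force
      have "bounded ((\<lambda>\<zeta>. u (\<Phi> (exp \<zeta>)) * cut2 (Re \<zeta>)) ` ?A)"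
        by (intro compact_imp_bounded compact_continuous_image continuous_on_subset[OF fc Asub] compact_cbox)
      then obtain C where C0: "\<forall>y\<in>(\<lambda>\<zeta>. u (\<Phi> (exp \<zeta>)) * cut2 (Re \<zeta>)) ` ?A. norm y \<le> C"
        unfolding bounded_iff by (rule exE)
      have C: "norm (u (\<Phi> (exp z)) * cut2 (Re z)) \<le> C" if "z \<in> ?A" for z
        using bspec[OF C0 imageI[OF that]] .
      show ?thesis
      proof (rule integrableI_bounded_set[where A = ?A and B = "\<bar>C\<bar>"])
        show "?F \<in> borel_measurable lborel"
        proof -
          have Sb: "?S \<in> sets borel" using S by simp
          have "continuous_on ?S (\<lambda>\<zeta>. u (\<Phi> (exp \<zeta>)) * cut2 (Re \<zeta>))"
            by (rule continuous_on_subset[OF fc]) blast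
          from borel_measurable_continuous_on_indicator[OF Sb this] show ?thesis
            by (simp only: real_scaleR_def measurable_lborel1 measurable_lborel2)
        qed
        show "AE z in lborel. z \<in> ?A \<longrightarrow> norm (?F z) \<le> \<bar>C\<bar>"
        proof (intro AE_I2 impI)
          fix z assume "z \<in> ?A"
          then show "norm (?F z) \<le> \<bar>C\<bar>" using C[of z] by (cases "z \<in> ?S") auto
        qed
        show "AE z in lborel. z \<notin> ?A \<longrightarrow> ?F z = 0"
        proof (intro AE_I2 impI)
          fix z assume "z \<notin> ?A"
          show "?F z = 0"
          proof (cases "z \<in> ?S")
            case True
            then have "Re z \<le> d - h \<or> c + h \<le> Re z" using \<open>z \<notin> ?A\<close> by (auto simp: A)
            then show ?thesis using cutleft(3) cutright(3) by auto
          qed simp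
        qed
      qed (use emeasure_bounded_finite[OF bounded_cbox] in auto)
    qed
    have "(\<integral>\<zeta>. ?F \<zeta> \<partial>lborel) \<le> (\<integral>\<zeta>. ?H \<zeta> \<partial>lborel)"
      by (rule integral_mono[OF iF iH FH])
    then show ?thesis unfolding H .
  qed
  show ?thesis using lower upper unfolding GL[symmetric] Gstrip by linarith
qed

end

section \<open>Mean value bound and isoperimetric inequality for u\<close>

lemma exp_pullback_near_circle:
  assumes "- \<delta> < x" "x < 0"
  shows "norm (exp (Complex x y)) < 1" "dist (exp (Complex x y)) (cis y) < \<delta>"
proof -
  show "norm (exp (Complex x y)) < 1" using assms by simp
  have "exp (Complex x y) - cis y = of_real (exp x - 1) * cis y"
    by (simp add: exp_eq_polar algebra_simps)
  then have "dist (exp (Complex x y)) (cis y) = \<bar>exp x - 1\<bar>"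
    by (simp add: dist_norm norm_mult del: of_real_diff)
  also have "\<dots> = 1 - exp x" using assms by simp
  also have "\<dots> \<le> - x" using exp_ge_add_one_self[of x] by linarith
  finally show "dist (exp (Complex x y)) (cis y) < \<delta>" using assms by simp
qed

context piecewise_C2
begin

text \<open>The limit of the truncated estimate. Since u(\<Phi>) is uniformly continuous on the
  closed disc, B may be its boundary values plus \<eta> and b its central value minus \<eta>, at a
  total cost of 4 pi \<eta>.\<close>

lemma mean_bound:
  assumes Phi: "\<Phi> holomorphic_on ball 0 R" "inj_on \<Phi> (ball 0 R)" "\<Phi> ` ball 0 R \<subseteq> \<Omega>" "1 < R"
    and \<psi>: "\<And>w. w \<in> ball 0 1 \<Longrightarrow> \<psi> (\<Phi> w) = w"
    and N: "0 \<le> N" "(\<integral>\<^sup>+z\<in>\<Phi> ` ball 0 1. ennreal (- ln (norm (\<psi> z))) * ennreal (neg_laplacian z) \<partial>lborel) = ennreal N"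
  shows "2 * pi * u (\<Phi> 0) \<le> integral {0..2*pi} (\<lambda>t. u (\<Phi> (cis t))) + N"
proof (rule field_le_epsilon)
  fix e :: real assume e: "0 < e"
  define \<eta> where "\<eta> = e / (4 * pi)"
  have \<eta>: "0 < \<eta>" using e by (simp add: \<eta>_def)
  have sub: "ball 0 1 \<subseteq> ball (0::complex) R" "cball 0 1 \<subseteq> ball (0::complex) R" using Phi(4) by auto
  have cf: "continuous_on (cball 0 1) (\<lambda>w. u (\<Phi> w))"
    by (rule continuous_on_compose2[OF cont(1) continuous_on_subset[OF holomorphic_on_imp_continuous_on[OF Phi(1)] sub(2)]])
       (use sub Phi(3) in blast)
  then have "uniformly_continuous_on (cball 0 1) (\<lambda>w. u (\<Phi> w))"
    by (rule compact_uniformly_continuous) simp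
  then obtain d where d: "0 < d" "\<And>w w'. w \<in> cball 0 1 \<Longrightarrow> w' \<in> cball 0 1 \<Longrightarrow> dist w' w < d \<Longrightarrow> dist (u (\<Phi> w')) (u (\<Phi> w)) < \<eta>"
    using \<eta> unfolding uniformly_continuous_on_def by metis
  define \<delta> where "\<delta> = min d (1/2)"
  have cB: "continuous_on {0..2*pi} (\<lambda>t. u (\<Phi> (cis t)))"
    by (rule continuous_on_compose2[OF cf]) (auto intro!: continuous_intros simp: cis_conv_exp)
  have "2 * pi * (u (\<Phi> 0) - \<eta>) \<le> integral {0..2*pi} (\<lambda>t. u (\<Phi> (cis t)) + \<eta>) + N"
  proof (rule mean_bound_approx[OF _ _ _ \<psi> N])
    show "\<Phi> holomorphic_on ball 0 1" "inj_on \<Phi> (ball 0 1)" "\<Phi> ` ball 0 1 \<subseteq> \<Omega>"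
      using Phi sub by (auto intro: holomorphic_on_subset inj_on_subset)
    show "0 < \<delta>" "\<delta> < 1" using d by (auto simp: \<delta>_def)
    show "continuous_on {0..2*pi} (\<lambda>t. u (\<Phi> (cis t)) + \<eta>)" by (intro continuous_intros cB)
    show "u (\<Phi> (exp (Complex x y))) \<le> u (\<Phi> (cis y)) + \<eta>" if "- \<delta> < x" "x < 0" for x y
      using d(2)[of "cis y" "exp (Complex x y)"] exp_pullback_near_circle[OF that, of y]
      by (auto simp: \<delta>_def dist_real_def)
    show "u (\<Phi> 0) - \<eta> \<le> u (\<Phi> w)" if "norm w < \<delta>" for w
      using d(2)[of 0 w] that by (auto simp: \<delta>_def dist_real_def)
  qed
  also have "integral {0..2*pi} (\<lambda>t. u (\<Phi> (cis t)) + \<eta>) = integral {0..2*pi} (\<lambda>t. u (\<Phi> (cis t))) + 2 * pi * \<eta>"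
    by (subst Henstock_Kurzweil_Integration.integral_add) (auto intro!: integrable_continuous_real cB)
  finally have "2 * pi * u (\<Phi> 0) \<le> integral {0..2*pi} (\<lambda>t. u (\<Phi> (cis t))) + N + 4 * pi * \<eta>"
    by (simp add: algebra_simps)
  then show "2 * pi * u (\<Phi> 0) \<le> integral {0..2*pi} (\<lambda>t. u (\<Phi> (cis t))) + N + e"
    by (simp add: \<eta>_def)
qed

text \<open>Supplies the potential bound for v = u(\<phi>) + ln |\<phi>'| at every w.
  \<open>mean_bound\<close> for \<phi> composed with the automorphism sending 0 to w handles the
  first summand; the second is harmonic and contributes its exact mean. K is the negative part of
  the Laplacian pulled back with the Jacobian, so its mass is preserved.\<close>

lemma isoperimetric_conformal:
  assumes phi: "\<phi> holomorphic_on ball 0 R" "inj_on \<phi> (ball 0 R)" "\<phi> ` ball 0 R \<subseteq> \<Omega>" "1 < R"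
    and k: "0 < k" "k \<le> 1"
    and mass: "(\<integral>\<^sup>+z\<in>\<phi> ` ball 0 1. ennreal (neg_laplacian z) \<partial>lborel) \<le> ennreal (2 * pi * (1 - k))"
  shows "(\<integral>\<^sup>+z\<in>ball 0 1. ennreal (exp (2 * (u (\<phi> z) + ln (norm (deriv \<phi> z))))) \<partial>lborel)
    \<le> ennreal ((integral {0..2*pi} (\<lambda>t. exp (u (\<phi> (cis t)) + ln (norm (deriv \<phi> (cis t))))))\<^sup>2 / (4 * pi * k))"
proof -
  let ?D = "ball (0::complex) 1"
  have sub: "?D \<subseteq> ball (0::complex) R" "cball 0 1 \<subseteq> ball (0::complex) R" using phi(4) by auto
  have phi1: "\<phi> holomorphic_on ?D" "inj_on \<phi> ?D"
    using phi sub by (auto intro: holomorphic_on_subset inj_on_subset)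
  have cphi: "continuous_on (cball 0 1) \<phi>"
    by (rule continuous_on_subset[OF holomorphic_on_imp_continuous_on[OF phi(1)] sub(2)])
  have hd: "deriv \<phi> holomorphic_on ball 0 R" using phi(1) by (rule holomorphic_deriv) simp
  have cd: "continuous_on (cball 0 1) (deriv \<phi>)"
    by (rule continuous_on_subset[OF holomorphic_on_imp_continuous_on[OF hd] sub(2)])
  have nz: "deriv \<phi> z \<noteq> 0" if "z \<in> ball 0 R" for z
    using holomorphic_injective_imp_regular[OF phi(1) open_ball phi(2) that] .
  \<comment> \<open>\<phi>' has no zeros on a convex set, so it has a holomorphic logarithm, and ln
    |\<phi>'| obeys the mean value property after composition with an automorphism.\<close>
  obtain l where l: "l holomorphic_on ball 0 R" "\<And>z. z \<in> ball 0 R \<Longrightarrow> deriv \<phi> z = exp (l z)"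
    using contractible_imp_holomorphic_log[OF hd _ nz] by (metis convex_ball convex_imp_contractible)
  have lRe: "ln (norm (deriv \<phi> z)) = Re (l z)" if "z \<in> ball 0 R" for z using l(2)[OF that] by simp
  note [measurable] = conformal_borel_measurable[OF open_ball phi1(1)]
  define K where "K z = ennreal (neg_laplacian (conformal_extension ?D \<phi> z)) * ennreal (conformal_density ?D \<phi> z)" for z
  have Km [measurable]: "K \<in> borel_measurable borel" unfolding K_def[abs_def] by measurable
  have KD: "K z = ennreal (neg_laplacian (\<phi> z)) * ennreal ((norm (deriv \<phi> z))\<^sup>2)" if "z \<in> ?D" for z
    using that by (simp add: K_def conformal_extension_def conformal_density_def)
  have oO: "open (\<phi> ` ?D)" using open_mapping_thm3[OF phi1(1) open_ball phi1(2)] .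
  obtain g where g: "g holomorphic_on \<phi> ` ?D" "\<And>z. z \<in> ?D \<Longrightarrow> g (\<phi> z) = z"
    using holomorphic_has_inverse[OF phi1(1) open_ball phi1(2)] by metis
  note [measurable] = conformal_borel_measurable(1)[OF oO g(1)]
  have cK: "compact (\<phi> ` cball 0 1)" "\<phi> ` cball 0 1 \<subseteq> \<Omega>"
    using compact_continuous_image[OF cphi] sub phi(3) by auto
  obtain B where B0: "\<forall>z\<in>\<phi> ` cball 0 1 \<inter> \<Omega>'. \<bar>uxx z\<bar> \<le> B \<and> \<bar>uyy z\<bar> \<le> B"
    using bdd[OF cK] ..
  have B: "\<bar>uxx z\<bar> \<le> B \<and> \<bar>uyy z\<bar> \<le> B" if "z \<in> \<phi> ` cball 0 1" "z \<in> \<Omega>'" for z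
    using bspec[OF B0 IntI[OF that]] .
  have nB: "neg_laplacian z \<le> 2 * \<bar>B\<bar>" if "z \<in> \<phi> ` cball 0 1" for z
    using B[OF that] by (auto simp: neg_laplacian_def indicator_def)
  have "bounded (deriv \<phi> ` cball 0 1)"
    using compact_imp_bounded[OF compact_continuous_image[OF cd compact_cball]] .
  then obtain M where M0: "\<forall>y\<in>deriv \<phi> ` cball 0 1. norm y \<le> M"
    unfolding bounded_iff ..
  have M: "norm (deriv \<phi> z) \<le> M" if "z \<in> cball 0 1" for z
    using bspec[OF M0 imageI[OF that]] .
  define C where "C = 2 * \<bar>B\<bar> * M\<^sup>2"
  have C0: "0 \<le> C" by (simp add: C_def)
  have KC: "K z \<le> ennreal C" if "z \<in> ?D" for z
  proof -
    have z: "z \<in> cball 0 1" using that by auto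
    then have "neg_laplacian (\<phi> z) * (norm (deriv \<phi> z))\<^sup>2 \<le> C"
      unfolding C_def by (intro mult_mono nB power_mono M imageI) auto
    then show ?thesis
      unfolding KD[OF that] by (simp add: ennreal_mult''[symmetric] ennreal_leI)
  qed
  show ?thesis
  proof (rule isoperimetric_of_potential_bound[OF k _ Km])
    have "continuous_on (cball 0 1) (\<lambda>z. u (\<phi> z) + ln (norm (deriv \<phi> z)))"
      using nz sub by (intro continuous_on_add continuous_on_ln continuous_on_norm cd
          continuous_on_compose2[OF cont(1) cphi cK(2)]) auto
    then show "continuous_on (cball 0 1) (\<lambda>z. u (\<phi> z) + ln (norm (deriv \<phi> z)))" .
    have "(\<integral>\<^sup>+z\<in>?D. K z \<partial>lborel) = (\<integral>\<^sup>+z\<in>?D. ennreal (neg_laplacian (\<phi> z)) * ennreal ((norm (deriv \<phi> z))\<^sup>2) \<partial>lborel)"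
      by (intro set_nn_integral_cong refl) (simp add: KD)
    also have "\<dots> = (\<integral>\<^sup>+z\<in>\<phi> ` ?D. ennreal (neg_laplacian z) \<partial>lborel)"
      by (rule nn_integral_conformal_image[OF open_ball phi1, symmetric]) measurable
    finally show "(\<integral>\<^sup>+z\<in>?D. K z \<partial>lborel) \<le> ennreal (2 * pi * (1 - k))" using mass by simp
  next
    fix w :: complex assume w: "norm w < 1"
    then have w': "norm (- w) < 1" by simp
    let ?P = "\<integral>\<^sup>+z\<in>?D. ennreal (- ln (norm (disc_aut (- w) z))) * K z \<partial>lborel"
    \<comment> \<open>Shows that the potential is finite. On the disc K \<le> C, and - ln t \<le> 1
      / t, which is the weight of \<open>carleman_disc_aut\<close> for k = 1/2; with p = 0 that
      lemma gives its integrability.\<close>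
    have "?P \<le> (\<integral>\<^sup>+z\<in>?D. ennreal (exp (2 * Re (poly 0 z)) * norm (disc_aut (- w) z) powr (- 2 * (1 - 1/2))) * ennreal C \<partial>lborel)"
    proof (rule nn_integral_mono_AE)
      show "AE z in lborel. ennreal (- ln (norm (disc_aut (- w) z))) * K z * indicator ?D z
        \<le> ennreal (exp (2 * Re (poly 0 z)) * norm (disc_aut (- w) z) powr (- 2 * (1 - 1/2))) * ennreal C * indicator ?D z"
        using AE_lborel_singleton[of w]
      proof eventually_elim
        fix z assume zw: "z \<noteq> w"
        show "ennreal (- ln (norm (disc_aut (- w) z))) * K z * indicator ?D z
          \<le> ennreal (exp (2 * Re (poly 0 z)) * norm (disc_aut (- w) z) powr (- 2 * (1 - 1/2))) * ennreal C * indicator ?D z"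
        proof (cases "z \<in> ?D")
          case True
          then have b: "0 < norm (disc_aut (- w) z)"
            using zw disc_aut_denominator_nonzero[OF w', of z] by (simp add: disc_aut_def)
          have "- ln (norm (disc_aut (- w) z)) \<le> inverse (norm (disc_aut (- w) z))"
            using ln_le_minus_one[of "inverse (norm (disc_aut (- w) z))"] b by (simp add: ln_inverse)
          also have "\<dots> = norm (disc_aut (- w) z) powr (- 2 * (1 - 1/2))"
            using b by (simp add: powr_minus)
          finally show ?thesis using True KC[OF True] by (simp add: mult_mono ennreal_leI)
        qed simp
      qed
    qed
    also have "\<dots> = (\<integral>\<^sup>+z\<in>?D. ennreal (exp (2 * Re (poly 0 z)) * norm (disc_aut (- w) z) powr (- 2 * (1 - 1/2))) \<partial>lborel) * ennreal C"
    proof -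
      have "(\<lambda>z. ennreal (exp (2 * Re (poly 0 z)) * norm (disc_aut (- w) z) powr (- 2 * (1 - 1/2)))) \<in> borel_measurable borel"
        unfolding disc_aut_def poly_0 by measurable
      then have "(\<lambda>z. ennreal (exp (2 * Re (poly 0 z)) * norm (disc_aut (- w) z) powr (- 2 * (1 - 1/2))) * indicator ?D z) \<in> borel_measurable lborel"
        by (auto intro!: borel_measurable_times_ennreal borel_measurable_indicator)
      from nn_integral_multc[OF this, of "ennreal C"] show ?thesis
        by (simp only: mult.assoc mult.commute[of "ennreal C"])
    qed
    also have "\<dots> < top"
    proof -
      have "(\<integral>\<^sup>+z\<in>?D. ennreal (exp (2 * Re (poly 0 z)) * norm (disc_aut (- w) z) powr (- 2 * (1 - 1/2))) \<partial>lborel) < top"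
        by (rule le_less_trans[OF carleman_disc_aut[OF _ _ w]]) simp_all
      then show ?thesis by (simp add: ennreal_mult_less_top)
    qed
    finally have "?P < top" .
    then obtain N where N: "0 \<le> N" "?P = ennreal N" by (cases ?P rule: ennreal_cases) simp_all
    obtain R' where R': "1 < R'" "disc_aut w holomorphic_on ball 0 R'" "disc_aut w ` ball 0 R' \<subseteq> ball 0 R"
      "inj_on (disc_aut w) (ball 0 R')"
      by (rule disc_aut_nbhd[OF w phi(4)])
    define \<Phi> where "\<Phi> = \<phi> \<circ> disc_aut w"
    have Phi: "\<Phi> holomorphic_on ball 0 R'" "inj_on \<Phi> (ball 0 R')" "\<Phi> ` ball 0 R' \<subseteq> \<Omega>"
      unfolding \<Phi>_def using R' phi
      by (auto intro: holomorphic_on_compose_gen comp_inj_on inj_on_subset)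
    define \<psi> where "\<psi> z = disc_aut (- w) (conformal_extension (\<phi> ` ?D) g z)" for z
    have [measurable]: "\<psi> \<in> borel_measurable borel" unfolding \<psi>_def[abs_def] disc_aut_def by measurable
    have \<psi>phi: "\<psi> (\<phi> z) = disc_aut (- w) z" if "z \<in> ?D" for z
      using that g(2) by (simp add: \<psi>_def conformal_extension_def)
    have PhiD: "\<Phi> ` ?D = \<phi> ` ?D" unfolding \<Phi>_def image_comp[symmetric] disc_aut_image_ball[OF w] ..
    have mb: "2 * pi * u (\<Phi> 0) \<le> integral {0..2*pi} (\<lambda>t. u (\<Phi> (cis t))) + N"
    proof (rule mean_bound[OF Phi R'(1) _ N(1)])
      show "\<psi> (\<Phi> z) = z" if "z \<in> ?D" for z
        using that w norm_disc_aut_less_1[of w z] by (simp add: \<Phi>_def \<psi>phi disc_aut_inverse)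
      have "(\<integral>\<^sup>+z\<in>\<phi> ` ?D. ennreal (- ln (norm (\<psi> z))) * ennreal (neg_laplacian z) \<partial>lborel)
        = (\<integral>\<^sup>+z\<in>?D. ennreal (- ln (norm (\<psi> (\<phi> z)))) * ennreal (neg_laplacian (\<phi> z)) * ennreal ((norm (deriv \<phi> z))\<^sup>2) \<partial>lborel)"
        by (rule nn_integral_conformal_image[OF open_ball phi1]) measurable
      also have "\<dots> = ?P"
        by (intro set_nn_integral_cong refl) (simp add: KD \<psi>phi mult.assoc)
      finally show "(\<integral>\<^sup>+z\<in>\<Phi> ` ?D. ennreal (- ln (norm (\<psi> z))) * ennreal (neg_laplacian z) \<partial>lborel) = ennreal N"
        unfolding PhiD using N(2) by simp
    qed
    have "(l \<circ> disc_aut w) holomorphic_on ball 0 R'"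
      using R' l(1) by (auto intro: holomorphic_on_compose_gen)
    from has_integral_circle_mean_Re[OF this R'(1)]
    have hl: "((\<lambda>t. Re (l (disc_aut w (cis t)))) has_integral 2 * pi * Re (l w)) {0..2*pi}" by simp
    have inR: "disc_aut w (cis t) \<in> ball 0 R" for t using norm_disc_aut_eq_1[OF w, of "cis t"] phi(4) by simp
    have cPu: "continuous_on {0..2*pi} (\<lambda>t. u (\<Phi> (cis t)))"
    proof -
      have "continuous_on (ball 0 R') (\<lambda>z. u (\<Phi> z))"
        by (rule continuous_on_compose2[OF cont(1) holomorphic_on_imp_continuous_on[OF Phi(1)] Phi(3)])
      then show ?thesis
        by (rule continuous_on_compose2) (use R'(1) in \<open>auto intro!: continuous_intros simp: cis_conv_exp\<close>)
    qed
    have "integral {0..2*pi} (\<lambda>t. u (\<phi> (disc_aut w (cis t))) + ln (norm (deriv \<phi> (disc_aut w (cis t)))))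
      = integral {0..2*pi} (\<lambda>t. u (\<Phi> (cis t)) + Re (l (disc_aut w (cis t))))"
      using lRe[OF inR] by (simp add: \<Phi>_def)
    also have "\<dots> = integral {0..2*pi} (\<lambda>t. u (\<Phi> (cis t))) + 2 * pi * Re (l w)"
      using hl cPu by (subst Henstock_Kurzweil_Integration.integral_add) (auto intro: integrable_continuous_real simp: integral_unique has_integral_integrable)
    finally have "integral {0..2*pi} (\<lambda>t. u (\<phi> (disc_aut w (cis t))) + ln (norm (deriv \<phi> (disc_aut w (cis t)))))
      = integral {0..2*pi} (\<lambda>t. u (\<Phi> (cis t))) + 2 * pi * Re (l w)" .
    moreover have "ln (norm (deriv \<phi> w)) = Re (l w)" using w phi(4) by (intro lRe) simp
    ultimately show "\<exists>N\<ge>0. ?P = ennreal N \<and> 2 * pi * (u (\<phi> w) + ln (norm (deriv \<phi> w)))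
      \<le> integral {0..2*pi} (\<lambda>t. u (\<phi> (disc_aut w (cis t))) + ln (norm (deriv \<phi> (disc_aut w (cis t))))) + N"
      using N mb by (intro exI[of _ N]) (simp add: \<Phi>_def distrib_left)
  qed
qed

end

section \<open>Green function and conformal radius of simply connected domains\<close>

lemma second_derivative_nonpos_at_max:
  fixes f f' :: "real \<Rightarrow> real"
  assumes d: "0 < d" and f: "\<And>t. \<bar>t\<bar> < d \<Longrightarrow> (f has_real_derivative f' t) (at t)"
    and f': "(f' has_real_derivative c) (at 0)" and max: "\<And>t. \<bar>t\<bar> < d \<Longrightarrow> f t \<le> f 0"
  shows "c \<le> 0"
proof (rule ccontr)
  assume "\<not> c \<le> 0"
  have f0: "f' 0 = 0"
    using DERIV_local_max[OF f[of 0] d] max d by auto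
  obtain e where e: "0 < e" "\<And>h. 0 < h \<Longrightarrow> h < e \<Longrightarrow> f' 0 < f' (0 + h)"
    using DERIV_pos_inc_right[OF f'] \<open>\<not> c \<le> 0\<close> by auto
  define s where "s = min d e / 2"
  have s: "0 < s" "s < d" "s < e" using d e(1) by (auto simp: s_def min_def)
  obtain z where z: "0 < z" "z < s" "f s - f 0 = (s - 0) * f' z"
    using MVT2[of 0 s f f'] f s by (metis abs_of_nonneg le_less_trans)
  have "0 < f' z" using e(2)[of z] z s f0 by simp
  then have "0 < f s - f 0" unfolding z(3) using s by simp
  then show False using max[of s] s by simp
qed

lemma has_partial_along_line:
  "has_partial v f d (z + of_real t * v) \<longleftrightarrow> ((\<lambda>s. f (z + of_real s * v)) has_real_derivative d) (at t)"
proof -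
  have "z + of_real t * v + of_real s * v = z + of_real (s + t) * v" for s by (simp add: algebra_simps)
  then show ?thesis
    unfolding has_partial_def using DERIV_shift[of "\<lambda>s. f (z + of_real s * v)" d 0 t] by (simp add: algebra_simps)
qed

lemma has_partial_imp_partial: "has_partial v f d z \<Longrightarrow> partial v f z = d"
  unfolding has_partial_def partial_def by (rule DERIV_imp_deriv)

lemma C1_on_has_partial: "C1_on S f \<Longrightarrow> v \<in> {1, \<i>} \<Longrightarrow> z \<in> S \<Longrightarrow> has_partial v f (partial v f z) z"
  unfolding C1_on_def using has_partial_imp_partial by metis

text \<open>The comparison principle, which makes the choice in \<open>green_H\<close> unique on the
  domain. Adding e |w|^2 makes the Laplacian of h - k strictly positive, and this contradicts the
  second derivative test in the directions 1 and \<i> at an interior maximum.\<close>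

lemma harmonic_le_of_frontier_le:
  assumes S: "open S" "bounded S"
    and h: "continuous_on (closure S) h" "harmonic_fun_on S h"
    and k: "continuous_on (closure S) k" "harmonic_fun_on S k"
    and le: "\<And>z. z \<in> frontier S \<Longrightarrow> h z \<le> k z" and z: "z \<in> S"
  shows "h z \<le> k z"
proof (rule ccontr)
  assume "\<not> h z \<le> k z"
  then have pos: "0 < h z - k z" by simp
  obtain B where B: "\<And>w. w \<in> closure S \<Longrightarrow> norm w \<le> B"
    using bounded_closure[OF S(2)] unfolding bounded_iff by blast
  have B0: "0 \<le> B" using B[of z] z closure_subset norm_ge_zero order_trans by blast
  \<comment> \<open>So small that the perturbation stays below h z - k z on the closure; then the
    maximum cannot lie on the frontier.\<close>
  define e where "e = (h z - k z) / (2 * (B\<^sup>2 + 1))"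
  have BB: "0 < B\<^sup>2 + 1" by (simp add: add_nonneg_pos)
  have e: "0 < e" using pos BB by (simp add: e_def)
  have eB: "e * B\<^sup>2 < h z - k z"
  proof -
    have "e * B\<^sup>2 \<le> e * (B\<^sup>2 + 1)" using e by simp
    also have "\<dots> = (h z - k z) / 2" using BB by (simp add: e_def field_simps)
    also have "\<dots> < h z - k z" using pos by simp
    finally show ?thesis .
  qed
  define D where "D w = h w - k w + e * (norm w)\<^sup>2" for w
  have cD: "continuous_on (closure S) D"
    unfolding D_def[abs_def] by (intro continuous_intros h k)
  have "compact (closure S)" using S(2) by (simp add: compact_closure)
  then obtain w where w: "w \<in> closure S" "\<And>y. y \<in> closure S \<Longrightarrow> D y \<le> D w"
    using continuous_attains_sup[OF _ _ cD] z closure_subset by (metis empty_iff subsetD)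
  have "w \<notin> frontier S"
  proof
    assume "w \<in> frontier S"
    then have "D w \<le> e * (norm w)\<^sup>2" using le by (simp add: D_def)
    also have "\<dots> \<le> e * B\<^sup>2" using e B[OF w(1)] by (intro mult_left_mono power_mono) auto
    also have "\<dots> < h z - k z" by (rule eB)
    also have "\<dots> \<le> D z" using e by (simp add: D_def)
    finally show False using w(2)[of z] z closure_subset[of S] by auto
  qed
  then have wS: "w \<in> S" using w(1) S(1) by (simp add: frontier_def interior_open)
  obtain d where d: "0 < d" "ball w d \<subseteq> S" using S(1) wS openE by blast
  have test: "partial v (partial v h) w - partial v (partial v k) w + 2 * e \<le> 0" if v: "v \<in> {1, \<i>}" for v
  proof (rule second_derivative_nonpos_at_max[OF d(1)])
    let ?l = "\<lambda>t::real. w + of_real t * v"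
    have nv: "norm v = 1" using v by auto
    have inS: "?l t \<in> S" if "\<bar>t\<bar> < d" for t
      using d(2) that nv by (auto simp: dist_norm norm_mult intro!: subsetD[OF d(2)])
    have sq: "(norm (?l t))\<^sup>2 = (norm w)\<^sup>2 + 2 * t * Re (w * cnj v) + t\<^sup>2" for t
      using v unfolding cmod_power2 by (auto simp: power2_eq_square algebra_simps)
    have dsq: "((\<lambda>t. (norm (?l t))\<^sup>2) has_real_derivative (2 * Re (w * cnj v) + 2 * t)) (at t)" for t
      unfolding sq by (auto intro!: derivative_eq_intros)
    have C: "C1_on S h" "C1_on S k" "C1_on S (partial v h)" "C1_on S (partial v k)"
      using h(2) k(2) v by (auto simp: harmonic_fun_on_def C2_on_def)
    show "((\<lambda>t. D (?l t)) has_real_derivative partial v h (?l t) - partial v k (?l t) + e * (2 * Re (w * cnj v) + 2 * t)) (at t)"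
      if "\<bar>t\<bar> < d" for t
      unfolding D_def
      using C1_on_has_partial[OF C(1) v inS[OF that]] C1_on_has_partial[OF C(2) v inS[OF that]]
      by (intro DERIV_add DERIV_diff DERIV_cmult dsq) (simp_all only: has_partial_along_line)
    have "((\<lambda>t. e * (2 * Re (w * cnj v) + 2 * t)) has_real_derivative 2 * e) (at 0)"
      by (auto intro!: derivative_eq_intros)
    then show "((\<lambda>t. partial v h (?l t) - partial v k (?l t) + e * (2 * Re (w * cnj v) + 2 * t)) has_real_derivative
        partial v (partial v h) w - partial v (partial v k) w + 2 * e) (at 0)"
      using C1_on_has_partial[OF C(3) v wS] C1_on_has_partial[OF C(4) v wS]
      by (intro DERIV_add DERIV_diff) (simp_all add: has_partial_def)
    show "D (?l t) \<le> D (?l 0)" if "\<bar>t\<bar> < d" for t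
      using w(2)[of "?l t"] inS[OF that] closure_subset[of S] by auto
  qed
  have "laplacian h w = 0" "laplacian k w = 0" using h(2) k(2) wS by (auto simp: harmonic_fun_on_def)
  then show False using test[of 1] test[of \<i>] e by (simp add: laplacian_def)
qed

section \<open>Harmonicity of logarithms and the explicit Green function\<close>

lemma has_partial_ln_norm_holomorphic:
  assumes "open S" "q holomorphic_on S" "z \<in> S" "q z \<noteq> 0"
  shows "has_partial v (\<lambda>z. ln (norm (q z))) (Re (v * (deriv q z / q z))) z"
  using assms by (intro has_partial_ln_norm holomorphic_derivI)

lemma has_partial_partial_ln_norm_holomorphic:
  assumes S: "open S" and q: "q holomorphic_on S" "\<And>z. z \<in> S \<Longrightarrow> q z \<noteq> 0" and z: "z \<in> S"
  shows "has_partial w (partial v (\<lambda>z. ln (norm (q z)))) (Re (w * (v * deriv (\<lambda>z. deriv q z / q z) z))) z"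
proof -
  have "\<forall>\<^sub>F y in nhds z. partial v (\<lambda>z. ln (norm (q z))) y = Re (v * (deriv q y / q y))"
    using eventually_nhds_in_open[OF S z]
    by eventually_elim (rule has_partial_imp_partial, rule has_partial_ln_norm_holomorphic[OF S q(1) _ q(2)])
  moreover have "has_partial w (\<lambda>z. Re (v * (deriv q z / q z))) (Re (w * (v * deriv (\<lambda>z. deriv q z / q z) z))) z"
  proof (rule has_partial_Re_holomorphic, rule DERIV_cmult)
    have "(\<lambda>z. deriv q z / q z) holomorphic_on S"
      using q by (intro holomorphic_intros holomorphic_deriv S) auto
    then show "((\<lambda>z. deriv q z / q z) has_field_derivative deriv (\<lambda>z. deriv q z / q z) z) (at z)"
      using S z holomorphic_derivI by blast
  qed
  ultimately show ?thesis by (rule has_partial_cong_ev[THEN iffD2])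
qed

text \<open>The second derivative in direction v is Re (v^2 (q'/q)'), and 1^2 + \<i>^2 = 0. Only the
  single-valued quotient q'/q occurs, so the argument works on domains of any connectivity.\<close>

lemma harmonic_ln_norm_holomorphic:
  assumes S: "open S" and q: "q holomorphic_on S" "\<And>z. z \<in> S \<Longrightarrow> q z \<noteq> 0"
  shows "harmonic_fun_on S (\<lambda>z. ln (norm (q z)))"
proof -
  have l: "(\<lambda>z. deriv q z / q z) holomorphic_on S"
    using q by (intro holomorphic_intros holomorphic_deriv S) auto
  have cl: "continuous_on S (\<lambda>z. Re (v * (deriv q z / q z)))" for v
    by (intro continuous_intros holomorphic_on_imp_continuous_on l)
  have cl2: "continuous_on S (\<lambda>z. Re (w * (v * deriv (\<lambda>z. deriv q z / q z) z)))" for v w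
    by (intro continuous_intros holomorphic_on_imp_continuous_on holomorphic_deriv l S)
  have "C1_on S (\<lambda>z. ln (norm (q z)))"
    unfolding C1_on_def using cl has_partial_ln_norm_holomorphic[OF S q(1)] q(2) by blast
  moreover have "C1_on S (partial v (\<lambda>z. ln (norm (q z))))" for v
    unfolding C1_on_def using cl2 has_partial_partial_ln_norm_holomorphic[OF S q] by blast
  moreover have "laplacian (\<lambda>z. ln (norm (q z))) z = 0" if "z \<in> S" for z
    unfolding laplacian_def
    using has_partial_imp_partial[OF has_partial_partial_ln_norm_holomorphic[OF S q that, of 1 1]]
      has_partial_imp_partial[OF has_partial_partial_ln_norm_holomorphic[OF S q that, of \<i> \<i>]]
    by (simp add: mult.assoc[symmetric])
  ultimately show ?thesis by (simp add: harmonic_fun_on_def C2_on_def)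
qed

context
  fixes \<Omega> :: "complex set" and \<psi> :: "complex \<Rightarrow> complex" and a :: complex
  assumes Om: "open \<Omega>" "bounded \<Omega>" and a: "a \<in> \<Omega>"
    and psi: "\<psi> holomorphic_on \<Omega>" "inj_on \<psi> \<Omega>" "\<psi> ` \<Omega> = ball 0 1" "\<psi> a = 0"
begin

text \<open>\<psi>(z) / (z - a) with its removable singularity filled in. The logarithm of its
  modulus is the harmonic function H of the Green function with pole a.\<close>

definition green_quotient :: "complex \<Rightarrow> complex" where
  "green_quotient z = (if z = a then deriv \<psi> a else \<psi> z / (z - a))"

lemma green_quotient_holomorphic: "green_quotient holomorphic_on \<Omega>"
proof -
  have "(\<lambda>z. if z = a then deriv \<psi> a else (\<psi> z - \<psi> a) / (z - a)) holomorphic_on \<Omega>"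
    using a Om by (intro pole_lemma psi) (simp add: interior_open)
  then show ?thesis by (simp add: green_quotient_def[abs_def] psi(4) cong: if_cong)
qed

lemma green_quotient_nonzero: "z \<in> \<Omega> \<Longrightarrow> green_quotient z \<noteq> 0"
  using holomorphic_injective_imp_regular[OF psi(1) Om(1) psi(2) a] psi(2,4) a
  by (auto simp: green_quotient_def inj_on_def)

lemma ln_norm_green_quotient:
  "z \<in> \<Omega> \<Longrightarrow> z \<noteq> a \<Longrightarrow> ln (norm (green_quotient z)) = ln (norm (\<psi> z)) - ln (norm (z - a))"
  using green_quotient_nonzero[of z] by (auto simp: green_quotient_def norm_divide ln_div)

text \<open>|\<psi>| tends to 1 at the boundary although \<psi> itself is not extended there: the
  set where |\<psi>| \<le> 1 - e is the image of a compact disc under the inverse map, hence at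
  positive distance from every boundary point.\<close>

lemma norm_riemann_map_continuous:
  "continuous_on (closure \<Omega>) (\<lambda>z. if z \<in> \<Omega> then norm (\<psi> z) else 1)" (is "continuous_on _ ?f")
proof (rule continuous_on_eq_continuous_within[THEN iffD2], rule ballI)
  obtain g where g: "g holomorphic_on ball 0 1" "\<And>z. z \<in> \<Omega> \<Longrightarrow> g (\<psi> z) = z"
    using holomorphic_has_inverse[OF psi(1) Om(1) psi(2)] psi(3) by metis
  fix w assume w: "w \<in> closure \<Omega>"
  show "continuous (at w within closure \<Omega>) ?f"
  proof (cases "w \<in> \<Omega>")
    case True
    have "continuous_on \<Omega> (\<lambda>z. norm (\<psi> z))"
      by (intro continuous_intros holomorphic_on_imp_continuous_on psi)
    then have c: "isCont (\<lambda>z. norm (\<psi> z)) w" using True Om(1) continuous_on_eq_continuous_at by blast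
    have ev: "\<forall>\<^sub>F z in nhds w. ?f z = norm (\<psi> z)"
      using eventually_nhds_in_open[OF Om(1) True] by eventually_elim simp
    have "isCont ?f w" by (rule iffD2[OF isCont_cong[OF ev] c])
    then show ?thesis by (rule continuous_at_imp_continuous_at_within)
  next
    case False
    show ?thesis unfolding continuous_within_eps_delta
    proof (intro allI impI)
      fix e :: real assume e: "0 < e"
      let ?K = "g ` cball 0 (1 - e)"
      have sub: "cball 0 (1 - e) \<subseteq> ball (0::complex) 1" using e by auto
      have "compact ?K"
        by (intro compact_continuous_image continuous_on_subset[OF holomorphic_on_imp_continuous_on[OF g(1)] sub]) simp
      moreover have "?K \<subseteq> \<Omega>" using sub psi(3) g(2) by (force simp: image_iff)
      ultimately have "open (- ?K)" "w \<in> - ?K" using False by (auto simp: compact_imp_closed open_Compl)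
      then obtain d where d: "0 < d" "ball w d \<subseteq> - ?K" using openE by blast
      have "dist (?f z) (?f w) < e" if "dist z w < d" for z
      proof (cases "z \<in> \<Omega>")
        case True
        then have 1: "norm (\<psi> z) < 1" using psi(3) by auto
        have "z \<notin> ?K" using d(2) that by (auto simp: dist_commute)
        then have "\<psi> z \<notin> cball 0 (1 - e)" using g(2)[OF True] by (metis image_eqI)
        then show ?thesis using True False 1 by (simp add: dist_real_def)
      qed (use e False in simp)
      then show "\<exists>d>0. \<forall>x'\<in>closure \<Omega>. dist x' w < d \<longrightarrow> dist (?f x') (?f w) < e" using d(1) by blast
    qed
  qed
qed

text \<open>The explicit candidate satisfies the three conditions in the definition of
  \<open>green_H\<close>, so the chosen function satisfies them as well, and the comparison
  principle in both directions identifies the two on \<Omega>.\<close>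

lemma green_H_eq: "z \<in> \<Omega> \<Longrightarrow> green_H \<Omega> a z = ln (norm (green_quotient z))"
proof -
  define h where "h z = (if z \<in> \<Omega> then ln (norm (green_quotient z)) else - ln (norm (z - a)))" for z
  let ?f = "\<lambda>z. if z \<in> \<Omega> then norm (\<psi> z) else 1"
  have "continuous_on (closure \<Omega>) h"
  proof (rule continuous_on_eq_continuous_within[THEN iffD2], rule ballI)
    fix w assume w: "w \<in> closure \<Omega>"
    show "continuous (at w within closure \<Omega>) h"
    proof (cases "w \<in> \<Omega>")
      case True
      have "continuous_on \<Omega> (\<lambda>z. ln (norm (green_quotient z)))"
        using green_quotient_nonzero
        by (intro continuous_intros holomorphic_on_imp_continuous_on green_quotient_holomorphic) auto
      then have c: "isCont (\<lambda>z. ln (norm (green_quotient z))) w" using True Om(1) continuous_on_eq_continuous_at by blast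
      have ev: "\<forall>\<^sub>F z in nhds w. h z = ln (norm (green_quotient z))"
        using eventually_nhds_in_open[OF Om(1) True] by eventually_elim (simp add: h_def)
      have "isCont h w" by (rule iffD2[OF isCont_cong[OF ev] c])
      then show ?thesis by (rule continuous_at_imp_continuous_at_within)
    next
      case False
      then have wa: "w \<noteq> a" using a by auto
      have "continuous (at w within closure \<Omega>) ?f"
        using norm_riemann_map_continuous w continuous_on_eq_continuous_within by blast
      then have "(?f \<longlongrightarrow> 1) (at w within closure \<Omega>)" using False by (simp add: continuous_within)
      then have "((\<lambda>z. ln (?f z) - ln (norm (z - a))) \<longlongrightarrow> ln 1 - ln (norm (w - a))) (at w within closure \<Omega>)"
        using wa by (intro tendsto_intros) auto
      moreover have "\<forall>\<^sub>F z in at w within closure \<Omega>. ln (?f z) - ln (norm (z - a)) = h z"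
      proof -
        have "\<forall>\<^sub>F z in at w within closure \<Omega>. z \<noteq> a" by (rule tendsto_imp_eventually_ne[OF tendsto_ident_at wa])
        then show ?thesis by eventually_elim (simp add: h_def ln_norm_green_quotient)
      qed
      ultimately have "(h \<longlongrightarrow> ln 1 - ln (norm (w - a))) (at w within closure \<Omega>)"
        by (rule Lim_transform_eventually)
      then show ?thesis using False by (simp add: continuous_within h_def)
    qed
  qed
  moreover have hh: "harmonic_fun_on \<Omega> h"
  proof -
    have 0: "harmonic_fun_on \<Omega> (\<lambda>z. ln (norm (green_quotient z)))"
      by (rule harmonic_ln_norm_holomorphic[OF Om(1) green_quotient_holomorphic green_quotient_nonzero])
    have hp: "has_partial v h d z \<longleftrightarrow> has_partial v (\<lambda>z. ln (norm (green_quotient z))) d z" if "z \<in> \<Omega>" for v d z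
    proof (rule has_partial_cong_ev)
      show "\<forall>\<^sub>F w in nhds z. h w = ln (norm (green_quotient w))"
        using eventually_nhds_in_open[OF Om(1) that] by eventually_elim (simp add: h_def)
    qed
    have "partial v h z = partial v (\<lambda>z. ln (norm (green_quotient z))) z" if "z \<in> \<Omega>" "v \<in> {1, \<i>}" for v z
      using 0 that C1_on_has_partial hp has_partial_imp_partial unfolding harmonic_fun_on_def C2_on_def by metis
    then have hp2: "has_partial w (partial v h) d z \<longleftrightarrow> has_partial w (partial v (\<lambda>z. ln (norm (green_quotient z)))) d z"
      if "z \<in> \<Omega>" "v \<in> {1, \<i>}" for v w d z
      using eventually_nhds_in_open[OF Om(1) that(1)] that(2)
      by (intro has_partial_cong_ev) (auto elim: eventually_mono)
    have p2: "partial w (partial v h) z = partial w (partial v (\<lambda>z. ln (norm (green_quotient z)))) z"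
      if "z \<in> \<Omega>" "v \<in> {1, \<i>}" "w \<in> {1, \<i>}" for v w z
      using 0 that C1_on_has_partial hp2 has_partial_imp_partial unfolding harmonic_fun_on_def C2_on_def by metis
    have "C1_on \<Omega> h" using 0 hp unfolding harmonic_fun_on_def C2_on_def C1_on_def by metis
    moreover have "\<forall>v\<in>{1, \<i>}. C1_on \<Omega> (partial v h)"
    proof
      fix v assume v: "v \<in> {1, \<i>}"
      then have "C1_on \<Omega> (partial v (\<lambda>z. ln (norm (green_quotient z))))"
        using 0 by (auto simp: harmonic_fun_on_def C2_on_def)
      then show "C1_on \<Omega> (partial v h)" unfolding C1_on_def using hp2[OF _ v] by metis
    qed
    moreover have "laplacian h z = 0" if "z \<in> \<Omega>" for z
      using 0 that unfolding laplacian_def harmonic_fun_on_def by (simp add: p2)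
    ultimately show ?thesis by (simp add: harmonic_fun_on_def C2_on_def)
  qed
  moreover have fr: "\<forall>w\<in>frontier \<Omega>. h w = - ln (norm (w - a))"
    using Om(1) by (auto simp: h_def frontier_def interior_open)
  ultimately have h: "continuous_on (closure \<Omega>) h \<and> harmonic_fun_on \<Omega> h \<and> (\<forall>w\<in>frontier \<Omega>. h w = - ln (norm (w - a)))"
    by blast
  have H: "continuous_on (closure \<Omega>) (green_H \<Omega> a) \<and> harmonic_fun_on \<Omega> (green_H \<Omega> a) \<and>
      (\<forall>w\<in>frontier \<Omega>. green_H \<Omega> a w = - ln (norm (w - a)))"
    unfolding green_H_def
    by (rule someI[of "\<lambda>h. continuous_on (closure \<Omega>) h \<and> harmonic_fun_on \<Omega> h \<and>
      (\<forall>w\<in>frontier \<Omega>. h w = - ln (norm (w - a)))" h, OF h])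
  assume z: "z \<in> \<Omega>"
  have "green_H \<Omega> a z \<le> h z" "h z \<le> green_H \<Omega> a z"
    by (rule harmonic_le_of_frontier_le[OF Om _ _ _ _ _ z]; use h H in simp)+
  then show "green_H \<Omega> a z = ln (norm (green_quotient z))" using z by (simp add: h_def)
qed

lemma green_eq: "z \<in> \<Omega> \<Longrightarrow> z \<noteq> a \<Longrightarrow> green \<Omega> z a = - ln (norm (\<psi> z)) / (2 * pi)"
  by (simp add: green_def green_H_eq ln_norm_green_quotient)

text \<open>The limit defining the Robin function removes the logarithmic pole, leaving the value of
  \<open>green_quotient\<close> at a, which is \<psi>'(a).\<close>

lemma conformal_radius_eq: "conformal_radius \<Omega> a = 1 / norm (deriv \<psi> a)"
proof -
  have "continuous_on \<Omega> (\<lambda>z. - ln (norm (green_quotient z)) / (2 * pi))"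
    using green_quotient_nonzero
    by (intro continuous_intros holomorphic_on_imp_continuous_on green_quotient_holomorphic) auto
  then have "((\<lambda>z. - ln (norm (green_quotient z)) / (2 * pi)) \<longlongrightarrow> - ln (norm (green_quotient a)) / (2 * pi)) (at a)"
    using a Om(1) continuous_on_eq_continuous_at isCont_def by blast
  moreover have "\<forall>\<^sub>F z in at a. - ln (norm (green_quotient z)) / (2 * pi) = ln (norm (z - a)) / (2 * pi) + green \<Omega> z a"
    using eventually_at_in_open[OF Om(1) a]
    by eventually_elim (simp add: green_def green_H_eq add_divide_distrib diff_divide_distrib)
  ultimately have "((\<lambda>z. ln (norm (z - a)) / (2 * pi) + green \<Omega> z a) \<longlongrightarrow> - ln (norm (green_quotient a)) / (2 * pi)) (at a)"
    by (rule Lim_transform_eventually)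
  then have "robin \<Omega> a = ln (norm (green_quotient a))"
    unfolding robin_def by (subst tendsto_Lim) auto
  then show ?thesis
    using green_quotient_nonzero[OF a] by (simp add: conformal_radius_def exp_minus green_quotient_def inverse_eq_divide)
qed

end

section \<open>Boundedness of conformal images of rectifiable domains\<close>

lemma abs_floor_diff_le_2:
  fixes x y :: real
  assumes "\<bar>x - y\<bar> \<le> 2"
  shows "\<lfloor>x\<rfloor> - \<lfloor>y\<rfloor> \<in> {-2..2}"
  using assms by (simp add: abs_le_iff) linarith

lemma dist_le_of_finite_cover:
  fixes m :: "'a \<Rightarrow> real" and \<alpha> \<beta> l :: real
  assumes Q: "finite Q" and l: "0 \<le> l" and cov: "{\<alpha>..\<beta>} \<subseteq> (\<Union>q\<in>Q. {m q - l..m q + l})"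
  shows "\<beta> - \<alpha> \<le> real (card Q) * (2 * l)"
proof (cases "\<alpha> \<le> \<beta>")
  case True
  have "ennreal (\<beta> - \<alpha>) = emeasure lborel {\<alpha>..\<beta>}" using True by simp
  also have "\<dots> \<le> emeasure lborel (\<Union>q\<in>Q. {m q - l..m q + l})"
    by (rule emeasure_mono[OF cov]) (use Q in auto)
  also have "\<dots> \<le> (\<Sum>q\<in>Q. emeasure lborel {m q - l..m q + l})"
    by (rule emeasure_subadditive_finite) (use Q in auto)
  also have "\<dots> = (\<Sum>q\<in>Q. ennreal (2 * l))" using l by (intro sum.cong refl) simp
  also have "\<dots> = ennreal (real (card Q) * (2 * l))"
    using l by (simp add: ennreal_mult ennreal_of_nat_eq_real_of_nat)
  finally show ?thesis using l by (subst (asm) ennreal_le_iff) auto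
next
  case False
  then show ?thesis using l by (smt (verit) mult_nonneg_nonneg of_nat_0_le_iff)
qed

lemma ball_infdist_subset:
  fixes S :: "'a::euclidean_space set"
  assumes "frontier S \<subseteq> G" "z \<in> S" "\<delta> \<le> infdist z G" "G \<noteq> {}"
  shows "ball z \<delta> \<subseteq> S"
proof -
  have "ball z \<delta> \<inter> G = {}"
  proof -
    have "dist z y \<ge> \<delta>" if "y \<in> G" for y using infdist_le[OF that, of z] assms(3) by simp
    then show ?thesis by force
  qed
  then have "ball z \<delta> \<inter> frontier S = {}" using assms(1) by blast
  show ?thesis
  proof (cases "0 < \<delta>")
    case True
    show ?thesis
      using connected_Int_frontier[OF connected_ball, of z \<delta> S] \<open>ball z \<delta> \<inter> frontier S = {}\<close> True assms(2)
      by (metis Diff_eq_empty_iff IntI centre_in_ball empty_iff)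
  next
    case False
    then show ?thesis by (simp add: ball_empty)
  qed
qed

text \<open>On the level set \<open>Re f = c\<close> inside the points at distance more than \<open>\<delta>\<close> from the curve
  the maximum of \<open>Im f\<close> is attained on the set of points at distance exactly \<open>\<delta>\<close>, because \<open>f\<close> is open.
  That set is covered by few discs of radius \<open>\<delta>\<close>, so it has a small image under \<open>Re f\<close>.\<close>

lemma conformal_Re_bound:
  assumes \<gamma>: "rectifiable_path \<gamma>"
    and S: "open S" "connected S" "bounded S" "frontier S \<subseteq> path_image \<gamma>" "S \<inter> path_image \<gamma> = {}"
    and f: "f holomorphic_on S" "inj_on f S" and M: "\<And>z. z \<in> S \<Longrightarrow> norm (deriv f z) \<le> M"
    and a: "a \<in> S"
  obtains C where "\<And>z. z \<in> S \<Longrightarrow> \<bar>Re (f z) - Re (f a)\<bar> \<le> C"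
proof -
  let ?G = "path_image \<gamma>"
  have pG: "path \<gamma>" using \<gamma> by (simp add: rectifiable_path_def)
  have G: "compact ?G" "?G \<noteq> {}" "closed ?G" using pG by (auto simp: compact_path_image closed_path_image)
  have M0: "0 \<le> M" using M[OF a] norm_ge_zero order_trans by blast
  obtain L where L: "0 \<le> L" "\<And>\<delta>. 0 < \<delta> \<Longrightarrow> finite (grid_square \<delta> ` ?G)"
    "\<And>\<delta>. 0 < \<delta> \<Longrightarrow> real (card (grid_square \<delta> ` ?G)) \<le> 4 * (L / \<delta> + 1)"
    using card_grid_squares[OF \<gamma>] by blast
  \<comment> \<open>The level points lie in at most 4 * 25 * (2 L / \<delta> + 1) squares, and each
    accounts for an interval of length 2 M \<delta>. In the product the factor \<delta> cancels, so
    the bound does not depend on how close z is to the curve.\<close>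
  have "\<bar>Re (f z) - Re (f a)\<bar> \<le> 200 * M * (2 * L + 1)" if z: "z \<in> S" for z
  proof -
    obtain p where p: "path p" "path_image p \<subseteq> S" "pathstart p = a" "pathfinish p = z"
      using path_connected_component S(1,2) a z by (metis connected_open_path_connected path_connected_def)
    have "compact (path_image p)" using p by (simp add: compact_path_image)
    moreover have "path_image p \<inter> ?G = {}" using p S(5) by blast
    ultimately obtain d where d: "0 < d" "\<And>x y. x \<in> path_image p \<Longrightarrow> y \<in> ?G \<Longrightarrow> d \<le> dist x y"
      using separate_compact_closed[OF _ G(3)] by metis
    \<comment> \<open>Smaller than the distance from the path to the curve, so that the whole path
      lies in the set V of points farther than \<delta> from the curve.\<close>
    define \<delta> where "\<delta> = min (d / 2) 1"
    have \<delta>: "0 < \<delta>" "\<delta> \<le> 1" "\<delta> < d" using d(1) by (auto simp: \<delta>_def)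
    define V where "V = {w \<in> S. \<delta> < infdist w ?G}"
    define Z where "Z = {w \<in> S. infdist w ?G = \<delta>}"
    have pV: "path_image p \<subseteq> V"
    proof
      fix x assume x: "x \<in> path_image p"
      obtain y where y: "y \<in> ?G" "infdist x ?G = dist x y" using infdist_attains_inf[OF G(3,2)] by blast
      then show "x \<in> V" using d(2)[OF x y(1)] \<delta> x p(2) by (auto simp: V_def)
    qed
    have oV: "open V"
    proof -
      have "open {w. \<delta> < infdist w ?G}" by (intro open_Collect_less continuous_intros)
      moreover have "V = S \<inter> {w. \<delta> < infdist w ?G}" by (auto simp: V_def)
      ultimately show ?thesis using S(1) by auto
    qed
    have clV: "w \<in> S \<and> \<delta> \<le> infdist w ?G" if "w \<in> closure V" for w
    proof -
      have "closed {w. \<delta> \<le> infdist w ?G}" by (intro closed_Collect_le continuous_intros)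
      then have "closure V \<subseteq> {w. \<delta> \<le> infdist w ?G}" by (intro closure_minimal) (auto simp: V_def)
      then have 1: "\<delta> \<le> infdist w ?G" using that by blast
      have "w \<in> closure S" using that closure_mono[of V S] by (auto simp: V_def)
      moreover have "w \<notin> frontier S"
      proof
        assume "w \<in> frontier S"
        then have "infdist w ?G = 0" using S(4) by (simp add: subsetD)
        then show False using 1 \<delta> by simp
      qed
      ultimately show ?thesis using 1 S(1) by (simp add: frontier_def interior_open)
    qed
    have cV: "compact (closure V)"
      using S(3) by (simp add: compact_closure V_def bounded_subset[of S])
    have cf: "continuous_on S f" using f(1) by (rule holomorphic_on_imp_continuous_on)
    have level: "\<exists>w\<in>Z. Re (f w) = Re (f x)" if x: "x \<in> path_image p" for x
    proof -
      let ?T = "{w \<in> closure V. Re (f w) = Re (f x)}"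
      have cfV: "continuous_on (closure V) f" using continuous_on_subset[OF cf] clV by blast
      have "closedin (top_of_set (closure V)) ?T"
        by (intro continuous_closedin_preimage_constant continuous_intros cfV)
      then have "compact ?T" using cV closedin_compact by blast
      moreover have "x \<in> ?T" using x pV closure_subset by auto
      moreover have "continuous_on ?T (\<lambda>w. Im (f w))"
        by (intro continuous_intros continuous_on_subset[OF cfV]) auto
      ultimately obtain w where w: "w \<in> ?T" "\<And>y. y \<in> ?T \<Longrightarrow> Im (f y) \<le> Im (f w)"
        using continuous_attains_sup[of ?T "\<lambda>w. Im (f w)"] by blast
      have "w \<notin> V"
      proof
        assume wV: "w \<in> V"
        have VS: "V \<subseteq> S" by (auto simp: V_def)
        have "open (f ` V)"
          using open_mapping_thm3[OF holomorphic_on_subset[OF f(1) VS] oV inj_on_subset[OF f(2) VS]] .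
        then obtain e where e: "0 < e" "ball (f w) e \<subseteq> f ` V" using wV openE by blast
        have "f w + \<i> * of_real (e / 2) \<in> ball (f w) e" using e by (simp add: dist_norm norm_mult)
        then obtain y where y: "y \<in> V" "f y = f w + \<i> * of_real (e / 2)" using e(2) by force
        then have "y \<in> ?T" using w(1) closure_subset by auto
        then show False using w(2)[of y] y(2) e(1) by simp
      qed
      then have "w \<in> Z" using clV[of w] w(1) by (auto simp: V_def Z_def)
      then show ?thesis using w(1) by auto
    qed
    \<comment> \<open>With mesh \<delta> / 2, two points of one square are closer than \<delta>. The
      disc of radius \<delta> around a point of Z stays in S, so |f'| \<le> M applies on the segment
      joining them.\<close>
    let ?g = "grid_square (\<delta> / 2)"
    have \<delta>2: "0 < \<delta> / 2" using \<delta> by simp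
    \<comment> \<open>A point of Z is two mesh widths away from some point of the curve, so its
      index differs by at most 2 in each coordinate: 25 squares for each square that the curve
      visits.\<close>
    have gZ: "?g ` Z \<subseteq> (\<lambda>(q, r). (fst q + fst r, snd q + snd r)) ` (?g ` ?G \<times> ({-2..2} \<times> {-2..2}))"
    proof
      fix q assume "q \<in> ?g ` Z"
      then obtain w where w: "w \<in> Z" "q = ?g w" by blast
      obtain y where y: "y \<in> ?G" "infdist w ?G = dist w y" using infdist_attains_inf[OF G(3,2)] by blast
      then have "norm (w - y) = \<delta>" using w by (simp add: Z_def dist_norm)
      then have "\<bar>Re w - Re y\<bar> \<le> \<delta>" "\<bar>Im w - Im y\<bar> \<le> \<delta>"
        using abs_Re_le_cmod[of "w - y"] abs_Im_le_cmod[of "w - y"] by simp_all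
      moreover have "\<bar>s / (\<delta> / 2) - t / (\<delta> / 2)\<bar> \<le> 2" if "\<bar>s - t\<bar> \<le> \<delta>" for s t
      proof -
        have "s / (\<delta> / 2) - t / (\<delta> / 2) = (s - t) / (\<delta> / 2)" by (rule diff_divide_distrib[symmetric])
        also have "\<bar>\<dots>\<bar> = \<bar>s - t\<bar> / (\<delta> / 2)" unfolding abs_divide[of "s - t"] by (simp only: abs_of_pos[OF \<delta>2])
        also have "\<dots> \<le> \<delta> / (\<delta> / 2)" using that \<delta> by (intro divide_right_mono) auto
        finally show ?thesis using \<delta> by simp
      qed
      ultimately have "\<bar>Re w / (\<delta> / 2) - Re y / (\<delta> / 2)\<bar> \<le> 2" "\<bar>Im w / (\<delta> / 2) - Im y / (\<delta> / 2)\<bar> \<le> 2"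
        by blast+
      from this[THEN abs_floor_diff_le_2]
      have "(fst q - fst (?g y), snd q - snd (?g y)) \<in> {-2..2} \<times> {-2..2}"
        by (simp add: w(2) grid_square_def)
      moreover have "q = (\<lambda>(q, r). (fst q + fst r, snd q + snd r)) (?g y, (fst q - fst (?g y), snd q - snd (?g y)))"
        by (simp add: prod_eq_iff)
      ultimately show "q \<in> (\<lambda>(q, r). (fst q + fst r, snd q + snd r)) ` (?g ` ?G \<times> ({-2..2} \<times> {-2..2}))"
        using y(1) by blast
    qed
    let ?P = "?g ` ?G \<times> ({-2..2::int} \<times> {-2..2::int})"
    have fP: "finite ?P" using L(2)[OF \<delta>2] by simp
    have fQ: "finite (?g ` Z)" using finite_subset[OF gZ] fP by blast
    have "card (?g ` Z) \<le> card ?P"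
      using card_mono[OF finite_imageI[OF fP] gZ] card_image_le[OF fP] order_trans by blast
    also have "card ?P = card (?g ` ?G) * 25" by (simp add: card_cartesian_product)
    finally have "real (card (?g ` Z)) \<le> real (card (?g ` ?G)) * 25"
      by (metis of_nat_le_iff of_nat_mult of_nat_numeral)
    also have "\<dots> \<le> (4 * (L / (\<delta> / 2) + 1)) * 25"
      by (intro mult_right_mono L(3) \<delta>2) simp
    finally have cQ: "real (card (?g ` Z)) \<le> 100 * (2 * L / \<delta> + 1)" by simp
    define m where "m q = Re (f (SOME w. w \<in> Z \<and> ?g w = q))" for q
    have near: "\<bar>Re (f w) - m (?g w)\<bar> \<le> M * \<delta>" if w: "w \<in> Z" for w
    proof -
      define y where "y = (SOME y. y \<in> Z \<and> ?g y = ?g w)"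
      have y: "y \<in> Z" "?g y = ?g w" using someI[of "\<lambda>y. y \<in> Z \<and> ?g y = ?g w" w] w by (auto simp: y_def)
      have fl: "\<lfloor>Re y / (\<delta> / 2)\<rfloor> = \<lfloor>Re w / (\<delta> / 2)\<rfloor>" "\<lfloor>Im y / (\<delta> / 2)\<rfloor> = \<lfloor>Im w / (\<delta> / 2)\<rfloor>"
        using y(2) by (simp_all add: grid_square_def)
      have half: "\<bar>s - t\<bar> < \<delta> / 2" if "\<lfloor>s / (\<delta> / 2)\<rfloor> = \<lfloor>t / (\<delta> / 2)\<rfloor>" for s t
      proof -
        have "\<bar>s / (\<delta> / 2) - t / (\<delta> / 2)\<bar> < 1" using that by linarith
        also have "s / (\<delta> / 2) - t / (\<delta> / 2) = (s - t) / (\<delta> / 2)" by (rule diff_divide_distrib[symmetric])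
        also have "\<bar>\<dots>\<bar> = \<bar>s - t\<bar> / (\<delta> / 2)" unfolding abs_divide[of "s - t"] by (simp only: abs_of_pos[OF \<delta>2])
        finally show ?thesis using \<delta>2 by (simp only: pos_divide_less_eq mult_1_left)
      qed
      have "norm (y - w) \<le> \<bar>Re (y - w)\<bar> + \<bar>Im (y - w)\<bar>" by (rule cmod_le)
      also have "\<dots> < \<delta>" using half[OF fl(1)] half[OF fl(2)] by simp
      finally have yw: "norm (y - w) < \<delta>" .
      have sub: "ball y \<delta> \<subseteq> S" using y(1) by (intro ball_infdist_subset[OF S(4) _ _ G(2)]) (auto simp: Z_def)
      have "norm (f w - f y) \<le> M * norm (w - y)"
      proof (rule field_differentiable_bound[OF convex_ball, of y \<delta>])
        show "(f has_field_derivative deriv f x) (at x within ball y \<delta>)" if "x \<in> ball y \<delta>" for x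
          using that sub f(1) S(1) holomorphic_derivI has_field_derivative_at_within by blast
        show "norm (deriv f x) \<le> M" if "x \<in> ball y \<delta>" for x using that sub M by blast
      qed (use yw \<delta> in \<open>auto simp: dist_norm norm_minus_commute\<close>)
      also have "\<dots> \<le> M * \<delta>" using yw M0 by (intro mult_left_mono) (auto simp: norm_minus_commute)
      finally have "norm (f w - f y) \<le> M * \<delta>" .
      then show ?thesis using abs_Re_le_cmod[of "f w - f y"] by (simp add: m_def y_def)
    qed
    have conn: "connected ((\<lambda>x. Re (f x)) ` path_image p)"
      by (intro connected_continuous_image connected_path_image p continuous_intros continuous_on_subset[OF cf p(2)])
    have ends: "Re (f a) \<in> (\<lambda>x. Re (f x)) ` path_image p" "Re (f z) \<in> (\<lambda>x. Re (f x)) ` path_image p"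
      using p(3,4) pathstart_in_path_image[of p] pathfinish_in_path_image[of p] by auto
    have cov: "(\<lambda>x. Re (f x)) ` path_image p \<subseteq> (\<Union>q\<in>?g ` Z. {m q - M * \<delta>..m q + M * \<delta>})"
    proof
      fix c assume "c \<in> (\<lambda>x. Re (f x)) ` path_image p"
      then obtain w where w: "w \<in> Z" "Re (f w) = c" using level by auto
      then have "c \<in> {m (?g w) - M * \<delta>..m (?g w) + M * \<delta>}" using near[OF w(1)] by (simp add: abs_le_iff)
      then show "c \<in> (\<Union>q\<in>?g ` Z. {m q - M * \<delta>..m q + M * \<delta>})" using w(1) by blast
    qed
    have "{Re (f a)..Re (f z)} \<subseteq> (\<Union>q\<in>?g ` Z. {m q - M * \<delta>..m q + M * \<delta>})"
      "{Re (f z)..Re (f a)} \<subseteq> (\<Union>q\<in>?g ` Z. {m q - M * \<delta>..m q + M * \<delta>})"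
      by (rule subset_trans[OF connected_contains_Icc[OF conn] cov], rule ends, rule ends)+
    from this[THEN dist_le_of_finite_cover[OF fQ, rotated]]
    have "\<bar>Re (f z) - Re (f a)\<bar> \<le> real (card (?g ` Z)) * (2 * (M * \<delta>))"
      using M0 \<delta> by (simp add: abs_le_iff)
    also have "\<dots> \<le> 100 * (2 * L / \<delta> + 1) * (2 * (M * \<delta>))"
      using M0 \<delta> by (intro mult_right_mono cQ) simp
    also have "\<dots> = 200 * M * (2 * L + \<delta>)" using \<delta> by (simp add: field_simps)
    also have "\<dots> \<le> 200 * M * (2 * L + 1)" using M0 \<delta> by (intro mult_left_mono) auto
    finally show ?thesis .
  qed
  then show ?thesis by (rule that)
qed

text \<open>The bound on the real part is applied to f and to - \<i> f, whose real part is Im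
  f.\<close>

lemma conformal_image_bounded:
  assumes \<gamma>: "rectifiable_path \<gamma>"
    and S: "open S" "connected S" "bounded S" "frontier S \<subseteq> path_image \<gamma>" "S \<inter> path_image \<gamma> = {}"
    and f: "f holomorphic_on S" "inj_on f S" and M: "\<And>z. z \<in> S \<Longrightarrow> norm (deriv f z) \<le> M"
    and a: "a \<in> S"
  shows "bounded (f ` S)"
proof -
  obtain C where C: "\<And>z. z \<in> S \<Longrightarrow> \<bar>Re (f z) - Re (f a)\<bar> \<le> C"
    using conformal_Re_bound[OF \<gamma> S f M a] by blast
  let ?h = "\<lambda>z. - \<i> * f z"
  have h: "?h holomorphic_on S" "inj_on ?h S" using f by (auto intro!: holomorphic_intros simp: inj_on_def)
  have "norm (deriv ?h z) \<le> M" if "z \<in> S" for z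
  proof -
    have "(?h has_field_derivative - \<i> * deriv f z) (at z)"
      by (intro DERIV_cmult holomorphic_derivI[OF f(1) S(1) that])
    then have "deriv ?h z = - \<i> * deriv f z" by (rule DERIV_imp_deriv)
    then show ?thesis using M[OF that] by (simp add: norm_mult)
  qed
  then obtain C' where C': "\<And>z. z \<in> S \<Longrightarrow> \<bar>Re (?h z) - Re (?h a)\<bar> \<le> C'"
    using conformal_Re_bound[OF \<gamma> S h _ a] by blast
  have "norm (f z) \<le> norm (f a) + (C + C')" if "z \<in> S" for z
  proof -
    have "norm (f z - f a) \<le> \<bar>Re (f z - f a)\<bar> + \<bar>Im (f z - f a)\<bar>" by (rule cmod_le)
    also have "\<dots> \<le> C + C'" using C[OF that] C'[OF that] by simp
    finally show ?thesis using norm_triangle_ineq2[of "f z" "f a"] by simp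
  qed
  then show ?thesis unfolding bounded_iff by blast
qed

section \<open>Averages of decreasing functions against Gamma densities\<close>

definition gamma_density :: "real \<Rightarrow> real \<Rightarrow> real" where
  "gamma_density p s = indicator {0<..} s * (s powr (p - 1) * exp (- s) / Gamma p)"

lemma gamma_density_nonneg: "0 < p \<Longrightarrow> 0 \<le> gamma_density p s"
  by (simp add: gamma_density_def Gamma_real_pos less_imp_le)

lemma gamma_density_pos: "0 < p \<Longrightarrow> 0 < s \<Longrightarrow> 0 < gamma_density p s"
  by (simp add: gamma_density_def Gamma_real_pos)

lemma gamma_density_measurable [measurable]: "gamma_density p \<in> borel_measurable borel"
  unfolding gamma_density_def[abs_def] by measurable

lemma gamma_density_integral:
  assumes "0 < p"
  shows "integrable lborel (gamma_density p)" "(\<integral>s. gamma_density p s \<partial>lborel) = 1"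
proof -
  have G: "0 < Gamma p" using assms by (rule Gamma_real_pos)
  have "((\<lambda>t. t powr (p - 1) / exp t / Gamma p) has_integral Gamma p / Gamma p) {0..}"
    by (intro has_integral_divide Gamma_integral_real assms)
  then have hi: "((\<lambda>t. t powr (p - 1) / exp t / Gamma p) has_integral 1) {0..}" using G by simp
  have "(\<integral>\<^sup>+s. ennreal (gamma_density p s) \<partial>lborel) = (\<integral>\<^sup>+s. ennreal (s powr (p - 1) / exp s / Gamma p) * indicator {0..} s \<partial>lborel)"
  proof (rule nn_integral_cong_AE)
    show "AE s in lborel. ennreal (gamma_density p s) = ennreal (s powr (p - 1) / exp s / Gamma p) * indicator {0..} s"
      using AE_lborel_singleton[of 0]
      by eventually_elim (auto simp: gamma_density_def indicator_def exp_minus field_simps)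
  qed
  also have "\<dots> = ennreal 1"
    by (rule nn_integral_has_integral_lebesgue'[OF _ hi]) (use G in simp)
  finally have nn: "(\<integral>\<^sup>+s. ennreal (gamma_density p s) \<partial>lborel) = ennreal 1" .
  show "integrable lborel (gamma_density p)"
    by (rule integrableI_nn_integral_finite[OF _ _ nn]) (use assms gamma_density_nonneg in auto)
  show "(\<integral>s. gamma_density p s \<partial>lborel) = 1"
    by (rule integral_eq_nn_integral[THEN trans]) (use assms gamma_density_nonneg nn in auto)
qed

text \<open>As p tends to 0 the Gamma density concentrates at 0, so at p = 0 it is replaced by the
  unit mass there.\<close>

definition gamma_average :: "(real \<Rightarrow> real) \<Rightarrow> real \<Rightarrow> real" where
  "gamma_average B p = (if p = 0 then B 0 else (\<integral>s. gamma_density p s * B s \<partial>lborel))"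

text \<open>Every interval of the half line has positive measure, so it contains points where B
  equals c; monotonicity squeezes B between two of them.\<close>

lemma AE_eq_antimono_imp_eq:
  fixes B :: "real \<Rightarrow> real"
  assumes mono: "\<And>s t. 0 \<le> s \<Longrightarrow> s \<le> t \<Longrightarrow> B t \<le> B s"
    and ae: "AE s in lborel. 0 < s \<longrightarrow> B s = c" and s: "0 < s"
  shows "B s = c"
proof -
  have ex: "\<exists>t. a < t \<and> t < b \<and> B t = c" if ab: "0 \<le> a" "a < b" for a b
  proof (rule ccontr)
    assume no: "\<not> ?thesis"
    have "AE t in lborel. t \<notin> {a<..<b}"
      using ae by eventually_elim (use no ab in force)
    then have "emeasure lborel {a<..<b} = 0" by (subst (asm) AE_iff_measurable[of "{a<..<b}"]) auto
    then show False using ab by simp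
  qed
  obtain t1 where "0 < t1" "t1 < s" "B t1 = c" using ex[of 0 s] s by auto
  moreover obtain t2 where "s < t2" "B t2 = c" using ex[of s "s + 1"] s by auto
  ultimately show ?thesis using mono[of t1 s] mono[of s t2] by auto
qed

context
  fixes B :: "real \<Rightarrow> real"
  assumes B_meas [measurable]: "B \<in> borel_measurable borel"
    and B_mono: "\<And>s t. 0 \<le> s \<Longrightarrow> s \<le> t \<Longrightarrow> B t \<le> B s"
    and B_nonneg: "\<And>s. 0 \<le> s \<Longrightarrow> 0 \<le> B s"
begin

lemma gamma_density_mult_integrable:
  assumes "0 < p"
  shows "integrable lborel (\<lambda>s. gamma_density p s * B s)"
proof (rule Bochner_Integration.integrable_bound)
  show "integrable lborel (\<lambda>s. gamma_density p s * B 0)"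
    using gamma_density_integral[OF assms] by simp
  show "AE s in lborel. norm (gamma_density p s * B s) \<le> norm (gamma_density p s * B 0)"
  proof (rule AE_I2)
    fix s
    show "norm (gamma_density p s * B s) \<le> norm (gamma_density p s * B 0)"
    proof (cases "0 < s")
      case True
      then show ?thesis
        using B_mono[of 0 s] B_nonneg[of s] gamma_density_nonneg[OF assms, of s]
        by (simp add: abs_mult mult_left_mono)
    qed (simp add: gamma_density_def)
  qed
qed simp

text \<open>The two densities cross exactly once, at s0, so (density p1 - density p2) * (B - B s0)
  is nonnegative for decreasing B. Integrating it gives the inequality, because equal masses cancel
  the constant B s0. Equality makes the product vanish almost everywhere, hence B = B s0 off the
  crossing point.\<close>

lemma gamma_average_comparison:
  assumes p: "0 \<le> p1" "p1 < p2"
  shows "gamma_average B p2 \<le> gamma_average B p1"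
    and "gamma_average B p2 = gamma_average B p1 \<Longrightarrow> 0 < s \<Longrightarrow> B s = gamma_average B p1"
proof -
  have p2: "0 < p2" using p by simp
  note i2 = gamma_density_mult_integrable[OF p2] and g2 = gamma_density_integral[OF p2]
  have "gamma_average B p2 \<le> gamma_average B p1 \<and>
    (gamma_average B p2 = gamma_average B p1 \<longrightarrow> (\<forall>s>0. B s = gamma_average B p1))"
  proof (cases "p1 = 0")
    case True
    \<comment> \<open>For p1 = 0 the comparison is with the point mass at 0, where B is
      largest.\<close>
    let ?f = "\<lambda>s. gamma_density p2 s * (B 0 - B s)"
    have f0: "0 \<le> ?f s" for s
    proof (cases "0 < s")
      case True
      then show ?thesis using B_mono[of 0 s] gamma_density_nonneg[OF p2, of s] by (intro mult_nonneg_nonneg) auto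
    qed (simp add: gamma_density_def)
    have fi: "integrable lborel ?f" using i2 g2(1) by (simp add: right_diff_distrib)
    have fI: "(\<integral>s. ?f s \<partial>lborel) = B 0 - gamma_average B p2"
      using i2 g2 p2 by (simp add: right_diff_distrib gamma_average_def)
    have "0 \<le> (\<integral>s. ?f s \<partial>lborel)" by (intro integral_nonneg_AE AE_I2 f0)
    then have 1: "gamma_average B p2 \<le> B 0" unfolding fI by simp
    have "\<forall>s>0. B s = B 0" if "gamma_average B p2 = B 0"
    proof -
      have "AE s in lborel. ?f s = 0"
        using integral_nonneg_eq_0_iff_AE[OF fi] f0 fI that by simp
      then have ae: "AE s in lborel. 0 < s \<longrightarrow> B s = B 0"
        by eventually_elim (use gamma_density_pos[OF p2] in force)
      show ?thesis using AE_eq_antimono_imp_eq[OF B_mono ae] by simp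
    qed
    moreover have "gamma_average B p1 = B 0" using True by (simp add: gamma_average_def)
    ultimately show ?thesis using 1 by (simp only:) blast
  next
    case False
    then have p1: "0 < p1" using p by simp
    note i1 = gamma_density_mult_integrable[OF p1] and g1 = gamma_density_integral[OF p1]
    have G: "0 < Gamma p1" "0 < Gamma p2" using p1 p2 by (auto intro: Gamma_real_pos)
    \<comment> \<open>The ratio of the densities is s^(p2 - p1) times Gamma p1 / Gamma p2, which
      increases in s and equals 1 exactly here.\<close>
    define s0 where "s0 = (Gamma p2 / Gamma p1) powr (1 / (p2 - p1))"
    have s0: "0 < s0" using G by (simp add: s0_def)
    have s0p: "s0 powr (p2 - p1) = Gamma p2 / Gamma p1" using p G by (simp add: s0_def powr_powr)
    have ratio: "gamma_density p2 s = gamma_density p1 s * ((s powr (p2 - p1)) / (s0 powr (p2 - p1)))" if "0 < s" for s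
    proof -
      have "s powr (p2 - 1) = s powr (p1 - 1) * s powr (p2 - p1)" by (simp add: powr_add[symmetric])
      then show ?thesis using that G by (simp add: gamma_density_def s0p)
    qed
    let ?f = "\<lambda>s. (gamma_density p1 s - gamma_density p2 s) * (B s - B s0)"
    have cmp: "gamma_density p2 s < gamma_density p1 s" if "0 < s" "s < s0" for s
    proof -
      have "s powr (p2 - p1) < s0 powr (p2 - p1)" using that p by (intro powr_less_mono2) auto
      then have "(s powr (p2 - p1)) / (s0 powr (p2 - p1)) < 1" using s0 by simp
      from mult_strict_left_mono[OF this gamma_density_pos[OF p1 that(1)]]
      show ?thesis unfolding ratio[OF that(1)] by simp
    qed
    have cmp': "gamma_density p1 s < gamma_density p2 s" if "s0 < s" for s
    proof -
      have s: "0 < s" using s0 that by simp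
      have "s0 powr (p2 - p1) < s powr (p2 - p1)" using that p s0 by (intro powr_less_mono2) auto
      then have "1 < (s powr (p2 - p1)) / (s0 powr (p2 - p1))" using s0 by simp
      from mult_strict_left_mono[OF this gamma_density_pos[OF p1 s]]
      show ?thesis unfolding ratio[OF s] by simp
    qed
    have f0: "0 \<le> ?f s" for s
    proof (cases "0 < s")
      case True
      consider "s < s0" | "s = s0" | "s0 < s" by linarith
      then show ?thesis
      proof cases
        case 1
        then show ?thesis using cmp[OF True 1] B_mono[of s s0] True by simp
      next
        case 3
        then show ?thesis using cmp'[OF 3] B_mono[of s0 s] s0 by (intro mult_nonpos_nonpos) auto
      qed simp
    qed (simp add: gamma_density_def)
    have exp: "?f s = gamma_density p1 s * B s - gamma_density p2 s * B s - B s0 * (gamma_density p1 s - gamma_density p2 s)" for s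
      by (simp add: algebra_simps)
    have fi: "integrable lborel ?f" unfolding exp using i1 i2 g1(1) g2(1) by simp
    have fI: "(\<integral>s. ?f s \<partial>lborel) = gamma_average B p1 - gamma_average B p2"
      unfolding exp using i1 i2 g1 g2 p1 p2 by (simp add: gamma_average_def)
    have "0 \<le> (\<integral>s. ?f s \<partial>lborel)" by (intro integral_nonneg_AE AE_I2 f0)
    then have 1: "gamma_average B p2 \<le> gamma_average B p1" unfolding fI by simp
    have "\<forall>s>0. B s = gamma_average B p1" if eq: "gamma_average B p2 = gamma_average B p1"
    proof -
      have "AE s in lborel. ?f s = 0"
        using integral_nonneg_eq_0_iff_AE[OF fi] f0 fI eq by simp
      then have ae: "AE s in lborel. 0 < s \<longrightarrow> B s = B s0"
      proof eventually_elim
        case (elim s)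
        show ?case
        proof (intro impI, rule ccontr)
          assume s: "0 < s" and "B s \<noteq> B s0"
          then have "gamma_density p1 s = gamma_density p2 s" "s \<noteq> s0" using elim by auto
          then show False using cmp[OF s] cmp'[of s] by (cases "s < s0") auto
        qed
      qed
      have "gamma_average B p1 = (\<integral>s. gamma_density p1 s * B s \<partial>lborel)"
        using p1 by (simp add: gamma_average_def)
      also have "\<dots> = (\<integral>s. gamma_density p1 s * B s0 \<partial>lborel)"
      proof (rule integral_cong_AE)
        show "AE s in lborel. gamma_density p1 s * B s = gamma_density p1 s * B s0"
          using ae by eventually_elim (auto simp: gamma_density_def)
      qed simp_all
      finally have "gamma_average B p1 = B s0" using g1 by simp
      then show ?thesis using AE_eq_antimono_imp_eq[OF B_mono ae] by simp
    qed
    then show ?thesis using 1 by blast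
  qed
  then show "gamma_average B p2 \<le> gamma_average B p1"
    "gamma_average B p2 = gamma_average B p1 \<Longrightarrow> 0 < s \<Longrightarrow> B s = gamma_average B p1" by blast+
qed

end

text \<open>The factor exp (- s) is bounded by 1. At integers p = n the bound is S^n / n!, which
  tends to 0, so the mass leaves every bounded interval.\<close>

lemma gamma_density_mass_le:
  assumes S: "0 < S" and p: "0 < p"
  shows "(\<integral>s. gamma_density p s * indicator {..S} s \<partial>lborel) \<le> S powr p / Gamma (p + 1)"
proof -
  have G: "0 < Gamma p" using p by (rule Gamma_real_pos)
  have hi: "((\<lambda>s. s powr (p - 1)) has_integral (S powr (p - 1 + 1) / (p - 1 + 1))) {0..S}"
    by (rule has_integral_powr_from_0) (use S p in auto)
  have "(\<integral>\<^sup>+s. ennreal (gamma_density p s * indicator {..S} s) \<partial>lborel) \<le>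
     (\<integral>\<^sup>+s. ennreal (s powr (p - 1) * (1 / Gamma p)) * indicator {0..S} s \<partial>lborel)"
  proof (rule nn_integral_mono)
    fix s :: real
    have "s powr (p - 1) * exp (- s) / Gamma p \<le> s powr (p - 1) * (1 / Gamma p)" if "0 < s"
    proof -
      have "s powr (p - 1) * exp (- s) \<le> s powr (p - 1) * 1" using that by (intro mult_left_mono) auto
      then show ?thesis using G by (simp add: divide_right_mono)
    qed
    then show "ennreal (gamma_density p s * indicator {..S} s) \<le> ennreal (s powr (p - 1) * (1 / Gamma p)) * indicator {0..S} s"
      using G by (auto simp: gamma_density_def indicator_def intro!: ennreal_leI)
  qed
  also have "\<dots> = ennreal (S powr (p - 1 + 1) / (p - 1 + 1) * (1 / Gamma p))"
    by (rule nn_integral_has_integral_lebesgue'[OF _ has_integral_mult_left[OF hi]]) (use G in auto)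
  also have "S powr (p - 1 + 1) / (p - 1 + 1) * (1 / Gamma p) = S powr p / Gamma (p + 1)"
    using p by (simp add: Gamma_plus1 nonpos_Ints_def)
  finally have 1: "(\<integral>\<^sup>+s. ennreal (gamma_density p s * indicator {..S} s) \<partial>lborel) \<le> ennreal (S powr p / Gamma (p + 1))" .
  have "integrable lborel (\<lambda>s. gamma_density p s * indicator {..S} s)"
    using gamma_density_integral(1)[OF p] by (intro integrable_real_mult_indicator) auto
  from nn_integral_eq_integral[OF this] 1
  have "ennreal (\<integral>s. gamma_density p s * indicator {..S} s \<partial>lborel) \<le> ennreal (S powr p / Gamma (p + 1))"
    using gamma_density_nonneg[OF p] by simp
  moreover have "0 < Gamma (p + 1)" using p by (intro Gamma_real_pos) simp
  ultimately show ?thesis by (subst (asm) ennreal_le_iff) auto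
qed

text \<open>The averages never fall below L, because B does not. Since they decrease in p, one
  exponent at which the average is below L + e settles all larger ones, and an integer exponent can
  be taken.\<close>

lemma gamma_average_tendsto:
  fixes B :: "real \<Rightarrow> real"
  assumes B_meas [measurable]: "B \<in> borel_measurable borel"
    and B_mono: "\<And>s t. 0 \<le> s \<Longrightarrow> s \<le> t \<Longrightarrow> B t \<le> B s"
    and B_nonneg: "\<And>s. 0 \<le> s \<Longrightarrow> 0 \<le> B s"
    and lim: "(B \<longlongrightarrow> L) at_top"
  shows "(gamma_average B \<longlongrightarrow> L) at_top"
proof (rule tendstoI)
  fix e :: real assume e: "0 < e"
  have L0: "0 \<le> L"
    by (rule tendsto_lowerbound[OF lim]) (auto intro!: eventually_at_top_linorderI[of 0] B_nonneg)
  have LB: "L \<le> B s" if "0 \<le> s" for s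
    by (rule tendsto_upperbound[OF lim]) (auto intro!: eventually_at_top_linorderI[of s] B_mono that)
  have "\<forall>\<^sub>F s in at_top. B s < L + e / 2" using lim e by (intro order_tendstoD) auto
  then obtain S0 where S0: "\<And>s. S0 \<le> s \<Longrightarrow> B s < L + e / 2" by (auto simp: eventually_at_top_linorder)
  define S where "S = max S0 1"
  have S: "0 < S" by (simp add: S_def)
  have BS: "B s \<le> (L + e / 2) + B 0 * indicator {..S} s" if "0 < s" for s
  proof (cases "s \<le> S")
    case True
    then show ?thesis using B_mono[of 0 s] that L0 e by simp
  next
    case False
    then have "S0 \<le> s" by (simp add: S_def)
    from S0[OF this] False show ?thesis by simp
  qed
  \<comment> \<open>The terms of the exponential series, used for the mass of the Gamma density on
    [0, S].\<close>
  have "(\<lambda>n. S ^ n / fact n) \<longlonglongrightarrow> 0"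
    using summable_LIMSEQ_zero[OF summable_exp[of S]] by (simp add: field_simps)
  then have "(\<lambda>n. B 0 * (S ^ n / fact n)) \<longlonglongrightarrow> B 0 * 0" by (intro tendsto_intros)
  then have "\<forall>\<^sub>F n in sequentially. B 0 * (S ^ n / fact n) < e / 2"
    using e by (intro order_tendstoD) auto
  then obtain n0 where n0: "\<And>n. n0 \<le> n \<Longrightarrow> B 0 * (S ^ n / fact n) < e / 2" by (auto simp: eventually_sequentially)
  define n where "n = Suc n0"
  have np: "0 < real n" by (simp add: n_def)
  note g = gamma_density_integral[OF np]
  have gi: "integrable lborel (\<lambda>s. gamma_density n s * indicator {..S} s)"
    using g(1) by (intro integrable_real_mult_indicator) auto
  have "gamma_average B n \<le> (\<integral>s. gamma_density n s * (L + e / 2) + B 0 * (gamma_density n s * indicator {..S} s) \<partial>lborel)"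
    unfolding gamma_average_def using np
  proof (simp, intro integral_mono)
    show "integrable lborel (\<lambda>s. gamma_density n s * B s)"
      by (rule gamma_density_mult_integrable[OF B_meas B_mono B_nonneg np])
    show "integrable lborel (\<lambda>s. gamma_density n s * (L + e / 2) + B 0 * (gamma_density n s * indicator {..S} s))"
      using g(1) gi by simp
    fix s
    show "gamma_density n s * B s \<le> gamma_density n s * (L + e / 2) + B 0 * (gamma_density n s * indicator {..S} s)"
    proof (cases "0 < s")
      case True
      show ?thesis
        using mult_left_mono[OF BS[OF True] gamma_density_nonneg[OF np, of s]] by (simp add: algebra_simps)
    qed (simp add: gamma_density_def)
  qed
  also have "\<dots> = (L + e / 2) + B 0 * (\<integral>s. gamma_density n s * indicator {..S} s \<partial>lborel)"
    using g gi by simp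
  also have "\<dots> \<le> (L + e / 2) + B 0 * (S powr n / Gamma (real n + 1))"
    using gamma_density_mass_le[OF S np] B_nonneg[of 0] by (intro add_left_mono mult_left_mono) auto
  also have "S powr n / Gamma (real n + 1) = S ^ n / fact n"
    using S by (simp add: powr_realpow Gamma_fact add.commute)
  also have "(L + e / 2) + B 0 * (S ^ n / fact n) < L + e" using n0[of n] unfolding n_def by linarith
  finally have up: "gamma_average B n < L + e" .
  have low: "L \<le> gamma_average B p" if "0 < p" for p
  proof -
    have "(\<integral>s. gamma_density p s * L \<partial>lborel) \<le> (\<integral>s. gamma_density p s * B s \<partial>lborel)"
    proof (rule integral_mono)
      show "integrable lborel (\<lambda>s. gamma_density p s * B s)"
        by (rule gamma_density_mult_integrable[OF B_meas B_mono B_nonneg that])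
      show "integrable lborel (\<lambda>s. gamma_density p s * L)" using gamma_density_integral[OF that] by simp
      show "gamma_density p s * L \<le> gamma_density p s * B s" for s
      proof (cases "0 < s")
        case True
        then show ?thesis using LB[of s] gamma_density_nonneg[OF that, of s] by (intro mult_left_mono) auto
      qed (simp add: gamma_density_def)
    qed
    then show ?thesis using gamma_density_integral[OF that] that by (simp add: gamma_average_def)
  qed
  show "\<forall>\<^sub>F p in at_top. dist (gamma_average B p) L < e"
  proof (rule eventually_at_top_dense[THEN iffD2], intro exI allI impI)
    fix p assume p: "real n < p"
    then have "gamma_average B p \<le> gamma_average B n"
      using np by (intro gamma_average_comparison(1)[OF B_meas B_mono B_nonneg]) auto
    then show "dist (gamma_average B p) L < e" using up low[of p] p np by (simp add: dist_real_def)
  qed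
qed

text \<open>T^p / Gamma (p + 1) is the integral of s^(p - 1) / Gamma p over [0, T]. The factor exp s
  undoes the exponential in the Gamma density; it is absorbed later into
  \<open>area_quotient\<close>.\<close>

lemma nn_integral_powr_layer_cake:
  fixes T :: "'a \<Rightarrow> real"
  assumes "sigma_finite_measure M" and [measurable]: "T \<in> borel_measurable M"
    and T: "\<And>z. 0 \<le> T z" and p: "0 < p"
  shows "(\<integral>\<^sup>+z. ennreal (T z powr p / Gamma (p + 1)) \<partial>M) =
    (\<integral>\<^sup>+s. ennreal (gamma_density p s * exp s) * emeasure M {z \<in> space M. s < T z} \<partial>lborel)"
proof -
  interpret M: sigma_finite_measure M by fact
  interpret P: pair_sigma_finite M lborel ..
  have G: "0 < Gamma p" using p by (rule Gamma_real_pos)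
  have inner: "ennreal (T z powr p / Gamma (p + 1)) = (\<integral>\<^sup>+s. ennreal (gamma_density p s * exp s) * indicator {..<T z} s \<partial>lborel)" for z
  proof -
    have hi: "((\<lambda>s. s powr (p - 1)) has_integral (T z powr (p - 1 + 1) / (p - 1 + 1))) {0..T z}"
      by (rule has_integral_powr_from_0) (use T p in auto)
    have "T z powr p / Gamma (p + 1) = T z powr (p - 1 + 1) / (p - 1 + 1) * (1 / Gamma p)"
      using p by (simp add: Gamma_plus1 nonpos_Ints_def)
    also have "ennreal \<dots> = (\<integral>\<^sup>+s. ennreal (s powr (p - 1) * (1 / Gamma p)) * indicator {0..T z} s \<partial>lborel)"
      by (rule nn_integral_has_integral_lebesgue'[OF _ has_integral_mult_left[OF hi], symmetric]) (use G in auto)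
    also have "\<dots> = (\<integral>\<^sup>+s. ennreal (gamma_density p s * exp s) * indicator {..<T z} s \<partial>lborel)"
    proof (rule nn_integral_cong_AE)
      show "AE s in lborel. ennreal (s powr (p - 1) * (1 / Gamma p)) * indicator {0..T z} s =
          ennreal (gamma_density p s * exp s) * indicator {..<T z} s"
        using AE_lborel_singleton[of 0] AE_lborel_singleton[of "T z"]
        by eventually_elim (auto simp: gamma_density_def indicator_def exp_minus field_simps)
    qed
    finally show ?thesis .
  qed
  have "(\<integral>\<^sup>+z. ennreal (T z powr p / Gamma (p + 1)) \<partial>M) =
     (\<integral>\<^sup>+z. \<integral>\<^sup>+s. ennreal (gamma_density p s * exp s) * indicator {x. fst x < T (snd x)} (s, z) \<partial>lborel \<partial>M)"
    unfolding inner by (intro nn_integral_cong) (auto simp: indicator_def)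
  also have "\<dots> = (\<integral>\<^sup>+s. \<integral>\<^sup>+z. ennreal (gamma_density p s * exp s) * indicator {x. fst x < T (snd x)} (s, z) \<partial>M \<partial>lborel)"
    by (rule P.Fubini'[symmetric]) (simp add: indicator_def)
  also have "\<dots> = (\<integral>\<^sup>+s. ennreal (gamma_density p s * exp s) * emeasure M {z \<in> space M. s < T z} \<partial>lborel)"
  proof (rule nn_integral_cong)
    fix s
    have "(\<integral>\<^sup>+z. ennreal (gamma_density p s * exp s) * indicator {x. fst x < T (snd x)} (s, z) \<partial>M)
        = (\<integral>\<^sup>+z. ennreal (gamma_density p s * exp s) * indicator {z \<in> space M. s < T z} z \<partial>M)"
      by (intro nn_integral_cong) (auto simp: indicator_def)
    also have "\<dots> = ennreal (gamma_density p s * exp s) * emeasure M {z \<in> space M. s < T z}"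
      by (rule nn_integral_cmult_indicator) measurable
    finally show "(\<integral>\<^sup>+z. ennreal (gamma_density p s * exp s) * indicator {x. fst x < T (snd x)} (s, z) \<partial>M)
      = ennreal (gamma_density p s * exp s) * emeasure M {z \<in> space M. s < T z}" .
  qed
  finally show ?thesis .
qed

section \<open>Area growth of conformal discs\<close>

text \<open>The difference of the two sides is a multiple of the integral of (g - mean)^2; by
  continuity its vanishing forces g to be constant.\<close>

lemma cauchy_schwarz_const:
  fixes g :: "real \<Rightarrow> real"
  assumes g: "continuous_on {0..2*pi} g"
  shows "(integral {0..2*pi} g)\<^sup>2 \<le> 2 * pi * integral {0..2*pi} (\<lambda>t. (g t)\<^sup>2)"
    and "(integral {0..2*pi} g)\<^sup>2 = 2 * pi * integral {0..2*pi} (\<lambda>t. (g t)\<^sup>2) \<Longrightarrow>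
      t \<in> {0..2*pi} \<Longrightarrow> g t = integral {0..2*pi} g / (2 * pi)"
proof -
  define m where "m = integral {0..2*pi} g / (2 * pi)"
  have i: "g integrable_on {0..2*pi}" "(\<lambda>t. (g t)\<^sup>2) integrable_on {0..2*pi}"
    using g by (auto intro!: integrable_continuous_real continuous_intros)
  have gm: "integral {0..2*pi} g = 2 * pi * m" by (simp add: m_def)
  have "((\<lambda>t. (g t)\<^sup>2 - 2 * m * g t + m\<^sup>2) has_integral
      (integral {0..2*pi} (\<lambda>t. (g t)\<^sup>2) - 2 * m * (2 * pi * m) + m\<^sup>2 * (2 * pi - 0))) {0..2*pi}"
    using has_integral_const_real[of "m\<^sup>2" 0 "2*pi"] i unfolding gm[symmetric]
    by (intro has_integral_add has_integral_diff has_integral_mult_right integrable_integral) (auto simp: mult.commute)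
  moreover have "(\<lambda>t. (g t)\<^sup>2 - 2 * m * g t + m\<^sup>2) = (\<lambda>t. (g t - m)\<^sup>2)"
    by (auto simp: power2_eq_square algebra_simps)
  ultimately have hi: "((\<lambda>t. (g t - m)\<^sup>2) has_integral (integral {0..2*pi} (\<lambda>t. (g t)\<^sup>2) - 2 * pi * m\<^sup>2)) {0..2*pi}"
    by (simp add: power2_eq_square algebra_simps)
  have sq: "(integral {0..2*pi} g)\<^sup>2 = 2 * pi * (2 * pi * m\<^sup>2)" unfolding gm by (simp add: power2_eq_square)
  have "0 \<le> integral {0..2*pi} (\<lambda>t. (g t)\<^sup>2) - 2 * pi * m\<^sup>2"
    using has_integral_nonneg[OF hi] by simp
  then show "(integral {0..2*pi} g)\<^sup>2 \<le> 2 * pi * integral {0..2*pi} (\<lambda>t. (g t)\<^sup>2)"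
    unfolding sq by (intro mult_left_mono) auto
  assume eq: "(integral {0..2*pi} g)\<^sup>2 = 2 * pi * integral {0..2*pi} (\<lambda>t. (g t)\<^sup>2)" and t: "t \<in> {0..2*pi}"
  have "integral {0..2*pi} (\<lambda>t. (g t)\<^sup>2) - 2 * pi * m\<^sup>2 = 0" using eq unfolding sq by simp
  then have hi0: "((\<lambda>t. (g t - m)\<^sup>2) has_integral 0) (cbox 0 (2*pi))" using hi by simp
  have cc: "continuous_on (cbox 0 (2*pi)) (\<lambda>t. (g t - m)\<^sup>2)"
    using g by (auto intro!: continuous_intros)
  have "pi \<in> box 0 (2*pi)" by simp
  then have ne: "box 0 (2*pi) \<noteq> {}" by blast
  have "(g t - m)\<^sup>2 = 0"
    by (rule has_integral_0_cbox_imp_0[OF cc _ hi0 ne]) (use t in auto)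
  then show "g t = integral {0..2*pi} g / (2 * pi)" by (simp add: m_def)
qed

text \<open>\<kappa> is tied to u only through the upper bound \<open>mass\<close>, which is
  inherited by every image of a smaller disc.\<close>

locale riemann_mapped = piecewise_C2 +
  fixes \<phi> \<psi> :: "complex \<Rightarrow> complex" and \<kappa> :: real
  assumes phi: "\<phi> holomorphic_on ball 0 1" "inj_on \<phi> (ball 0 1)" "\<phi> ` ball 0 1 = \<Omega>"
    and psi: "\<And>w. w \<in> ball 0 1 \<Longrightarrow> \<psi> (\<phi> w) = w"
    and kappa: "0 < \<kappa>" "\<kappa> \<le> 1"
    and mass: "(\<integral>\<^sup>+z\<in>\<Omega>. ennreal (neg_laplacian z) \<partial>lborel) \<le> ennreal (2 * pi * (1 - \<kappa>))"
    and area_finite: "(\<integral>\<^sup>+z\<in>\<Omega>. ennreal (exp (2 * u z)) \<partial>lborel) < top"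
begin

text \<open>\<open>logfactor\<close> is the logarithm of the conformal factor pulled back to the disc, and in logarithmic polar
  coordinates \<open>area_rate\<close> is the derivative of \<open>area_to\<close>.\<close>

definition logfactor :: "complex \<Rightarrow> real" where
  "logfactor w = u (\<phi> w) + ln (norm (deriv \<phi> w))"

definition area_rate :: "real \<Rightarrow> real" where
  "area_rate x = integral {0..2*pi} (\<lambda>t. exp (2 * logfactor (exp (Complex x t)))) * exp (2 * x)"

definition area_to :: "real \<Rightarrow> real" where
  "area_to x = enn2real (\<integral>\<^sup>+z\<in>\<phi> ` ball 0 (exp x). ennreal (exp (2 * u z)) \<partial>lborel)"

text \<open>u is continuous on \<Omega> only; the extension by 0 is Borel measurable and can enter
  the change of variables.\<close>

definition u_ext :: "complex \<Rightarrow> real" where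
  "u_ext z = indicator \<Omega> z * u z"

lemma u_ext_measurable [measurable]: "u_ext \<in> borel_measurable borel"
  using borel_measurable_continuous_on_indicator[OF _ cont(1)] open_dom by (simp add: u_ext_def[abs_def])

lemma set_nn_integral_u_ext:
  "A \<subseteq> \<Omega> \<Longrightarrow> (\<integral>\<^sup>+z\<in>A. ennreal (exp (2 * u z)) \<partial>lborel) = (\<integral>\<^sup>+z\<in>A. ennreal (exp (2 * u_ext z)) \<partial>lborel)"
  by (intro set_nn_integral_cong refl) (auto simp: u_ext_def)

lemma deriv_phi_nonzero: "w \<in> ball 0 1 \<Longrightarrow> deriv \<phi> w \<noteq> 0"
  using holomorphic_injective_imp_regular[OF phi(1) open_ball phi(2)] .

lemma logfactor_continuous: "continuous_on (ball 0 1) logfactor"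
proof -
  have 1: "continuous_on (ball 0 1) (\<lambda>w. u (\<phi> w))"
    by (rule continuous_on_compose2[OF cont(1) holomorphic_on_imp_continuous_on[OF phi(1)]]) (use phi(3) in auto)
  have "deriv \<phi> holomorphic_on ball 0 1" by (rule holomorphic_deriv[OF phi(1) open_ball])
  then show ?thesis
    unfolding logfactor_def[abs_def] using deriv_phi_nonzero
    by (intro continuous_on_add 1 continuous_on_ln continuous_on_norm holomorphic_on_imp_continuous_on) auto
qed

lemma sub_ball: "x \<le> 0 \<Longrightarrow> ball 0 (exp x) \<subseteq> ball (0::complex) 1"
  by (intro subset_ball) simp

lemma sub_image: "x \<le> 0 \<Longrightarrow> \<phi> ` ball 0 (exp x) \<subseteq> \<Omega>"
  using sub_ball phi(3) by blast

lemma area_to_nn: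
  assumes "x \<le> 0"
  shows "ennreal (area_to x) = (\<integral>\<^sup>+z\<in>\<phi> ` ball 0 (exp x). ennreal (exp (2 * u z)) \<partial>lborel)"
proof -
  have "(\<integral>\<^sup>+z\<in>\<phi> ` ball 0 (exp x). ennreal (exp (2 * u z)) \<partial>lborel) \<le> (\<integral>\<^sup>+z\<in>\<Omega>. ennreal (exp (2 * u z)) \<partial>lborel)"
    using sub_image[OF assms] by (intro nn_integral_mono) (auto simp: indicator_def)
  also note area_finite
  finally show ?thesis by (simp add: area_to_def)
qed

lemma area_to_nonneg: "0 \<le> area_to x"
  by (simp add: area_to_def)

lemma area_to_ball:
  assumes "x \<le> 0"
  shows "ennreal (area_to x) = (\<integral>\<^sup>+w\<in>ball 0 (exp x). ennreal (exp (2 * logfactor w)) \<partial>lborel)"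
proof -
  have h: "\<phi> holomorphic_on ball 0 (exp x)" "inj_on \<phi> (ball 0 (exp x))"
    using phi sub_ball[OF assms] by (auto intro: holomorphic_on_subset inj_on_subset)
  have "ennreal (area_to x) = (\<integral>\<^sup>+z\<in>\<phi> ` ball 0 (exp x). ennreal (exp (2 * u_ext z)) \<partial>lborel)"
    unfolding area_to_nn[OF assms] by (rule set_nn_integral_u_ext[OF sub_image[OF assms]])
  also have "\<dots> = (\<integral>\<^sup>+w\<in>ball 0 (exp x). ennreal (exp (2 * u_ext (\<phi> w))) * ennreal ((norm (deriv \<phi> w))\<^sup>2) \<partial>lborel)"
    by (rule nn_integral_conformal_image[OF open_ball h]) measurable
  also have "\<dots> = (\<integral>\<^sup>+w\<in>ball 0 (exp x). ennreal (exp (2 * logfactor w)) \<partial>lborel)"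
  proof (intro set_nn_integral_cong refl)
    fix w :: complex assume "w \<in> space lborel \<inter> ball 0 (exp x)"
    then have w: "w \<in> ball 0 1" using sub_ball[OF assms] by auto
    then have "\<phi> w \<in> \<Omega>" using phi(3) by blast
    moreover have "exp (2 * logfactor w) = exp (2 * u (\<phi> w)) * (norm (deriv \<phi> w))\<^sup>2"
      using deriv_phi_nonzero[OF w] by (simp add: logfactor_def distrib_left exp_add exp_double)
    ultimately show "ennreal (exp (2 * u_ext (\<phi> w))) * ennreal ((norm (deriv \<phi> w))\<^sup>2) = ennreal (exp (2 * logfactor w))"
      by (simp add: u_ext_def ennreal_mult)
  qed
  finally show ?thesis .
qed

lemma exp_Complex_in_disc: "x < 0 \<Longrightarrow> exp (Complex x t) \<in> ball 0 1"
  by simp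

lemma continuous_logfactor_strip: "continuous_on ({..<0} \<times> UNIV) (\<lambda>(x, t). exp (2 * logfactor (exp (Complex x t))))"
proof -
  have "continuous_on ({..<0} \<times> UNIV) (\<lambda>p. exp (Complex (fst p) (snd p)))"
    unfolding Complex_eq by (intro continuous_intros)
  then have "continuous_on ({..<0} \<times> UNIV) (\<lambda>p. logfactor (exp (Complex (fst p) (snd p))))"
    by (rule continuous_on_compose2[OF logfactor_continuous]) (auto intro: exp_Complex_in_disc)
  then show ?thesis by (auto simp: case_prod_beta' intro!: continuous_intros)
qed

lemma continuous_logfactor_circle:
  "x < 0 \<Longrightarrow> continuous_on A (\<lambda>t. logfactor (exp (Complex x t)))"
  by (rule continuous_on_compose2[OF logfactor_continuous]) (auto simp: Complex_eq intro!: continuous_intros)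

lemma area_rate_continuous: "continuous_on {..<0} area_rate"
proof -
  have "continuous_on ({..<0} \<times> cbox 0 (2*pi)) (\<lambda>(x, t). exp (2 * logfactor (exp (Complex x t))))"
    by (rule continuous_on_subset[OF continuous_logfactor_strip]) auto
  then have "continuous_on {..<0} (\<lambda>x. integral (cbox 0 (2*pi)) (\<lambda>t. exp (2 * logfactor (exp (Complex x t)))))"
    by (rule integral_continuous_on_param)
  then show ?thesis unfolding area_rate_def[abs_def] by (auto intro!: continuous_intros)
qed

lemma area_rate_nonneg: "x < 0 \<Longrightarrow> 0 \<le> area_rate x"
  unfolding area_rate_def
  by (intro mult_nonneg_nonneg integral_nonneg integrable_continuous_real continuous_intros continuous_logfactor_circle) auto

lemma area_to_polar:
  assumes "b \<le> 0"
  shows "ennreal (area_to b) = (\<integral>\<^sup>+x\<in>{..<b}. ennreal (area_rate x) \<partial>lborel)"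
proof -
  define E where "E w = indicator (ball 0 1) w * exp (2 * logfactor w)" for w
  have c: "continuous_on (ball 0 1) (\<lambda>w. exp (2 * logfactor w))" by (intro continuous_intros logfactor_continuous)
  have "(\<lambda>w. indicator (ball 0 1) w *\<^sub>R exp (2 * logfactor w)) \<in> borel_measurable borel"
    by (rule borel_measurable_continuous_on_indicator[OF _ c]) simp
  then have [measurable]: "E \<in> borel_measurable borel" by (simp add: E_def[abs_def])
  have "ennreal (area_to b) = (\<integral>\<^sup>+w\<in>ball 0 (exp b). ennreal (E w) \<partial>lborel)"
    unfolding area_to_ball[OF assms] using sub_ball[OF assms]
    by (intro set_nn_integral_cong refl) (auto simp: E_def indicator_def)
  also have "\<dots> = (\<integral>\<^sup>+x\<in>{..<b}. (\<integral>\<^sup>+t\<in>{0..2*pi}. ennreal (E (exp (Complex x t))) \<partial>lborel) * ennreal (exp (2 * x)) \<partial>lborel)"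
    by (rule nn_integral_ball_polar) measurable
  also have "\<dots> = (\<integral>\<^sup>+x\<in>{..<b}. ennreal (area_rate x) \<partial>lborel)"
  proof (intro set_nn_integral_cong refl)
    fix x assume "x \<in> space lborel \<inter> {..<b}"
    then have x: "x < 0" using assms by simp
    have "(\<integral>\<^sup>+t\<in>{0..2*pi}. ennreal (E (exp (Complex x t))) \<partial>lborel)
        = (\<integral>\<^sup>+t\<in>{0..2*pi}. ennreal (exp (2 * logfactor (exp (Complex x t)))) \<partial>lborel)"
      using exp_Complex_in_disc[OF x] by (intro set_nn_integral_cong refl) (simp add: E_def)
    also have "\<dots> = ennreal (integral {0..2*pi} (\<lambda>t. exp (2 * logfactor (exp (Complex x t)))))"
      by (rule set_nn_integral_continuous_eq_integral) (auto intro!: continuous_intros continuous_logfactor_circle x)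
    finally show "(\<integral>\<^sup>+t\<in>{0..2*pi}. ennreal (E (exp (Complex x t))) \<partial>lborel) * ennreal (exp (2 * x)) = ennreal (area_rate x)"
      by (simp add: area_rate_def ennreal_mult'')
  qed
  finally show ?thesis .
qed

lemma area_to_diff:
  assumes "a \<le> b" "b < 0"
  shows "area_to b = area_to a + integral {a..b} area_rate"
proof -
  have c: "continuous_on {a..b} area_rate" using assms by (intro continuous_on_subset[OF area_rate_continuous]) auto
  have nn: "0 \<le> area_rate x" if "x \<in> {a..b}" for x using area_rate_nonneg that assms by simp
  have m: "(\<lambda>x. ennreal (area_rate x) * indicator S x) \<in> borel_measurable lborel" if "S \<in> sets borel" "S \<subseteq> {..<0}" for S
  proof -
    have "(\<lambda>x. indicator {..<0} x *\<^sub>R area_rate x) \<in> borel_measurable borel"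
      by (rule borel_measurable_continuous_on_indicator[OF _ area_rate_continuous]) simp
    then have "(\<lambda>x. ennreal (indicator {..<0} x *\<^sub>R area_rate x) * indicator S x) \<in> borel_measurable lborel"
      using that by measurable
    moreover have "(\<lambda>x. ennreal (indicator {..<0} x *\<^sub>R area_rate x) * indicator S x) = (\<lambda>x. ennreal (area_rate x) * indicator S x)"
      using that by (auto simp: indicator_def fun_eq_iff)
    ultimately show ?thesis by (simp only:)
  qed
  have "ennreal (area_to b) = (\<integral>\<^sup>+x\<in>{..<b}. ennreal (area_rate x) \<partial>lborel)" using assms by (intro area_to_polar) simp
  also have "\<dots> = (\<integral>\<^sup>+x. ennreal (area_rate x) * indicator {..<a} x + ennreal (area_rate x) * indicator {a..b} x \<partial>lborel)"
  proof (rule nn_integral_cong_AE)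
    show "AE x in lborel. ennreal (area_rate x) * indicator {..<b} x = ennreal (area_rate x) * indicator {..<a} x + ennreal (area_rate x) * indicator {a..b} x"
      using AE_lborel_singleton[of b] by eventually_elim (use assms in \<open>auto simp: indicator_def\<close>)
  qed
  also have "\<dots> = (\<integral>\<^sup>+x\<in>{..<a}. ennreal (area_rate x) \<partial>lborel) + (\<integral>\<^sup>+x\<in>{a..b}. ennreal (area_rate x) \<partial>lborel)"
    using assms by (intro nn_integral_add m) auto
  also have "\<dots> = ennreal (area_to a) + ennreal (integral {a..b} area_rate)"
    using assms set_nn_integral_continuous_eq_integral[OF c nn] area_to_polar[of a] by simp
  also have "\<dots> = ennreal (area_to a + integral {a..b} area_rate)"
    using area_to_nonneg integral_nonneg[OF integrable_continuous_real[OF c] nn] by (simp add: ennreal_plus)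
  finally show ?thesis
    using area_to_nonneg integral_nonneg[OF integrable_continuous_real[OF c] nn]
    by (subst (asm) ennreal_inj) (simp_all del: ennreal_plus)
qed

lemma area_to_has_derivative:
  assumes "x < 0"
  shows "(area_to has_real_derivative area_rate x) (at x)"
proof -
  define a b where "a = x - 1" and "b = x / 2"
  have ab: "a < x" "x < b" "b < 0" using assms by (auto simp: a_def b_def)
  have c: "continuous_on {a..b} area_rate" using ab by (intro continuous_on_subset[OF area_rate_continuous]) auto
  have "((\<lambda>y. integral {a..y} area_rate) has_real_derivative area_rate x) (at x within {a..b})"
    by (rule integral_has_real_derivative[OF c]) (use ab in auto)
  then have d: "((\<lambda>y. area_to a + integral {a..y} area_rate) has_real_derivative area_rate x) (at x within {a..b})"
    by (auto intro!: derivative_eq_intros)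
  have eq: "area_to a + integral {a..y} area_rate = area_to y" if "y \<in> {a..b}" for y
    using area_to_diff[of a y] that ab by simp
  have "x \<in> {a..b}" using ab by simp
  from has_field_derivative_transform_within[OF d zero_less_one this eq]
  have "(area_to has_real_derivative area_rate x) (at x within {a..b})" .
  moreover have "at x within {a..b} = at x" using ab by (intro at_within_interior) simp
  ultimately show ?thesis by (simp only:)
qed

text \<open>Rescaling w to r w with r = exp x gives a map that is conformal on the disc of radius 1
  / r > 1, as \<open>isoperimetric_conformal\<close> demands. The factor r of its derivative is the
  summand x in the exponent.\<close>

lemma area_to_le:
  assumes x: "x < 0"
  shows "area_to x \<le> (integral {0..2*pi} (\<lambda>t. exp (logfactor (exp (Complex x t)) + x)))\<^sup>2 / (4 * pi * \<kappa>)"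
proof -
  define r where "r = exp x"
  have r: "0 < r" "r < 1" using x by (auto simp: r_def)
  define \<Phi> where "\<Phi> w = \<phi> (of_real r * w)" for w
  let ?R = "1 / r"
  have R: "1 < ?R" using r by simp
  have inD: "of_real r * w \<in> ball 0 1" if "w \<in> ball 0 ?R" for w :: complex
    using that r by (simp add: norm_mult field_simps)
  have h: "\<Phi> holomorphic_on ball 0 ?R"
  proof -
    have "(\<phi> \<circ> (\<lambda>w. of_real r * w)) holomorphic_on ball 0 ?R"
      by (rule holomorphic_on_compose_gen[OF _ phi(1)]) (use inD in \<open>auto intro!: holomorphic_intros\<close>)
    then show ?thesis by (simp add: \<Phi>_def[abs_def] o_def)
  qed
  have inj: "inj_on \<Phi> (ball 0 ?R)"
  proof (rule inj_onI)
    fix w w' assume "w \<in> ball 0 ?R" "w' \<in> ball 0 ?R" "\<Phi> w = \<Phi> w'"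
    then have "of_real r * w = of_real r * w'" using inD phi(2) unfolding \<Phi>_def inj_on_def by blast
    then show "w = w'" using r by simp
  qed
  have im: "\<Phi> ` ball 0 ?R \<subseteq> \<Omega>" using inD phi(3) by (auto simp: \<Phi>_def)
  have rb: "(\<lambda>w. of_real r * w) ` ball 0 1 = ball (0::complex) r"
  proof (intro equalityI subsetI)
    fix w :: complex assume "w \<in> ball 0 r"
    then have "w = of_real r * (w / of_real r)" "w / of_real r \<in> ball 0 1" using r by (auto simp: norm_divide)
    then show "w \<in> (\<lambda>w. of_real r * w) ` ball 0 1" by blast
  qed (use r in \<open>auto simp: norm_mult\<close>)
  have im1: "\<Phi> ` ball 0 1 = \<phi> ` ball 0 (exp x)"
    unfolding r_def[symmetric] rb[symmetric] image_image \<Phi>_def ..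
  have dP: "deriv \<Phi> w = of_real r * deriv \<phi> (of_real r * w)" if "w \<in> ball 0 ?R" for w
  proof -
    have "(\<phi> has_field_derivative deriv \<phi> (of_real r * w)) (at (of_real r * w))"
      using holomorphic_derivI[OF phi(1) open_ball inD[OF that]] .
    then have "(\<Phi> has_field_derivative deriv \<phi> (of_real r * w) * of_real r) (at w)"
      unfolding \<Phi>_def[abs_def] by (intro DERIV_chain2[where f = \<phi>]) (auto intro!: derivative_eq_intros)
    then show ?thesis by (simp add: DERIV_imp_deriv mult.commute)
  qed
  have lf: "u (\<Phi> w) + ln (norm (deriv \<Phi> w)) = logfactor (of_real r * w) + x" if "w \<in> ball 0 ?R" for w
    using dP[OF that] r deriv_phi_nonzero[OF inD[OF that]]
    by (simp add: logfactor_def \<Phi>_def norm_mult ln_mult) (simp add: r_def)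
  have sub1: "ball 0 1 \<subseteq> ball (0::complex) ?R" using R by (intro subset_ball) simp
  have h1: "\<Phi> holomorphic_on ball 0 1" "inj_on \<Phi> (ball 0 1)" using h inj sub1 by (auto intro: holomorphic_on_subset inj_on_subset)
  have m1: "(\<integral>\<^sup>+z\<in>\<Phi> ` ball 0 1. ennreal (neg_laplacian z) \<partial>lborel) \<le> ennreal (2 * pi * (1 - \<kappa>))"
  proof -
    have "(\<integral>\<^sup>+z\<in>\<Phi> ` ball 0 1. ennreal (neg_laplacian z) \<partial>lborel) \<le> (\<integral>\<^sup>+z\<in>\<Omega>. ennreal (neg_laplacian z) \<partial>lborel)"
      using im sub1 by (intro nn_integral_mono) (auto simp: indicator_def)
    also note mass
    finally show ?thesis .
  qed
  have "ennreal (area_to x) = (\<integral>\<^sup>+z\<in>\<Phi> ` ball 0 1. ennreal (exp (2 * u_ext z)) \<partial>lborel)"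
    unfolding im1 using x area_to_nn[of x] set_nn_integral_u_ext[OF sub_image, of x] by simp
  also have "\<dots> = (\<integral>\<^sup>+w\<in>ball 0 1. ennreal (exp (2 * u_ext (\<Phi> w))) * ennreal ((norm (deriv \<Phi> w))\<^sup>2) \<partial>lborel)"
    by (rule nn_integral_conformal_image[OF open_ball h1]) measurable
  also have "\<dots> = (\<integral>\<^sup>+w\<in>ball 0 1. ennreal (exp (2 * (u (\<Phi> w) + ln (norm (deriv \<Phi> w))))) \<partial>lborel)"
  proof (intro set_nn_integral_cong refl)
    fix w :: complex assume "w \<in> space lborel \<inter> ball 0 1"
    then have w: "w \<in> ball 0 ?R" using sub1 by auto
    then have "\<Phi> w \<in> \<Omega>" using im by blast
    moreover have "deriv \<Phi> w \<noteq> 0" using dP[OF w] deriv_phi_nonzero[OF inD[OF w]] r by simp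
    ultimately show "ennreal (exp (2 * u_ext (\<Phi> w))) * ennreal ((norm (deriv \<Phi> w))\<^sup>2) = ennreal (exp (2 * (u (\<Phi> w) + ln (norm (deriv \<Phi> w)))))"
      by (simp add: u_ext_def ennreal_mult[symmetric] distrib_left exp_add exp_double)
  qed
  also have "\<dots> \<le> ennreal ((integral {0..2*pi} (\<lambda>t. exp (u (\<Phi> (cis t)) + ln (norm (deriv \<Phi> (cis t))))))\<^sup>2 / (4 * pi * \<kappa>))"
    by (rule isoperimetric_conformal[OF h inj im R kappa m1])
  also have "integral {0..2*pi} (\<lambda>t. exp (u (\<Phi> (cis t)) + ln (norm (deriv \<Phi> (cis t)))))
      = integral {0..2*pi} (\<lambda>t. exp (logfactor (exp (Complex x t)) + x))"
  proof -
    have "u (\<Phi> (cis t)) + ln (norm (deriv \<Phi> (cis t))) = logfactor (exp (Complex x t)) + x" for t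
      using lf[of "cis t"] R by (simp add: exp_eq_polar r_def)
    then show ?thesis by simp
  qed
  finally show ?thesis using kappa by (subst (asm) ennreal_le_iff) auto
qed

lemma area_rate_eq_square:
  "area_rate x = integral {0..2*pi} (\<lambda>t. (exp (logfactor (exp (Complex x t)) + x))\<^sup>2)"
proof -
  have "(exp (logfactor (exp (Complex x t)) + x))\<^sup>2 = exp (2 * logfactor (exp (Complex x t))) * exp (2 * x)" for t
    by (simp add: exp_double[symmetric] exp_add[symmetric] distrib_left)
  then show ?thesis by (simp add: area_rate_def)
qed

lemma area_to_le_rate:
  assumes x: "x < 0"
  shows "2 * \<kappa> * area_to x \<le> area_rate x"
proof -
  have "continuous_on {0..2*pi} (\<lambda>t. exp (logfactor (exp (Complex x t)) + x))"
    by (intro continuous_intros continuous_logfactor_circle x)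
  from cauchy_schwarz_const(1)[OF this]
  have "area_to x \<le> 2 * pi * area_rate x / (4 * pi * \<kappa>)"
    using kappa by (intro order_trans[OF area_to_le[OF x]] divide_right_mono) (auto simp: area_rate_eq_square)
  then show ?thesis using kappa by (simp add: field_simps)
qed

lemma area_quotient_mono:
  assumes "x \<le> y" "y < 0"
  shows "exp (- 2 * \<kappa> * x) * area_to x \<le> exp (- 2 * \<kappa> * y) * area_to y"
proof (rule DERIV_nonneg_imp_nondecreasing[OF assms(1)])
  fix z assume "x \<le> z" "z \<le> y"
  then have z: "z < 0" using assms by simp
  have "((\<lambda>x. exp (- 2 * \<kappa> * x) * area_to x) has_real_derivative
      exp (- 2 * \<kappa> * z) * (- 2 * \<kappa>) * area_to z + area_rate z * exp (- 2 * \<kappa> * z)) (at z)"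
    by (auto intro!: derivative_eq_intros area_to_has_derivative[OF z])
  moreover have "0 \<le> exp (- 2 * \<kappa> * z) * (- 2 * \<kappa>) * area_to z + area_rate z * exp (- 2 * \<kappa> * z)"
    using area_to_le_rate[OF z] by (simp add: algebra_simps)
  ultimately show "\<exists>d. ((\<lambda>x. exp (- 2 * \<kappa> * x) * area_to x) has_real_derivative d) (at z) \<and> 0 \<le> d" by blast
qed

text \<open>The growth estimate is available for r < 1 only. The endpoint y = 0, which represents
  the total area, follows by letting z tend to 0 from the left and using area_to z \<le> area_to
  0.\<close>

lemma area_quotient_mono_0:
  assumes "x \<le> y" "y \<le> 0"
  shows "exp (- 2 * \<kappa> * x) * area_to x \<le> exp (- 2 * \<kappa> * y) * area_to y"
proof (cases "y < 0")
  case True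
  then show ?thesis using area_quotient_mono assms by simp
next
  case False
  then have y: "y = 0" using assms by simp
  show ?thesis
  proof (cases "x < 0")
    case True
    have mono0: "area_to z \<le> area_to 0" if "z < 0" for z
    proof -
      have "ennreal (area_to z) \<le> ennreal (area_to 0)"
        unfolding area_to_polar[OF less_imp_le[OF that]] area_to_polar[OF order_refl]
        using that by (intro nn_integral_mono) (auto simp: indicator_def)
      then show ?thesis using area_to_nonneg by (subst (asm) ennreal_le_iff) auto
    qed
    have "((\<lambda>z. exp (- 2 * \<kappa> * z) * area_to 0) \<longlongrightarrow> exp (- 2 * \<kappa> * 0) * area_to 0) (at_left 0)"
      by (intro tendsto_intros)
    moreover have "\<forall>\<^sub>F z in at_left 0. exp (- 2 * \<kappa> * x) * area_to x \<le> exp (- 2 * \<kappa> * z) * area_to 0"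
    proof (rule eventually_at_leftI[OF _ True])
      fix z assume "z \<in> {x<..<0}"
      then have z: "x \<le> z" "z < 0" by auto
      have "exp (- 2 * \<kappa> * x) * area_to x \<le> exp (- 2 * \<kappa> * z) * area_to z" by (rule area_quotient_mono[OF z])
      also have "\<dots> \<le> exp (- 2 * \<kappa> * z) * area_to 0" by (intro mult_left_mono mono0 z) simp
      finally show "exp (- 2 * \<kappa> * x) * area_to x \<le> exp (- 2 * \<kappa> * z) * area_to 0" .
    qed
    ultimately have "exp (- 2 * \<kappa> * x) * area_to x \<le> exp (- 2 * \<kappa> * 0) * area_to 0"
      by (rule tendsto_lowerbound) simp
    then show ?thesis unfolding y .
  qed (use assms y in simp)
qed

text \<open>Near the centre the conformal factor is almost constant, so the area of a disc of radius
  r = exp x is asymptotically pi r^2 times its value at 0.\<close>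

lemma area_quotient_tendsto:
  "((\<lambda>x. exp (- 2 * x) * area_to x) \<longlongrightarrow> pi * exp (2 * logfactor 0)) at_bot"
proof (rule tendstoI)
  fix e :: real assume e: "0 < e"
  \<comment> \<open>The resulting error pi e' is e / 2, strictly below e.\<close>
  define e' where "e' = e / (2 * pi)"
  have e': "0 < e'" using e by (simp add: e'_def)
  have "continuous_on (ball 0 1) (\<lambda>w. exp (2 * logfactor w))" by (intro continuous_intros logfactor_continuous)
  then have "isCont (\<lambda>w. exp (2 * logfactor w)) 0"
    using continuous_on_eq_continuous_at[OF open_ball] by (metis centre_in_ball zero_less_one)
  then obtain d where d: "0 < d" "\<And>w. norm w < d \<Longrightarrow> \<bar>exp (2 * logfactor w) - exp (2 * logfactor 0)\<bar> < e'"
    using e' unfolding continuous_at_eps_delta by (auto simp: dist_real_def)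
  let ?c = "exp (2 * logfactor 0)"
  have small: "\<bar>exp (- 2 * x) * area_to x - pi * ?c\<bar> \<le> pi * e'" if x: "x < min 0 (ln d)" for x
  proof -
    have rate: "(?c - e') * (2 * pi) * exp (2 * y) \<le> area_rate y" "area_rate y \<le> (?c + e') * (2 * pi) * exp (2 * y)"
      if "y < x" for y
    proof -
      have y: "y < 0" using that x by simp
      have "exp y < exp (ln d)" using that x by simp
      then have yd: "exp y < d" using d(1) by simp
      have b: "\<bar>exp (2 * logfactor (exp (Complex y t))) - ?c\<bar> < e'" for t using d(2)[of "exp (Complex y t)"] yd by simp
      have i: "(\<lambda>t. exp (2 * logfactor (exp (Complex y t)))) integrable_on {0..2*pi}"
        by (intro integrable_continuous_real continuous_intros continuous_logfactor_circle y)
      let ?F = "\<lambda>t. exp (2 * logfactor (exp (Complex y t)))"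
      have F: "?c - e' \<le> ?F t" "?F t \<le> ?c + e'" for t using b[of t] by (auto simp: abs_less_iff)
      have "integral {0..2*pi} (\<lambda>t. ?c - e') \<le> integral {0..2*pi} ?F"
        by (intro integral_le i F) auto
      then have "(?c - e') * (2 * pi) \<le> integral {0..2*pi} ?F" by (simp add: mult.commute)
      then show "(?c - e') * (2 * pi) * exp (2 * y) \<le> area_rate y"
        unfolding area_rate_def by (intro mult_right_mono) auto
      have "integral {0..2*pi} ?F \<le> integral {0..2*pi} (\<lambda>t. ?c + e')"
        by (intro integral_le i F) auto
      then have "integral {0..2*pi} ?F \<le> (?c + e') * (2 * pi)" by (simp add: mult.commute)
      then show "area_rate y \<le> (?c + e') * (2 * pi) * exp (2 * y)"
        unfolding area_rate_def by (intro mult_right_mono) auto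
    qed
    have n: "(\<integral>\<^sup>+y\<in>{..<x}. ennreal (C * (2 * pi) * exp (2 * y)) \<partial>lborel) = ennreal (C * pi * exp (2 * x))" if "0 \<le> C" for C
    proof -
      have "(\<integral>\<^sup>+y\<in>{..<x}. ennreal (C * (2 * pi) * exp (2 * y)) \<partial>lborel) = (\<integral>\<^sup>+y. ennreal (C * (2 * pi)) * (ennreal (exp (2 * y)) * indicator {..<x} y) \<partial>lborel)"
        using that by (intro nn_integral_cong) (simp add: ennreal_mult mult.assoc)
      also have "\<dots> = ennreal (C * (2 * pi)) * ennreal (exp (2 * x) / 2)"
        by (subst nn_integral_cmult) (simp_all add: nn_integral_exp_lessThan)
      finally show ?thesis using that by (simp add: ennreal_mult[symmetric])
    qed
    have x0: "x \<le> 0" using x by simp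
    have up: "area_to x \<le> (?c + e') * pi * exp (2 * x)"
    proof -
      have "ennreal (area_to x) \<le> ennreal ((?c + e') * pi * exp (2 * x))"
        unfolding area_to_polar[OF x0] using e'
        by (subst n[symmetric]) (auto intro!: nn_integral_mono ennreal_leI rate simp: indicator_def add_nonneg_nonneg)
      then show ?thesis using e' by (subst (asm) ennreal_le_iff) (auto intro!: mult_nonneg_nonneg add_nonneg_nonneg)
    qed
    have low: "(?c - e') * pi * exp (2 * x) \<le> area_to x"
    \<comment> \<open>The comparison runs through \<open>ennreal\<close> and needs a nonnegative
      constant; for a negative one the lower bound is trivial.\<close>
    proof (cases "0 \<le> ?c - e'")
      case True
      have "ennreal ((?c - e') * pi * exp (2 * x)) \<le> ennreal (area_to x)"
        unfolding area_to_polar[OF x0] using True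
        by (subst n[symmetric]) (auto intro!: nn_integral_mono ennreal_leI rate simp: indicator_def)
      then show ?thesis using area_to_nonneg by (subst (asm) ennreal_le_iff) auto
    next
      case False
      then have "(?c - e') * pi * exp (2 * x) \<le> 0" by (intro mult_nonpos_nonneg) auto
      then show ?thesis using area_to_nonneg[of x] by linarith
    qed
    have ee: "exp (- 2 * x) * exp (2 * x) = 1" by (simp add: exp_add[symmetric])
    have cancel: "exp (- 2 * x) * (C * exp (2 * x)) = C" for C
      using ee by (metis mult.assoc mult.commute mult.right_neutral)
    have "exp (- 2 * x) * area_to x \<le> exp (- 2 * x) * ((?c + e') * pi * exp (2 * x))"
      by (intro mult_left_mono up) simp
    then have 1: "exp (- 2 * x) * area_to x \<le> ?c * pi + e' * pi"
      unfolding cancel by (simp only: distrib_right)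
    have "exp (- 2 * x) * ((?c - e') * pi * exp (2 * x)) \<le> exp (- 2 * x) * area_to x"
      by (intro mult_left_mono low) simp
    then have 2: "?c * pi - e' * pi \<le> exp (- 2 * x) * area_to x"
      unfolding cancel by (simp only: left_diff_distrib)
    show ?thesis using 1 2 by (simp only: abs_le_iff mult.commute[of pi]) linarith
  qed
  have "pi * e' < e" using e by (simp add: e'_def)
  then show "\<forall>\<^sub>F x in at_bot. dist (exp (- 2 * x) * area_to x) (pi * ?c) < e"
    unfolding eventually_at_bot_dense dist_real_def using small by (intro exI[of _ "min 0 (ln d)"]) force
qed

end

section \<open>The functional as a Gamma average\<close>

context riemann_mapped
begin

text \<open>The function B: s is the level of -2 \<kappa> ln |\<psi>|, so the logarithmic radius is
  - s / (2 \<kappa>). Negative levels would lie outside the disc and get the value 0.\<close>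

definition area_quotient :: "real \<Rightarrow> real" where
  "area_quotient s = (if s < 0 then 0 else exp s * area_to (- s / (2 * \<kappa>)))"

lemma area_quotient_nonneg: "0 \<le> area_quotient s"
  using area_to_nonneg by (simp add: area_quotient_def)

lemma area_quotient_antimono:
  assumes "0 \<le> s" "s \<le> t"
  shows "area_quotient t \<le> area_quotient s"
proof -
  have "exp (- 2 * \<kappa> * (- t / (2 * \<kappa>))) * area_to (- t / (2 * \<kappa>)) \<le> exp (- 2 * \<kappa> * (- s / (2 * \<kappa>))) * area_to (- s / (2 * \<kappa>))"
    using assms kappa by (intro area_quotient_mono_0) (auto simp: divide_right_mono)
  then show ?thesis using assms kappa by (simp add: area_quotient_def)
qed

lemma area_quotient_measurable [measurable]: "area_quotient \<in> borel_measurable borel"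
proof -
  have "continuous_on {..<0} area_to"
    using area_to_has_derivative DERIV_isCont by (auto intro!: continuous_at_imp_continuous_on)
  then have [measurable]: "(\<lambda>x. indicator {..<0} x *\<^sub>R area_to x) \<in> borel_measurable borel"
    by (intro borel_measurable_continuous_on_indicator) auto
  have "area_quotient = (\<lambda>s. indicator {0} s * area_to 0 + exp s * (indicator {..<0} (- s / (2 * \<kappa>)) *\<^sub>R area_to (- s / (2 * \<kappa>))))"
    using kappa by (auto simp: area_quotient_def fun_eq_iff indicator_def zero_less_divide_iff)
  moreover have "(\<lambda>s. indicator {0} s * area_to 0 + exp s * (indicator {..<0} (- s / (2 * \<kappa>)) *\<^sub>R area_to (- s / (2 * \<kappa>)))) \<in> borel_measurable borel"
    by measurable
  ultimately show ?thesis by simp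
qed

lemma psi_image: "z \<in> \<Omega> \<Longrightarrow> \<psi> z \<in> ball 0 1 \<and> \<phi> (\<psi> z) = z"
  using phi(3) psi by (metis imageE)

lemma psi_holomorphic: "\<psi> holomorphic_on \<Omega>"
proof -
  obtain g where g: "g holomorphic_on \<Omega>" "\<And>z. z \<in> ball 0 1 \<Longrightarrow> g (\<phi> z) = z"
    using holomorphic_has_inverse[OF phi(1) open_ball phi(2)] phi(3) by metis
  show ?thesis
    by (rule holomorphic_transform[OF g(1)]) (metis g(2) psi_image)
qed

lemma phi_0: "\<phi> 0 \<in> \<Omega>" "\<psi> (\<phi> 0) = 0"
  using phi(3) psi[of 0] by auto

lemma psi_eq_0_iff: "z \<in> \<Omega> \<Longrightarrow> \<psi> z = 0 \<longleftrightarrow> z = \<phi> 0"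
  using psi_image[of z] phi_0 by auto

text \<open>4 pi \<kappa> times the Green function, extended by 0. At the pole \<phi> 0 it takes the
  dummy value 0, because ln 0 = 0.\<close>

definition log_psi :: "complex \<Rightarrow> real" where
  "log_psi z = indicator \<Omega> z * (- 2 * \<kappa> * ln (norm (\<psi> z)))"

lemma log_psi_measurable [measurable]: "log_psi \<in> borel_measurable borel"
proof -
  note [measurable] = conformal_borel_measurable(1)[OF open_dom(1) psi_holomorphic]
  have "\<Omega> \<in> sets borel" using open_dom by simp
  then have "(\<lambda>z. indicator \<Omega> z * (- 2 * \<kappa> * ln (norm (conformal_extension \<Omega> \<psi> z)))) \<in> borel_measurable borel"
    by measurable
  moreover have "(\<lambda>z. indicator \<Omega> z * (- 2 * \<kappa> * ln (norm (conformal_extension \<Omega> \<psi> z)))) = log_psi"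
    by (auto simp: log_psi_def conformal_extension_def indicator_def fun_eq_iff)
  ultimately show ?thesis by (simp only:)
qed

lemma log_psi_pos: "z \<in> \<Omega> \<Longrightarrow> z \<noteq> \<phi> 0 \<Longrightarrow> 0 < log_psi z"
  using psi_image[of z] psi_eq_0_iff[of z] kappa by (simp add: log_psi_def mult_neg_pos mult_pos_neg)

lemma log_psi_nonneg: "0 \<le> log_psi z"
proof (cases "z \<in> \<Omega> \<and> z \<noteq> \<phi> 0")
  case True
  then show ?thesis using log_psi_pos by (auto intro: less_imp_le)
next
  case False
  then show ?thesis using phi_0 by (auto simp: log_psi_def)
qed

definition area_measure :: "complex measure" where
  "area_measure = density lborel (\<lambda>z. ennreal (indicator \<Omega> z * exp (2 * u_ext z)))"

lemma density_meas [measurable]: "(\<lambda>z. indicator \<Omega> z * exp (2 * u_ext z)) \<in> borel_measurable borel"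
proof -
  have "\<Omega> \<in> sets borel" using open_dom by simp
  then show ?thesis by measurable
qed

lemma ennreal_density_meas: "(\<lambda>z. ennreal (indicator \<Omega> z * exp (2 * u_ext z))) \<in> borel_measurable lborel"
  by measurable

lemma emeasure_area_measure:
  assumes "A \<in> sets borel"
  shows "emeasure area_measure A = (\<integral>\<^sup>+z\<in>A \<inter> \<Omega>. ennreal (exp (2 * u z)) \<partial>lborel)"
  using assms unfolding area_measure_def
  by (subst emeasure_density[OF ennreal_density_meas]) (auto intro!: nn_integral_cong simp: indicator_def u_ext_def)

lemma sigma_finite_area_measure: "sigma_finite_measure area_measure"
proof -
  have "emeasure area_measure (space area_measure) \<noteq> \<infinity>"
    using area_finite emeasure_area_measure[of UNIV] by (simp add: area_measure_def)
  then have "finite_measure area_measure" by (rule finite_measureI)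
  then show ?thesis by (rule finite_measure.axioms(1))
qed

lemma AE_area_measure: "AE z in area_measure. z \<noteq> \<phi> 0 \<and> z \<in> \<Omega>"
  unfolding area_measure_def AE_density[OF ennreal_density_meas]
  using AE_lborel_singleton[of "\<phi> 0"] by eventually_elim (auto simp: indicator_def)

text \<open>Superlevel sets of the Green function are the images of concentric discs, up to the
  pole, where \<open>log_psi\<close> has its dummy value; a single point is null.\<close>

lemma emeasure_log_psi_gt:
  assumes s: "0 \<le> s"
  shows "emeasure area_measure {z. s < log_psi z} = ennreal (area_to (- s / (2 * \<kappa>)))"
proof -
  let ?x = "- s / (2 * \<kappa>)"
  have x: "?x \<le> 0" using s kappa by simp
  have "emeasure area_measure {z. s < log_psi z} = (\<integral>\<^sup>+z\<in>{z. s < log_psi z} \<inter> \<Omega>. ennreal (exp (2 * u z)) \<partial>lborel)"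
    by (rule emeasure_area_measure) measurable
  also have "\<dots> = (\<integral>\<^sup>+z\<in>\<phi> ` ball 0 (exp ?x). ennreal (exp (2 * u z)) \<partial>lborel)"
  proof (rule nn_integral_cong_AE)
    have mem: "z \<in> {z. s < log_psi z} \<inter> \<Omega> \<longleftrightarrow> z \<in> \<phi> ` ball 0 (exp ?x)" if "z \<noteq> \<phi> 0" for z
    proof (cases "z \<in> \<Omega>")
      case True
      have n: "0 < norm (\<psi> z)" using psi_eq_0_iff[OF True] that by simp
      have "log_psi z = - (ln (norm (\<psi> z)) * (2 * \<kappa>))" using True by (simp add: log_psi_def)
      then have "s < log_psi z \<longleftrightarrow> ln (norm (\<psi> z)) * (2 * \<kappa>) < - s"
        by (simp only: less_minus_iff[of s])
      also have "\<dots> \<longleftrightarrow> ln (norm (\<psi> z)) < ?x"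
        using kappa by (subst pos_less_divide_eq) simp_all
      also have "\<dots> \<longleftrightarrow> norm (\<psi> z) < exp ?x"
        using n by (metis exp_less_cancel_iff exp_ln)
      also have "\<dots> \<longleftrightarrow> z \<in> \<phi> ` ball 0 (exp ?x)"
      proof
        assume "norm (\<psi> z) < exp ?x"
        then have "\<psi> z \<in> ball 0 (exp ?x)" by simp
        then show "z \<in> \<phi> ` ball 0 (exp ?x)" using psi_image[OF True] by (metis imageI)
      next
        assume "z \<in> \<phi> ` ball 0 (exp ?x)"
        then obtain w where w: "z = \<phi> w" "w \<in> ball 0 (exp ?x)" by blast
        then show "norm (\<psi> z) < exp ?x" using psi[of w] sub_ball[OF x] by auto
      qed
      finally show ?thesis using True by simp
    next
      case False
      then show ?thesis using sub_image[OF x] by auto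
    qed
    show "AE z in lborel. ennreal (exp (2 * u z)) * indicator ({z. s < log_psi z} \<inter> \<Omega>) z
      = ennreal (exp (2 * u z)) * indicator (\<phi> ` ball 0 (exp ?x)) z"
      using AE_lborel_singleton[of "\<phi> 0"] by eventually_elim (use mem in \<open>simp add: indicator_def\<close>)
  qed
  finally show ?thesis unfolding area_to_nn[OF x] .
qed

lemma nn_integral_log_psi_powr:
  assumes p: "0 \<le> p"
  shows "(\<integral>\<^sup>+z. ennreal (log_psi z powr p / Gamma (p + 1)) \<partial>area_measure) = ennreal (gamma_average area_quotient p)"
proof (cases "p = 0")
  case True
  \<comment> \<open>\<open>0 powr 0\<close> is 0, so the integrand is 1 only where
    \<open>log_psi\<close> is nonzero: on \<Omega> away from the pole, hence almost
    everywhere.\<close>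
  have "(\<integral>\<^sup>+z. ennreal (log_psi z powr p / Gamma (p + 1)) \<partial>area_measure) = (\<integral>\<^sup>+z. 1 \<partial>area_measure)"
  proof (rule nn_integral_cong_AE)
    show "AE z in area_measure. ennreal (log_psi z powr p / Gamma (p + 1)) = 1"
      using AE_area_measure
    proof eventually_elim
      case (elim z)
      then have "log_psi z \<noteq> 0" using log_psi_pos[of z] by simp
      then show ?case using True by simp
    qed
  qed
  also have "\<dots> = emeasure area_measure UNIV" by (simp add: area_measure_def)
  also have "\<dots> = ennreal (area_to 0)"
    using phi(3) by (simp add: emeasure_area_measure area_to_nn)
  finally show ?thesis using True by (simp add: gamma_average_def area_quotient_def)
next
  case False
  then have p0: "0 < p" using p by simp
  have sp: "space area_measure = UNIV" by (simp add: area_measure_def)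
  have "(\<integral>\<^sup>+z. ennreal (log_psi z powr p / Gamma (p + 1)) \<partial>area_measure)
      = (\<integral>\<^sup>+s. ennreal (gamma_density p s * exp s) * emeasure area_measure {z \<in> space area_measure. s < log_psi z} \<partial>lborel)"
    by (rule nn_integral_powr_layer_cake[OF sigma_finite_area_measure _ log_psi_nonneg p0]) (simp add: area_measure_def)
  also have "\<dots> = (\<integral>\<^sup>+s. ennreal (gamma_density p s * area_quotient s) \<partial>lborel)"
  proof (rule nn_integral_cong)
    fix s :: real
    show "ennreal (gamma_density p s * exp s) * emeasure area_measure {z \<in> space area_measure. s < log_psi z} = ennreal (gamma_density p s * area_quotient s)"
    proof (cases "0 < s")
      case True
      then have "emeasure area_measure {z \<in> space area_measure. s < log_psi z} = ennreal (area_to (- s / (2 * \<kappa>)))"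
        using emeasure_log_psi_gt[of s] sp by simp
      then show ?thesis
        using True gamma_density_nonneg[OF p0, of s] area_to_nonneg
        by (simp add: area_quotient_def ennreal_mult[symmetric] mult.assoc)
    qed (simp add: gamma_density_def)
  qed
  also have "\<dots> = ennreal (\<integral>s. gamma_density p s * area_quotient s \<partial>lborel)"
    using gamma_density_mult_integrable[OF area_quotient_measurable area_quotient_antimono area_quotient_nonneg p0]
      gamma_density_nonneg[OF p0] area_quotient_nonneg
    by (intro nn_integral_eq_integral) auto
  finally show ?thesis using False by (simp add: gamma_average_def)
qed

lemma functional_eq_gamma_average:
  fixes G :: "complex \<Rightarrow> real"
  assumes p: "0 \<le> p" and G: "\<And>z. z \<in> \<Omega> \<Longrightarrow> z \<noteq> \<phi> 0 \<Longrightarrow> G z = - ln (norm (\<psi> z)) / (2 * pi)"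
  shows "(4 * pi * \<kappa>) powr p / Gamma (p + 1) * (LINT z:\<Omega>|lebesgue. G z powr p * exp (2 * u z))
    = gamma_average area_quotient p"
proof -
  have Gp: "0 < Gamma (p + 1)" using p by (intro Gamma_real_pos) simp
  have k0: "0 < 4 * pi * \<kappa>" using kappa by simp
  define c where "c = (4 * pi * \<kappa>) powr p / Gamma (p + 1)"
  have c: "0 < c" unfolding c_def by (intro divide_pos_pos Gp) (use kappa in simp)
  define D where "D z = indicator \<Omega> z * exp (2 * u_ext z)" for z
  have [measurable]: "D \<in> borel_measurable borel" unfolding D_def[abs_def] by measurable
  \<comment> \<open>Agrees with the integrand at every point, the pole included, and is Borel
    measurable. So the integral over the completed measure reduces to one over \<open>lborel\<close>
    before the value at the pole is discarded.\<close>
  define f where "f z = (if z = \<phi> 0 then G z powr p else (log_psi z / (4 * pi * \<kappa>)) powr p) * D z" for z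
  have fm [measurable]: "f \<in> borel_measurable borel"
  proof -
    have "f = (\<lambda>z. (if z \<in> {\<phi> 0} then G (\<phi> 0) powr p else (log_psi z / (4 * pi * \<kappa>)) powr p) * D z)"
      by (auto simp: f_def)
    then show ?thesis by simp
  qed
  have f0: "0 \<le> f z" for z by (simp add: f_def D_def)
  have "(LINT z:\<Omega>|lebesgue. G z powr p * exp (2 * u z)) = (\<integral>z. f z \<partial>lebesgue)"
    unfolding set_lebesgue_integral_def
  proof (intro Bochner_Integration.integral_cong refl)
    fix z
    show "indicator \<Omega> z *\<^sub>R (G z powr p * exp (2 * u z)) = f z"
      using G[of z] kappa by (cases "z \<in> \<Omega>") (auto simp: f_def D_def u_ext_def log_psi_def)
  qed
  also have "\<dots> = (\<integral>z. f z \<partial>lborel)" by (rule integral_completion) simp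
  also have "c * \<dots> = (\<integral>z. c * f z \<partial>lborel)" by simp
  also have "\<dots> = enn2real (\<integral>\<^sup>+z. ennreal (c * f z) \<partial>lborel)"
    by (rule integral_eq_nn_integral) (use c f0 in auto)
  also have "(\<integral>\<^sup>+z. ennreal (c * f z) \<partial>lborel) = (\<integral>\<^sup>+z. ennreal (D z) * ennreal (log_psi z powr p / Gamma (p + 1)) \<partial>lborel)"
  proof (rule nn_integral_cong_AE)
    show "AE z in lborel. ennreal (c * f z) = ennreal (D z) * ennreal (log_psi z powr p / Gamma (p + 1))"
      using AE_lborel_singleton[of "\<phi> 0"]
    proof eventually_elim
      case (elim z)
      have "c * f z = D z * (log_psi z powr p / Gamma (p + 1))"
        using elim kappa log_psi_nonneg[of z] by (simp add: f_def c_def powr_divide)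
      moreover have "0 \<le> D z" by (simp add: D_def)
      ultimately show ?case by (simp only: ennreal_mult')
    qed
  qed
  also have "\<dots> = (\<integral>\<^sup>+z. ennreal (log_psi z powr p / Gamma (p + 1)) \<partial>area_measure)"
    unfolding area_measure_def D_def by (subst nn_integral_density) auto
  also have "\<dots> = ennreal (gamma_average area_quotient p)" by (rule nn_integral_log_psi_powr[OF p])
  also have "enn2real \<dots> = gamma_average area_quotient p"
  proof -
    have "0 \<le> gamma_average area_quotient p"
      using p gamma_density_nonneg area_quotient_nonneg
      by (auto simp: gamma_average_def intro!: integral_nonneg_AE)
    then show ?thesis by simp
  qed
  finally show ?thesis by (simp add: c_def)
qed

text \<open>With x = - s / (2 \<kappa>), B s = exp ((2 - 2 \<kappa>) x) * (exp (- 2 x) * area_to x).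
  The second factor has a positive limit as x tends to minus infinity; the first tends to 0 if
  \<kappa> < 1 and is 1 if \<kappa> = 1.\<close>

lemma area_quotient_tendsto_top:
  "(area_quotient \<longlongrightarrow> (if \<kappa> < 1 then 0 else pi * exp (2 * logfactor 0))) at_top"
proof -
  let ?L = "pi * exp (2 * logfactor 0)"
  have "filterlim (\<lambda>s. 1 / (2 * \<kappa>) * s) at_top at_top"
    using kappa by (intro filterlim_tendsto_pos_mult_at_top[OF tendsto_const]) (auto simp: filterlim_ident)
  then have x: "filterlim (\<lambda>s. - s / (2 * \<kappa>)) at_bot at_top"
    by (simp add: filterlim_uminus_at_top)
  have 1: "((\<lambda>s. exp (- 2 * (- s / (2 * \<kappa>))) * area_to (- s / (2 * \<kappa>))) \<longlongrightarrow> ?L) at_top"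
    by (rule filterlim_compose[OF area_quotient_tendsto x])
  have eq: "\<forall>\<^sub>F s in at_top. exp ((2 - 2 * \<kappa>) * (- s / (2 * \<kappa>))) * (exp (- 2 * (- s / (2 * \<kappa>))) * area_to (- s / (2 * \<kappa>))) = area_quotient s"
  proof (rule eventually_at_top_linorderI[of 0])
    fix s :: real assume "0 \<le> s"
    have "exp ((2 - 2 * \<kappa>) * (- s / (2 * \<kappa>))) * exp (- 2 * (- s / (2 * \<kappa>))) = exp s"
      unfolding exp_add[symmetric] using kappa by (simp add: field_simps)
    then show "exp ((2 - 2 * \<kappa>) * (- s / (2 * \<kappa>))) * (exp (- 2 * (- s / (2 * \<kappa>))) * area_to (- s / (2 * \<kappa>))) = area_quotient s"
      using \<open>0 \<le> s\<close> by (simp add: area_quotient_def mult.assoc[symmetric])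
  qed
  show ?thesis
  proof (cases "\<kappa> < 1")
    case True
    have "filterlim (\<lambda>x. (2 - 2 * \<kappa>) * x) at_bot at_bot"
      using True by (intro filterlim_tendsto_pos_mult_at_bot[OF tendsto_const]) (auto simp: filterlim_ident)
    from filterlim_compose[OF exp_at_bot filterlim_compose[OF this x]]
    have "((\<lambda>s. exp ((2 - 2 * \<kappa>) * (- s / (2 * \<kappa>)))) \<longlongrightarrow> 0) at_top" .
    from Lim_transform_eventually[OF tendsto_mult[OF this 1] eq] show ?thesis using True by simp
  next
    case False
    then have k1: "\<kappa> = 1" using kappa by simp
    have "((\<lambda>s. exp ((2 - 2 * \<kappa>) * (- s / (2 * \<kappa>)))) \<longlongrightarrow> 1) at_top" by (simp add: k1)
    from Lim_transform_eventually[OF tendsto_mult[OF this 1] eq] show ?thesis using False by simp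
  qed
qed

lemma functional_tendsto:
  "(gamma_average area_quotient \<longlongrightarrow> (if \<kappa> < 1 then 0 else pi * exp (2 * logfactor 0))) at_top"
  by (rule gamma_average_tendsto[OF area_quotient_measurable area_quotient_antimono area_quotient_nonneg area_quotient_tendsto_top])

lemma functional_antimono:
  "0 \<le> p1 \<Longrightarrow> p1 < p2 \<Longrightarrow> gamma_average area_quotient p2 \<le> gamma_average area_quotient p1"
  by (rule gamma_average_comparison(1)[OF area_quotient_measurable area_quotient_antimono area_quotient_nonneg])

lemma equality_imp_constant_factor:
  assumes p: "0 \<le> p1" "p1 < p2" and eq: "gamma_average area_quotient p2 = gamma_average area_quotient p1"
    and w: "w \<in> ball 0 1"
  shows "logfactor w = logfactor 0"
proof -
  define c where "c = gamma_average area_quotient p1"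
  have Bc: "area_quotient s = c" if "0 < s" for s
    unfolding c_def
    by (rule gamma_average_comparison(2)[OF area_quotient_measurable area_quotient_antimono area_quotient_nonneg p eq that])
  let ?L = "if \<kappa> < 1 then 0 else pi * exp (2 * logfactor 0)"
  have "(area_quotient \<longlongrightarrow> c) at_top"
    by (rule tendsto_eventually) (auto intro!: eventually_at_top_linorderI[of 1] Bc)
  then have cL: "c = ?L" using area_quotient_tendsto_top by (rule tendsto_unique[rotated]) simp
  have area: "area_to x = c * exp (2 * \<kappa> * x)" if "x < 0" for x
  proof -
    have "0 < - 2 * \<kappa> * x" using that kappa by (simp add: mult_pos_neg)
    then have 1: "exp (- 2 * \<kappa> * x) * area_to x = c"
      using Bc[of "- 2 * \<kappa> * x"] kappa by (simp add: area_quotient_def)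
    have "area_to x = (exp (- 2 * \<kappa> * x) * exp (2 * \<kappa> * x)) * area_to x" by (simp add: exp_add[symmetric])
    also have "\<dots> = (exp (- 2 * \<kappa> * x) * area_to x) * exp (2 * \<kappa> * x)" by (simp only: mult_ac)
    finally show ?thesis unfolding 1 .
  qed
  \<comment> \<open>If \<kappa> < 1, then the constant value of B is its limit 0, so small discs
    would have area 0, against the positive limit in \<open>area_quotient_tendsto\<close>.\<close>
  have k1: "\<kappa> = 1"
  proof (rule ccontr)
    assume "\<kappa> \<noteq> 1"
    then have "c = 0" using cL kappa by simp
    then have "\<forall>\<^sub>F x in at_bot. exp (- 2 * x) * area_to x = 0"
      using area by (auto simp: eventually_at_bot_dense intro!: exI[of _ 0])
    then have "((\<lambda>x. exp (- 2 * x) * area_to x) \<longlongrightarrow> 0) at_bot" by (rule tendsto_eventually)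
    then have "pi * exp (2 * logfactor 0) = 0"
      by (rule tendsto_unique[OF trivial_limit_at_bot_linorder area_quotient_tendsto])
    then show False by simp
  qed
  have cpi: "c = pi * exp (2 * logfactor 0)" using cL k1 by simp
  \<comment> \<open>Now area_to x = c exp (2 x), so its derivative is twice itself, and the
    isoperimetric inequality followed by Cauchy-Schwarz returns this same value. Equality in
    Cauchy-Schwarz makes the conformal factor constant on each circle, and c = pi exp (2 logfactor
    0) gives all circles the same constant.\<close>
  have const: "exp (2 * logfactor (exp (Complex x t))) = exp (2 * logfactor 0)" if x: "x < 0" and t: "t \<in> {0..2*pi}" for x t
  proof -
    have "((\<lambda>y. c * exp (2 * y)) has_real_derivative c * (exp (2 * x) * 2)) (at x)"
      by (auto intro!: derivative_eq_intros)
    then have d: "((\<lambda>y. c * exp (2 * y)) has_real_derivative c * (exp (2 * x) * 2)) (at x)" .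
    have ev: "\<forall>\<^sub>F y in nhds x. c * exp (2 * y) = area_to y"
      using eventually_nhds_in_open[of "{..<0}" x] x area k1 by (auto elim: eventually_mono)
    have "(area_to has_real_derivative c * (exp (2 * x) * 2)) (at x)"
      by (rule iffD1[OF DERIV_cong_ev[OF refl ev refl] d])
    then have rate: "area_rate x = 2 * c * exp (2 * x)"
      using DERIV_unique[OF area_to_has_derivative[OF x]] by simp
    let ?g = "\<lambda>t. exp (logfactor (exp (Complex x t)) + x)"
    have cg: "continuous_on {0..2*pi} ?g" by (intro continuous_intros continuous_logfactor_circle x)
    have sq: "integral {0..2*pi} (\<lambda>t. (?g t)\<^sup>2) = 2 * c * exp (2 * x)"
      using rate by (simp add: area_rate_eq_square)
    have "c * exp (2 * x) \<le> (integral {0..2*pi} ?g)\<^sup>2 / (4 * pi)"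
      using area_to_le[OF x] area[OF x] k1 by simp
    then have "2 * pi * (2 * c * exp (2 * x)) \<le> (integral {0..2*pi} ?g)\<^sup>2" by (simp add: field_simps)
    then have e: "(integral {0..2*pi} ?g)\<^sup>2 = 2 * pi * integral {0..2*pi} (\<lambda>t. (?g t)\<^sup>2)"
      using cauchy_schwarz_const(1)[OF cg] sq by simp
    have "?g t = integral {0..2*pi} ?g / (2 * pi)" by (rule cauchy_schwarz_const(2)[OF cg e t])
    then have "(?g t)\<^sup>2 = (integral {0..2*pi} ?g)\<^sup>2 / (4 * pi\<^sup>2)" by (simp add: power_divide power_mult_distrib)
    also have "\<dots> = exp (2 * logfactor 0) * exp (2 * x)"
      unfolding e sq cpi by (simp add: power2_eq_square)
    also have "(?g t)\<^sup>2 = exp (2 * logfactor (exp (Complex x t))) * exp (2 * x)"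
      by (simp add: exp_double[symmetric] exp_add[symmetric] distrib_left)
    finally show ?thesis by simp
  qed
  show ?thesis
  proof (cases "w = 0")
    case False
    have "w = of_real (norm w) * exp (\<i> * of_real (Arg2pi w))" using Arg2pi[of w] unfolding is_Arg_def by blast
    also have "\<dots> = exp (Complex (ln (norm w)) (Arg2pi w))"
      using False unfolding exp_eq_polar[of "Complex _ _"] by (simp add: cis_conv_exp)
    finally have we: "w = exp (Complex (ln (norm w)) (Arg2pi w))" .
    have "ln (norm w) < 0" using w False by simp
    moreover have "Arg2pi w \<in> {0..2*pi}" using Arg2pi[of w] by simp
    ultimately have "exp (2 * logfactor w) = exp (2 * logfactor 0)" using const we by metis
    then show ?thesis by simp
  qed simp
qed

text \<open>Discs now have exactly Euclidean area up to a constant factor, so for \<kappa> = 1 the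
  function B is constant, and averages against a probability density do not depend on p.\<close>

lemma constant_factor_imp_functional:
  assumes k1: "\<kappa> = 1" and const: "\<And>w. w \<in> ball 0 1 \<Longrightarrow> logfactor w = l" and p: "0 \<le> p"
  shows "gamma_average area_quotient p = pi * exp (2 * l)"
proof -
  have area: "area_to x = pi * exp (2 * l) * exp (2 * x)" if x: "x \<le> 0" for x
  proof -
    have "ennreal (area_to x) = (\<integral>\<^sup>+w. ennreal (exp (2 * l)) * indicator (ball 0 (exp x)) w \<partial>(lborel :: complex measure))"
      unfolding area_to_ball[OF x] using sub_ball[OF x] by (intro set_nn_integral_cong refl) (auto simp: const)
    also have "\<dots> = (\<integral>\<^sup>+x\<in>{..<x}. (\<integral>\<^sup>+y\<in>{0..2*pi}. ennreal (exp (2 * l)) \<partial>lborel) * ennreal (exp (2 * x)) \<partial>lborel)"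
      by (rule nn_integral_ball_polar) simp
    also have "\<dots> = (\<integral>\<^sup>+y. ennreal (exp (2 * l) * (2 * pi)) * (ennreal (exp (2 * y)) * indicator {..<x} y) \<partial>lborel)"
      by (intro nn_integral_cong) (simp add: nn_integral_cmult_indicator ennreal_mult mult.assoc)
    also have "\<dots> = ennreal (exp (2 * l) * (2 * pi)) * ennreal (exp (2 * x) / 2)"
      by (subst nn_integral_cmult) (simp_all add: nn_integral_exp_lessThan)
    also have "\<dots> = ennreal (pi * exp (2 * l) * exp (2 * x))"
      by (simp add: ennreal_mult[symmetric] mult_ac)
    finally show ?thesis using area_to_nonneg by (subst (asm) ennreal_inj) auto
  qed
  have B: "area_quotient s = pi * exp (2 * l)" if "0 \<le> s" for s
  proof -
    have "area_to (- s / 2) = pi * exp (2 * l) * exp (2 * (- s / 2))" using that by (intro area) simp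
    moreover have "area_quotient s = exp s * area_to (- s / 2)"
      using area_quotient_def[of s] that by (simp add: k1)
    ultimately have "area_quotient s = (exp s * exp (2 * (- s / 2))) * (pi * exp (2 * l))"
      by (simp only: mult_ac)
    also have "exp s * exp (2 * (- s / 2)) = 1" by (simp add: exp_add[symmetric])
    finally show ?thesis by simp
  qed
  show ?thesis
  proof (cases "p = 0")
    case False
    then have p0: "0 < p" using p by simp
    have eq: "gamma_density p s * area_quotient s = gamma_density p s * (pi * exp (2 * l))" for s
      using B[of s] by (cases "0 < s") (auto simp: gamma_density_def)
    show ?thesis using False gamma_density_integral[OF p0] unfolding gamma_average_def eq by simp
  qed (simp add: gamma_average_def B)
qed

end

section \<open>Reduction to the Riemann map\<close>

text \<open>A disc automorphism applied first moves the image of 0 to a, so that the level curves of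
  the Green function with pole a come from concentric circles.\<close>

lemma centered_riemann_map:
  assumes "open S" "simply_connected S" "S \<noteq> UNIV" "a \<in> S"
  obtains \<phi> \<psi> where "\<phi> holomorphic_on ball 0 1" "inj_on \<phi> (ball 0 1)" "\<phi> ` ball 0 1 = S"
    "\<And>w. w \<in> ball 0 1 \<Longrightarrow> \<psi> (\<phi> w) = w" "\<phi> 0 = a"
proof -
  have "S \<noteq> {}" using assms(4) by blast
  then have "\<exists>f g. f holomorphic_on S \<and> g holomorphic_on ball 0 1 \<and> (\<forall>z\<in>S. f z \<in> ball 0 1 \<and> g (f z) = z) \<and>
      (\<forall>z\<in>ball 0 1. g z \<in> S \<and> f (g z) = z)"
    using iffD1[OF simply_connected_eq_biholomorphic_to_disc[OF assms(1)] assms(2)] assms(3) by satx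
  then obtain f g where f': "f holomorphic_on S \<and> g holomorphic_on ball 0 1 \<and> (\<forall>z\<in>S. f z \<in> ball 0 1 \<and> g (f z) = z) \<and>
      (\<forall>z\<in>ball 0 1. g z \<in> S \<and> f (g z) = z)"
    by (elim exE)
  have f: "f holomorphic_on S" "g holomorphic_on ball 0 1"
    "\<And>z. z \<in> S \<Longrightarrow> f z \<in> ball 0 1 \<and> g (f z) = z" "\<And>z. z \<in> ball 0 1 \<Longrightarrow> g z \<in> S \<and> f (g z) = z"
    using f' by auto
  define w where "w = f a"
  have w: "norm w < 1" using f(3)[OF assms(4)] by (simp add: w_def)
  have w': "norm (- w) < 1" using w by simp
  define \<phi> where "\<phi> = g \<circ> disc_aut w"
  define \<psi> where "\<psi> = disc_aut (- w) \<circ> f"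
  have da: "disc_aut w holomorphic_on ball 0 1"
    using disc_aut_denominator_nonzero[OF w] unfolding disc_aut_def[abs_def]
    by (intro holomorphic_intros) (auto simp: less_imp_le)
  have din: "disc_aut w z \<in> ball 0 1" if "z \<in> ball 0 1" for z
    using norm_disc_aut_less_1[OF w] that by simp
  have inv: "\<psi> (\<phi> z) = z" if "z \<in> ball 0 1" for z
    using f(4)[OF din[OF that]] disc_aut_inverse[OF w, of z] that by (simp add: \<phi>_def \<psi>_def)
  show ?thesis
  proof (rule that)
    show "\<phi> holomorphic_on ball 0 1"
      unfolding \<phi>_def by (rule holomorphic_on_compose_gen[OF da f(2)]) (use din in blast)
    show "inj_on \<phi> (ball 0 1)" by (rule inj_on_inverseI[of _ \<psi>]) (rule inv)
    have "g ` ball 0 1 = S"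
    proof (intro equalityI subsetI)
      show "z \<in> S" if "z \<in> g ` ball 0 1" for z using that f(4) by auto
      show "z \<in> g ` ball 0 1" if "z \<in> S" for z by (rule image_eqI[of _ g "f z"]) (use f(3)[OF that] in auto)
    qed
    then show "\<phi> ` ball 0 1 = S" unfolding \<phi>_def image_comp[symmetric] disc_aut_image_ball[OF w] .
    show "\<psi> (\<phi> z) = z" if "z \<in> ball 0 1" for z by (rule inv[OF that])
    show "\<phi> 0 = a" using f(3)[OF assms(4)] by (simp add: \<phi>_def w_def)
  qed
qed

text \<open>U is the union of the pieces. On each piece the derivative has a continuous extension to
  the part of the closure in \<Omega>, hence is bounded on compact sets; the sum of the finitely
  many bounds serves all pieces.\<close>

lemma piecewise_continuous_partialE:
  assumes "piecewise_continuous_partial \<Omega> v f"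
  obtains U C where "open U" "U \<subseteq> \<Omega>" "\<forall>z\<in>U. has_partial v f (partial v f z) z"
    "continuous_on U (partial v f)"
    "\<forall>K. compact K \<and> K \<subseteq> \<Omega> \<longrightarrow> (\<exists>B. \<forall>z\<in>K \<inter> U. \<bar>partial v f z\<bar> \<le> B)"
    "finite C" "\<forall>c\<in>C. rectifiable_path c" "\<Omega> - U \<subseteq> (\<Union>c\<in>C. path_image c)"
proof -
  obtain \<D> where D: "curve_division \<Omega> \<D>"
    and ex: "\<forall>D\<in>\<D>. \<exists>h. continuous_on (\<Omega> \<inter> closure D) h \<and> (\<forall>z\<in>D. has_partial v f (h z) z)"
    using assms unfolding piecewise_continuous_partial_def by blast
  obtain h where h: "\<And>D. D \<in> \<D> \<Longrightarrow> continuous_on (\<Omega> \<inter> closure D) (h D)"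
    "\<And>D z. D \<in> \<D> \<Longrightarrow> z \<in> D \<Longrightarrow> has_partial v f (h D z) z"
    using bchoice[OF ex] by auto
  have fin: "finite \<D>" and sub: "\<And>D. D \<in> \<D> \<Longrightarrow> open D \<and> D \<subseteq> \<Omega>"
    using D by (auto simp: curve_division_def)
  obtain C where C: "finite C" "\<forall>c\<in>C. rectifiable_path c" "\<Omega> - \<Union>\<D> \<subseteq> (\<Union>c\<in>C. path_image c)"
    using D unfolding curve_division_def by blast
  have ph: "partial v f z = h D z" if "D \<in> \<D>" "z \<in> D" for D z
    by (rule has_partial_imp_partial[OF h(2)[OF that]])
  have co: "continuous_on D (partial v f)" if "D \<in> \<D>" for D
  proof (rule continuous_on_eq)
    show "continuous_on D (h D)"
      by (rule continuous_on_subset[OF h(1)[OF that]]) (use sub[OF that] closure_subset in blast)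
  qed (use ph that in simp)
  show ?thesis
  proof (rule that[of "\<Union>\<D>" C])
    show "open (\<Union>\<D>)" "\<Union>\<D> \<subseteq> \<Omega>" using sub by auto
    show "\<forall>z\<in>\<Union>\<D>. has_partial v f (partial v f z) z"
    proof
      fix z assume z: "z \<in> \<Union>\<D>"
      obtain D where D: "D \<in> \<D>" "z \<in> D" using z ..
      show "has_partial v f (partial v f z) z" using h(2)[OF D] unfolding ph[OF D] .
    qed
    show "continuous_on (\<Union>\<D>) (partial v f)"
      using continuous_on_open_UN[of \<D> "\<lambda>D. D" "partial v f"] co sub by simp
    show "\<forall>K. compact K \<and> K \<subseteq> \<Omega> \<longrightarrow> (\<exists>B. \<forall>z\<in>K \<inter> \<Union>\<D>. \<bar>partial v f z\<bar> \<le> B)"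
    proof (intro allI impI, elim conjE)
      fix K assume K: "compact K" "K \<subseteq> \<Omega>"
      have exB: "\<exists>B. \<forall>z\<in>K \<inter> closure D. \<bar>h D z\<bar> \<le> B" if "D \<in> \<D>" for D
      proof -
        have "compact (K \<inter> closure D)" using K(1) by (simp add: compact_Int_closed)
        moreover have "continuous_on (K \<inter> closure D) (h D)"
          by (rule continuous_on_subset[OF h(1)[OF that]]) (use K(2) in blast)
        ultimately have "bounded (h D ` (K \<inter> closure D))"
          by (intro compact_imp_bounded compact_continuous_image)
        then obtain B where "\<forall>y\<in>h D ` (K \<inter> closure D). norm y \<le> B" unfolding bounded_iff ..
        then show ?thesis by (intro exI[of _ B]) simp
      qed
      obtain B where B: "\<And>D z. D \<in> \<D> \<Longrightarrow> z \<in> K \<inter> closure D \<Longrightarrow> \<bar>h D z\<bar> \<le> B D"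
      proof -
        have "\<forall>D\<in>\<D>. \<exists>B. \<forall>z\<in>K \<inter> closure D. \<bar>h D z\<bar> \<le> B" by (intro ballI exB)
        from bchoice[OF this] obtain B where "\<forall>D\<in>\<D>. \<forall>z\<in>K \<inter> closure D. \<bar>h D z\<bar> \<le> B D" ..
        then show thesis by (intro that[of B]) (use bspec in fast)
      qed
      have "\<bar>partial v f z\<bar> \<le> (\<Sum>D\<in>\<D>. \<bar>B D\<bar>)" if z: "z \<in> K \<inter> \<Union>\<D>" for z
      proof -
        obtain D where zD: "D \<in> \<D>" "z \<in> D" using z by blast
        have "\<bar>partial v f z\<bar> \<le> \<bar>B D\<bar>"
          using B[OF zD(1), of z] z zD(2) closure_subset[of D] by (simp add: ph[OF zD] subset_iff)
        also have "\<dots> \<le> (\<Sum>D\<in>\<D>. \<bar>B D\<bar>)" using fin zD(1) by (intro member_le_sum) auto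
        finally show ?thesis .
      qed
      then show "\<exists>B. \<forall>z\<in>K \<inter> \<Union>\<D>. \<bar>partial v f z\<bar> \<le> B" by (intro exI ballI)
    qed
  qed (use C in auto)
qed

lemma AE_finite_union:
  assumes "finite C" "\<And>c. c \<in> C \<Longrightarrow> AE x in M. finite {y. P c x y}"
    and "\<And>x y. Q x y \<Longrightarrow> \<exists>c\<in>C. P c x y"
  shows "AE x in M. finite {y. Q x y}"
proof -
  have "AE x in M. \<forall>c\<in>C. finite {y. P c x y}"
    using assms(1,2) by (simp add: AE_finite_all)
  then show ?thesis
  proof eventually_elim
    case (elim x)
    have "{y. Q x y} \<subseteq> (\<Union>c\<in>C. {y. P c x y})" using assms(3) by blast
    then show ?case using elim assms(1) by (meson finite_UN_I finite_subset)
  qed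
qed

text \<open>The two pure second derivatives may come with different divisions of \<Omega>. The
  intersection of the two unions of pieces works for both, and its complement in \<Omega> is covered
  by all the curves together.\<close>

lemma piecewise_C2_of_second_partials:
  assumes "open \<Omega>" "continuous_on \<Omega> u" "C1_on \<Omega> u" "piecewise_continuous_second_partials \<Omega> u"
  obtains \<Omega>' where "piecewise_C2 \<Omega> \<Omega>' u (partial 1 u) (partial \<i> u) (partial 1 (partial 1 u)) (partial \<i> (partial \<i> u))"
    "\<Omega> - \<Omega>' \<in> null_sets lborel"
proof -
  have p: "piecewise_continuous_partial \<Omega> 1 (partial 1 u)" "piecewise_continuous_partial \<Omega> \<i> (partial \<i> u)"
    using assms(4) by (auto simp: piecewise_continuous_second_partials_def)
  obtain U C where U: "open U" "U \<subseteq> \<Omega>" "\<forall>z\<in>U. has_partial 1 (partial 1 u) (partial 1 (partial 1 u) z) z"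
    "continuous_on U (partial 1 (partial 1 u))"
    "\<forall>K. compact K \<and> K \<subseteq> \<Omega> \<longrightarrow> (\<exists>B. \<forall>z\<in>K \<inter> U. \<bar>partial 1 (partial 1 u) z\<bar> \<le> B)"
    "finite C" "\<forall>c\<in>C. rectifiable_path c" "\<Omega> - U \<subseteq> (\<Union>c\<in>C. path_image c)"
    by (rule piecewise_continuous_partialE[OF p(1)])
  obtain V D where V: "open V" "V \<subseteq> \<Omega>" "\<forall>z\<in>V. has_partial \<i> (partial \<i> u) (partial \<i> (partial \<i> u) z) z"
    "continuous_on V (partial \<i> (partial \<i> u))"
    "\<forall>K. compact K \<and> K \<subseteq> \<Omega> \<longrightarrow> (\<exists>B. \<forall>z\<in>K \<inter> V. \<bar>partial \<i> (partial \<i> u) z\<bar> \<le> B)"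
    "finite D" "\<forall>c\<in>D. rectifiable_path c" "\<Omega> - V \<subseteq> (\<Union>c\<in>D. path_image c)"
    by (rule piecewise_continuous_partialE[OF p(2)])
  let ?W = "U \<inter> V"
  have fin: "finite (C \<union> D)" and rect: "\<And>c. c \<in> C \<union> D \<Longrightarrow> rectifiable_path c"
    using U(6,7) V(6,7) by auto
  have cov: "z \<in> \<Omega> - ?W \<Longrightarrow> \<exists>c\<in>C \<union> D. z \<in> path_image c" for z using U(8) V(8) by blast
    have d1: "open \<Omega>" "open ?W" "?W \<subseteq> \<Omega>" "continuous_on \<Omega> u"
      using assms(1,2) U(1,2) V(1) by auto
    have d2: "continuous_on \<Omega> (partial 1 u)" "continuous_on \<Omega> (partial \<i> u)"
    proof -
      have "continuous_on \<Omega> (partial v u)" if "v \<in> {1, \<i>}" for v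
      proof -
        have "\<exists>h. continuous_on \<Omega> h \<and> (\<forall>z\<in>\<Omega>. has_partial v u (h z) z)"
          using assms(3) that unfolding C1_on_def by (rule bspec)
        then obtain h where h: "continuous_on \<Omega> h" "\<forall>z\<in>\<Omega>. has_partial v u (h z) z" by (elim exE conjE)
        show ?thesis
          by (rule continuous_on_eq[OF h(1)]) (rule has_partial_imp_partial[OF bspec[OF h(2)], symmetric])
      qed
      then show "continuous_on \<Omega> (partial 1 u)" "continuous_on \<Omega> (partial \<i> u)" by auto
    qed
    have d3: "continuous_on ?W (partial 1 (partial 1 u))" "continuous_on ?W (partial \<i> (partial \<i> u))"
      using U(4) V(4) by (auto intro: continuous_on_subset)
    have d4: "has_partial 1 u (partial 1 u z) z" "has_partial \<i> u (partial \<i> u z) z" if "z \<in> \<Omega>" for z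
      using C1_on_has_partial[OF assms(3)] that by auto
    have d5: "has_partial 1 (partial 1 u) (partial 1 (partial 1 u) z) z"
      "has_partial \<i> (partial \<i> u) (partial \<i> (partial \<i> u) z) z" if "z \<in> ?W" for z
      using U(3) V(3) that by auto
    have d6: "\<exists>B. \<forall>z\<in>K \<inter> ?W. \<bar>partial 1 (partial 1 u) z\<bar> \<le> B \<and> \<bar>partial \<i> (partial \<i> u) z\<bar> \<le> B"
      if K: "compact K" "K \<subseteq> \<Omega>" for K
    proof -
      obtain B1 B2 where B: "\<forall>z\<in>K \<inter> U. \<bar>partial 1 (partial 1 u) z\<bar> \<le> B1" "\<forall>z\<in>K \<inter> V. \<bar>partial \<i> (partial \<i> u) z\<bar> \<le> B2"
        using spec[OF U(5), of K] spec[OF V(5), of K] K by auto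
      show ?thesis
      proof (intro exI[of _ "max B1 B2"] ballI)
        fix z assume z: "z \<in> K \<inter> ?W"
        then show "\<bar>partial 1 (partial 1 u) z\<bar> \<le> max B1 B2 \<and> \<bar>partial \<i> (partial \<i> u) z\<bar> \<le> max B1 B2"
          using bspec[OF B(1), of z] bspec[OF B(2), of z] by (simp add: le_max_iff_disj)
      qed
    qed
    have d7: "AE y in lborel. finite {x. Complex x y \<in> \<Omega> - ?W}"
      by (rule AE_finite_union[OF fin AE_finite_horizontal_slice[OF rect] cov])
    have d8: "AE x in lborel. finite {y. Complex x y \<in> \<Omega> - ?W}"
      by (rule AE_finite_union[OF fin AE_finite_vertical_slice[OF rect] cov])
  show ?thesis
  proof (rule that)
    show "piecewise_C2 \<Omega> ?W u (partial 1 u) (partial \<i> u) (partial 1 (partial 1 u)) (partial \<i> (partial \<i> u))"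
      by (rule piecewise_C2.intro[OF d1(1) d1(2) d1(3) d1(4) d2(1) d2(2) d3(1) d3(2) d4(1) d4(2) d5(1) d5(2) d6 d7 d8])
    have "(\<Union>c\<in>C \<union> D. path_image c) \<in> null_sets lborel"
      using fin rect rectifiable_path_image_null by (intro null_sets_UN') (auto simp: countable_finite)
    then show "\<Omega> - ?W \<in> null_sets lborel"
      by (rule null_sets_subset) (use assms(1) U(1) V(1) cov in auto)
  qed
qed

section \<open>The equality case: conformal maps onto discs\<close>

lemma partial_cong_ev:
  assumes "\<forall>\<^sub>F w in nhds z. f w = g w"
  shows "partial v f z = partial v g z"
proof -
  \<comment> \<open>Through this choice form the equality also holds at points where no derivative
    exists.\<close>
  have "partial v f z = (SOME d. has_partial v f d z)" for f
    unfolding partial_def has_partial_def deriv_def ..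
  then show ?thesis using has_partial_cong_ev[OF assms] by simp
qed

lemma laplacian_cong_on_open:
  assumes "open S" "\<And>z. z \<in> S \<Longrightarrow> f z = g z" "z \<in> S"
  shows "laplacian f z = laplacian g z"
proof -
  have "partial v f w = partial v g w" if "w \<in> S" for v w
    using eventually_nhds_in_open[OF assms(1) that] by (intro partial_cong_ev) (auto elim: eventually_mono simp: assms(2))
  then have "partial v (partial v f) z = partial v (partial v g) z" for v
    using eventually_nhds_in_open[OF assms(1,3)] by (intro partial_cong_ev) (auto elim: eventually_mono)
  then show ?thesis by (simp add: laplacian_def)
qed

lemma laplacian_ln_norm_deriv:
  assumes "open S" "f holomorphic_on S" "inj_on f S" "\<And>z. z \<in> S \<Longrightarrow> u z = ln (norm (deriv f z))" "z \<in> S"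
  shows "laplacian u z = 0"
proof -
  have "harmonic_fun_on S (\<lambda>z. ln (norm (deriv f z)))"
    using holomorphic_injective_imp_regular[OF assms(2,1,3)]
    by (intro harmonic_ln_norm_holomorphic assms holomorphic_deriv) auto
  then show ?thesis
    using laplacian_cong_on_open[OF assms(1,4,5)] assms(5) by (simp add: harmonic_fun_on_def)
qed

text \<open>Schwarz's lemma for F and for its inverse at the single point 1/2 gives |F(1/2)| = 1/2,
  and equality at one nonzero point already forces a rotation.\<close>

lemma conformal_self_map_of_disc_fixing_0:
  assumes F: "F holomorphic_on ball 0 1" "inj_on F (ball 0 1)" "F ` ball 0 1 = ball 0 1" "F 0 = 0"
  obtains \<alpha> where "norm \<alpha> = 1" "\<And>z. z \<in> ball 0 1 \<Longrightarrow> F z = \<alpha> * z"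
proof -
  obtain g where g: "g holomorphic_on ball 0 1" "\<And>z. z \<in> ball 0 1 \<Longrightarrow> g (F z) = z"
    using holomorphic_has_inverse[OF F(1) open_ball F(2)] F(3) by metis
  have F1: "norm (F z) < 1" if "norm z < 1" for z using F(3) that by (metis dist_0_norm image_eqI mem_ball)
  have g1: "norm (g z) < 1" if "norm z < 1" for z
  proof -
    have "z \<in> F ` ball 0 1" using F(3) that by simp
    then show ?thesis using g(2) by auto
  qed
  have g0: "g 0 = 0" using g(2)[of 0] F(4) by simp
  have half: "norm (1/2 :: complex) < 1" by simp
  have "norm (F (1/2)) \<le> norm (1/2 :: complex)" by (rule Schwarz_Lemma(1)[OF F(1) F(4) F1 half])
  moreover have "norm (g (F (1/2))) \<le> norm (F (1/2))" by (rule Schwarz_Lemma(1)[OF g(1) g0 g1 F1[OF half]])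
  ultimately have "norm (F (1/2)) = norm (1/2 :: complex)" using g(2)[of "1/2"] by simp
  then have "\<exists>z. norm z < 1 \<and> z \<noteq> 0 \<and> norm (F z) = norm z" by (intro exI[of _ "1/2"]) simp
  then obtain \<alpha> where "\<forall>z. norm z < 1 \<longrightarrow> F z = \<alpha> * z" "norm \<alpha> = 1"
    using Schwarz_Lemma(3)[OF F(1) F(4) F1 half] by blast
  then show ?thesis by (intro that[of \<alpha>]) auto
qed

lemma (in riemann_mapped) deriv_psi_phi:
  assumes z: "z \<in> \<Omega>"
  shows "deriv \<psi> z * deriv \<phi> (\<psi> z) = 1"
proof -
  let ?w = "\<psi> z"
  have w: "?w \<in> ball 0 1" "\<phi> ?w = z" using psi_image[OF z] by auto
  have d\<psi>: "(\<psi> has_field_derivative deriv \<psi> z) (at z)" using psi_holomorphic open_dom(1) z holomorphic_derivI by blast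
  have d\<phi>: "(\<phi> has_field_derivative deriv \<phi> ?w) (at ?w)" using phi(1) w(1) holomorphic_derivI open_ball by blast
  have "(\<psi> \<circ> \<phi> has_field_derivative deriv \<psi> z * deriv \<phi> ?w) (at ?w)"
    using d\<psi> d\<phi> w(2) by (intro DERIV_chain) simp_all
  moreover have "(\<psi> \<circ> \<phi> has_field_derivative 1) (at ?w)"
    by (rule has_field_derivative_transform_within_open[OF DERIV_ident open_ball w(1)]) (simp add: psi)
  ultimately show ?thesis by (rule DERIV_unique)
qed

text \<open>If the factor is constant, f = exp (logfactor 0) \<psi> is the required map. Conversely
  f(\<phi>), recentred and divided by r, is a conformal self-map of the disc fixing 0, hence a
  rotation, so |f'(\<phi>) \<phi>'| = r; with u = ln |f'| this says that \<open>logfactor\<close> is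
  ln r everywhere.\<close>

lemma (in riemann_mapped) constant_factor_iff_disc:
  "(\<forall>w\<in>ball 0 1. logfactor w = logfactor 0) \<longleftrightarrow>
    (\<exists>f r. conformal_map_on \<Omega> f \<and> r > 0 \<and> f ` \<Omega> = ball (f (\<phi> 0)) r \<and> (\<forall>z\<in>\<Omega>. u z = ln (norm (deriv f z))))"
proof
  assume c: "\<forall>w\<in>ball 0 1. logfactor w = logfactor 0"
  define r where "r = exp (logfactor 0)"
  define f where "f z = of_real r * \<psi> z" for z
  have r: "0 < r" by (simp add: r_def)
  have f0: "f (\<phi> 0) = 0" using phi_0 by (simp add: f_def)
  have \<psi>i: "inj_on \<psi> \<Omega>" by (rule inj_on_inverseI[of _ \<phi>]) (use psi_image in blast)
  have cm: "conformal_map_on \<Omega> f"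
    unfolding conformal_map_on_def f_def[abs_def] using \<psi>i r
    by (auto intro!: holomorphic_intros psi_holomorphic simp: inj_on_def)
  have im: "f ` \<Omega> = ball (f (\<phi> 0)) r"
  proof (intro equalityI subsetI)
    fix w assume "w \<in> f ` \<Omega>"
    then obtain z where z: "z \<in> \<Omega>" "w = of_real r * \<psi> z" by (auto simp: f_def)
    then have "norm w = r * norm (\<psi> z)" using r by (simp add: norm_mult)
    then show "w \<in> ball (f (\<phi> 0)) r" using psi_image[OF z(1)] r by (simp add: f0)
  next
    fix w assume "w \<in> ball (f (\<phi> 0)) r"
    then have b: "w / of_real r \<in> ball 0 1" using r by (simp add: f0 norm_divide)
    have "w = f (\<phi> (w / of_real r))" using psi[OF b] r by (simp add: f_def)
    moreover have "\<phi> (w / of_real r) \<in> \<Omega>" using b phi(3) by blast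
    ultimately show "w \<in> f ` \<Omega>" by blast
  qed
  have "u z = ln (norm (deriv f z))" if z: "z \<in> \<Omega>" for z
  proof -
    let ?w = "\<psi> z"
    have w: "?w \<in> ball 0 1" "\<phi> ?w = z" using psi_image[OF z] by auto
    have one: "deriv \<psi> z * deriv \<phi> ?w = 1" by (rule deriv_psi_phi[OF z])
    then have nn: "norm (deriv \<psi> z) * norm (deriv \<phi> ?w) = 1" by (metis norm_mult norm_one)
    have "(f has_field_derivative of_real r * deriv \<psi> z) (at z)"
      unfolding f_def[abs_def]
      by (rule DERIV_cmult[OF holomorphic_derivI[OF psi_holomorphic open_dom(1) z]])
    then have df: "deriv f z = of_real r * deriv \<psi> z" by (rule DERIV_imp_deriv)
    have p: "0 < norm (deriv \<psi> z)" "0 < norm (deriv \<phi> ?w)" using one by auto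
    have "ln (norm (deriv \<psi> z)) + ln (norm (deriv \<phi> ?w)) = 0"
      using ln_mult_pos[OF p] nn by simp
    moreover have "u z + ln (norm (deriv \<phi> ?w)) = logfactor 0"
      using c w by (metis logfactor_def)
    moreover have "ln (norm (deriv f z)) = logfactor 0 + ln (norm (deriv \<psi> z))"
      using p r by (simp add: df norm_mult ln_mult) (simp add: r_def)
    ultimately show ?thesis by simp
  qed
  then show "\<exists>f r. conformal_map_on \<Omega> f \<and> r > 0 \<and> f ` \<Omega> = ball (f (\<phi> 0)) r \<and> (\<forall>z\<in>\<Omega>. u z = ln (norm (deriv f z)))"
    using cm im r by blast
next
  assume "\<exists>f r. conformal_map_on \<Omega> f \<and> r > 0 \<and> f ` \<Omega> = ball (f (\<phi> 0)) r \<and> (\<forall>z\<in>\<Omega>. u z = ln (norm (deriv f z)))"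
  then obtain f r where f: "f holomorphic_on \<Omega>" "inj_on f \<Omega>" and r: "0 < r" and im: "f ` \<Omega> = ball (f (\<phi> 0)) r"
    and u: "\<And>z. z \<in> \<Omega> \<Longrightarrow> u z = ln (norm (deriv f z))"
    unfolding conformal_map_on_def by blast
  define F where "F w = (f (\<phi> w) - f (\<phi> 0)) / of_real r" for w
  have h: "(f \<circ> \<phi>) holomorphic_on ball 0 1" using holomorphic_on_compose_gen[OF phi(1) f(1)] phi(3) by simp
  have F: "F holomorphic_on ball 0 1"
    using h r unfolding F_def[abs_def] o_def by (intro holomorphic_intros) auto
  have Fi: "inj_on F (ball 0 1)"
  proof (rule inj_onI)
    fix x y assume xy: "x \<in> ball 0 1" "y \<in> ball 0 1" "F x = F y"
    then have "f (\<phi> x) = f (\<phi> y)" using r by (simp add: F_def)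
    moreover have "\<phi> x \<in> \<Omega>" "\<phi> y \<in> \<Omega>" using xy phi(3) by blast+
    ultimately have "\<phi> x = \<phi> y" using f(2) by (simp add: inj_on_def)
    then show "x = y" using xy phi(2) by (simp add: inj_on_def)
  qed
  have Fim: "F ` ball 0 1 = ball 0 1"
  proof -
    have "F ` ball 0 1 = (\<lambda>z. (z - f (\<phi> 0)) / of_real r) ` (f ` \<Omega>)"
      unfolding phi(3)[symmetric] image_image F_def ..
    also have "\<dots> = ball 0 1"
    proof (intro equalityI subsetI)
      fix w assume "w \<in> (\<lambda>z. (z - f (\<phi> 0)) / of_real r) ` (f ` \<Omega>)"
      then show "w \<in> ball 0 1" unfolding im using r by (auto simp: norm_divide dist_norm norm_minus_commute)
    next
      fix w :: complex assume w: "w \<in> ball 0 1"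
      have "w = (\<lambda>z. (z - f (\<phi> 0)) / of_real r) (f (\<phi> 0) + of_real r * w)" using r by simp
      moreover have "f (\<phi> 0) + of_real r * w \<in> ball (f (\<phi> 0)) r" using w r by (simp add: dist_norm norm_mult)
      ultimately show "w \<in> (\<lambda>z. (z - f (\<phi> 0)) / of_real r) ` (f ` \<Omega>)" unfolding im by blast
    qed
    finally show ?thesis .
  qed
  have F0: "F 0 = 0" by (simp add: F_def)
  obtain \<alpha> where \<alpha>: "norm \<alpha> = 1" "\<And>z. z \<in> ball 0 1 \<Longrightarrow> F z = \<alpha> * z"
    using conformal_self_map_of_disc_fixing_0[OF F Fi Fim F0] by blast
  have "logfactor w = ln r" if w: "w \<in> ball 0 1" for w
  proof -
    have pw: "\<phi> w \<in> \<Omega>" using w phi(3) by blast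
    have d1: "(f has_field_derivative deriv f (\<phi> w)) (at (\<phi> w))" using f(1) open_dom(1) pw holomorphic_derivI by blast
    have d2: "(\<phi> has_field_derivative deriv \<phi> w) (at w)" using phi(1) w holomorphic_derivI open_ball by blast
    have "(f \<circ> \<phi> has_field_derivative deriv f (\<phi> w) * deriv \<phi> w) (at w)" by (rule DERIV_chain[OF d1 d2])
    moreover have "(f \<circ> \<phi> has_field_derivative of_real r * \<alpha>) (at w)"
    proof (rule has_field_derivative_transform_within_open[of "\<lambda>w. f (\<phi> 0) + of_real r * (\<alpha> * w)", OF _ open_ball w])
      show "((\<lambda>w. f (\<phi> 0) + of_real r * (\<alpha> * w)) has_field_derivative of_real r * \<alpha>) (at w)"
        by (auto intro!: derivative_eq_intros)
      show "f (\<phi> 0) + of_real r * (\<alpha> * z) = (f \<circ> \<phi>) z" if "z \<in> ball 0 1" for z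
        using \<alpha>(2)[OF that] r by (simp add: F_def field_simps)
    qed
    ultimately have "deriv f (\<phi> w) * deriv \<phi> w = of_real r * \<alpha>" by (rule DERIV_unique)
    then have nm: "norm (deriv f (\<phi> w)) * norm (deriv \<phi> w) = r" using \<alpha>(1) r by (metis abs_of_pos mult.right_neutral norm_mult norm_of_real)
    then have "0 < norm (deriv f (\<phi> w))" "0 < norm (deriv \<phi> w)" using r by auto
    then show ?thesis using u[OF pw] nm by (simp add: logfactor_def flip: ln_mult_pos)
  qed
  then show "\<forall>w\<in>ball 0 1. logfactor w = logfactor 0" by simp
qed

text \<open>Integrability makes the Bochner integral in \<open>kappa\<close> equal to the
  nonnegative integral. On the dividing curves the two integrands may differ, but these form a null
  set.\<close>

lemma (in piecewise_C2) nn_integral_neg_laplacian: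
  assumes null: "\<Omega> - \<Omega>' \<in> null_sets lborel" and lap: "\<And>z. z \<in> \<Omega>' \<Longrightarrow> laplacian u z = uxx z + uyy z"
    and int: "set_integrable lebesgue \<Omega> (\<lambda>z. max (- laplacian u z) 0)"
  shows "(\<integral>\<^sup>+z\<in>\<Omega>. ennreal (neg_laplacian z) \<partial>lborel) = ennreal (2 * pi * (1 - kappa \<Omega> u))"
proof -
  have "(\<integral>\<^sup>+z\<in>\<Omega>. ennreal (neg_laplacian z) \<partial>lborel) = (\<integral>\<^sup>+z\<in>\<Omega>. ennreal (neg_laplacian z) \<partial>lebesgue)"
    by (simp add: nn_integral_completion)
  also have "\<dots> = (\<integral>\<^sup>+z. ennreal (indicator \<Omega> z *\<^sub>R max (- laplacian u z) 0) \<partial>lebesgue)"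
  proof (rule nn_integral_cong_AE)
    have "AE z in lebesgue. z \<notin> \<Omega> - \<Omega>'" by (rule AE_completion[OF AE_not_in[OF null]])
    then show "AE z in lebesgue. ennreal (neg_laplacian z) * indicator \<Omega> z = ennreal (indicator \<Omega> z *\<^sub>R max (- laplacian u z) 0)"
      by eventually_elim (auto simp: neg_laplacian_def lap indicator_def)
  qed
  also have "\<dots> = ennreal (LINT z:\<Omega>|lebesgue. max (- laplacian u z) 0)"
    unfolding set_lebesgue_integral_def
    by (rule nn_integral_eq_integral) (use int in \<open>auto simp: set_integrable_def indicator_def\<close>)
  also have "(LINT z:\<Omega>|lebesgue. max (- laplacian u z) 0) = 2 * pi * (1 - kappa \<Omega> u)"
    by (simp add: kappa_def)
  finally show ?thesis .
qed

lemma kappa_le_1: "kappa \<Omega> u \<le> 1"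
proof -
  have "0 \<le> (LINT z:\<Omega>|lebesgue. max (- laplacian u z) 0)"
    unfolding set_lebesgue_integral_def by (rule Bochner_Integration.integral_nonneg) (simp add: indicator_def)
  then show ?thesis by (simp add: kappa_def)
qed

lemma nn_integral_finite_of_continuous_closure:
  fixes f :: "complex \<Rightarrow> real"
  assumes "open S" "bounded S" "continuous_on (closure S) f"
  shows "(\<integral>\<^sup>+z\<in>S. ennreal (exp (2 * f z)) \<partial>lborel) < top"
proof -
  have "compact (closure S)" using assms(2) by simp
  then have "bounded (f ` closure S)" using assms(3) by (intro compact_imp_bounded compact_continuous_image)
  then obtain M where "\<forall>y\<in>f ` closure S. norm y \<le> M" unfolding bounded_iff ..
  then have M: "f z \<le> M" if "z \<in> S" for z using that closure_subset[of S] by fastforce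
  have "(\<integral>\<^sup>+z\<in>S. ennreal (exp (2 * f z)) \<partial>lborel) \<le> (\<integral>\<^sup>+z. ennreal (exp (2 * M)) * indicator S z \<partial>lborel)"
    by (intro nn_integral_mono) (auto simp: indicator_def ennreal_leI M)
  also have "\<dots> = ennreal (exp (2 * M)) * emeasure lborel S"
    using assms(1) by (subst nn_integral_cmult_indicator) auto
  also have "\<dots> < top" using emeasure_bounded_finite[OF assms(2)] by (simp add: ennreal_mult_less_top)
  finally show ?thesis .
qed

text \<open>With g the inverse of f, \<psi>(g) is a Riemann map of the image centred at f(a). The
  formula 1 / |derivative at the centre| applies to both domains, as both are bounded, and the chain
  rule compares the two.\<close>

lemma conformal_radius_image:
  assumes S: "open S" "bounded S" "a \<in> S" and \<psi>: "\<psi> holomorphic_on S" "inj_on \<psi> S" "\<psi> ` S = ball 0 1" "\<psi> a = 0"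
    and f: "f holomorphic_on S" "inj_on f S" "bounded (f ` S)"
  shows "conformal_radius (f ` S) (f a) = norm (deriv f a) * conformal_radius S a"
proof -
  obtain g where g: "g holomorphic_on f ` S" "\<And>z. z \<in> S \<Longrightarrow> deriv f z * deriv g (f z) = 1" "\<And>z. z \<in> S \<Longrightarrow> g (f z) = z"
    using holomorphic_has_inverse[OF f(1) S(1) f(2)] by auto
  have op: "open (f ` S)" by (rule open_mapping_thm3[OF f(1) S(1) f(2)])
  have gim: "g ` f ` S = S" using g(3) by (force simp: image_image)
  have h: "(\<psi> \<circ> g) holomorphic_on f ` S"
    by (rule holomorphic_on_compose_gen[OF g(1) \<psi>(1)]) (simp add: gim)
  have inj: "inj_on (\<psi> \<circ> g) (f ` S)"
  proof (rule comp_inj_on)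
    show "inj_on g (f ` S)" by (rule inj_on_inverseI[of _ f]) (auto simp: g(3))
  qed (simp add: gim \<psi>(2))
  have im: "(\<psi> \<circ> g) ` (f ` S) = ball 0 1" by (metis gim image_comp \<psi>(3))
  have fa: "f a \<in> f ` S" using S(3) by blast
  have d: "(\<psi> \<circ> g has_field_derivative deriv \<psi> a * deriv g (f a)) (at (f a))"
  proof (rule DERIV_chain)
    show "(\<psi> has_field_derivative deriv \<psi> a) (at (g (f a)))"
      unfolding g(3)[OF S(3)] by (rule holomorphic_derivI[OF \<psi>(1) S(1) S(3)])
    show "(g has_field_derivative deriv g (f a)) (at (f a))" by (rule holomorphic_derivI[OF g(1) op fa])
  qed
  have "conformal_radius (f ` S) (f a) = 1 / norm (deriv (\<psi> \<circ> g) (f a))"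
    by (rule conformal_radius_eq[OF op f(3) fa h inj im]) (simp add: g(3) S(3) \<psi>(4))
  also have "\<dots> = (1 / norm (deriv g (f a))) * (1 / norm (deriv \<psi> a))"
    by (simp add: DERIV_imp_deriv[OF d] norm_mult)
  also have "1 / norm (deriv g (f a)) = norm (deriv f a)"
  proof -
    have "norm (deriv f a) * norm (deriv g (f a)) = 1" using g(2)[OF S(3)] by (simp flip: norm_mult)
    then show ?thesis by (metis mult_zero_right nonzero_eq_divide_eq zero_neq_one)
  qed
  finally show ?thesis by (simp only: conformal_radius_eq[OF S \<psi>])
qed

context riemann_mapped
begin

lemma psi_inj: "inj_on \<psi> \<Omega>"
  by (rule inj_on_inverseI[of _ \<phi>]) (use psi_image in blast)

lemma psi_onto: "\<psi> ` \<Omega> = ball 0 1"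
proof (intro equalityI subsetI)
  fix w :: complex assume "w \<in> ball 0 1"
  then have "w = \<psi> (\<phi> w)" "\<phi> w \<in> \<Omega>" using psi phi(3) by auto
  then show "w \<in> \<psi> ` \<Omega>" by (rule image_eqI)
qed (use psi_image in blast)

lemma exp_logfactor_0:
  assumes "bounded \<Omega>"
  shows "exp (logfactor 0) = exp (u (\<phi> 0)) * conformal_radius \<Omega> (\<phi> 0)"
proof -
  have one: "deriv \<psi> (\<phi> 0) * deriv \<phi> 0 = 1" using deriv_psi_phi[OF phi_0(1)] by (simp add: phi_0(2))
  then have nn: "norm (deriv \<psi> (\<phi> 0)) * norm (deriv \<phi> 0) = 1" by (metis norm_mult norm_one)
  have n0: "norm (deriv \<phi> 0) \<noteq> 0" using one by auto
  have "conformal_radius \<Omega> (\<phi> 0) = 1 / norm (deriv \<psi> (\<phi> 0))"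
    by (rule conformal_radius_eq[OF open_dom(1) assms phi_0(1) psi_holomorphic psi_inj psi_onto phi_0(2)])
  also have "\<dots> = norm (deriv \<phi> 0)" using nn by (metis mult_zero_left nonzero_divide_eq_eq mult.commute zero_neq_one)
  finally show ?thesis using n0 by (simp add: logfactor_def exp_add)
qed

lemma green_functional_eq:
  assumes "bounded \<Omega>" "0 \<le> p"
  shows "green_functional \<Omega> u p (\<phi> 0) \<kappa> = gamma_average area_quotient p"
  unfolding green_functional_def
  by (rule functional_eq_gamma_average[OF assms(2)])
    (rule green_eq[OF open_dom(1) assms(1) phi_0(1) psi_holomorphic psi_inj psi_onto phi_0(2)])

end

theorem theorem3p2:
  fixes \<gamma> :: "real \<Rightarrow> complex" and \<Omega> :: "complex set"
    and u :: "complex \<Rightarrow> real" and a :: complex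
  assumes "rectifiable_simple_closed_curve \<gamma>"
    and "\<Omega> = inside (path_image \<gamma>)"
    and "continuous_on (\<Omega> \<union> path_image \<gamma>) u"
    and "C1_on \<Omega> u"
    and "piecewise_continuous_second_partials \<Omega> u"
    and "a \<in> \<Omega>"
    and "set_integrable lebesgue \<Omega> (\<lambda>z. max (- laplacian u z) 0)"
    and "kappa \<Omega> u > 0"
  shows
    "(\<forall>p1 p2. 0 \<le> p1 \<and> p1 < p2 \<longrightarrow>
        green_functional \<Omega> u p2 a (kappa \<Omega> u) \<le> green_functional \<Omega> u p1 a (kappa \<Omega> u) \<and>
        (green_functional \<Omega> u p2 a (kappa \<Omega> u) = green_functional \<Omega> u p1 a (kappa \<Omega> u) \<longleftrightarrow>
          (\<exists>f r. conformal_map_on \<Omega> f \<and> r > 0 \<and> f ` \<Omega> = ball (f a) r \<and>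
                 (\<forall>z\<in>\<Omega>. u z = ln (norm (deriv f z)))))) \<and>
     ((\<lambda>p. green_functional \<Omega> u p a (kappa \<Omega> u)) \<longlongrightarrow>
        (if kappa \<Omega> u < 1 then 0 else pi * (exp (u a) * conformal_radius \<Omega> a)\<^sup>2)) at_top \<and>
     (\<forall>f. conformal_map_on \<Omega> f \<and> (\<forall>z\<in>\<Omega>. u z = ln (norm (deriv f z))) \<longrightarrow>
        exp (u a) * conformal_radius \<Omega> a = conformal_radius (f ` \<Omega>) (f a))"
proof -
  have \<gamma>: "simple_path \<gamma>" "pathfinish \<gamma> = pathstart \<gamma>" "rectifiable_path \<gamma>"
    using assms(1) by (auto simp: rectifiable_simple_closed_curve_def)
  have \<Omega>: "open \<Omega>" "connected \<Omega>" "bounded \<Omega>" and fr: "frontier \<Omega> = path_image \<gamma>"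
    using Jordan_inside_outside[OF \<gamma>(1,2)] by (simp_all add: assms(2))
  have sc: "simply_connected \<Omega>"
    unfolding assms(2) by (rule simply_connected_inside_simple_path[OF \<gamma>(1)])
  have nu: "\<Omega> \<noteq> UNIV" using \<Omega>(3) not_bounded_UNIV by blast
  have cl: "closure \<Omega> = \<Omega> \<union> path_image \<gamma>" using closure_Un_frontier[of \<Omega>] by (simp add: fr)
  have cont: "continuous_on (closure \<Omega>) u" using assms(3) by (simp add: cl)
  obtain \<phi> \<psi> where \<phi>: "\<phi> holomorphic_on ball 0 1" "inj_on \<phi> (ball 0 1)" "\<phi> ` ball 0 1 = \<Omega>"
    and \<psi>: "\<And>w. w \<in> ball 0 1 \<Longrightarrow> \<psi> (\<phi> w) = w" and \<phi>0: "\<phi> 0 = a"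
    using centered_riemann_map[OF \<Omega>(1) sc nu assms(6)] by metis
  obtain \<Omega>' where pc: "piecewise_C2 \<Omega> \<Omega>' u (partial 1 u) (partial \<i> u) (partial 1 (partial 1 u)) (partial \<i> (partial \<i> u))"
    and null: "\<Omega> - \<Omega>' \<in> null_sets lborel"
    using piecewise_C2_of_second_partials[OF \<Omega>(1) continuous_on_subset[OF assms(3)] assms(4,5)] by blast
  interpret pc: piecewise_C2 \<Omega> \<Omega>' u "partial 1 u" "partial \<i> u" "partial 1 (partial 1 u)" "partial \<i> (partial \<i> u)"
    by (rule pc)
  define \<kappa> where "\<kappa> = kappa \<Omega> u"
  have mass: "(\<integral>\<^sup>+z\<in>\<Omega>. ennreal (pc.neg_laplacian z) \<partial>lborel) \<le> ennreal (2 * pi * (1 - \<kappa>))"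
    unfolding \<kappa>_def by (rule eq_refl[OF pc.nn_integral_neg_laplacian[OF null _ assms(7)]]) (simp add: laplacian_def)
  interpret R: riemann_mapped \<Omega> \<Omega>' u "partial 1 u" "partial \<i> u" "partial 1 (partial 1 u)" "partial \<i> (partial \<i> u)" \<phi> \<psi> \<kappa>
  proof
    show "0 < \<kappa>" "\<kappa> \<le> 1" using assms(8) kappa_le_1 by (auto simp: \<kappa>_def)
    show "(\<integral>\<^sup>+z\<in>\<Omega>. ennreal (exp (2 * u z)) \<partial>lborel) < top"
      by (rule nn_integral_finite_of_continuous_closure[OF \<Omega>(1,3) cont])
  qed (fact \<phi> \<psi> mass)+
  have F: "green_functional \<Omega> u p a \<kappa> = gamma_average R.area_quotient p" if "0 \<le> p" for p
    using R.green_functional_eq[OF \<Omega>(3) that] by (simp add: \<phi>0)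
  have disc: "(\<exists>f r. conformal_map_on \<Omega> f \<and> r > 0 \<and> f ` \<Omega> = ball (f a) r \<and> (\<forall>z\<in>\<Omega>. u z = ln (norm (deriv f z))))
      \<longleftrightarrow> (\<forall>w\<in>ball 0 1. R.logfactor w = R.logfactor 0)"
    using R.constant_factor_iff_disc by (simp add: \<phi>0)
  \<comment> \<open>u = ln |f'| is harmonic, so the Laplacian vanishes on \<Omega>. Constancy of the
    conformal factor determines the functional only together with this value of \<kappa>.\<close>
  have kappa_1: "\<kappa> = 1" if "conformal_map_on \<Omega> f" "\<forall>z\<in>\<Omega>. u z = ln (norm (deriv f z))" for f
  proof -
    have "laplacian u z = 0" if "z \<in> \<Omega>" for z
      using laplacian_ln_norm_deriv[OF \<Omega>(1), of f u z] \<open>conformal_map_on \<Omega> f\<close> \<open>\<forall>z\<in>\<Omega>. u z = ln (norm (deriv f z))\<close> that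
      by (simp add: conformal_map_on_def)
    then have "(LINT z:\<Omega>|lebesgue. max (- laplacian u z) 0) = (LINT z:\<Omega>|lebesgue. 0)"
      unfolding set_lebesgue_integral_def by (intro Bochner_Integration.integral_cong refl) (simp add: indicator_def)
    then show ?thesis by (simp add: \<kappa>_def kappa_def set_lebesgue_integral_def)
  qed
  have equality: "green_functional \<Omega> u p2 a \<kappa> = green_functional \<Omega> u p1 a \<kappa> \<longleftrightarrow>
      (\<exists>f r. conformal_map_on \<Omega> f \<and> r > 0 \<and> f ` \<Omega> = ball (f a) r \<and> (\<forall>z\<in>\<Omega>. u z = ln (norm (deriv f z))))"
    if p: "0 \<le> p1" "p1 < p2" for p1 p2
  proof
    assume "green_functional \<Omega> u p2 a \<kappa> = green_functional \<Omega> u p1 a \<kappa>"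
    then have "gamma_average R.area_quotient p2 = gamma_average R.area_quotient p1" using p by (simp add: F)
    then show "\<exists>f r. conformal_map_on \<Omega> f \<and> r > 0 \<and> f ` \<Omega> = ball (f a) r \<and> (\<forall>z\<in>\<Omega>. u z = ln (norm (deriv f z)))"
      unfolding disc by (intro ballI R.equality_imp_constant_factor[OF p])
  next
    assume ex: "\<exists>f r. conformal_map_on \<Omega> f \<and> r > 0 \<and> f ` \<Omega> = ball (f a) r \<and> (\<forall>z\<in>\<Omega>. u z = ln (norm (deriv f z)))"
    then have k1: "\<kappa> = 1" using kappa_1 by (elim exE conjE)
    have const: "\<forall>w\<in>ball 0 1. R.logfactor w = R.logfactor 0" using ex unfolding disc .
    have "gamma_average R.area_quotient p = pi * exp (2 * R.logfactor 0)" if "0 \<le> p" for p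
      by (rule R.constant_factor_imp_functional[OF k1 bspec[OF const] that])
    then show "green_functional \<Omega> u p2 a \<kappa> = green_functional \<Omega> u p1 a \<kappa>" using p by (simp add: F)
  qed
  have "pi * exp (2 * R.logfactor 0) = pi * (exp (u a) * conformal_radius \<Omega> a)\<^sup>2"
    using R.exp_logfactor_0[OF \<Omega>(3)] by (simp add: exp_double \<phi>0)
  from R.functional_tendsto[unfolded this]
  have "(gamma_average R.area_quotient \<longlongrightarrow> (if \<kappa> < 1 then 0 else pi * (exp (u a) * conformal_radius \<Omega> a)\<^sup>2)) at_top" .
  moreover have "\<forall>\<^sub>F p in at_top. gamma_average R.area_quotient p = green_functional \<Omega> u p a \<kappa>"
    using eventually_ge_at_top[of 0] by eventually_elim (simp add: F)
  ultimately have limit: "((\<lambda>p. green_functional \<Omega> u p a \<kappa>) \<longlongrightarrow>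
      (if \<kappa> < 1 then 0 else pi * (exp (u a) * conformal_radius \<Omega> a)\<^sup>2)) at_top"
    by (rule Lim_transform_eventually)
  have radius: "exp (u a) * conformal_radius \<Omega> a = conformal_radius (f ` \<Omega>) (f a)"
    if f: "conformal_map_on \<Omega> f" "\<forall>z\<in>\<Omega>. u z = ln (norm (deriv f z))" for f
  proof -
    have h: "f holomorphic_on \<Omega>" "inj_on f \<Omega>" using f(1) by (auto simp: conformal_map_on_def)
    have e: "norm (deriv f z) = exp (u z)" if "z \<in> \<Omega>" for z
      using bspec[OF f(2) that] holomorphic_injective_imp_regular[OF h(1) \<Omega>(1) h(2) that] by simp
    have "bounded (u ` closure \<Omega>)"
      using \<Omega>(3) cont by (intro compact_imp_bounded compact_continuous_image) simp_all
    then obtain M where "\<forall>y\<in>u ` closure \<Omega>. norm y \<le> M" unfolding bounded_iff ..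
    \<comment> \<open>Continuity of u up to the boundary curve bounds it on the compact closure, and
      |f'| = exp u turns this into the derivative bound that \<open>conformal_image_bounded\<close>
      requires.\<close>
    then have "u z \<le> M" if "z \<in> \<Omega>" for z using that closure_subset[of \<Omega>] by fastforce
    then have M: "norm (deriv f z) \<le> exp M" if "z \<in> \<Omega>" for z using that by (simp add: e)
    have no: "\<Omega> \<inter> path_image \<gamma> = {}" unfolding assms(2) by (rule inside_no_overlap)
    have b: "bounded (f ` \<Omega>)"
      by (rule conformal_image_bounded[OF \<gamma>(3) \<Omega> eq_refl[OF fr] no h M assms(6)])
    show ?thesis
      using conformal_radius_image[OF \<Omega>(1,3) assms(6) R.psi_holomorphic R.psi_inj R.psi_onto _ h b] R.phi_0(2)
      by (simp add: e assms(6) \<phi>0)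
  qed
  show ?thesis
    unfolding \<kappa>_def[symmetric] using R.functional_antimono equality limit radius by (auto simp: F)
qed
end
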